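(* Let $S$ be an arithmetical maximal order in a quotient semigroup $Q$ and let $\alpha$ denote the set of maximal orders of $Q$ equivalent to $S$. Let $\eta\colon\mathcal F_v(\alpha)\to\mathbb G$ be the abstract norm of $\mathcal F_v(\alpha)$, let $P_{S^\bullet}=\{\eta(Sq):q\in Q^\bullet\}$, $C=\mathbb G/P_{S^\bullet}$, and $C_M=\{[\eta(I)]\in C: I\in\mathcal I_v(\alpha)\text{ maximal integral}\}$. Assume that a divisorial fractional left $S$-ideal $I$ is principal if and only if $\eta(I)\in P_{S^\bullet}$. Let $\theta\colon S^\bullet\to\mathcal B(C_M)$ be the transfer homomorphism induced by the block homomorphism of $\mathcal H_S\subset\mathcal I_v(\alpha)$. Let $\mathsf d$ be a distance on $S^\bullet$ that is invariant under conjugation by normalizing elements. Then $$\mathsf c_{\mathsf d}(S^\bullet,\theta)\le 2.$$ Moreover, for all $a\in S^\bullet$, $$\mathsf c_{\mathsf d}(a)\le\max\{\mathsf c_p(\theta(a)),2\},\qquad \mathsf c_{\mathsf d}(S^\bullet)\le\max\{\mathsf c_p(\mathcal B(C_M)),2\},$$ $$\mathsf c_{\mathsf d,\mathrm{mon}}(a)\le\max\{\mathsf c_{p,\mathrm{mon}}(\theta(a)),2\},\qquad \mathsf c_{\mathsf d,\mathrm{mon}}(S^\bullet)\le\max\{\mathsf c_{p,\mathrm{mon}}(\mathcal B(C_M)),2\},$$ $$\mathsf c_{\mathsf d,\mathrm{eq}}(a)\le\max\{\mathsf c_{p,\mathrm{eq}}(\theta(a)),2\},\qquad \mathsf c_{\mathsf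 d,\mathrm{eq}}(S^\bullet)\le\max\{\mathsf c_{p,\mathrm{eq}}(\mathcal B(C_M)),2\}.$$
   Context: **Semigroups and categories.** Semigroups have a neutral element; $S^\bullet$ denotes the subsemigroup of cancellative elements of $S$, $S^\times$ the units. In a small category (identified with its set of elements=morphisms, identities $G_0$), $s(a),t(a)$ are source and target and $ab$ is defined iff $t(a)=s(b)$. In a groupoid $G$, $G(e,f)$, $G(e)=G(e,e)$, $G(e,\cdot)$, $G(\cdot,f)$ denote the sets of elements with the indicated source/target. In a cancellative small category (in particular a cancellative semigroup): $a\simeq b$ if $b=\varepsilon a\eta$ with units $\varepsilon,\eta$; an atom is a non-unit $u$ such that $u=ab$ implies $a$ or $b$ is a unit; $\mathcal A(\cdot)$ is the set of atoms; atomic means every non-unit is a finite product of atoms. **Orders.** A quotient semigroup is a semigroup $Q$ in which every cancellative element is invertible. A subsemigroup $S\subset Q$ is an order in $Q$ if for all $q\in Q$ there are $a,b\in S$ and $c,d\in S\cap Q^\times$ with $q=ac^{-1}=d^{-1}b$. Orders $S,S'$ are equivalent if there are $a,b,c,d\in Q^\times$ with $aSb\subset S'$ and $cS'd\subset S$; a maximal order is an order maximal under inclusion in its equivalence class. A fractional left $S$-ideal is $I\subset Q$ with $SI\subset I$ for which there are $x,y\in Q^\times$ with $x\in I$, $Iy\subset S$; it is a left $S$-ideal if also $I\subset S$; right versions are analogous; a fractional $S$-ideal is both a fractional left and right $S$-ideal. $I^{-1}=\{q\in Q: IqI\subset I\}$, $I_v=(I^{-1})^{-1}$, and $I$ is divisorial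 if $I=I_v$. Divisorial fractional left (right) $S$-ideals form a lattice under inclusion with $I\vee J=(I\cup J)_v$, $I\wedge J=I\cap J$. $S$ is bounded if every fractional left and every fractional right $S$-ideal contains a fractional $S$-ideal. A maximal order $S$ is arithmetical if (A1) it satisfies the ACC on divisorial left $S$-ideals and on divisorial right $S$-ideals; (A2) it is bounded; (A3) the lattices of divisorial fractional left and of divisorial fractional right $S$-ideals are modular. A fractional left $S$-ideal is principal if it equals $Sq$ with $q\in Q^\bullet$. **The groupoid $\mathcal F_v(\alpha)$ and abstract norm.** $\mathcal F_v(\alpha)$ is the set of all divisorial fractional left $S'$-ideals with $S'\in\alpha$. With $s(I)=\{q\in Q:qI\subset I\}$, $t(I)=\{q\in Q:Iq\subset I\}$ (both in $\alpha$), product $I\cdot_vJ=(IJ)_v$ if $t(I)=s(J)$, and order $\subset$, it is a groupoid with identities $\alpha$ (in fact a so-called arithmetical groupoid). $\mathcal I_v(\alpha)$ is its reduced atomic subcategory of integral elements, i.e. divisorial left $S'$-ideals, $S'\in\alpha$; its atoms are the maximal integral elements, i.e. the maximal elements of $\{I\in\mathcal I_v(\alpha):s(I)=S'\}\setminus\{S'\}$, $S'\in\alpha$. Write $G=\mathcal F_v(\alpha)$, $G_+=\mathcal I_v(\alpha)$. Each $G(e)$ is a free abelian group and $x\mapsto a^{-1}xa$ ($a\in G(e,f)$) is an order isomorphism $G(e)\to G(f)$ independent of $a$. For $x\in G(e)$ put $(x)=\{a^{-1}xa:a\in G(e,\cdot)\}$; $\mathbb G=\{(x):x\in G(e),e\in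 G_0\}$ with the ordered group structure transported from $G(e)$ along $x\mapsto(x)$ (independent of $e$). For an atom $u$ of $G_+$ let $\eta(u)=(x)$ with $x=\sup\{x'\in G(s(u)):x'\le u\}$; this extends uniquely to a homomorphism $\eta:G\to\mathbb G$, the abstract norm. $[\mathcal X]$ is the class of $\mathcal X\in\mathbb G$ in $C$, written additively. **Block homomorphism.** $\mathcal F(C_M)$ is the free abelian monoid on $C_M$, $\mathcal B(C_M)=\{g_1\cdots g_l\in\mathcal F(C_M):g_1+\cdots+g_l=0\}$. $\mathcal H_S=\{q^{-1}(Sa)q:q\in Q^\bullet,a\in S^\bullet\}\subset\mathcal I_v(\alpha)$. The block homomorphism $\mathcal H_S\to\mathcal B(C_M)$ sends $J$ to $[\eta(I_1)]\cdots[\eta(I_k)]$ whenever $J=I_1\cdot_v\cdots\cdot_vI_k$ with maximal integral $I_i$ (the neutral element if $J$ is an identity; well defined), and $\theta(a)$ is the image of $Sa$, for $a\in S^\bullet$. **Rigid factorizations** of a cancellative semigroup $T$. Tuples $(\varepsilon;u_1,\dots,u_k)$ with $k\ge0$, $\varepsilon\in T^\times$, $u_i\in\mathcal A(T)$; $(\varepsilon;u_1,\dots,u_k)$ and $(\varepsilon';v_1,\dots,v_l)$ are identified if $k=l$, $\varepsilon u_1\cdots u_k=\varepsilon'v_1\cdots v_k$, and either $k=0$ or there are $\delta_2,\dots,\delta_k\in T^\times$, $\delta_{k+1}=1$, with $\varepsilon'v_1=\varepsilon u_1\delta_2^{-1}$, $v_i=\delta_iu_i\delta_{i+1}^{-1}$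 ($i\in[2,k]$). Classes $\varepsilon*u_1*\cdots*u_k$ form a semigroup $\mathsf Z^*(T)$ with $(\varepsilon*u_1*\cdots*u_k)*(\varepsilon'*v_1*\cdots*v_l)=\varepsilon*u_1*\cdots*u_k\varepsilon'*v_1*\cdots*v_l$ (and $\varepsilon\varepsilon'*v_1*\cdots*v_l$ if $k=0$). $|z|=k$, $\pi:\mathsf Z^*(T)\to T$ multiplies, $\mathsf Z^*(a)=\pi^{-1}(\{a\})$. **Distances.** A distance on $T$ is a map $\mathsf d:\{(z,z')\in\mathsf Z^*(T)^2:\pi(z)=\pi(z')\}\to\mathbb N_0$ with, whenever $\pi(z)=\pi(z')=\pi(z'')$: $\mathsf d(z,z)=0$; symmetry; $\mathsf d(z,z')\le\mathsf d(z,z'')+\mathsf d(z'',z')$; $\mathsf d(x*z,x*z')=\mathsf d(z,z')=\mathsf d(z*y,z'*y)$ for all $x,y$; $\big||z|-|z'|\big|\le\mathsf d(z,z')\le\max\{|z|,|z'|,1\}$. The permutable distance is $\mathsf d_p(\varepsilon*u_1*\cdots*u_k,\eta*v_1*\cdots*v_l)=\max\{k,l\}-n$, $n$ being the largest cardinality of $I\subset[1,k]$ admitting an injection $\sigma:I\to[1,l]$ with $u_i\simeq v_{\sigma(i)}$ on $I$. A distance $\mathsf d$ on $S^\bullet$ is invariant under conjugation by normalizing elements if for all $n\in Q^\bullet$ with $n^{-1}Sn=S$, $\mathsf d(z,z')=\mathsf d(\psi_n(z),\psi_n(z'))$ whenever $\pi(z)=\pi(z')$, where $\psi_n(\varepsilon*u_1*\cdots*u_k)=(n^{-1}\varepsilon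 n)*n^{-1}u_1n*\cdots*n^{-1}u_kn$. **Catenary degrees.** An $N$-chain between $z,z'\in\mathsf Z^*(a)$ is $z=z_0,\dots,z_n=z'$ in $\mathsf Z^*(a)$ with $\mathsf d(z_{i-1},z_i)\le N$; monotone if the $|z_i|$ are weakly increasing or weakly decreasing. $\mathsf c_{\mathsf d}(a)$ [$\mathsf c_{\mathsf d,\mathrm{mon}}(a)$] is the least $N\in\mathbb N_0\cup\{\infty\}$ such that any two elements of $\mathsf Z^*(a)$ are connected by an [a monotone] $N$-chain; $\mathsf c_{\mathsf d,\mathrm{eq}}(a)$ the least $N$ such that any two of equal length are connected by a monotone $N$-chain. For the semigroup one takes suprema over its elements. Subscript $p$ means $\mathsf d=\mathsf d_p$. Since $\theta$ is a transfer homomorphism, it maps atoms to atoms and induces $\theta^*(\varepsilon*u_1*\cdots*u_k)=\theta(u_1)*\cdots*\theta(u_k)$; $\mathsf c_{\mathsf d}(a,\theta)$ is the least $N$ such that any $z,z'\in\mathsf Z^*(a)$ with $\mathsf d_p(\theta^*(z),\theta^*(z'))=0$ are connected by an $N$-chain $z=z_0,\dots,z_n=z'$ in distance $\mathsf d$ with $\mathsf d_p(\theta^*(z_i),\theta^*(z))=0$ for all $i$; $\mathsf c_{\mathsf d}(S^\bullet,\theta)=\sup_a\mathsf c_{\mathsf d}(a,\theta)$. *)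

theory Defs
  imports "HOL-Algebra.Coset" "HOL-Library.Multiset" "HOL-Library.Extended_Nat"
    "HOL-Library.FuncSet"
begin

section \<open>Cancellative elements, associated elements, atoms\<close>

text \<open>
  Semigroups have a neutral element, so a semigroup is a \<^locale>\<open>monoid\<close> and a subsemigroup is a
  \<^locale>\<open>submonoid\<close>. A subsemigroup \<open>S\<close> of \<open>Q\<close>, regarded as a semigroup in its own right, is
  \<open>Q\<lparr>carrier := S\<rparr>\<close>.
\<close>

definition cancellative :: "('a, 'b) monoid_scheme \<Rightarrow> 'a set" where
  "cancellative T = {a \<in> carrier T. \<forall>b \<in> carrier T. \<forall>c \<in> carrier T.
     (a \<otimes>\<^bsub>T\<^esub> b = a \<otimes>\<^bsub>T\<^esub> c \<longrightarrow> b = c) \<and> (b \<otimes>\<^bsub>T\<^esub> a = c \<otimes>\<^bsub>T\<^esub> a \<longrightarrow> b = c)}"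

definition cancellative_part :: "('a, 'b) monoid_scheme \<Rightarrow> 'a set \<Rightarrow> ('a, 'b) monoid_scheme" where
  "cancellative_part Q S = Q\<lparr>carrier := cancellative (Q\<lparr>carrier := S\<rparr>)\<rparr>"

text \<open>
  The notions \<open>associated\<close> and \<open>irreducible\<close> of HOL-Algebra are based on one-sided divisibility and
  do not give the following two notions in a noncommutative semigroup.
\<close>

definition unit_assoc :: "('m, 'x) monoid_scheme \<Rightarrow> 'm \<Rightarrow> 'm \<Rightarrow> bool" where
  "unit_assoc T a b \<longleftrightarrow> (\<exists>\<epsilon> \<in> Units T. \<exists>\<eta> \<in> Units T. b = \<epsilon> \<otimes>\<^bsub>T\<^esub> a \<otimes>\<^bsub>T\<^esub> \<eta>)"

definition atoms :: "('m, 'x) monoid_scheme \<Rightarrow> 'm set" where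
  "atoms T = {u \<in> carrier T - Units T. \<forall>a \<in> carrier T. \<forall>b \<in> carrier T.
     u = a \<otimes>\<^bsub>T\<^esub> b \<longrightarrow> a \<in> Units T \<or> b \<in> Units T}"


section \<open>Orders and their ideals\<close>

definition quotient_semigroup :: "('a, 'b) monoid_scheme \<Rightarrow> bool" where
  "quotient_semigroup Q \<longleftrightarrow> monoid Q \<and> cancellative Q \<subseteq> Units Q"

definition order_in :: "('a, 'b) monoid_scheme \<Rightarrow> 'a set \<Rightarrow> bool" where
  "order_in Q S \<longleftrightarrow> submonoid S Q \<and>
     (\<forall>q \<in> carrier Q.
        (\<exists>a \<in> S. \<exists>c \<in> S \<inter> Units Q. q = a \<otimes>\<^bsub>Q\<^esub> inv\<^bsub>Q\<^esub> c) \<and>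
        (\<exists>b \<in> S. \<exists>d \<in> S \<inter> Units Q. q = inv\<^bsub>Q\<^esub> d \<otimes>\<^bsub>Q\<^esub> b))"

definition equivalent_orders :: "('a, 'b) monoid_scheme \<Rightarrow> 'a set \<Rightarrow> 'a set \<Rightarrow> bool" where
  "equivalent_orders Q S S' \<longleftrightarrow>
     (\<exists>a \<in> Units Q. \<exists>b \<in> Units Q. \<exists>c \<in> Units Q. \<exists>d \<in> Units Q.
        (a <#\<^bsub>Q\<^esub> S) #>\<^bsub>Q\<^esub> b \<subseteq> S' \<and> (c <#\<^bsub>Q\<^esub> S') #>\<^bsub>Q\<^esub> d \<subseteq> S)"

definition maximal_order :: "('a, 'b) monoid_scheme \<Rightarrow> 'a set \<Rightarrow> bool" where
  "maximal_order Q S \<longleftrightarrow> order_in Q S \<and>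
     (\<forall>S'. order_in Q S' \<and> equivalent_orders Q S S' \<and> S \<subseteq> S' \<longrightarrow> S' = S)"

definition maximal_orders_equiv :: "('a, 'b) monoid_scheme \<Rightarrow> 'a set \<Rightarrow> 'a set set" where
  "maximal_orders_equiv Q S = {S'. maximal_order Q S' \<and> equivalent_orders Q S S'}"

definition frac_left_ideal :: "('a, 'b) monoid_scheme \<Rightarrow> 'a set \<Rightarrow> 'a set \<Rightarrow> bool" where
  "frac_left_ideal Q S I \<longleftrightarrow> I \<subseteq> carrier Q \<and> S <#>\<^bsub>Q\<^esub> I \<subseteq> I \<and>
     (\<exists>x \<in> Units Q. \<exists>y \<in> Units Q. x \<in> I \<and> I #>\<^bsub>Q\<^esub> y \<subseteq> S)"

definition frac_right_ideal :: "('a, 'b) monoid_scheme \<Rightarrow> 'a set \<Rightarrow> 'a set \<Rightarrow> bool" where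
  "frac_right_ideal Q S I \<longleftrightarrow> I \<subseteq> carrier Q \<and> I <#>\<^bsub>Q\<^esub> S \<subseteq> I \<and>
     (\<exists>x \<in> Units Q. \<exists>y \<in> Units Q. x \<in> I \<and> y <#\<^bsub>Q\<^esub> I \<subseteq> S)"

definition frac_ideal :: "('a, 'b) monoid_scheme \<Rightarrow> 'a set \<Rightarrow> 'a set \<Rightarrow> bool" where
  "frac_ideal Q S I \<longleftrightarrow> frac_left_ideal Q S I \<and> frac_right_ideal Q S I"

definition left_order_ideal :: "('a, 'b) monoid_scheme \<Rightarrow> 'a set \<Rightarrow> 'a set \<Rightarrow> bool" where
  "left_order_ideal Q S I \<longleftrightarrow> frac_left_ideal Q S I \<and> I \<subseteq> S"

definition right_order_ideal :: "('a, 'b) monoid_scheme \<Rightarrow> 'a set \<Rightarrow> 'a set \<Rightarrow> bool" where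
  "right_order_ideal Q S I \<longleftrightarrow> frac_right_ideal Q S I \<and> I \<subseteq> S"

definition ideal_inv :: "('a, 'b) monoid_scheme \<Rightarrow> 'a set \<Rightarrow> 'a set" where
  "ideal_inv Q I = {q \<in> carrier Q. (I #>\<^bsub>Q\<^esub> q) <#>\<^bsub>Q\<^esub> I \<subseteq> I}"

definition div_closure :: "('a, 'b) monoid_scheme \<Rightarrow> 'a set \<Rightarrow> 'a set" where
  "div_closure Q I = ideal_inv Q (ideal_inv Q I)"

definition divisorial :: "('a, 'b) monoid_scheme \<Rightarrow> 'a set \<Rightarrow> bool" where
  "divisorial Q I \<longleftrightarrow> I = div_closure Q I"

definition bounded_order :: "('a, 'b) monoid_scheme \<Rightarrow> 'a set \<Rightarrow> bool" where
  "bounded_order Q S \<longleftrightarrow>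
     (\<forall>I. frac_left_ideal Q S I \<or> frac_right_ideal Q S I \<longrightarrow> (\<exists>J. frac_ideal Q S J \<and> J \<subseteq> I))"

definition ascending_chain_condition :: "'a set set \<Rightarrow> bool" where
  "ascending_chain_condition \<I> \<longleftrightarrow>
     (\<forall>f :: nat \<Rightarrow> 'a set. (\<forall>n. f n \<in> \<I> \<and> f n \<subseteq> f (Suc n)) \<longrightarrow> (\<exists>m. \<forall>n \<ge> m. f n = f m))"

text \<open>
  The modular law for a lattice of divisorial fractional (left or right) ideals, in which the
  join of \<open>I\<close> and \<open>J\<close> is \<open>(I \<union> J)\<^sub>v\<close> and the meet is \<open>I \<inter> J\<close>.
\<close>

definition modular_ideal_lattice :: "('a, 'b) monoid_scheme \<Rightarrow> 'a set set \<Rightarrow> bool" where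
  "modular_ideal_lattice Q \<I> \<longleftrightarrow> (\<forall>I \<in> \<I>. \<forall>J \<in> \<I>. \<forall>K \<in> \<I>. I \<subseteq> K \<longrightarrow>
     div_closure Q (I \<union> (J \<inter> K)) = div_closure Q (I \<union> J) \<inter> K)"

definition arithmetical_maximal_order :: "('a, 'b) monoid_scheme \<Rightarrow> 'a set \<Rightarrow> bool" where
  "arithmetical_maximal_order Q S \<longleftrightarrow> maximal_order Q S \<and>
     ascending_chain_condition {I. left_order_ideal Q S I \<and> divisorial Q I} \<and>
     ascending_chain_condition {I. right_order_ideal Q S I \<and> divisorial Q I} \<and>
     bounded_order Q S \<and>
     modular_ideal_lattice Q {I. frac_left_ideal Q S I \<and> divisorial Q I} \<and>
     modular_ideal_lattice Q {I. frac_right_ideal Q S I \<and> divisorial Q I}"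

definition principal_left :: "('a, 'b) monoid_scheme \<Rightarrow> 'a set \<Rightarrow> 'a set \<Rightarrow> bool" where
  "principal_left Q S I \<longleftrightarrow> (\<exists>q \<in> cancellative Q. I = S #>\<^bsub>Q\<^esub> q)"


section \<open>The groupoid of divisorial fractional ideals and its abstract norm\<close>

definition Fv :: "('a, 'b) monoid_scheme \<Rightarrow> 'a set set \<Rightarrow> 'a set set" where
  "Fv Q \<alpha> = {I. divisorial Q I \<and> (\<exists>S' \<in> \<alpha>. frac_left_ideal Q S' I)}"

definition Iv :: "('a, 'b) monoid_scheme \<Rightarrow> 'a set set \<Rightarrow> 'a set set" where
  "Iv Q \<alpha> = {I. divisorial Q I \<and> (\<exists>S' \<in> \<alpha>. left_order_ideal Q S' I)}"

definition src :: "('a, 'b) monoid_scheme \<Rightarrow> 'a set \<Rightarrow> 'a set" where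
  "src Q I = {q \<in> carrier Q. q <#\<^bsub>Q\<^esub> I \<subseteq> I}"

definition tgt :: "('a, 'b) monoid_scheme \<Rightarrow> 'a set \<Rightarrow> 'a set" where
  "tgt Q I = {q \<in> carrier Q. I #>\<^bsub>Q\<^esub> q \<subseteq> I}"

text \<open>
  The groupoid product; it is meant only for \<open>tgt Q I = src Q J\<close>. The inverse in the groupoid
  is \<^const>\<open>ideal_inv\<close>.
\<close>

definition vmult :: "('a, 'b) monoid_scheme \<Rightarrow> 'a set \<Rightarrow> 'a set \<Rightarrow> 'a set" where
  "vmult Q I J = div_closure Q (I <#>\<^bsub>Q\<^esub> J)"

definition vertex_group :: "('a, 'b) monoid_scheme \<Rightarrow> 'a set set \<Rightarrow> 'a set \<Rightarrow> 'a set set" where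
  "vertex_group Q \<alpha> e = {x \<in> Fv Q \<alpha>. src Q x = e \<and> tgt Q x = e}"

definition maximal_integral :: "('a, 'b) monoid_scheme \<Rightarrow> 'a set set \<Rightarrow> 'a set set" where
  "maximal_integral Q \<alpha> = {I. \<exists>S' \<in> \<alpha>. I \<in> {J \<in> Iv Q \<alpha>. src Q J = S'} - {S'} \<and>
     (\<forall>J \<in> {J \<in> Iv Q \<alpha>. src Q J = S'} - {S'}. I \<subseteq> J \<longrightarrow> J = I)}"

definition conj_class :: "('a, 'b) monoid_scheme \<Rightarrow> 'a set set \<Rightarrow> 'a set \<Rightarrow> 'a set set" where
  "conj_class Q \<alpha> x =
     {vmult Q (vmult Q (ideal_inv Q a) x) a | a. a \<in> Fv Q \<alpha> \<and> src Q a = src Q x}"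

text \<open>
  The group of all \<open>(x)\<close>, where \<open>(x)\<close> is \<^const>\<open>conj_class\<close>: its multiplication is transported from
  any vertex group. Its order plays no role in what follows.
\<close>

definition norm_group :: "('a, 'b) monoid_scheme \<Rightarrow> 'a set set \<Rightarrow> 'a set set monoid" where
  "norm_group Q \<alpha> =
     \<lparr>carrier = {conj_class Q \<alpha> x | x e. e \<in> \<alpha> \<and> x \<in> vertex_group Q \<alpha> e},
      monoid.mult = (\<lambda>X Y. THE Z. \<exists>e \<in> \<alpha>. \<exists>x \<in> vertex_group Q \<alpha> e. \<exists>y \<in> vertex_group Q \<alpha> e.
                X = conj_class Q \<alpha> x \<and> Y = conj_class Q \<alpha> y \<and> Z = conj_class Q \<alpha> (vmult Q x y)),
      one = (THE Z. \<exists>e \<in> \<alpha>. Z = conj_class Q \<alpha> e)\<rparr>"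

definition is_supremum :: "'a set set \<Rightarrow> 'a set set \<Rightarrow> 'a set \<Rightarrow> bool" where
  "is_supremum \<X> M x \<longleftrightarrow> x \<in> \<X> \<and> (\<forall>m \<in> M. m \<subseteq> x) \<and> (\<forall>y \<in> \<X>. (\<forall>m \<in> M. m \<subseteq> y) \<longrightarrow> x \<subseteq> y)"

text \<open>
  \<open>\<eta>\<close> is a homomorphism from the groupoid to \<^const>\<open>norm_group\<close> taking the prescribed values on the
  atoms. It is determined by this on \<open>Fv Q \<alpha>\<close>; its values elsewhere are irrelevant.
\<close>

definition abstract_norm ::
    "('a, 'b) monoid_scheme \<Rightarrow> 'a set set \<Rightarrow> ('a set \<Rightarrow> 'a set set) \<Rightarrow> bool" where
  "abstract_norm Q \<alpha> \<eta> \<longleftrightarrow>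
     \<eta> \<in> Fv Q \<alpha> \<rightarrow> carrier (norm_group Q \<alpha>) \<and>
     (\<forall>a \<in> Fv Q \<alpha>. \<forall>b \<in> Fv Q \<alpha>. tgt Q a = src Q b \<longrightarrow>
        \<eta> (vmult Q a b) = \<eta> a \<otimes>\<^bsub>norm_group Q \<alpha>\<^esub> \<eta> b) \<and>
     (\<forall>u \<in> maximal_integral Q \<alpha>. \<exists>x.
        is_supremum (vertex_group Q \<alpha> (src Q u)) {x' \<in> vertex_group Q \<alpha> (src Q u). x' \<subseteq> u} x \<and>
        \<eta> u = conj_class Q \<alpha> x)"


section \<open>Class group and block homomorphism\<close>

definition principal_norms ::
    "('a, 'b) monoid_scheme \<Rightarrow> 'a set \<Rightarrow> ('a set \<Rightarrow> 'a set set) \<Rightarrow> 'a set set set" where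
  "principal_norms Q S \<eta> = {\<eta> (S #>\<^bsub>Q\<^esub> q) | q. q \<in> cancellative Q}"

definition class_group :: "('a, 'b) monoid_scheme \<Rightarrow> 'a set set \<Rightarrow> 'a set set set
    \<Rightarrow> 'a set set set monoid" where
  "class_group Q \<alpha> P = norm_group Q \<alpha> Mod P"

definition ideal_class :: "('a, 'b) monoid_scheme \<Rightarrow> 'a set set \<Rightarrow> 'a set set set
    \<Rightarrow> ('a set \<Rightarrow> 'a set set) \<Rightarrow> 'a set \<Rightarrow> 'a set set set" where
  "ideal_class Q \<alpha> P \<eta> I = P #>\<^bsub>norm_group Q \<alpha>\<^esub> \<eta> I"

text \<open>
  Free abelian monoids are written as multisets. The group \<open>C\<close> is in multiplicative notation
  here, so zero-sum sequences are those with product \<open>\<one>\<^bsub>C\<^esub>\<close>; as \<open>C\<close> is meant to be commutative, the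
  order of the factors does not matter.
\<close>

definition block_monoid :: "('c, 'x) monoid_scheme \<Rightarrow> 'c set \<Rightarrow> 'c multiset monoid" where
  "block_monoid C M =
     \<lparr>carrier = {mset gs | gs. set gs \<subseteq> M \<and> foldr (\<otimes>\<^bsub>C\<^esub>) gs \<one>\<^bsub>C\<^esub> = \<one>\<^bsub>C\<^esub>},
      monoid.mult = (+), one = {#}\<rparr>"

text \<open>\<open>integral_factors Q \<alpha> J [I\<^sub>1, \<dots>, I\<^sub>k]\<close>: \<open>J\<close> is the groupoid product of the maximal integral \<open>I\<^sub>i\<close>.\<close>

inductive integral_factors ::
    "('a, 'b) monoid_scheme \<Rightarrow> 'a set set \<Rightarrow> 'a set \<Rightarrow> 'a set list \<Rightarrow> bool"
  for Q :: "('a, 'b) monoid_scheme" and \<alpha> :: "'a set set" where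
  identity: "e \<in> \<alpha> \<Longrightarrow> integral_factors Q \<alpha> e []"
| product: "I \<in> maximal_integral Q \<alpha> \<Longrightarrow> integral_factors Q \<alpha> J Is \<Longrightarrow> tgt Q I = src Q J \<Longrightarrow>
    integral_factors Q \<alpha> (vmult Q I J) (I # Is)"

definition conj_principal_ideals :: "('a, 'b) monoid_scheme \<Rightarrow> 'a set \<Rightarrow> 'a set set" where
  "conj_principal_ideals Q S =
     {(inv\<^bsub>Q\<^esub> q <#\<^bsub>Q\<^esub> (S #>\<^bsub>Q\<^esub> a)) #>\<^bsub>Q\<^esub> q | q a.
        q \<in> cancellative Q \<and> a \<in> cancellative (Q\<lparr>carrier := S\<rparr>)}"

definition block_hom :: "('a, 'b) monoid_scheme \<Rightarrow> 'a set \<Rightarrow> 'a set set \<Rightarrow> 'a set set set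
    \<Rightarrow> ('a set \<Rightarrow> 'a set set) \<Rightarrow> 'a set \<Rightarrow> 'a set set set multiset" where
  "block_hom Q S \<alpha> P \<eta> = (\<lambda>J \<in> conj_principal_ideals Q S.
     THE B. \<exists>Is. integral_factors Q \<alpha> J Is \<and> B = mset (map (ideal_class Q \<alpha> P \<eta>) Is))"


section \<open>Rigid factorizations\<close>

text \<open>
  \<open>(\<epsilon>; u\<^sub>1, \<dots>, u\<^sub>k)\<close> is the pair \<open>(\<epsilon>, [u\<^sub>1, \<dots>, u\<^sub>k])\<close>; a rigid factorization is an equivalence class
  of such tuples.
\<close>

type_synonym 'm tuple = "'m \<times> 'm list"

definition tuples :: "('m, 'x) monoid_scheme \<Rightarrow> 'm tuple set" where
  "tuples T = {(\<epsilon>, us). \<epsilon> \<in> Units T \<and> set us \<subseteq> atoms T}"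

definition tuple_prod :: "('m, 'x) monoid_scheme \<Rightarrow> 'm tuple \<Rightarrow> 'm" where
  "tuple_prod T = (\<lambda>(\<epsilon>, us). \<epsilon> \<otimes>\<^bsub>T\<^esub> foldr (\<otimes>\<^bsub>T\<^esub>) us \<one>\<^bsub>T\<^esub>)"

text \<open>Lists are indexed from \<open>0\<close>, so \<open>\<delta> i\<close> below is the unit \<open>\<delta>\<^bsub>i+1\<^esub>\<close> of the usual indexing.\<close>

definition tuple_rel :: "('m, 'x) monoid_scheme \<Rightarrow> ('m tuple \<times> 'm tuple) set" where
  "tuple_rel T = {((\<epsilon>, us), (\<epsilon>', vs)).
     (\<epsilon>, us) \<in> tuples T \<and> (\<epsilon>', vs) \<in> tuples T \<and>
     length us = length vs \<and> tuple_prod T (\<epsilon>, us) = tuple_prod T (\<epsilon>', vs) \<and>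
     (us = [] \<or>
      (\<exists>\<delta> :: nat \<Rightarrow> 'm. (\<forall>i \<in> {1..<length us}. \<delta> i \<in> Units T) \<and> \<delta> (length us) = \<one>\<^bsub>T\<^esub> \<and>
         \<epsilon>' \<otimes>\<^bsub>T\<^esub> vs ! 0 = \<epsilon> \<otimes>\<^bsub>T\<^esub> us ! 0 \<otimes>\<^bsub>T\<^esub> inv\<^bsub>T\<^esub> (\<delta> 1) \<and>
         (\<forall>i \<in> {1..<length us}. vs ! i = \<delta> i \<otimes>\<^bsub>T\<^esub> us ! i \<otimes>\<^bsub>T\<^esub> inv\<^bsub>T\<^esub> (\<delta> (Suc i)))))}"

definition rigid_class :: "('m, 'x) monoid_scheme \<Rightarrow> 'm tuple \<Rightarrow> 'm tuple set" where
  "rigid_class T x = tuple_rel T `` {x}"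

definition Zstar :: "('m, 'x) monoid_scheme \<Rightarrow> 'm tuple set set" where
  "Zstar T = tuples T // tuple_rel T"

definition rep :: "'m tuple set \<Rightarrow> 'm tuple" where
  "rep z = (SOME x. x \<in> z)"

fun tuple_mult :: "('m, 'x) monoid_scheme \<Rightarrow> 'm tuple \<Rightarrow> 'm tuple \<Rightarrow> 'm tuple" where
  "tuple_mult T (\<epsilon>, us) (\<epsilon>', vs) =
     (if us = [] then (\<epsilon> \<otimes>\<^bsub>T\<^esub> \<epsilon>', vs)
      else (\<epsilon>, butlast us @ [last us \<otimes>\<^bsub>T\<^esub> \<epsilon>'] @ vs))"

definition rigid_mult ::
    "('m, 'x) monoid_scheme \<Rightarrow> 'm tuple set \<Rightarrow> 'm tuple set \<Rightarrow> 'm tuple set" where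
  "rigid_mult T z z' = rigid_class T (tuple_mult T (rep z) (rep z'))"

definition rigid_length :: "'m tuple set \<Rightarrow> nat" where
  "rigid_length z = length (snd (rep z))"

definition rigid_pi :: "('m, 'x) monoid_scheme \<Rightarrow> 'm tuple set \<Rightarrow> 'm" where
  "rigid_pi T z = tuple_prod T (rep z)"

definition rigid_facts :: "('m, 'x) monoid_scheme \<Rightarrow> 'm \<Rightarrow> 'm tuple set set" where
  "rigid_facts T a = {z \<in> Zstar T. rigid_pi T z = a}"


section \<open>Distances\<close>

definition distance_on ::
    "('m, 'x) monoid_scheme \<Rightarrow> ('m tuple set \<Rightarrow> 'm tuple set \<Rightarrow> nat) \<Rightarrow> bool" where
  "distance_on T d \<longleftrightarrow>
     (\<forall>a. \<forall>z \<in> rigid_facts T a. \<forall>z' \<in> rigid_facts T a.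
        d z z = 0 \<and> d z z' = d z' z \<and>
        (\<forall>z'' \<in> rigid_facts T a. d z z' \<le> d z z'' + d z'' z') \<and>
        (\<forall>x \<in> Zstar T. d (rigid_mult T x z) (rigid_mult T x z') = d z z') \<and>
        (\<forall>y \<in> Zstar T. d (rigid_mult T z y) (rigid_mult T z' y) = d z z') \<and>
        \<bar>int (rigid_length z) - int (rigid_length z')\<bar> \<le> int (d z z') \<and>
        d z z' \<le> max (max (rigid_length z) (rigid_length z')) 1)"

definition perm_distance ::
    "('m, 'x) monoid_scheme \<Rightarrow> 'm tuple set \<Rightarrow> 'm tuple set \<Rightarrow> nat" where
  "perm_distance T z z' =
     (let us = snd (rep z); vs = snd (rep z') in
      max (length us) (length vs) -
      Max {card I | I \<sigma>. I \<subseteq> {..<length us} \<and> inj_on \<sigma> I \<and> \<sigma> ` I \<subseteq> {..<length vs} \<and>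
             (\<forall>i \<in> I. unit_assoc T (us ! i) (vs ! \<sigma> i))})"

text \<open>
  For \<open>n\<close> normalizing \<open>S\<close>, conjugation by \<open>n\<close> is an automorphism of the semigroup of cancellative
  elements of \<open>S\<close>, so the image of a rigid factorization under it is again a full equivalence
  class of tuples.
\<close>

definition conj_fact ::
    "('a, 'b) monoid_scheme \<Rightarrow> 'a \<Rightarrow> 'a tuple set \<Rightarrow> 'a tuple set" where
  "conj_fact Q n z =
     (\<lambda>(\<epsilon>, us). (inv\<^bsub>Q\<^esub> n \<otimes>\<^bsub>Q\<^esub> \<epsilon> \<otimes>\<^bsub>Q\<^esub> n, map (\<lambda>u. inv\<^bsub>Q\<^esub> n \<otimes>\<^bsub>Q\<^esub> u \<otimes>\<^bsub>Q\<^esub> n) us)) ` z"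

definition conj_invariant :: "('a, 'b) monoid_scheme \<Rightarrow> 'a set
    \<Rightarrow> ('a tuple set \<Rightarrow> 'a tuple set \<Rightarrow> nat) \<Rightarrow> bool" where
  "conj_invariant Q S d \<longleftrightarrow>
     (\<forall>n \<in> cancellative Q. (inv\<^bsub>Q\<^esub> n <#\<^bsub>Q\<^esub> S) #>\<^bsub>Q\<^esub> n = S \<longrightarrow>
        (\<forall>a. \<forall>z \<in> rigid_facts (cancellative_part Q S) a.
             \<forall>z' \<in> rigid_facts (cancellative_part Q S) a.
               d z z' = d (conj_fact Q n z) (conj_fact Q n z')))"


section \<open>Catenary degrees\<close>

definition is_chain :: "('m, 'x) monoid_scheme \<Rightarrow> ('m tuple set \<Rightarrow> 'm tuple set \<Rightarrow> nat)
    \<Rightarrow> enat \<Rightarrow> 'm \<Rightarrow> 'm tuple set \<Rightarrow> 'm tuple set \<Rightarrow> 'm tuple set list \<Rightarrow> bool" where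
  "is_chain T d N a z z' zs \<longleftrightarrow> zs \<noteq> [] \<and> hd zs = z \<and> last zs = z' \<and>
     set zs \<subseteq> rigid_facts T a \<and> successively (\<lambda>x y. enat (d x y) \<le> N) zs"

definition monotone_chain :: "'m tuple set list \<Rightarrow> bool" where
  "monotone_chain zs \<longleftrightarrow> sorted_wrt (\<le>) (map rigid_length zs) \<or> sorted_wrt (\<ge>) (map rigid_length zs)"

definition cat_elem :: "('m, 'x) monoid_scheme \<Rightarrow> ('m tuple set \<Rightarrow> 'm tuple set \<Rightarrow> nat)
    \<Rightarrow> 'm \<Rightarrow> enat" where
  "cat_elem T d a = (LEAST N. \<forall>z \<in> rigid_facts T a. \<forall>z' \<in> rigid_facts T a.
     \<exists>zs. is_chain T d N a z z' zs)"

definition cat_mon_elem :: "('m, 'x) monoid_scheme \<Rightarrow> ('m tuple set \<Rightarrow> 'm tuple set \<Rightarrow> nat)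
    \<Rightarrow> 'm \<Rightarrow> enat" where
  "cat_mon_elem T d a = (LEAST N. \<forall>z \<in> rigid_facts T a. \<forall>z' \<in> rigid_facts T a.
     \<exists>zs. is_chain T d N a z z' zs \<and> monotone_chain zs)"

definition cat_eq_elem :: "('m, 'x) monoid_scheme \<Rightarrow> ('m tuple set \<Rightarrow> 'm tuple set \<Rightarrow> nat)
    \<Rightarrow> 'm \<Rightarrow> enat" where
  "cat_eq_elem T d a = (LEAST N. \<forall>z \<in> rigid_facts T a. \<forall>z' \<in> rigid_facts T a.
     rigid_length z = rigid_length z' \<longrightarrow> (\<exists>zs. is_chain T d N a z z' zs \<and> monotone_chain zs))"

definition cat :: "('m, 'x) monoid_scheme \<Rightarrow> ('m tuple set \<Rightarrow> 'm tuple set \<Rightarrow> nat) \<Rightarrow> enat" where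
  "cat T d = (SUP a \<in> carrier T. cat_elem T d a)"

definition cat_mon :: "('m, 'x) monoid_scheme \<Rightarrow> ('m tuple set \<Rightarrow> 'm tuple set \<Rightarrow> nat) \<Rightarrow> enat" where
  "cat_mon T d = (SUP a \<in> carrier T. cat_mon_elem T d a)"

definition cat_eq :: "('m, 'x) monoid_scheme \<Rightarrow> ('m tuple set \<Rightarrow> 'm tuple set \<Rightarrow> nat) \<Rightarrow> enat" where
  "cat_eq T d = (SUP a \<in> carrier T. cat_eq_elem T d a)"

definition theta_star ::
    "('n, 'y) monoid_scheme \<Rightarrow> ('m \<Rightarrow> 'n) \<Rightarrow> 'm tuple set \<Rightarrow> 'n tuple set" where
  "theta_star B \<theta> z = rigid_class B (\<one>\<^bsub>B\<^esub>, map \<theta> (snd (rep z)))"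

text \<open>The catenary degree in the fibers of \<open>\<theta>\<close>, a transfer homomorphism from \<open>T\<close> to \<open>B\<close>.\<close>

definition cat_fiber_elem :: "('m, 'x) monoid_scheme \<Rightarrow> ('n, 'y) monoid_scheme \<Rightarrow> ('m \<Rightarrow> 'n)
    \<Rightarrow> ('m tuple set \<Rightarrow> 'm tuple set \<Rightarrow> nat) \<Rightarrow> 'm \<Rightarrow> enat" where
  "cat_fiber_elem T B \<theta> d a = (LEAST N. \<forall>z \<in> rigid_facts T a. \<forall>z' \<in> rigid_facts T a.
     perm_distance B (theta_star B \<theta> z) (theta_star B \<theta> z') = 0 \<longrightarrow>
     (\<exists>zs. is_chain T d N a z z' zs \<and>
        (\<forall>y \<in> set zs. perm_distance B (theta_star B \<theta> y) (theta_star B \<theta> z) = 0)))"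

definition cat_fiber :: "('m, 'x) monoid_scheme \<Rightarrow> ('n, 'y) monoid_scheme \<Rightarrow> ('m \<Rightarrow> 'n)
    \<Rightarrow> ('m tuple set \<Rightarrow> 'm tuple set \<Rightarrow> nat) \<Rightarrow> enat" where
  "cat_fiber T B \<theta> d = (SUP a \<in> carrier T. cat_fiber_elem T B \<theta> d a)"

end

theory Submission
  imports Defs "HOL-Combinatorics.List_Permutation" "HOL-Algebra.Divisibility"
begin

text \<open>
  Up to units, the rigid factorizations of \<open>a\<close> are the chains of principal left ideals from \<open>S a\<close> to
  \<open>S\<close> in the modular lattice of divisorial fractional left \<open>S\<close>-ideals. Label a cover \<open>I \<subset> J\<close> by the class
  in \<open>C\<close> of the norm of the maximal integral element \<open>J\<^sup>-\<^sup>1 I\<close>. Perspective covers have the same label,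
  so by Jordan-Hoelder every interval carries a multiset of labels, for \<open>S a \<subseteq> S\<close> the block \<open>\<theta> a\<close>, and a
  left ideal \<open>I\<close> below a principal one is principal iff the product of the labels between them is \<open>\<one>\<close>.
  Two adjacent covers with distinct labels can be exchanged, hence the labels along a chain can be
  put into any order. Therefore, if \<open>u w = a\<close> and \<open>v w' = a\<close> begin factorizations with the same
  \<open>\<theta>\<close>-image and \<open>\<theta> u = \<theta> v\<close>, one can replace \<open>u\<close> and the next atom, with their product fixed, such that the interval
  between \<open>S w \<inter> S w'\<close> and \<open>S w\<close> becomes shorter. Iterating this connects any two factorizations in a
  fiber of \<open>\<theta>\<close> by steps that change two adjacent atoms, and such a step has distance at most \<open>2\<close>.
  Chains of factorizations of \<open>\<theta> a\<close> lift to chains of factorizations of \<open>a\<close> up to steps in the fibers.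
\<close>

section \<open>Modular lattices with labelled covers\<close>

text \<open>The label of a cover is read off from the residual of all \<open>q\<close> with
  \<open>q J \<subseteq> I\<close>, a two-sided divisorial ideal. Perspective covers have equal
  residuals, because an integral two-sided ideal that carries \<open>H\<close> into \<open>I\<close>
  also carries the join of \<open>I\<close> and \<open>H\<close> into \<open>I\<close>. The residual
  of a cover is maximal among the proper integral two-sided ideals; this makes adjacent covers with
  different residuals exchangeable. Two chains with the same sequence of labels can still differ, so
  ordering the labels does not finish the proof. The cover on which a shortening step turns need not
  end in a principal ideal; the labels above it are reordered so as to complete it to the block of
  an atom, since principality depends only on the product of labels. The class group is commutative
  since two-sided divisorial ideals commute, which is reduced to coprime ones. The number 2 is the
  size of a changed window: translation invariance removes the common atoms on both sides, and a
  distance is bounded by the number of atoms that remain.\<close>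

definition wf_on_top :: "'a set set \<Rightarrow> 'a set \<Rightarrow> bool" where
  "wf_on_top L J \<longleftrightarrow> wf {(K', K). K \<in> L \<and> K' \<in> L \<and> K \<subset> K' \<and> K' \<subseteq> J}"

text \<open>A lattice of fractional ideals is usually unbounded in both directions, so each chain
  condition is stated relative to a bound. As well-foundedness it serves directly for induction and
  for the choice of minimal elements.\<close>

definition wf_on_bot :: "'a set set \<Rightarrow> 'a set \<Rightarrow> bool" where
  "wf_on_bot L I \<longleftrightarrow> wf {(K, K'). K \<in> L \<and> K' \<in> L \<and> K \<subset> K' \<and> I \<subseteq> K}"

definition cov :: "'a set set \<Rightarrow> 'a set \<Rightarrow> 'a set \<Rightarrow> bool" where
  "cov L I J \<longleftrightarrow> I \<in> L \<and> J \<in> L \<and> I \<subset> J \<and> (\<forall>K \<in> L. I \<subseteq> K \<longrightarrow> K \<subseteq> J \<longrightarrow> K = I \<or> K = J)"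

locale modular_lattice =
  fixes L :: "'a set set" and jn :: "'a set \<Rightarrow> 'a set \<Rightarrow> 'a set"
  assumes int_closed: "I \<in> L \<Longrightarrow> J \<in> L \<Longrightarrow> I \<inter> J \<in> L"
    and jn_closed: "I \<in> L \<Longrightarrow> J \<in> L \<Longrightarrow> jn I J \<in> L"
    and jn_upper1: "I \<in> L \<Longrightarrow> J \<in> L \<Longrightarrow> I \<subseteq> jn I J"
    and jn_upper2: "I \<in> L \<Longrightarrow> J \<in> L \<Longrightarrow> J \<subseteq> jn I J"
    and jn_least: "I \<in> L \<Longrightarrow> J \<in> L \<Longrightarrow> K \<in> L \<Longrightarrow> I \<subseteq> K \<Longrightarrow> J \<subseteq> K \<Longrightarrow> jn I J \<subseteq> K"
    and modular: "I \<in> L \<Longrightarrow> J \<in> L \<Longrightarrow> K \<in> L \<Longrightarrow> I \<subseteq> K \<Longrightarrow> jn I J \<inter> K \<subseteq> jn I (J \<inter> K)"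
    and acc: "J \<in> L \<Longrightarrow> wf_on_top L J"
    and dcc: "I \<in> L \<Longrightarrow> wf_on_bot L I"
begin

section \<open>Covers under joins and meets in a modular lattice\<close>

lemma jn_absorb: "I \<in> L \<Longrightarrow> J \<in> L \<Longrightarrow> J \<subseteq> I \<Longrightarrow> jn I J = I"
  by (meson jn_least jn_upper1 order_refl subset_antisym)

lemma jn_commute: "I \<in> L \<Longrightarrow> J \<in> L \<Longrightarrow> jn I J = jn J I"
  by (meson jn_closed jn_least jn_upper1 jn_upper2 subset_antisym)

text \<open>By modularity an element \<open>K\<close> between \<open>B\<close> and the join is
  determined by \<open>K \<inter> A\<close>, and the cover leaves only two values for this
  meet.\<close>

lemma cov_up:
  assumes c: "cov L (A \<inter> B) A" and B: "B \<in> L"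
  shows "cov L B (jn A B)"
proof -
  have A: "A \<in> L" using c by (simp add: cov_def)
  have "K = B \<or> K = jn A B" if K: "K \<in> L" "B \<subseteq> K" "K \<subseteq> jn A B" for K
  proof -
    have "K \<inter> A = A \<inter> B \<or> K \<inter> A = A"
      using c K int_closed[OF K(1) A] unfolding cov_def by (metis Int_commute Int_mono inf_le1 order_refl)
    then show ?thesis
    proof
      assume "K \<inter> A = A"
      then have "jn A B \<subseteq> K" using jn_least[OF A B K(1)] K by auto
      then show ?thesis using K by auto
    next
      assume e: "K \<inter> A = A \<inter> B"
      have "K \<subseteq> jn B A \<inter> K" using K jn_commute[OF A B] by auto
      also have "\<dots> \<subseteq> jn B (A \<inter> K)" using modular[OF B A K(1)] K by auto
      also have "\<dots> = B" using jn_absorb[OF B int_closed[OF A B]] e by (simp add: Int_commute)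
      finally show ?thesis using K by auto
    qed
  qed
  moreover have "B \<noteq> jn A B" using c jn_upper1[OF A B] unfolding cov_def by auto
  ultimately show ?thesis unfolding cov_def using A B jn_closed jn_upper2[OF A B] by auto
qed

text \<open>Dual to \<open>cov_up\<close>: an element \<open>K\<close> between
  \<open>A \<inter> B\<close> and \<open>A\<close> is recovered from its join with \<open>B\<close>
  by intersecting with \<open>A\<close>.\<close>

lemma cov_down:
  assumes c: "cov L B (jn A B)" and A: "A \<in> L"
  shows "cov L (A \<inter> B) A"
proof -
  have B: "B \<in> L" using c by (simp add: cov_def)
  have "K = A \<inter> B \<or> K = A" if K: "K \<in> L" "A \<inter> B \<subseteq> K" "K \<subseteq> A" for K
  proof -
    have s: "jn B K \<subseteq> jn A B"
      using jn_least[OF B K(1) jn_closed[OF A B]] jn_upper2[OF A B] jn_upper1[OF A B] K by auto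
    have "jn B K = B \<or> jn B K = jn A B"
      using c s jn_closed[OF B K(1)] jn_upper1[OF B K(1)] unfolding cov_def by auto
    then show ?thesis
    proof
      assume "jn B K = B"
      then have "K \<subseteq> B" using jn_upper2[OF B K(1)] by auto
      then show ?thesis using K by auto
    next
      assume e: "jn B K = jn A B"
      have "A \<subseteq> jn K B \<inter> A" using e jn_commute[OF B K(1)] jn_upper1[OF A B] by auto
      also have "\<dots> \<subseteq> jn K (B \<inter> A)" using modular[OF K(1) B A K(3)] .
      also have "\<dots> = K" using jn_absorb[OF K(1), of "B \<inter> A"] K int_closed A B by (simp add: Int_commute)
      finally show ?thesis using K by auto
    qed
  qed
  moreover have "A \<noteq> A \<inter> B"
  proof
    assume "A = A \<inter> B"
    then have "jn A B = B" using jn_absorb[OF B A] jn_commute[OF A B] by auto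
    then show False using c unfolding cov_def by auto
  qed
  ultimately show ?thesis unfolding cov_def using A B int_closed by auto
qed

lemma cov_exists:
  assumes "I \<in> L" "J \<in> L" "I \<subset> J"
  shows "\<exists>K. cov L I K \<and> K \<subseteq> J"
proof -
  let ?r = "{(K, K'). K \<in> L \<and> K' \<in> L \<and> K \<subset> K' \<and> I \<subseteq> K}"
  have "wf ?r" using dcc[OF assms(1)] by (simp add: wf_on_bot_def)
  then obtain K where K: "K \<in> {K \<in> L. I \<subset> K \<and> K \<subseteq> J}"
    and min: "\<And>y. (y, K) \<in> ?r \<Longrightarrow> y \<notin> {K \<in> L. I \<subset> K \<and> K \<subseteq> J}"
    using wfE_min[of ?r J "{K \<in> L. I \<subset> K \<and> K \<subseteq> J}"] assms by blast
  have "cov L I K"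
    unfolding cov_def using K assms(1)
  proof (intro conjI ballI impI)
    fix X assume X: "X \<in> L" "I \<subseteq> X" "X \<subseteq> K"
    show "X = I \<or> X = K"
      using min[of X] X K by blast
  qed auto
  then show ?thesis using K by auto
qed

end

section \<open>Multisets of labels along maximal chains\<close>

inductive seg :: "'a set set \<Rightarrow> ('a set \<Rightarrow> 'a set \<Rightarrow> 'c) \<Rightarrow> 'a set \<Rightarrow> 'a set \<Rightarrow> 'c multiset \<Rightarrow> bool"
  for L lab where
  refl: "I \<in> L \<Longrightarrow> seg L lab I I {#}"
| step: "cov L I J \<Longrightarrow> seg L lab J K M \<Longrightarrow> seg L lab I K (add_mset (lab I J) M)"

locale labelled_lattice = modular_lattice L jn
  for L :: "'a set set" and jn +
  fixes lab :: "'a set \<Rightarrow> 'a set \<Rightarrow> 'c"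
  assumes lab_persp: "cov L I J \<Longrightarrow> H \<in> L \<Longrightarrow> H \<subseteq> J \<Longrightarrow> jn I H = J \<Longrightarrow> lab (I \<inter> H) H = lab I J"
    and lab_swap: "cov L I J \<Longrightarrow> cov L J K \<Longrightarrow> lab I J \<noteq> lab J K \<Longrightarrow>
      \<exists>W. cov L I W \<and> cov L W K \<and> lab I W = lab J K \<and> lab W K = lab I J"
begin

abbreviation sg where "sg \<equiv> seg L lab"

lemma seg_mem: "sg I J M \<Longrightarrow> I \<in> L \<and> J \<in> L \<and> I \<subseteq> J"
  by (induction rule: seg.induct) (auto simp: cov_def)

lemma seg_trans: "sg I J M \<Longrightarrow> sg J K N \<Longrightarrow> sg I K (M + N)"
  by (induction rule: seg.induct) (auto intro: seg.step)

lemma seg_cov: "cov L I J \<Longrightarrow> sg I J {#lab I J#}"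
  using seg.step[of L I J lab J "{#}"] seg.refl[of J L lab] by (auto simp: cov_def)

lemma seg_empty: "sg I J {#} \<Longrightarrow> I = J"
  by (erule seg.cases) auto

lemma seg_neq: "sg I J M \<Longrightarrow> M \<noteq> {#} \<Longrightarrow> I \<noteq> J"
  by (induction rule: seg.induct) (auto simp: cov_def dest: seg_mem)

lemma seg_exists:
  assumes "I \<in> L" "J \<in> L" "I \<subseteq> J"
  shows "\<exists>M. sg I J M"
proof -
  let ?r = "{(K', K). K \<in> L \<and> K' \<in> L \<and> K \<subset> K' \<and> K' \<subseteq> J}"
  have "wf ?r" using acc[OF assms(2)] by (simp add: wf_on_top_def)
  then show ?thesis using assms(1,3)
  proof (induction I rule: wf_induct_rule)
    case (less I)
    show ?case
    proof (cases "I = J")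
      case True
      then show ?thesis using seg.refl less.prems by blast
    next
      case False
      then obtain K where K: "cov L I K" "K \<subseteq> J"
        using cov_exists[of I J] less.prems assms(2) by blast
      then have "(K, I) \<in> ?r" by (auto simp: cov_def)
      then obtain M where "sg K J M" using less.IH[of K] K by (auto simp: cov_def)
      then show ?thesis using seg.step K(1) by blast
    qed
  qed
qed

text \<open>Two distinct covers of one element meet in it, so modularity makes their join a cover of
  both; perspectivity carries each label to the opposite side.\<close>

lemma diamond:
  assumes "cov L I J" "cov L I J'" "J \<noteq> J'"
  shows "J \<inter> J' = I" "cov L J (jn J J')" "cov L J' (jn J J')"
    "lab J' (jn J J') = lab I J" "lab J (jn J J') = lab I J'"
proof -
  have J: "J \<in> L" "J' \<in> L" using assms by (auto simp: cov_def)
  show i: "J \<inter> J' = I"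
  proof -
    have c: "I \<subseteq> J" "I \<noteq> J" "I \<subseteq> J'"
      "\<And>K. K \<in> L \<Longrightarrow> I \<subseteq> K \<Longrightarrow> K \<subseteq> J \<Longrightarrow> K = I \<or> K = J"
      "\<And>K. K \<in> L \<Longrightarrow> I \<subseteq> K \<Longrightarrow> K \<subseteq> J' \<Longrightarrow> K = I \<or> K = J'"
      using assms(1,2) by (auto simp: cov_def)
    have "J \<inter> J' = I \<or> J \<inter> J' = J"
      using c(1,3) c(4)[OF int_closed[OF J]] by auto
    moreover have "J \<inter> J' \<noteq> J"
      using c(1,2) c(5)[OF J(1)] assms(3) by blast
    ultimately show ?thesis by blast
  qed
  show c1: "cov L J' (jn J J')" using cov_up[of J J'] i assms J by auto
  show c2: "cov L J (jn J J')"
    using cov_up[of J' J] i assms J jn_commute[OF J] by (simp add: Int_commute)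
  show "lab J' (jn J J') = lab I J"
    using lab_persp[OF c1 J(1) jn_upper1[OF J] jn_commute[OF J(2,1)]] i by (simp add: Int_commute)
  show "lab J (jn J J') = lab I J'"
    using lab_persp[OF c2 J(2) jn_upper2[OF J] HOL.refl] i by simp
qed

text \<open>The Jordan-Hoelder argument: two chains that start with different covers are compared
  with a third one through the join of these covers.\<close>

theorem seg_unique: "sg I K M \<Longrightarrow> sg I K M' \<Longrightarrow> M = M'"
proof (induction "size M" arbitrary: I M M' rule: less_induct)
  case less
  show ?case
  proof (cases "I = K")
    case True
    then show ?thesis using less.prems seg_neq by blast
  next
    case False
    obtain J M0 where 1: "cov L I J" "sg J K M0" "M = add_mset (lab I J) M0"
      using less.prems(1) False by (cases rule: seg.cases) auto
    obtain J' M0' where 2: "cov L I J'" "sg J' K M0'" "M' = add_mset (lab I J') M0'"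
      using less.prems(2) False by (cases rule: seg.cases) auto
    show ?thesis
    proof (cases "J = J'")
      case True
      then show ?thesis using less.hyps[of M0 J M0'] 1 2 by auto
    next
      case False
      note d = diamond[OF 1(1) 2(1) False]
      let ?H = "jn J J'"
      have JK: "J \<in> L" "J' \<in> L" "K \<in> L" "J \<subseteq> K" "J' \<subseteq> K"
        using seg_mem[OF 1(2)] seg_mem[OF 2(2)] by auto
      then obtain N where N: "sg ?H K N"
        using seg_exists[of ?H K] jn_closed[OF JK(1,2)] jn_least[OF JK] by auto
      have a: "sg J K (add_mset (lab I J') N)" using seg.step[OF d(2) N] d by simp
      then have M0: "M0 = add_mset (lab I J') N" using less.hyps[of M0 J] 1 by auto
      have "sg J' K (add_mset (lab I J) N)" using seg.step[OF d(3) N] d by simp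
      \<comment> \<open>This multiset has the size of \<open>M0\<close>, so the induction hypothesis
        applies although the size of \<open>M0'\<close> is not yet known.\<close>
      then have "add_mset (lab I J) N = M0'"
        using less.hyps[of "add_mset (lab I J) N" J' M0'] 1 2 M0 by auto
      then show ?thesis using 1 2 M0 by (auto simp: add_mset_commute)
    qed
  qed
qed

text \<open>The label \<open>c\<close> sinks to the bottom as in bubble sort: a cover below it
  either carries \<open>c\<close> already or has a different label and can be exchanged with
  it.\<close>

lemma seg_bubble:
  "sg I J M \<Longrightarrow> c \<in># M \<Longrightarrow> \<exists>K. cov L I K \<and> lab I K = c \<and> sg K J (M - {#c#})"
proof (induction rule: seg.induct)
  case (refl I)
  then show ?case by simp
next
  case (step I J K M)
  show ?case
  proof (cases "lab I J = c")
    case True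
    then show ?thesis using step by auto
  next
    case False
    then have cM: "c \<in># M" using step by auto
    then obtain K' where K': "cov L J K'" "lab J K' = c" "sg K' K (M - {#c#})"
      using step.IH by blast
    then obtain W where W: "cov L I W" "cov L W K'" "lab I W = c" "lab W K' = lab I J"
      using lab_swap[OF step.hyps(1) K'(1)] False by auto
    have "sg W K (add_mset (lab I J) (M - {#c#}))"
      using seg.step[OF W(2) K'(3)] W by simp
    then show ?thesis using W False cM by auto
  qed
qed

text \<open>Every splitting of the labels into a lower and an upper part is realised by an
  intermediate element. Factorizations with prescribed blocks are found in this way.\<close>

lemma seg_permute: "sg I J (M1 + M2) \<Longrightarrow> \<exists>K. sg I K M1 \<and> sg K J M2"
proof (induction M1 arbitrary: I)
  case empty
  then have "sg I I {#}" using seg.refl[of I L lab] seg_mem[OF empty] by simp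
  then show ?case using empty by auto
next
  case (add c M1)
  obtain K where K: "cov L I K" "lab I K = c" "sg K J (M1 + M2)"
    using seg_bubble[OF add.prems, of c] by auto
  then obtain K' where K': "sg K K' M1" "sg K' J M2" using add.IH[OF K(3)] by auto
  have "sg I K' (add_mset c M1)" using seg.step[OF K(1) K'(1)] K(2) by simp
  then show ?case using K'(2) by auto
qed

text \<open>Taking joins with \<open>B\<close> moves the chain from \<open>A \<inter> B\<close> to
  \<open>A\<close> cover by cover, and each cover is perspective to its image.\<close>

lemma seg_transpose:
  assumes "sg I A M" "B \<in> L" "I = A \<inter> B"
  shows "sg B (jn A B) M"
  using assms
proof (induction arbitrary: B rule: seg.induct)
  case (refl I)
  then have "jn I B = B" using jn_absorb[of B I] jn_commute[of B I] by auto
  then show ?case using seg.refl[OF refl(2)] by simp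
next
  case (step I I1 A M)
  have mem: "I \<in> L" "I1 \<in> L" "A \<in> L" "I1 \<subseteq> A" using step.hyps(1) seg_mem[OF step.hyps(2)] by (auto simp: cov_def)
  have i: "I1 \<inter> B = I" using step.prems mem step.hyps(1) unfolding cov_def by auto
  let ?B = "jn I1 B"
  have c: "cov L B ?B" using cov_up[of I1 B] i step.hyps(1) step.prems(1) by simp
  have l: "lab B ?B = lab I I1"
    using lab_persp[OF c mem(2) jn_upper1[OF mem(2) step.prems(1)]
        jn_commute[OF step.prems(1) mem(2)]] i by (simp add: Int_commute)
  have BA: "B \<inter> A \<in> L" "B \<inter> A \<subseteq> I1"
    using mem step.prems int_closed[of B A] i by auto
  \<comment> \<open>Modularity keeps the rest of the chain in position: \<open>A\<close> meets the
    new lower end \<open>?B\<close> exactly in \<open>I1\<close>.\<close>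
  have "A \<inter> ?B \<subseteq> I1"
    using modular[OF mem(2) step.prems(1) mem(3) mem(4)] jn_absorb[OF mem(2) BA] by auto
  then have "I1 = A \<inter> ?B" using mem(4) jn_upper1[OF mem(2) step.prems(1)] by auto
  then have s: "sg ?B (jn A ?B) M" using step.IH[OF jn_closed[OF mem(2) step.prems(1)]] by simp
  have "jn A ?B = jn A B"
  proof (rule antisym)
    have AB: "A \<subseteq> jn A B" "B \<subseteq> jn A B" "jn A B \<in> L"
      using jn_upper1 jn_upper2 jn_closed mem step.prems by auto
    then have "?B \<subseteq> jn A B" using jn_least[of I1 B "jn A B"] mem step.prems by auto
    then show "jn A ?B \<subseteq> jn A B" using jn_least[of A ?B "jn A B"] AB mem jn_closed step.prems by auto
    have "A \<subseteq> jn A ?B" "?B \<subseteq> jn A ?B" "B \<subseteq> ?B"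
      using jn_upper1 jn_upper2 jn_closed mem step.prems by auto
    then show "jn A B \<subseteq> jn A ?B" using jn_least[of A B "jn A ?B"] mem jn_closed step.prems by auto
  qed
  then show ?case using seg.step[OF c s] l by simp
qed

end

section \<open>Rigid factorizations in cancellative monoids\<close>

locale cancel_monoid = monoid T for T (structure) +
  assumes all_cancel: "carrier T \<subseteq> cancellative T"
begin

lemma r_cancel: "a \<in> carrier T \<Longrightarrow> b \<in> carrier T \<Longrightarrow> c \<in> carrier T \<Longrightarrow> b \<otimes> a = c \<otimes> a \<Longrightarrow> b = c"
  using all_cancel by (auto simp: cancellative_def)

abbreviation pr :: "'a list \<Rightarrow> 'a" where "pr us \<equiv> foldr (\<otimes>) us \<one>"

lemma pr_closed [simp, intro]: "set us \<subseteq> carrier T \<Longrightarrow> pr us \<in> carrier T"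
  by (induction us) auto

lemma pr_append: "set us \<subseteq> carrier T \<Longrightarrow> set vs \<subseteq> carrier T \<Longrightarrow> pr (us @ vs) = pr us \<otimes> pr vs"
  by (induction us) (auto simp: m_assoc)

text \<open>Cancellation turns one-sided inverses into two-sided ones: a right inverse
  \<open>c\<close> of \<open>a\<close> satisfies
  \<open>(c \<otimes> a) \<otimes> c = \<one> \<otimes> c\<close>.\<close>

lemma Units_prodD:
  assumes "a \<in> carrier T" "b \<in> carrier T" "a \<otimes> b \<in> Units T"
  shows "a \<in> Units T" "b \<in> Units T"
proof -
  let ?v = "inv (a \<otimes> b)"
  have v: "?v \<in> carrier T" using assms(3) by simp
  define c where "c = b \<otimes> ?v"
  have c: "c \<in> carrier T" "a \<otimes> c = \<one>"
    using assms v by (auto simp: c_def m_assoc[symmetric] Units_r_inv)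
  have "c \<otimes> (a \<otimes> c) = c \<otimes> \<one>" using c by simp
  then have "(c \<otimes> a) \<otimes> c = \<one> \<otimes> c" using c assms by (simp add: m_assoc)
  then have "c \<otimes> a = \<one>" using r_cancel[of c "c \<otimes> a" \<one>] c assms by simp
  then show a: "a \<in> Units T" using c assms unfolding Units_def by blast
  have "b = inv a \<otimes> (a \<otimes> b)" using a assms by (simp add: m_assoc[symmetric])
  then show "b \<in> Units T" using a assms(3) by (metis Units_inv_Units Units_m_closed)
qed

declare Units_closed [simp]

lemma unit_inv_cancel [simp]:
  assumes "\<delta> \<in> Units T" "u \<in> carrier T"
  shows "inv \<delta> \<otimes> (\<delta> \<otimes> u) = u" "\<delta> \<otimes> (inv \<delta> \<otimes> u) = u" "u \<otimes> \<delta> \<otimes> inv \<delta> = u" "u \<otimes> inv \<delta> \<otimes> \<delta> = u"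
proof -
  have c: "\<delta> \<in> carrier T" "inv \<delta> \<in> carrier T" using assms by auto
  show "inv \<delta> \<otimes> (\<delta> \<otimes> u) = u" using m_assoc[OF c(2) c(1) assms(2)] assms by simp
  show "\<delta> \<otimes> (inv \<delta> \<otimes> u) = u" using m_assoc[OF c(1) c(2) assms(2)] assms by simp
  show "u \<otimes> \<delta> \<otimes> inv \<delta> = u" using m_assoc[OF assms(2) c] assms by simp
  show "u \<otimes> inv \<delta> \<otimes> \<delta> = u" using m_assoc[OF assms(2) c(2,1)] assms by simp
qed

lemma atoms_carrier: "u \<in> atoms T \<Longrightarrow> u \<in> carrier T"
  by (simp add: atoms_def)

lemma atoms_sub: "set us \<subseteq> atoms T \<Longrightarrow> set us \<subseteq> carrier T"
  using atoms_carrier by blast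

lemma atom_unit_left:
  assumes u: "u \<in> atoms T" and \<delta>: "\<delta> \<in> Units T"
  shows "\<delta> \<otimes> u \<in> atoms T"
  unfolding atoms_def
proof (intro CollectI conjI ballI impI)
  have uc: "u \<in> carrier T" "u \<notin> Units T" using u by (auto simp: atoms_def)
  show "\<delta> \<otimes> u \<in> carrier T - Units T"
    using uc \<delta> Units_prodD(2)[of \<delta> u] by auto
  fix a b assume ab: "a \<in> carrier T" "b \<in> carrier T" "\<delta> \<otimes> u = a \<otimes> b"
  have "u = inv \<delta> \<otimes> (\<delta> \<otimes> u)" using unit_inv_cancel(1)[OF \<delta> uc(1)] by simp
  also have "\<dots> = (inv \<delta> \<otimes> a) \<otimes> b" using ab \<delta> by (simp add: m_assoc)
  finally have "inv \<delta> \<otimes> a \<in> Units T \<or> b \<in> Units T"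
    using u ab \<delta> by (auto simp: atoms_def)
  then show "a \<in> Units T \<or> b \<in> Units T" using Units_prodD(2)[of "inv \<delta>" a] \<delta> ab by auto
qed

lemma atom_unit_right:
  assumes u: "u \<in> atoms T" and \<delta>: "\<delta> \<in> Units T"
  shows "u \<otimes> \<delta> \<in> atoms T"
  unfolding atoms_def
proof (intro CollectI conjI ballI impI)
  have uc: "u \<in> carrier T" "u \<notin> Units T" using u by (auto simp: atoms_def)
  show "u \<otimes> \<delta> \<in> carrier T - Units T"
    using uc \<delta> Units_prodD(1)[of u \<delta>] by auto
  fix a b assume ab: "a \<in> carrier T" "b \<in> carrier T" "u \<otimes> \<delta> = a \<otimes> b"
  have "u = (u \<otimes> \<delta>) \<otimes> inv \<delta>" using unit_inv_cancel(3)[OF \<delta> uc(1)] by simp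
  also have "\<dots> = a \<otimes> (b \<otimes> inv \<delta>)" using ab \<delta> by (simp add: m_assoc)
  finally have "a \<in> Units T \<or> b \<otimes> inv \<delta> \<in> Units T"
    using u ab \<delta> by (auto simp: atoms_def)
  then show "a \<in> Units T \<or> b \<in> Units T" using Units_prodD(1)[of b "inv \<delta>"] \<delta> ab by auto
qed

text \<open>The units \<open>\<delta>\<close> are multiplied onto the tails of the products, which avoids their inverses in
  \<^const>\<open>tuple_rel\<close>.\<close>

definition sim :: "'a tuple \<Rightarrow> 'a tuple \<Rightarrow> bool" where
  "sim x y \<longleftrightarrow> x \<in> tuples T \<and> y \<in> tuples T \<and> length (snd x) = length (snd y) \<and>
     tuple_prod T x = tuple_prod T y \<and>
     (\<forall>i \<in> {1..<length (snd x)}. \<exists>\<delta> \<in> Units T. pr (drop i (snd y)) = \<delta> \<otimes> pr (drop i (snd x)))"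

lemma tuplesD:
  assumes "(\<epsilon>, us) \<in> tuples T"
  shows "\<epsilon> \<in> Units T" "\<epsilon> \<in> carrier T" "set us \<subseteq> atoms T" "set us \<subseteq> carrier T"
    "i < length us \<Longrightarrow> us ! i \<in> carrier T" "set (drop i us) \<subseteq> carrier T"
    "pr (drop i us) \<in> carrier T"
proof -
  show 1: "\<epsilon> \<in> Units T" "\<epsilon> \<in> carrier T" "set us \<subseteq> atoms T" "set us \<subseteq> carrier T"
    using assms atoms_sub by (auto simp: tuples_def)
  show "i < length us \<Longrightarrow> us ! i \<in> carrier T" using 1 by auto
  show "set (drop i us) \<subseteq> carrier T" using 1(4) set_drop_subset[of i us] by auto
  then show "pr (drop i us) \<in> carrier T" by auto
qed

text \<open>From the last entry backwards the units between neighbouring entries telescope, which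
  leaves one unit in front of each tail. Conversely, each entry is recovered from two consecutive
  tails by right cancellation.\<close>

lemma tuple_rel_iff: "(x, y) \<in> tuple_rel T \<longleftrightarrow> sim x y"
proof -
  obtain \<epsilon> us \<epsilon>' vs where xy: "x = (\<epsilon>, us)" "y = (\<epsilon>', vs)" by (metis surj_pair)
  let ?L = "\<exists>\<delta> :: nat \<Rightarrow> 'a. (\<forall>i \<in> {1..<length us}. \<delta> i \<in> Units T) \<and> \<delta> (length us) = \<one> \<and>
         \<epsilon>' \<otimes> vs ! 0 = \<epsilon> \<otimes> us ! 0 \<otimes> inv (\<delta> 1) \<and>
         (\<forall>i \<in> {1..<length us}. vs ! i = \<delta> i \<otimes> us ! i \<otimes> inv (\<delta> (Suc i)))"
  let ?R = "\<forall>i \<in> {1..<length us}. \<exists>\<delta> \<in> Units T. pr (drop i vs) = \<delta> \<otimes> pr (drop i us)"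
  let ?H = "x \<in> tuples T \<and> y \<in> tuples T \<and> length us = length vs \<and> tuple_prod T x = tuple_prod T y"
  have eqv: "?L \<longleftrightarrow> ?R"
    if t: "x \<in> tuples T" "y \<in> tuples T" and l: "length us = length vs" and
      p: "tuple_prod T x = tuple_prod T y" and ne: "us \<noteq> []"
  proof
    note tu = tuplesD[OF t(1)[unfolded xy]] and tv = tuplesD[OF t(2)[unfolded xy]]
    assume ?L
    then obtain \<delta> where \<delta>: "\<And>i. i \<in> {1..<length us} \<Longrightarrow> \<delta> i \<in> Units T" "\<delta> (length us) = \<one>"
      "\<And>i. i \<in> {1..<length us} \<Longrightarrow> vs ! i = \<delta> i \<otimes> us ! i \<otimes> inv (\<delta> (Suc i))" by blast
    have "pr (drop i vs) = \<delta> i \<otimes> pr (drop i us)" if "i \<le> length us" "1 \<le> i" for i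
      using that
    proof (induction i rule: inc_induct)
      case base
      then show ?case using l \<delta>(2) by simp
    next
      case (step i)
      then have i: "i < length us" "i < length vs" "1 \<le> i" using l by auto
      have U: "\<delta> i \<in> Units T" "\<delta> (Suc i) \<in> Units T"
        using \<delta>(1)[of i] \<delta>(1)[of "Suc i"] \<delta>(2) i by (cases "Suc i = length us"; simp)+
      have "pr (drop i vs) = vs ! i \<otimes> pr (drop (Suc i) vs)"
        using i by (simp add: Cons_nth_drop_Suc[symmetric])
      also have "\<dots> = (\<delta> i \<otimes> us ! i \<otimes> inv (\<delta> (Suc i))) \<otimes> (\<delta> (Suc i) \<otimes> pr (drop (Suc i) us))"
        using step \<delta>(3)[of i] i by simp
      also have "\<dots> = \<delta> i \<otimes> (us ! i \<otimes> (inv (\<delta> (Suc i)) \<otimes> (\<delta> (Suc i) \<otimes> pr (drop (Suc i) us))))"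
        using U U[THEN Units_closed] tu(5)[OF i(1)] tu(7)[of "Suc i"] by (simp add: m_assoc)
      also have "inv (\<delta> (Suc i)) \<otimes> (\<delta> (Suc i) \<otimes> pr (drop (Suc i) us)) = pr (drop (Suc i) us)"
        using unit_inv_cancel(1)[OF U(2) tu(7)] by simp
      also have "us ! i \<otimes> pr (drop (Suc i) us) = pr (drop i us)"
        using i by (simp add: Cons_nth_drop_Suc[symmetric])
      finally show ?case .
    qed
    then show ?R using \<delta>(1) by auto
  next
    note tu = tuplesD[OF t(1)[unfolded xy]] and tv = tuplesD[OF t(2)[unfolded xy]]
    assume ?R
    then have "\<forall>i. \<exists>d. i \<in> {1..<length us} \<longrightarrow> d \<in> Units T \<and> pr (drop i vs) = d \<otimes> pr (drop i us)"
      by auto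
    then obtain d where d: "\<And>i. i \<in> {1..<length us} \<Longrightarrow>
        d i \<in> Units T \<and> pr (drop i vs) = d i \<otimes> pr (drop i us)"
      by metis
    \<comment> \<open>The value \<open>\<one>\<close> at \<open>length us\<close> is the convention
      that no unit is inserted after the last entry.\<close>
    define \<delta> where "\<delta> i = (if i < length us then d i else \<one>)" for i
    have \<delta>: "\<delta> i \<in> Units T \<and> pr (drop i vs) = \<delta> i \<otimes> pr (drop i us)" if "1 \<le> i" for i
      using d[of i] that l by (auto simp: \<delta>_def)
    have key: "y' = x' \<otimes> inv (\<delta> (Suc i))"
      if "x' \<in> carrier T" "y' \<in> carrier T"
        "y' \<otimes> pr (drop (Suc i) vs) = x' \<otimes> pr (drop (Suc i) us)" for x' y' i
    proof -
      have D: "\<delta> (Suc i) \<in> Units T" "pr (drop (Suc i) vs) = \<delta> (Suc i) \<otimes> pr (drop (Suc i) us)"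
        using \<delta>[of "Suc i"] by auto
      have "(y' \<otimes> \<delta> (Suc i)) \<otimes> pr (drop (Suc i) us) = x' \<otimes> pr (drop (Suc i) us)"
        using that D tu(7)[of "Suc i"] by (simp add: m_assoc)
      then have "y' \<otimes> \<delta> (Suc i) = x'"
        using r_cancel[OF tu(7)[of "Suc i"]] that D by blast
      then show ?thesis using that D by (auto simp: m_assoc)
    qed
    have "\<epsilon>' \<otimes> vs ! 0 = \<epsilon> \<otimes> us ! 0 \<otimes> inv (\<delta> (Suc 0))"
    proof (rule key)
      have zc: "us ! 0 \<in> carrier T" "vs ! 0 \<in> carrier T" "pr (drop (Suc 0) us) \<in> carrier T"
        "pr (drop (Suc 0) vs) \<in> carrier T" "\<epsilon> \<in> carrier T" "\<epsilon>' \<in> carrier T"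
        using tu(5)[of 0] tv(5)[of 0] tu(2,7) tv(2,7) ne l length_greater_0_conv[of us]
          length_greater_0_conv[of vs] by simp_all
      have z: "us = us ! 0 # drop (Suc 0) us" "vs = vs ! 0 # drop (Suc 0) vs"
        using ne l by (cases us; cases vs; simp)+
      have "\<epsilon> \<otimes> pr us = \<epsilon>' \<otimes> pr vs" using p xy by (simp add: tuple_prod_def)
      then have "\<epsilon> \<otimes> (us ! 0 \<otimes> pr (drop (Suc 0) us)) = \<epsilon>' \<otimes> (vs ! 0 \<otimes> pr (drop (Suc 0) vs))"
        using arg_cong[OF z(1), of pr] arg_cong[OF z(2), of pr] by simp
      then show "\<epsilon>' \<otimes> vs ! 0 \<otimes> pr (drop (Suc 0) vs) = \<epsilon> \<otimes> us ! 0 \<otimes> pr (drop (Suc 0) us)"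
        using zc by (simp add: m_assoc)
      show "\<epsilon> \<otimes> us ! 0 \<in> carrier T" "\<epsilon>' \<otimes> vs ! 0 \<in> carrier T" using zc by auto
    qed
    moreover have "vs ! i = \<delta> i \<otimes> us ! i \<otimes> inv (\<delta> (Suc i))" if i: "i \<in> {1..<length us}" for i
    proof (rule key)
      have "pr (drop i vs) = \<delta> i \<otimes> pr (drop i us)" using \<delta> i by auto
      moreover have "pr (drop i vs) = vs ! i \<otimes> pr (drop (Suc i) vs)"
        "pr (drop i us) = us ! i \<otimes> pr (drop (Suc i) us)"
        using i l by (auto simp: Cons_nth_drop_Suc[symmetric])
      ultimately show "vs ! i \<otimes> pr (drop (Suc i) vs) = \<delta> i \<otimes> us ! i \<otimes> pr (drop (Suc i) us)"
        using \<delta>[of i] i tu(5,7) by (auto simp: m_assoc)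
    qed (use i \<delta>[of i] tu(5) tv(5) l in auto)
    moreover have "\<delta> (length us) = \<one>" by (simp add: \<delta>_def)
    moreover have "\<forall>i \<in> {1..<length us}. \<delta> i \<in> Units T" using \<delta> by auto
    ultimately show ?L by (intro exI[of _ \<delta>]) auto
  qed
  have "(x, y) \<in> tuple_rel T \<longleftrightarrow> ?H \<and> (us = [] \<or> ?L)" by (simp add: tuple_rel_def xy)
  moreover have "sim x y \<longleftrightarrow> ?H \<and> ?R" by (simp add: sim_def xy)
  moreover have "us = [] \<Longrightarrow> ?R" by simp
  ultimately show ?thesis using eqv by (cases "us = []") blast+
qed

lemma sim_refl: "x \<in> tuples T \<Longrightarrow> sim x x"
proof -
  assume x: "x \<in> tuples T"
  have "\<exists>\<delta> \<in> Units T. pr (drop i (snd x)) = \<delta> \<otimes> pr (drop i (snd x))" for i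
    using tuplesD(7)[of "fst x" "snd x" i] x by (intro bexI[of _ \<one>]) auto
  then show ?thesis using x by (auto simp: sim_def)
qed

lemma sim_sym: "sim x y \<Longrightarrow> sim y x"
proof -
  assume s: "sim x y"
  have "\<exists>\<delta> \<in> Units T. pr (drop i (snd x)) = \<delta> \<otimes> pr (drop i (snd y))"
    if i: "i \<in> {1..<length (snd y)}" for i
  proof -
    obtain \<delta> where \<delta>: "\<delta> \<in> Units T" "pr (drop i (snd y)) = \<delta> \<otimes> pr (drop i (snd x))"
      using s i unfolding sim_def by metis
    have "pr (drop i (snd x)) \<in> carrier T"
      using tuplesD(7)[of "fst x" "snd x" i] s by (auto simp: sim_def)
    then show ?thesis using \<delta> by (intro bexI[of _ "inv \<delta>"]) auto
  qed
  then show ?thesis using s by (auto simp: sim_def)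
qed

lemma sim_trans: "sim x y \<Longrightarrow> sim y z \<Longrightarrow> sim x z"
proof -
  assume s: "sim x y" and s': "sim y z"
  have "\<exists>\<delta> \<in> Units T. pr (drop i (snd z)) = \<delta> \<otimes> pr (drop i (snd x))"
    if i: "i \<in> {1..<length (snd x)}" for i
  proof -
    obtain \<delta> where \<delta>: "\<delta> \<in> Units T" "pr (drop i (snd y)) = \<delta> \<otimes> pr (drop i (snd x))"
      using s i unfolding sim_def by metis
    obtain \<delta>' where \<delta>': "\<delta>' \<in> Units T" "pr (drop i (snd z)) = \<delta>' \<otimes> pr (drop i (snd y))"
      using s s' i unfolding sim_def by metis
    have "pr (drop i (snd x)) \<in> carrier T"
      using tuplesD(7)[of "fst x" "snd x" i] s by (auto simp: sim_def)
    then show ?thesis using \<delta> \<delta>' by (intro bexI[of _ "\<delta>' \<otimes> \<delta>"]) (auto simp: m_assoc)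
  qed
  then show ?thesis using s s' by (auto simp: sim_def)
qed

section \<open>Rigid factorizations as equivalence classes, and their product\<close>

abbreviation cls where "cls \<equiv> rigid_class T"

lemma cls_eq: "cls x = {y. sim x y}"
  by (auto simp: rigid_class_def tuple_rel_iff)

lemma cls_eq_iff: "x \<in> tuples T \<Longrightarrow> cls x = cls y \<longleftrightarrow> sim x y"
  unfolding cls_eq using sim_refl sim_sym sim_trans by blast

lemma Zstar_iff: "z \<in> Zstar T \<longleftrightarrow> (\<exists>x \<in> tuples T. z = cls x)"
  by (auto simp: Zstar_def quotient_def rigid_class_def)

lemma rep_cls: "x \<in> tuples T \<Longrightarrow> sim x (rep (cls x))"
proof -
  assume "x \<in> tuples T"
  then have "x \<in> cls x" using sim_refl by (auto simp: cls_eq)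
  then have "rep (cls x) \<in> cls x" unfolding rep_def by (rule someI)
  then show ?thesis by (simp add: cls_eq)
qed

lemma rep_Zstar: "z \<in> Zstar T \<Longrightarrow> rep z \<in> tuples T \<and> z = cls (rep z)"
  using rep_cls cls_eq_iff unfolding Zstar_iff by (metis sim_def)

lemma rigid_length_cls: "x \<in> tuples T \<Longrightarrow> rigid_length (cls x) = length (snd x)"
  using rep_cls[of x] by (simp add: rigid_length_def sim_def)

lemma rigid_pi_cls: "x \<in> tuples T \<Longrightarrow> rigid_pi T (cls x) = tuple_prod T x"
  using rep_cls[of x] by (simp add: rigid_pi_def sim_def)

lemma cls_facts: "x \<in> tuples T \<Longrightarrow> tuple_prod T x = a \<Longrightarrow> cls x \<in> rigid_facts T a"
  using Zstar_iff rigid_pi_cls by (auto simp: rigid_facts_def)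

lemma pr_mult_last:
  assumes "us \<noteq> []" "set us \<subseteq> carrier T" "\<phi> \<in> carrier T" "set vs \<subseteq> carrier T"
  shows "pr (butlast us @ [last us \<otimes> \<phi>] @ vs) = pr us \<otimes> (\<phi> \<otimes> pr vs)"
proof -
  have b: "set (butlast us) \<subseteq> carrier T" "last us \<in> carrier T"
    using assms by (auto dest: in_set_butlastD)
  have "pr us = pr (butlast us @ [last us])" using assms(1) by simp
  also have "\<dots> = pr (butlast us) \<otimes> last us" using b pr_append[of "butlast us" "[last us]"] by simp
  finally have "pr us = pr (butlast us) \<otimes> last us" .
  moreover have "pr (butlast us @ ((last us \<otimes> \<phi>) # vs)) = pr (butlast us) \<otimes> pr ((last us \<otimes> \<phi>) # vs)"
    using b assms by (intro pr_append) auto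
  ultimately show ?thesis using b assms by (simp add: m_assoc)
qed

lemma tuple_mult_tuples:
  assumes "(\<epsilon>, us) \<in> tuples T" "(\<phi>, vs) \<in> tuples T"
  shows "tuple_mult T (\<epsilon>, us) (\<phi>, vs) \<in> tuples T"
proof (cases "us = []")
  case False
  then have "last us \<in> atoms T" "set (butlast us) \<subseteq> atoms T"
    using assms by (auto simp: tuples_def dest: in_set_butlastD)
  then show ?thesis using assms False atom_unit_right by (auto simp: tuples_def)
qed (use assms in \<open>auto simp: tuples_def\<close>)

lemma tuple_mult_prod:
  assumes "(\<epsilon>, us) \<in> tuples T" "(\<phi>, vs) \<in> tuples T"
  shows "tuple_prod T (tuple_mult T (\<epsilon>, us) (\<phi>, vs)) =
    tuple_prod T (\<epsilon>, us) \<otimes> tuple_prod T (\<phi>, vs)"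
  using tuplesD[OF assms(1)] tuplesD[OF assms(2)] pr_mult_last[of us \<phi> vs]
  by (auto simp: tuple_prod_def m_assoc)

text \<open>\<open>sim\<close> speaks of tails, so compatibility with products is reduced to the
  tails of a product. The unit of the second tuple enters exactly those tails that begin in the
  first.\<close>

lemma tuple_mult_drop:
  assumes "(\<epsilon>, us) \<in> tuples T" "(\<phi>, vs) \<in> tuples T" "us \<noteq> []"
  shows "pr (drop i (snd (tuple_mult T (\<epsilon>, us) (\<phi>, vs)))) =
    (if i < length us then pr (drop i us) \<otimes> tuple_prod T (\<phi>, vs) else pr (drop (i - length us) vs))"
proof (cases "i < length us")
  case True
  have "drop i (butlast us @ [last us \<otimes> \<phi>] @ vs) =
      butlast (drop i us) @ [last (drop i us) \<otimes> \<phi>] @ vs"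
    using True by (simp add: drop_butlast)
  then show ?thesis
    using True assms(3) pr_mult_last[of "drop i us" \<phi> vs] tuplesD(6)[OF assms(1), of i]
      tuplesD[OF assms(2)] by (simp add: tuple_prod_def)
next
  case False
  then have "drop i (butlast us @ [last us \<otimes> \<phi>] @ vs) = drop (i - length us) vs"
  proof -
    have "butlast us @ [last us \<otimes> \<phi>] @ vs = (butlast us @ [last us \<otimes> \<phi>]) @ vs" by simp
    moreover have "length (butlast us @ [last us \<otimes> \<phi>]) = length us" using assms(3) by (cases us) auto
    ultimately show ?thesis using False by (simp only: drop_append drop_all) simp
  qed
  then show ?thesis using False assms(3) by simp
qed

lemma tuple_mult_sim:
  assumes "sim (\<epsilon>, us) (\<epsilon>', us')" "sim (\<phi>, vs) (\<phi>', vs')"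
  shows "sim (tuple_mult T (\<epsilon>, us) (\<phi>, vs)) (tuple_mult T (\<epsilon>', us') (\<phi>', vs'))"
proof -
  have t: "(\<epsilon>, us) \<in> tuples T" "(\<epsilon>', us') \<in> tuples T" "(\<phi>, vs) \<in> tuples T" "(\<phi>', vs') \<in> tuples T"
    and l: "length us = length us'" "length vs = length vs'"
    and p: "tuple_prod T (\<epsilon>, us) = tuple_prod T (\<epsilon>', us')"
      "tuple_prod T (\<phi>, vs) = tuple_prod T (\<phi>', vs')"
    and du: "\<And>i. i \<in> {1..<length us} \<Longrightarrow> \<exists>\<delta> \<in> Units T. pr (drop i us') = \<delta> \<otimes> pr (drop i us)"
    and dv: "\<And>i. i \<in> {1..<length vs} \<Longrightarrow> \<exists>\<delta> \<in> Units T. pr (drop i vs') = \<delta> \<otimes> pr (drop i vs)"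
    using assms by (auto simp: sim_def)
  note tu = tuplesD[OF t(1)] and tv = tuplesD[OF t(3)] and tv' = tuplesD[OF t(4)]
  \<comment> \<open>At the seam the second tuple has handed its leading unit to the first, so the
    two tails that start there differ by the quotient of \<open>\<phi>\<close> and
    \<open>\<phi>'\<close>.\<close>
  have v0: "\<exists>\<delta> \<in> Units T. pr vs' = \<delta> \<otimes> pr vs"
  proof -
    have "\<phi> \<otimes> pr vs = \<phi>' \<otimes> pr vs'" using p(2) by (simp add: tuple_prod_def)
    then have "inv \<phi>' \<otimes> (\<phi> \<otimes> pr vs) = pr vs'"
      using tv(1,2) tv'(1,2) tv(7)[of 0] tv'(7)[of 0] by (simp add: m_assoc[symmetric])
    then show ?thesis
      using tv(1,2) tv'(1,2) tv(7)[of 0] by (intro bexI[of _ "inv \<phi>' \<otimes> \<phi>"]) (auto simp: m_assoc)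
  qed
  have "\<exists>\<delta> \<in> Units T. pr (drop i (snd (tuple_mult T (\<epsilon>', us') (\<phi>', vs')))) =
      \<delta> \<otimes> pr (drop i (snd (tuple_mult T (\<epsilon>, us) (\<phi>, vs))))"
    if i: "i \<in> {1..<length (snd (tuple_mult T (\<epsilon>, us) (\<phi>, vs)))}" for i
  proof (cases "us = []")
    case True
    then show ?thesis using l i dv by simp
  next
    case False
    then have ne: "us' \<noteq> []" using l by auto
    have len: "length (snd (tuple_mult T (\<epsilon>, us) (\<phi>, vs))) = length us + length vs"
      using False by simp
    show ?thesis
    proof (cases "i < length us")
      case True
      then obtain \<delta> where \<delta>: "\<delta> \<in> Units T" "pr (drop i us') = \<delta> \<otimes> pr (drop i us)"
        using du[of i] i by auto
      have "tuple_prod T (\<phi>, vs) \<in> carrier T" using tv(2) tv(7)[of 0] by (simp add: tuple_prod_def)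
      then show ?thesis
        unfolding tuple_mult_drop[OF t(1,3) False] tuple_mult_drop[OF t(2,4) ne]
        using True l p \<delta> tu(7)[of i] by (intro bexI[of _ \<delta>]) (auto simp: m_assoc)
    next
      case i': False
      have "\<exists>\<delta> \<in> Units T. pr (drop (i - length us) vs') = \<delta> \<otimes> pr (drop (i - length us) vs)"
      proof (cases "i = length us")
        case True
        then show ?thesis using v0 by simp
      next
        case False
        then have "i - length us \<in> {1..<length vs}" using i' i unfolding len by auto
        then show ?thesis using dv by blast
      qed
      then show ?thesis
        unfolding tuple_mult_drop[OF t(1,3) False] tuple_mult_drop[OF t(2,4) ne]
        using i' l by auto
    qed
  qed
  moreover have "length (snd (tuple_mult T (\<epsilon>, us) (\<phi>, vs))) =
      length (snd (tuple_mult T (\<epsilon>', us') (\<phi>', vs')))"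
    using l by auto
  ultimately show ?thesis
    unfolding sim_def using tuple_mult_tuples t tuple_mult_prod[OF t(1,3)]
      tuple_mult_prod[OF t(2,4)] p by auto
qed

lemma rigid_mult_cls:
  assumes "x \<in> tuples T" "y \<in> tuples T"
  shows "rigid_mult T (cls x) (cls y) = cls (tuple_mult T x y)"
proof -
  have "sim (tuple_mult T x y) (tuple_mult T (rep (cls x)) (rep (cls y)))"
    using tuple_mult_sim rep_cls[OF assms(1)] rep_cls[OF assms(2)] by (metis surj_pair)
  then show ?thesis
    unfolding rigid_mult_def using cls_eq_iff by (metis sim_def)
qed

lemma rigid_mult_one:
  assumes "set us \<subseteq> atoms T" "set vs \<subseteq> atoms T"
  shows "rigid_mult T (cls (\<one>, us)) (cls (\<one>, vs)) = cls (\<one>, us @ vs)"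
proof -
  have t: "(\<one>, us) \<in> tuples T" "(\<one>, vs) \<in> tuples T" using assms by (auto simp: tuples_def)
  have "last us \<in> carrier T" if "us \<noteq> []"
    using that atoms_sub[OF assms(1)] last_in_set by blast
  then have "tuple_mult T (\<one>, us) (\<one>, vs) = (\<one>, us @ vs)"
    using append_butlast_last_id[of us] by (metis append.assoc append_Nil r_one l_one one_closed tuple_mult.simps)
  then show ?thesis using rigid_mult_cls[OF t] by simp
qed

text \<open>Invariance under multiplication removes the common outer atoms, and the upper bound for
  a distance then counts only the atoms in the middle. For two atoms this gives the constant
  2.\<close>

lemma dist_mid:
  assumes d: "distance_on T d"
    and s: "set xs \<subseteq> atoms T" "set ms \<subseteq> atoms T" "set ms' \<subseteq> atoms T" "set ys \<subseteq> atoms T"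
    and p: "pr ms = pr ms'"
  shows "d (cls (\<one>, xs @ ms @ ys)) (cls (\<one>, xs @ ms' @ ys)) \<le> max (max (length ms) (length ms')) 1"
proof -
  have t: "(\<one>, us) \<in> tuples T" if "set us \<subseteq> atoms T" for us using that by (auto simp: tuples_def)
  have f: "cls (\<one>, us) \<in> rigid_facts T (pr us)" if "set us \<subseteq> atoms T" for us
    using cls_facts[OF t[OF that]] pr_closed[OF atoms_sub[OF that]] by (simp add: tuple_prod_def)
  have Z: "cls (\<one>, us) \<in> Zstar T" if "set us \<subseteq> atoms T" for us
    using t[OF that] Zstar_iff by blast
  have xm: "set (xs @ ms) \<subseteq> atoms T" "set (xs @ ms') \<subseteq> atoms T" using s by auto
  have pm: "pr (xs @ ms) = pr (xs @ ms')"
    using pr_append[of xs ms] pr_append[of xs ms'] s p atoms_sub by simp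
  have "d (cls (\<one>, (xs @ ms) @ ys)) (cls (\<one>, (xs @ ms') @ ys)) = d (cls (\<one>, xs @ ms)) (cls (\<one>, xs @ ms'))"
    using d[unfolded distance_on_def, rule_format, OF f[OF xm(1)] f[OF xm(2), folded pm]] Z[OF s(4)]
      rigid_mult_one[OF xm(1) s(4)] rigid_mult_one[OF xm(2) s(4)] by auto
  also have "\<dots> = d (cls (\<one>, ms)) (cls (\<one>, ms'))"
    using d[unfolded distance_on_def, rule_format, OF f[OF s(2)] f[OF s(3), folded p]] Z[OF s(1)]
      rigid_mult_one[OF s(1,2)] rigid_mult_one[OF s(1,3)] by auto
  also have "\<dots> \<le> max (max (length ms) (length ms')) 1"
    using d[unfolded distance_on_def, rule_format, OF f[OF s(2)] f[OF s(3), folded p]]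
      rigid_length_cls[OF t[OF s(2)]] rigid_length_cls[OF t[OF s(3)]] by auto
  finally show ?thesis by simp
qed

section \<open>Reduced monoids and the permutable distance\<close>

lemma reduced_sim:
  assumes red: "Units T = {\<one>}" and s: "sim x y"
  shows "x = y"
proof -
  obtain \<epsilon> us \<epsilon>' vs where xy: "x = (\<epsilon>, us)" "y = (\<epsilon>', vs)" by (metis surj_pair)
  have t: "(\<epsilon>, us) \<in> tuples T" "(\<epsilon>', vs) \<in> tuples T" "length us = length vs"
    "\<epsilon> \<otimes> pr us = \<epsilon>' \<otimes> pr vs"
    using s xy by (auto simp: sim_def tuple_prod_def)
  note tu = tuplesD[OF t(1)] and tv = tuplesD[OF t(2)]
  have e: "\<epsilon> = \<one>" "\<epsilon>' = \<one>" using tu tv red by auto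
  have *: "pr (drop i us) = pr (drop i vs)" for i
  proof -
    consider "i = 0" | "i \<in> {1..<length us}" | "length us \<le> i" by fastforce
    then show ?thesis
    proof cases
      case 1 then show ?thesis using t(4) e tu(7)[of 0] tv(7)[of 0] by simp
    next
      case 2
      then show ?thesis using s xy red tu(7)[of i] by (auto simp: sim_def)
    next
      case 3 then show ?thesis using t by simp
    qed
  qed
  have "us ! i = vs ! i" if "i < length us" for i
  proof -
    have "us ! i \<otimes> pr (drop (Suc i) us) = vs ! i \<otimes> pr (drop (Suc i) us)"
      using *[of i] *[of "Suc i"] that t(3) by (simp add: Cons_nth_drop_Suc[symmetric])
    then show ?thesis using r_cancel tu(5,7) tv(5) that t(3) by metis
  qed
  then show ?thesis using xy e t(3) nth_equalityI by blast
qed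

end

text \<open>When association is equality, a matching of entries is a common submultiset of the two
  lists, and equal multisets are matched completely by a permutation of positions.\<close>

lemma perm_matching_sizes:
  fixes us :: "'b list" and vs :: "'b list"
  defines "A \<equiv> {card I | I \<sigma>. I \<subseteq> {..<length us} \<and> inj_on \<sigma> I \<and> \<sigma> ` I \<subseteq> {..<length vs} \<and>
             (\<forall>i \<in> I. us ! i = vs ! \<sigma> i)}"
  shows "finite A" "A \<noteq> {}"
    "\<exists>C. C \<subseteq># mset us \<and> C \<subseteq># mset vs \<and> size C = Max A"
    "mset us = mset vs \<Longrightarrow> length us \<le> Max A"
proof -
  have "A \<subseteq> card ` Pow {..<length us}" unfolding A_def by auto
  then show fin: "finite A" by (rule finite_subset) simp
  have "0 \<in> A" unfolding A_def by (rule CollectI, rule exI[of _ "{}"]) auto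
  then show ne: "A \<noteq> {}" by blast
  obtain I \<sigma> where I: "Max A = card I" "I \<subseteq> {..<length us}" "inj_on \<sigma> I" "\<sigma> ` I \<subseteq> {..<length vs}"
    "\<forall>i \<in> I. us ! i = vs ! \<sigma> i"
    using Max_in[OF fin ne] unfolding A_def by blast
  have m: "mset ws = image_mset ((!) ws) (mset_set {..<length ws})" for ws :: "'b list"
    by (metis atLeast_upt map_nth mset_map mset_set_set distinct_upt mset_upt atLeast0LessThan)
  let ?C = "image_mset ((!) us) (mset_set I)"
  have fI: "finite I" using I(2) finite_subset by blast
  have "?C \<subseteq># mset us"
    unfolding m[of us] using I(2) by (intro image_mset_subseteq_mono) (simp add: subset_imp_msubset_mset_set)
  moreover have "?C = image_mset ((!) vs) (mset_set (\<sigma> ` I))"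
    using I(3,5) fI by (subst image_mset_mset_set[OF I(3), symmetric])
      (auto simp: multiset.map_comp intro!: image_mset_cong)
  then have "?C \<subseteq># mset vs"
    unfolding m[of vs] using I(4) by (simp add: image_mset_subseteq_mono subset_imp_msubset_mset_set)
  ultimately show "\<exists>C. C \<subseteq># mset us \<and> C \<subseteq># mset vs \<and> size C = Max A"
    using I(1) fI by (intro exI[of _ ?C]) auto
  assume "mset us = mset vs"
  then obtain f where "bij_betw f {..<length us} {..<length vs}" "\<forall>i<length us. us ! i = vs ! f i"
    using permutation_Ex_bij by blast
  then have "length us \<in> A"
    unfolding A_def by (intro CollectI exI[of _ "{..<length us}"] exI[of _ f]) (auto simp: bij_betw_def)
  then show "length us \<le> Max A" using fin by simp
qed

context cancel_monoid
begin

lemma reduced_cls: "Units T = {\<one>} \<Longrightarrow> x \<in> tuples T \<Longrightarrow> cls x = {x}"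
  unfolding cls_eq using reduced_sim sim_refl by blast

lemma reduced_rep: "Units T = {\<one>} \<Longrightarrow> x \<in> tuples T \<Longrightarrow> rep (cls x) = x"
  by (simp add: reduced_cls rep_def)

text \<open>\<open>C\<close> comes from a largest matching; at most \<open>perm_distance\<close>
  many entries of either list stay outside it.\<close>

lemma reduced_perm_distance:
  assumes red: "Units T = {\<one>}" and t: "(\<epsilon>, us) \<in> tuples T" "(\<epsilon>', vs) \<in> tuples T"
  shows "\<exists>C. C \<subseteq># mset us \<and> C \<subseteq># mset vs \<and>
      max (length us) (length vs) \<le> perm_distance T (cls (\<epsilon>, us)) (cls (\<epsilon>', vs)) + size C"
    and "mset us = mset vs \<Longrightarrow> perm_distance T (cls (\<epsilon>, us)) (cls (\<epsilon>', vs)) = 0"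
proof -
  have ua: "unit_assoc T a b \<longleftrightarrow> a = b" if "a \<in> carrier T" for a b
    using that red by (auto simp: unit_assoc_def)
  let ?A = "{card I | I \<sigma>. I \<subseteq> {..<length us} \<and> inj_on \<sigma> I \<and> \<sigma> ` I \<subseteq> {..<length vs} \<and>
             (\<forall>i \<in> I. unit_assoc T (us ! i) (vs ! \<sigma> i))}"
  have A: "?A = {card I | I \<sigma>. I \<subseteq> {..<length us} \<and> inj_on \<sigma> I \<and> \<sigma> ` I \<subseteq> {..<length vs} \<and>
             (\<forall>i \<in> I. us ! i = vs ! \<sigma> i)}"
  proof -
    have "(\<forall>i \<in> I. unit_assoc T (us ! i) (vs ! \<sigma> i)) = (\<forall>i \<in> I. us ! i = vs ! \<sigma> i)"
      if "I \<subseteq> {..<length us}" for I \<sigma>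
      using ua tuplesD(5)[OF t(1)] that by (intro ball_cong) auto
    then show ?thesis by (intro Collect_cong) metis
  qed
  have pd: "perm_distance T (cls (\<epsilon>, us)) (cls (\<epsilon>', vs)) = max (length us) (length vs) - Max ?A"
    using reduced_rep[OF red t(1)] reduced_rep[OF red t(2)] by (simp add: perm_distance_def)
  show "\<exists>C. C \<subseteq># mset us \<and> C \<subseteq># mset vs \<and>
      max (length us) (length vs) \<le> perm_distance T (cls (\<epsilon>, us)) (cls (\<epsilon>', vs)) + size C"
    using perm_matching_sizes(3)[of us vs] unfolding pd A by fastforce
  assume m: "mset us = mset vs"
  then show "perm_distance T (cls (\<epsilon>, us)) (cls (\<epsilon>', vs)) = 0"
    using perm_matching_sizes(4)[OF m] mset_eq_length[OF m] unfolding pd A by simp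
qed

end

section \<open>Factorizations read off from a labelled modular lattice\<close>

text \<open>The block monoid with an arbitrary carrier, so that the lattice arguments do not mention
  the class group.\<close>

definition mset_monoid :: "'c multiset set \<Rightarrow> 'c multiset monoid" where
  "mset_monoid Z = \<lparr>carrier = Z, monoid.mult = (+), one = {#}\<rparr>"

text \<open>\<open>pid w\<close> plays the role of \<open>S w\<close>, \<open>th\<close> that of \<open>\<theta>\<close>, and \<open>Z\<close> is the set of zero-sum sequences.\<close>

locale transfer_lattice = labelled_lattice L jn lab + cancel_monoid T
  for L :: "'a set set" and jn and lab :: "'a set \<Rightarrow> 'a set \<Rightarrow> 'c"
    and T :: "('t, 'x) monoid_scheme" (structure) +
  fixes pid :: "'t \<Rightarrow> 'a set" and th :: "'t \<Rightarrow> 'c multiset" and Z :: "'c multiset set"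
  assumes pid_L: "w \<in> carrier T \<Longrightarrow> pid w \<in> L"
    and pid_eq: "w \<in> carrier T \<Longrightarrow> w' \<in> carrier T \<Longrightarrow> pid w = pid w' \<Longrightarrow> \<exists>\<delta> \<in> Units T. w' = \<delta> \<otimes> w"
    and th_seg: "u \<in> carrier T \<Longrightarrow> w \<in> carrier T \<Longrightarrow> seg L lab (pid (u \<otimes> w)) (pid w) (th u)"
    and th_Z: "u \<in> carrier T \<Longrightarrow> th u \<in> Z"
    and pid_exists: "a \<in> carrier T \<Longrightarrow> seg L lab (pid a) K N \<Longrightarrow> seg L lab K (pid \<one>) M \<Longrightarrow> M \<in> Z \<Longrightarrow>
      \<exists>w \<in> carrier T. K = pid w"
    and pid_dvd: "w \<in> carrier T \<Longrightarrow> a \<in> carrier T \<Longrightarrow> pid a \<subseteq> pid w \<Longrightarrow> \<exists>u \<in> carrier T. a = u \<otimes> w"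
    and Z_zero: "{#} \<in> Z"
    and Z_add: "M \<in> Z \<Longrightarrow> M + N \<in> Z \<longleftrightarrow> N \<in> Z"
begin

section \<open>The transfer property\<close>

lemma seg_top: "w \<in> carrier T \<Longrightarrow> sg (pid w) (pid \<one>) (th w)"
  using th_seg[of w \<one>] by simp

lemma th_mult:
  assumes "u \<in> carrier T" "w \<in> carrier T"
  shows "th (u \<otimes> w) = th u + th w"
  using seg_unique[OF seg_top[of "u \<otimes> w"] seg_trans[OF th_seg[OF assms] seg_top[OF assms(2)]]] assms
  by simp

lemma th_one: "th \<one> = {#}"
  using seg_unique[OF seg_top[OF one_closed] seg.refl[OF pid_L[OF one_closed]]] .

lemma th_eqI:
  assumes "u \<in> carrier T" "w \<in> carrier T" "sg (pid (u \<otimes> w)) (pid w) M"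
  shows "th u = M"
  using seg_unique[OF th_seg[OF assms(1,2)] assms(3)] .

lemma th_unit_iff:
  assumes "u \<in> carrier T"
  shows "th u = {#} \<longleftrightarrow> u \<in> Units T"
proof
  assume "th u = {#}"
  then have "pid \<one> = pid u" using seg_top[OF assms] seg_empty by metis
  then show "u \<in> Units T" using pid_eq[OF one_closed assms] by auto
next
  assume u: "u \<in> Units T"
  have "th u + th (inv u) = {#}" using th_mult[of u "inv u"] u th_one by simp
  then show "th u = {#}" by simp
qed

abbreviation "B \<equiv> mset_monoid Z"

lemma B_simps [simp]: "carrier B = Z" "monoid.mult B = (+)" "one B = {#}"
  by (simp_all add: mset_monoid_def)

lemma B_cancel: "cancel_monoid B"
proof -
  have "monoid B"
    by (rule monoidI) (auto simp: Z_zero Z_add)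
  then show ?thesis
    unfolding cancel_monoid_def cancel_monoid_axioms_def by (auto simp: cancellative_def)
qed

lemma B_Units: "Units B = {{#}}"
  using Z_zero by (auto simp: Units_def)

lemma B_atoms: "M \<in> atoms B \<longleftrightarrow> M \<in> Z \<and> M \<noteq> {#} \<and>
    (\<forall>A \<in> Z. \<forall>A' \<in> Z. M = A + A' \<longrightarrow> A = {#} \<or> A' = {#})"
  by (auto simp: atoms_def B_Units)

text \<open>A decomposition of \<open>th u\<close> is realised by an element between
  \<open>pid u\<close> and \<open>pid \<one>\<close>. It is principal because the labels above it
  lie in \<open>Z\<close>, and so it decomposes \<open>u\<close>.\<close>

lemma th_atom:
  assumes u: "u \<in> carrier T"
  shows "u \<in> atoms T \<longleftrightarrow> th u \<in> atoms B"
proof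
  assume a: "u \<in> atoms T"
  have ne: "th u \<noteq> {#}" using a th_unit_iff[OF u] by (auto simp: atoms_def)
  have "A = {#} \<or> A' = {#}" if A: "A \<in> Z" "A' \<in> Z" "th u = A + A'" for A A'
  proof -
    obtain K where K: "sg (pid u) K A" "sg K (pid \<one>) A'"
      using seg_permute seg_top[OF u] A(3) by metis
    obtain w where w: "w \<in> carrier T" "K = pid w" using pid_exists[OF u K A(2)] by auto
    obtain v where v: "v \<in> carrier T" "u = v \<otimes> w"
      using pid_dvd[OF w(1) u] seg_mem[OF K(1)] w(2) by auto
    have "th w = A'" using seg_unique[OF seg_top[OF w(1)]] K(2) w(2) by auto
    moreover have "th v = A" using th_eqI[OF v(1) w(1)] K(1) v w by auto
    moreover have "v \<in> Units T \<or> w \<in> Units T" using a v w by (auto simp: atoms_def)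
    ultimately show ?thesis using th_unit_iff v(1) w(1) by auto
  qed
  then show "th u \<in> atoms B" using ne th_Z[OF u] B_atoms by blast
next
  assume a: "th u \<in> atoms B"
  have "v \<in> Units T \<or> w \<in> Units T" if vw: "v \<in> carrier T" "w \<in> carrier T" "u = v \<otimes> w" for v w
  proof -
    have "th v = {#} \<or> th w = {#}" using a B_atoms th_mult[OF vw(1,2)] vw th_Z by auto
    then show ?thesis using th_unit_iff vw by auto
  qed
  moreover have "u \<notin> Units T" using a B_atoms th_unit_iff[OF u] by auto
  ultimately show "u \<in> atoms T" using u by (auto simp: atoms_def)
qed

lemma th_atoms: "set us \<subseteq> carrier T \<Longrightarrow> set (map th us) \<subseteq> atoms B \<Longrightarrow> set us \<subseteq> atoms T"
  using th_atom by auto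

lemma th_pr: "set us \<subseteq> carrier T \<Longrightarrow> th (pr us) = sum_list (map th us)"
  by (induction us) (auto simp: th_one th_mult)

lemma Z_sum: "set bs \<subseteq> Z \<Longrightarrow> sum_list bs \<in> Z"
  by (induction bs) (auto simp: Z_zero Z_add)

lemma th_unit_mult:
  assumes "u \<in> carrier T" "\<delta> \<in> Units T"
  shows "th (u \<otimes> \<delta>) = th u" "th (\<delta> \<otimes> u) = th u"
  using assms th_mult th_unit_iff[of \<delta>] by auto

text \<open>The blocks may come in any order, since the labels above \<open>pid a\<close> may. Only
  for the empty list does the unit survive; otherwise the first factor absorbs it.\<close>

lemma lift_factorization:
  assumes "a \<in> carrier T" "set bs \<subseteq> Z" "th a = sum_list bs"
  shows "\<exists>\<epsilon> us. \<epsilon> \<in> Units T \<and> set us \<subseteq> carrier T \<and> map th us = bs \<and> a = \<epsilon> \<otimes> pr us"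
  using assms
proof (induction bs arbitrary: a)
  case Nil
  then show ?case using th_unit_iff by (intro exI[of _ a] exI[of _ "[]"]) auto
next
  case (Cons b bs)
  obtain K where K: "sg (pid a) K b" "sg K (pid \<one>) (sum_list bs)"
    using seg_permute[of "pid a" "pid \<one>" b "sum_list bs"] seg_top[OF Cons.prems(1)] Cons.prems(3) by auto
  obtain w where w: "w \<in> carrier T" "K = pid w"
    using pid_exists[OF Cons.prems(1) K] Z_sum[of bs] Cons.prems(2) by auto
  obtain u where u: "u \<in> carrier T" "a = u \<otimes> w"
    using pid_dvd[OF w(1) Cons.prems(1)] seg_mem[OF K(1)] w(2) by auto
  have "th w = sum_list bs" using seg_unique[OF seg_top[OF w(1)]] K(2) w(2) by auto
  moreover have thu: "th u = b" using th_eqI[OF u(1) w(1)] K(1) u w by auto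
  ultimately obtain \<epsilon> us where us: "\<epsilon> \<in> Units T" "set us \<subseteq> carrier T" "map th us = bs" "w = \<epsilon> \<otimes> pr us"
    using Cons.IH[OF w(1)] Cons.prems(2) by auto
  have "a = \<one> \<otimes> pr ((u \<otimes> \<epsilon>) # us)" using u us by (simp add: m_assoc)
  then show ?case
    using us u thu th_unit_mult(1)[OF u(1) us(1)]
    by (intro exI[of _ \<one>] exI[of _ "(u \<otimes> \<epsilon>) # us"]) auto
qed

lemma lift_factorization_ne:
  assumes "a \<in> carrier T" "set bs \<subseteq> Z" "th a = sum_list bs" "bs \<noteq> []"
  shows "\<exists>us. set us \<subseteq> carrier T \<and> map th us = bs \<and> a = pr us"
proof -
  obtain \<epsilon> us where us: "\<epsilon> \<in> Units T" "set us \<subseteq> carrier T" "map th us = bs" "a = \<epsilon> \<otimes> pr us"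
    using lift_factorization[OF assms(1-3)] by blast
  obtain u us' where u: "us = u # us'" using us(3) assms(4) by (cases us) auto
  then have "a = pr ((\<epsilon> \<otimes> u) # us')" using us by (simp add: m_assoc)
  then show ?thesis using us u th_unit_mult(2)[of u \<epsilon>] by (intro exI[of _ "(\<epsilon> \<otimes> u) # us'"]) auto
qed

text \<open>Lists of atoms stand for rigid factorizations with trivial leading unit.
  \<open>rig\<close> stays in one class; \<open>swap\<close> changes a window of two atoms, keeps
  their product and their blocks, and so stays in the fiber.\<close>

inductive stp :: "'t list \<Rightarrow> 't list \<Rightarrow> bool" where
  rig: "sim (\<one>, us) (\<one>, vs) \<Longrightarrow> stp us vs"
| swap: "set (xs @ [a, b] @ ys) \<subseteq> atoms T \<Longrightarrow> a' \<in> atoms T \<Longrightarrow> b' \<in> atoms T \<Longrightarrow> a \<otimes> b = a' \<otimes> b' \<Longrightarrow>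
    {#th a, th b#} = {#th a', th b'#} \<Longrightarrow> stp (xs @ [a, b] @ ys) (xs @ [a', b'] @ ys)"

abbreviation conn where "conn \<equiv> stp\<^sup>*\<^sup>*"

lemma stp_cons:
  assumes "stp us vs" "u \<in> atoms T"
  shows "stp (u # us) (u # vs)"
  using assms(1)
proof cases
  case rig
  have t: "(\<one>, us) \<in> tuples T" "(\<one>, vs) \<in> tuples T" and p: "pr us = pr vs"
    and l: "length us = length vs"
    and s: "\<And>i. i \<in> {1..<length us} \<Longrightarrow> \<exists>\<delta> \<in> Units T. pr (drop i vs) = \<delta> \<otimes> pr (drop i us)"
    using rig atoms_sub[of us] atoms_sub[of vs] by (auto simp: sim_def tuple_prod_def tuples_def)
  have "\<exists>\<delta> \<in> Units T. pr (drop i (u # vs)) = \<delta> \<otimes> pr (drop i (u # us))" if "i \<in> {1..<length (u # us)}" for i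
  proof (cases "i = 1")
    case True
    then show ?thesis using p tuplesD(4)[OF t(2)] by (intro bexI[of _ \<one>]) auto
  next
    case False
    then have "i - 1 \<in> {1..<length us}" "drop i (u # vs) = drop (i - 1) vs" "drop i (u # us) = drop (i - 1) us"
      using that by (auto simp: drop_Cons')
    then show ?thesis using s by metis
  qed
  then have "sim (\<one>, u # us) (\<one>, u # vs)"
    using t p l assms(2) atoms_carrier by (auto simp: sim_def tuple_prod_def tuples_def)
  then show ?thesis by (rule stp.rig)
next
  case (swap xs a b ys a' b')
  then show ?thesis using stp.swap[of "u # xs" a b ys a' b'] assms(2) by auto
qed

lemma conn_cons: "conn us vs \<Longrightarrow> u \<in> atoms T \<Longrightarrow> conn (u # us) (u # vs)"
  by (induction rule: rtranclp_induct) (auto intro: stp_cons rtranclp.rtrancl_into_rtrancl)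

text \<open>The unit \<open>\<delta>\<close> moves across the gap into the next atom, which is why
  the list has to go on after \<open>u\<close>; the rigid factorization stays the same.\<close>

lemma conn_unit_shift:
  assumes "set (u # us) \<subseteq> atoms T" "us \<noteq> []" "v \<in> carrier T" "\<delta> \<in> Units T" "u = v \<otimes> \<delta>"
  shows "\<exists>us2. set us2 \<subseteq> atoms T \<and> map th us2 = map th us \<and> pr us2 = \<delta> \<otimes> pr us \<and> v \<in> atoms T \<and>
    conn (u # us) (v # us2)"
proof -
  obtain x xs where us: "us = x # xs" using assms(2) by (cases us) auto
  have c: "set us \<subseteq> carrier T" "x \<in> carrier T" "set xs \<subseteq> carrier T"
    using assms(1) us atoms_carrier by auto
  have v: "v \<in> atoms T"
    using atom_unit_right[of u "inv \<delta>"] assms by simp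
  let ?us2 = "(\<delta> \<otimes> x) # xs"
  have p: "pr ?us2 = \<delta> \<otimes> pr us" using us c assms(4) by (simp add: m_assoc)
  have a2: "set ?us2 \<subseteq> atoms T" using us assms(1) atom_unit_left[OF _ assms(4)] by auto
  have "sim (\<one>, u # us) (\<one>, v # ?us2)"
  proof -
    have "\<exists>d \<in> Units T. pr (drop i (v # ?us2)) = d \<otimes> pr (drop i (u # us))" if "i \<in> {1..<length (u # us)}" for i
    proof (cases "i = 1")
      case True
      then show ?thesis using p assms(4) by (intro bexI[of _ \<delta>]) auto
    next
      case False
      then have "drop i (v # ?us2) = drop i (u # us)" using that us by (auto simp: drop_Cons')
      moreover have "pr (drop i (u # us)) \<in> carrier T"
        using tuplesD(7)[of \<one> "u # us" i] assms(1) by (auto simp: tuples_def)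
      ultimately show ?thesis by (intro bexI[of _ \<one>]) auto
    qed
    moreover have "v \<otimes> \<delta> \<otimes> pr us = v \<otimes> pr ?us2" using p c assms by (simp add: m_assoc)
    moreover have "v \<otimes> pr ?us2 \<in> carrier T"
      using c assms by (intro m_closed pr_closed) auto
    ultimately show ?thesis
      using assms a2 v us by (auto simp: sim_def tuples_def tuple_prod_def)
  qed
  then have "conn (u # us) (v # ?us2)" by (blast intro: stp.rig)
  then show ?thesis using v p a2 us th_unit_mult(2)[OF c(2) assms(4)] by (intro exI[of _ ?us2]) auto
qed

lemma in_sum_list_mset: "c \<in># sum_list bs \<Longrightarrow> \<exists>b \<in> set bs. c \<in># b"
  by (induction bs) auto

text \<open>Let e and f be the ideals of the two tails and r a cover of e below their join. Another
  ideal e' under r, with the same labels below it as e, can be chosen above the meet of r and f; the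
  interval from its meet with f up to e' is then shorter. The labels above r are ordered such that e
  and e' both lie one block below a common principal ideal.\<close>

lemma fiber_improve:
  assumes us: "set (u # us) \<subseteq> atoms T" and vs: "set (v # vs) \<subseteq> atoms T"
    and p: "pr (u # us) = pr (v # vs)" and uv: "th u = th v"
    and M: "sg (pid (pr us) \<inter> pid (pr vs)) (pid (pr us)) M" and ne: "M \<noteq> {#}"
  shows "\<exists>u2 us3 u' u2' M'. set (u2 # us3) \<subseteq> atoms T \<and> set [u', u2'] \<subseteq> atoms T \<and>
    pr (u2 # us3) = pr us \<and> mset (map th (u2 # us3)) = mset (map th us) \<and>
    u \<otimes> u2 = u' \<otimes> u2' \<and> th u' = th u \<and> th u2' = th u2 \<and>
    sg (pid (pr (u2' # us3)) \<inter> pid (pr vs)) (pid (pr (u2' # us3))) M' \<and> size M' < size M"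
proof -
  define w where "w = pr us"
  define w' where "w' = pr vs"
  define a where "a = u \<otimes> w"
  have uc: "u \<in> carrier T" "set us \<subseteq> carrier T" "v \<in> carrier T" "set vs \<subseteq> carrier T"
    using us vs atoms_carrier by auto
  have c: "w \<in> carrier T" "w' \<in> carrier T" "a \<in> carrier T" "a = v \<otimes> w'"
    using uc p by (auto simp: w_def w'_def a_def)
  let ?I = "pid a" and ?e = "pid w" and ?f = "pid w'" and ?t = "pid \<one>"
  have Ie: "sg ?I ?e (th u)" using th_seg[OF uc(1) c(1)] by (simp add: a_def)
  have If: "sg ?I ?f (th u)" using th_seg[OF uc(3) c(2)] c(4) uv by simp
  note mI = seg_mem[OF Ie] and mf = seg_mem[OF If]
  have L: "?I \<in> L" "?e \<in> L" "?f \<in> L" "?e \<inter> ?f \<in> L" using mI mf int_closed by auto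
  obtain D where D: "sg ?I (?e \<inter> ?f) D" using seg_exists[OF L(1,4)] mI mf by auto
  have M: "sg (?e \<inter> ?f) ?e M" using M by (simp add: w_def w'_def)
  obtain N where N: "sg (?e \<inter> ?f) ?f N" using seg_exists[OF L(4,3)] by auto
  have DM: "th u = D + M" using seg_unique[OF Ie seg_trans[OF D M]] .
  have DN: "th u = D + N" using seg_unique[OF If seg_trans[OF D N]] .
  \<comment> \<open>Equal blocks of \<open>u\<close> and \<open>v\<close> put the meet equally far
    below both ideals.\<close>
  have NM: "N = M" using DM DN by simp
  let ?J = "jn ?f ?e"
  have eJ: "sg ?e ?J M"
    using seg_transpose[OF N L(2)] NM by (simp add: Int_commute)
  obtain r M' where r: "cov L ?e r" "sg r ?J M'" "M = add_mset (lab ?e r) M'"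
    using eJ ne by (cases rule: seg.cases) auto
  define k where "k = lab ?e r"
  have rL: "r \<in> L" "?e \<subseteq> r" "r \<subseteq> ?J" using seg_mem[OF r(2)] r(1) by (auto simp: cov_def)
  define s where "s = r \<inter> ?f"
  have sL: "s \<in> L" using int_closed rL L by (simp add: s_def)
  have es: "?e \<inter> s = ?e \<inter> ?f" using rL by (auto simp: s_def)
  have ers: "sg ?e r {#k#}" using seg_cov[OF r(1)] by (simp add: k_def)
  have jes: "jn ?e s = r"
  proof
    show "jn ?e s \<subseteq> r" using jn_least[OF L(2) sL rL(1,2)] by (simp add: s_def)
    have "jn ?e ?f \<inter> r \<subseteq> jn ?e (?f \<inter> r)" using modular[OF L(2,3) rL(1,2)] .
    then show "r \<subseteq> jn ?e s" using rL(3) jn_commute[OF L(2,3)] by (simp add: s_def Int_commute Int_absorb2)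
  qed
  have sr: "sg s r M" using seg_transpose[OF M[folded es] sL HOL.refl] jes by simp
  obtain X where X: "sg ?I s X" using seg_exists[OF L(1) sL] mI mf rL by (auto simp: s_def)
  have "th u + {#k#} = X + M" using seg_unique[OF seg_trans[OF Ie ers] seg_trans[OF X sr]] .
  then have XD: "X = D + {#k#}" using DM by simp
  have Mk: "M = M' + {#k#}" using r(3) by (simp add: k_def)
  \<comment> \<open>The interval from \<open>s\<close> to \<open>r\<close> has the labels
    \<open>M\<close>. Placing \<open>k\<close> on top yields \<open>e'\<close>, which like
    \<open>?e\<close> is covered by \<open>r\<close> with label \<open>k\<close>.\<close>
  obtain e' where e': "sg s e' M'" "sg e' r {#k#}"
    using seg_permute sr[unfolded Mk] by blast
  have Ie': "sg ?I e' (th u)" using seg_trans[OF X e'(1)] XD DM Mk by (simp add: ac_simps)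
  have top: "sg ?e ?t (th w)" "sg ?f ?t (th w')" using seg_top c by auto
  have "?J \<subseteq> ?t"
    using jn_least[OF L(3,2) pid_L[OF one_closed]] seg_mem[OF top(1)] seg_mem[OF top(2)] by auto
  then obtain R where R: "sg r ?t R" using seg_exists[OF rL(1) pid_L[OF one_closed]] rL(3) by auto
  have thw: "th w = {#k#} + R" using seg_unique[OF top(1) seg_trans[OF ers R]] .
  have thw': "th w = sum_list (map th us)" using th_pr uc by (simp add: w_def)
  then have "k \<in># sum_list (map th us)" using thw by (metis union_iff union_single_eq_member add_mset_add_single)
  \<comment> \<open>\<open>r\<close> need not be principal. Some atom \<open>x\<close> of
    \<open>us\<close> contains the label \<open>k\<close>, and the other labels of
    \<open>th x\<close> are placed directly above \<open>r\<close> to reach the principal ideal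
    \<open>e2\<close>.\<close>
  then obtain x where x: "x \<in> set us" "k \<in># th x" using in_sum_list_mset by fastforce
  then obtain p q where pq: "us = p @ x # q" by (meson split_list)
  let ?bs = "map th (p @ q)"
  have bsZ: "set ?bs \<subseteq> Z" using th_Z uc(2) pq by auto
  obtain B' where B': "th x = {#k#} + B'" using x(2) by (metis insert_DiffM add_mset_add_single union_commute)
  have "th w = th x + sum_list ?bs" using thw' pq by (simp add: ac_simps)
  then have RB: "R = B' + sum_list ?bs" using thw B' by (simp add: ac_simps)
  obtain e2 where e2: "sg r e2 B'" "sg e2 ?t (sum_list ?bs)"
    using seg_permute R[unfolded RB] by blast
  obtain w2 where w2: "w2 \<in> carrier T" "e2 = pid w2"
    using pid_exists[OF c(3) seg_trans[OF seg_trans[OF Ie ers] e2(1)] e2(2) Z_sum[OF bsZ]] by auto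
  have ee2: "sg ?e (pid w2) (th x)" using seg_trans[OF ers e2(1)] B' w2 by simp
  have ee2': "sg e' (pid w2) (th x)" using seg_trans[OF e'(2) e2(1)] B' w2 by simp
  have xZ: "th x \<in> Z" using th_Z uc(2) x(1) by auto
  obtain w1 where w1: "w1 \<in> carrier T" "e' = pid w1"
    using pid_exists[OF c(3) Ie' seg_trans[OF ee2' e2(2)[unfolded w2(2)]]] Z_add[OF xZ] Z_sum[OF bsZ] by auto
  obtain u2 where u2: "u2 \<in> carrier T" "w = u2 \<otimes> w2"
    using pid_dvd[OF w2(1) c(1)] seg_mem[OF ee2] by auto
  obtain u2' where u2': "u2' \<in> carrier T" "w1 = u2' \<otimes> w2"
    using pid_dvd[OF w2(1) w1(1)] seg_mem[OF ee2'] w1 by auto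
  obtain u' where u': "u' \<in> carrier T" "a = u' \<otimes> w1"
    using pid_dvd[OF w1(1) c(3)] seg_mem[OF Ie'] w1 by auto
  have th2: "th u2 = th x" using th_eqI[OF u2(1) w2(1)] ee2 u2 by simp
  have th2': "th u2' = th x" using th_eqI[OF u2'(1) w2(1)] ee2' u2' w1 by simp
  have thu': "th u' = th u" using th_eqI[OF u'(1) w1(1)] Ie' u' w1 by simp
  have "th w2 = sum_list ?bs" using seg_unique[OF seg_top[OF w2(1)]] e2(2) w2(2) by auto
  then obtain \<epsilon> us3 where us3: "\<epsilon> \<in> Units T" "set us3 \<subseteq> carrier T" "map th us3 = ?bs" "w2 = \<epsilon> \<otimes> pr us3"
    using lift_factorization[OF w2(1) bsZ] by blast
  let ?y = "u2 \<otimes> \<epsilon>" and ?y' = "u2' \<otimes> \<epsilon>"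
  have yc: "?y \<in> carrier T" "?y' \<in> carrier T" "pr us3 \<in> carrier T" using u2 u2' us3 by auto
  have thy: "th ?y = th x" "th ?y' = th x" using th_unit_mult(1) us3 u2 u2' th2 th2' by auto
  have wy: "w = ?y \<otimes> pr us3" "w1 = ?y' \<otimes> pr us3" using u2 u2' us3 by (auto simp: m_assoc)
  have "(u \<otimes> ?y) \<otimes> pr us3 = (u' \<otimes> ?y') \<otimes> pr us3"
    using u'(2) wy yc u'(1) uc(1) by (simp add: a_def m_assoc del: m_closed)
  then have eq: "u \<otimes> ?y = u' \<otimes> ?y'" using r_cancel[OF yc(3)] yc uc u' by blast
  have at: "th x \<in> atoms B" "\<And>y. y \<in> set us \<Longrightarrow> th y \<in> atoms B" "th u \<in> atoms B"
    using th_atom us uc x(1) by auto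
  have "set (map th us3) \<subseteq> atoms B" using us3(3) at(2) pq by auto
  then have a3: "set us3 \<subseteq> atoms T" using th_atoms us3(2) by blast
  have ay: "?y \<in> atoms T" "?y' \<in> atoms T" "u' \<in> atoms T"
    using th_atom yc u' thy thu' at by auto
  \<comment> \<open>As \<open>e'\<close> lies above \<open>s\<close>, the new gap is part of the
    interval from \<open>s\<close> to \<open>e'\<close>, whose multiset \<open>M'\<close> has one
    label less than \<open>M\<close>.\<close>
  have sub: "s \<subseteq> e' \<inter> ?f" using seg_mem[OF e'(1)] by (auto simp: s_def)
  have e'L: "e' \<in> L" using seg_mem[OF Ie'] by auto
  obtain M2 where M2: "sg s (e' \<inter> ?f) M2" using seg_exists[OF sL int_closed[OF e'L L(3)] sub] by auto
  obtain M3 where M3: "sg (e' \<inter> ?f) e' M3" using seg_exists[OF int_closed[OF e'L L(3)] e'L] by auto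
  have "M' = M2 + M3" using seg_unique[OF e'(1) seg_trans[OF M2 M3]] .
  then have sz: "size M3 < size M" using Mk by simp
  have ms: "mset (map th (?y # us3)) = mset (map th us)" using thy us3(3) pq by simp
  have pe: "pr (?y # us3) = pr us" using wy(1) by (simp add: w_def)
  have M3': "sg (pid (pr (?y' # us3)) \<inter> pid (pr vs)) (pid (pr (?y' # us3))) M3"
    using M3 wy(2) w1(2) by (simp add: w'_def)
  show ?thesis
    by (intro exI[of _ ?y] exI[of _ us3] exI[of _ u'] exI[of _ ?y'] exI[of _ M3])
      (use ay a3 pe ms eq thu' thy M3' sz in simp)
qed

text \<open>The induction on the length connects the tails once the first atoms agree. The inner
  induction in \<open>claim\<close>, on the labels between the meet of the two tail ideals and the
  first of them, makes the first atoms agree up to a unit.\<close>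

theorem fiber_connected:
  assumes "set us \<subseteq> atoms T" "set vs \<subseteq> atoms T" "pr us = pr vs"
    "mset (map th us) = mset (map th vs)"
  shows "conn us vs"
  using assms
proof (induction "length us" arbitrary: us vs rule: less_induct)
  case less
  have IH: "conn us' vs'" if "length us' < length us" "set us' \<subseteq> atoms T" "set vs' \<subseteq> atoms T"
    "pr us' = pr vs'" "mset (map th us') = mset (map th vs')" for us' vs'
    using less.hyps that by blast
  have len: "length us = length vs" using mset_eq_length[OF less.prems(4)] by simp
  show ?case
  proof (cases vs)
    case Nil
    then show ?thesis using len by simp
  next
    case (Cons v vs')
    note vs = less.prems(2)[unfolded Cons]
    have vc: "v \<in> carrier T" "set vs' \<subseteq> carrier T" using vs atoms_carrier by auto
    have claim: "conn (u # us') vs"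
      if "set (u # us') \<subseteq> atoms T" "pr (u # us') = pr vs" "mset (map th (u # us')) = mset (map th vs)"
        "th u = th v" "sg (pid (pr us') \<inter> pid (pr vs')) (pid (pr us')) M" for u us' M
      using that
    proof (induction "size M" arbitrary: u us' M rule: less_induct)
      case (less M u us')
      have uc: "u \<in> carrier T" "set us' \<subseteq> carrier T" using less.prems(1) atoms_carrier by auto
      have l': "length us' < length us"
        using mset_eq_length[OF less.prems(3)] len by simp
      have p: "u \<otimes> pr us' = v \<otimes> pr vs'" using less.prems(2) Cons by simp
      have m: "mset (map th us') = mset (map th vs')" using less.prems(3,4) Cons by simp
      show ?case
      proof (cases "M = {#}")
        case True
        \<comment> \<open>With an empty gap one tail ideal is contained in the other, and the equal
          blocks of the first atoms force equality. So the tails, and then the first atoms, agree up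
          to a unit.\<close>
        then have sub: "pid (pr us') \<subseteq> pid (pr vs')" using less.prems(5) seg_empty by blast
        have cw: "pr us' \<in> carrier T" "pr vs' \<in> carrier T" using uc vc by auto
        obtain X where X: "sg (pid (pr us')) (pid (pr vs')) X"
          using seg_exists[OF pid_L[OF cw(1)] pid_L[OF cw(2)] sub] by auto
        have "th v = th u + X"
          using th_eqI[OF vc(1) cw(2)] seg_trans[OF th_seg[OF uc(1) cw(1)] X] p by simp
        then have "pid (pr us') = pid (pr vs')" using less.prems(4) X seg_empty by simp
        then obtain \<delta> where \<delta>: "\<delta> \<in> Units T" "pr vs' = \<delta> \<otimes> pr us'" using pid_eq[OF cw] by auto
        have "u \<otimes> pr us' = (v \<otimes> \<delta>) \<otimes> pr us'" using p \<delta> vc cw by (simp add: m_assoc)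
        then have u: "u = v \<otimes> \<delta>" using r_cancel[OF cw(1) uc(1)] \<delta> vc by simp
        show ?thesis
        proof (cases "us' = []")
          case True
          then have "vs' = []" using m by simp
          then show ?thesis using True p uc vc Cons by simp
        next
          case False
          obtain us2 where us2: "set us2 \<subseteq> atoms T" "map th us2 = map th us'" "pr us2 = \<delta> \<otimes> pr us'"
            "conn (u # us') (v # us2)"
            using conn_unit_shift[OF less.prems(1) False vc(1) \<delta>(1) u] by blast
          have "conn us2 vs'"
            using IH[of us2 vs'] us2 \<delta> m vs l' by (metis length_map set_subset_Cons subset_trans)
          then have "conn (v # us2) vs" using conn_cons[of us2 vs' v] vs Cons by simp
          then show ?thesis using us2(4) by simp
        qed
      next
        case False
        obtain u2 us3 u' u2' M' where *: "set (u2 # us3) \<subseteq> atoms T" "set [u', u2'] \<subseteq> atoms T"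
          "pr (u2 # us3) = pr us'" "mset (map th (u2 # us3)) = mset (map th us')"
          "u \<otimes> u2 = u' \<otimes> u2'" "th u' = th u" "th u2' = th u2"
          "sg (pid (pr (u2' # us3)) \<inter> pid (pr vs')) (pid (pr (u2' # us3))) M'" "size M' < size M"
          using fiber_improve[OF less.prems(1) vs less.prems(2)[unfolded Cons] less.prems(4,5) False] by blast
        have "set us' \<subseteq> atoms T" using less.prems(1) by simp
        then have "conn us' (u2 # us3)" using IH[OF l' _ *(1)] *(3,4) by simp
        then have c1: "conn (u # us') (u # u2 # us3)" using conn_cons less.prems(1) by simp
        have "stp ([] @ [u, u2] @ us3) ([] @ [u', u2'] @ us3)"
          by (rule stp.swap) (use * less.prems(1) in auto)
        then have c2: "conn (u # us') (u' # u2' # us3)" using c1 by simp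
        have c3: "u2 \<in> carrier T" "u' \<in> carrier T" "u2' \<in> carrier T" "pr us3 \<in> carrier T"
          using * atoms_carrier atoms_sub[of us3] by auto
        have "u' \<otimes> (u2' \<otimes> pr us3) = u \<otimes> (u2 \<otimes> pr us3)"
          using m_assoc[OF uc(1) c3(1,4)] m_assoc[OF c3(2,3,4)] *(5) by simp
        then have "pr (u' # u2' # us3) = pr vs" using *(3) less.prems(2) by simp
        then have "conn (u' # u2' # us3) vs"
          using less.hyps[OF *(9), of u' "u2' # us3"] * less.prems by simp
        then show ?thesis using c2 by simp
      qed
    qed
    obtain u us' where us: "us = u # us'" using len Cons by (cases us) auto
    have uc: "u \<in> carrier T" "set us' \<subseteq> carrier T" "u \<in> atoms T" "set us' \<subseteq> atoms T"
      using less.prems(1) us atoms_carrier by auto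
    have seg: "\<exists>M. sg (pid (pr ys) \<inter> pid (pr vs')) (pid (pr ys)) M" if "set ys \<subseteq> carrier T" for ys
      using seg_exists[of "pid (pr ys) \<inter> pid (pr vs')" "pid (pr ys)"] int_closed pid_L that vc by auto
    show ?thesis
    proof (cases "th u = th v")
      case True
      then show ?thesis using claim seg[OF uc(2)] less.prems us by metis
    next
      case False
      \<comment> \<open>The block of \<open>v\<close> occurs later in the list. By the induction
        hypothesis for the tail it can be moved to the second place, and one change of the first two
        atoms brings it to the front.\<close>
      have "th v \<in># mset (map th us)" using less.prems(4) Cons by simp
      then obtain x where "x \<in> set us'" "th x = th v" using us False by auto
      then obtain p q where pq: "us' = p @ x # q" and x: "th x = th v" by (meson split_list)
      let ?bs = "th v # map th (p @ q)"
      have Zs: "set ?bs \<subseteq> Z" "{th v, th u} \<subseteq> Z" using th_Z uc vc pq by auto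
      have "th (pr us') = sum_list ?bs" using th_pr[OF uc(2)] pq x by (simp add: ac_simps)
      then obtain ys where ys: "set ys \<subseteq> carrier T" "map th ys = ?bs" "pr us' = pr ys"
        using lift_factorization_ne[OF pr_closed[OF uc(2)] Zs(1)] by (metis list.distinct(1))
      then obtain y us3 where y: "ys = y # us3" by (cases ys) auto
      have ta: "\<And>z. z \<in> set us \<Longrightarrow> th z \<in> atoms B" using th_atom less.prems(1) atoms_carrier by blast
      have tv: "th v \<in> atoms B" using th_atom vs vc by auto
      have "set (map th ys) \<subseteq> atoms B" unfolding ys(2) using ta us pq tv by auto
      then have ya: "set ys \<subseteq> atoms T" using th_atoms ys(1) by blast
      have "mset (map th us') = mset (map th ys)" unfolding ys(2) using pq x by simp
      then have "conn us' ys" using IH[of us' ys] us uc ya ys(3) by simp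
      then have c1: "conn us (u # y # us3)" using conn_cons uc(3) us y by simp
      have yc: "y \<in> carrier T" "th y = th v" "set us3 \<subseteq> carrier T" using ys y by auto
      have "th (u \<otimes> y) = sum_list [th v, th u]" using th_mult[OF uc(1) yc(1)] yc by (simp add: ac_simps)
      then obtain zs where zs: "set zs \<subseteq> carrier T" "map th zs = [th v, th u]" "u \<otimes> y = pr zs"
        using lift_factorization_ne[of "u \<otimes> y" "[th v, th u]"] Zs uc(1) yc(1)
        by (metis empty_set insert_subset list.distinct(1) list.simps(15) m_closed)
      then obtain y' u' where z: "zs = [y', u']" by (auto simp: map_eq_Cons_conv)
      then have zc: "y' \<in> carrier T" "u' \<in> carrier T" "th y' = th v" "th u' = th u" "u \<otimes> y = y' \<otimes> u'"
        using zs by auto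
      have za: "y' \<in> atoms T" "u' \<in> atoms T" using th_atom zc tv ta us by auto
      have "stp ([] @ [u, y] @ us3) ([] @ [y', u'] @ us3)"
        by (rule stp.swap) (use zc za ya y uc yc in auto)
      then have c2: "conn us (y' # u' # us3)" using c1 by simp
      have p3: "pr us3 \<in> carrier T" using yc by simp
      have "y' \<otimes> (u' \<otimes> pr us3) = u \<otimes> (y \<otimes> pr us3)"
        using m_assoc[OF uc(1) yc(1) p3] m_assoc[OF zc(1,2) p3] zc(5) by simp
      then have "pr (y' # u' # us3) = pr vs" using ys(3) y us less.prems(3) by simp
      moreover have "mset (map th (y' # u' # us3)) = mset (map th vs)"
      proof -
        have "mset (map th us) = add_mset (th u) (mset (map th ys))"
          unfolding ys(2) using us pq x by simp
        then show ?thesis using less.prems(4) y yc zc by (simp add: add_mset_commute)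
      qed
      moreover obtain M where "sg (pid (pr (u' # us3)) \<inter> pid (pr vs')) (pid (pr (u' # us3))) M"
        using seg[of "u' # us3"] zc yc by auto
      ultimately have "conn (y' # u' # us3) vs" using claim[of y' "u' # us3" M] zc za ya y by simp
      then show ?thesis using c2 by simp
    qed
  qed
qed

end

text \<open>Chains as reachability inside \<open>F\<close>. The relation \<open>R\<close> on lengths
  selects the kind of chain: the full relation for all chains, \<open>\<le>\<close> or
  \<open>\<ge>\<close> for monotone ones. So one lifting argument serves every catenary
  degree.\<close>

definition steps :: "'z set \<Rightarrow> ('z \<Rightarrow> 'z \<Rightarrow> nat) \<Rightarrow> enat \<Rightarrow> ('z \<Rightarrow> nat) \<Rightarrow> (nat \<Rightarrow> nat \<Rightarrow> bool) \<Rightarrow>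
    'z \<Rightarrow> 'z \<Rightarrow> bool" where
  "steps F d N len R = (\<lambda>x y. x \<in> F \<and> y \<in> F \<and> enat (d x y) \<le> N \<and> R (len x) (len y))\<^sup>*\<^sup>*"

text \<open>Transitivity of \<open>R\<close> turns the comparison of neighbouring lengths into
  sortedness of the whole list.\<close>

lemma steps_iff_list:
  assumes R: "reflp R" "transp R" and x: "x \<in> F"
  shows "steps F d N len R x y \<longleftrightarrow>
    (\<exists>zs. zs \<noteq> [] \<and> hd zs = x \<and> last zs = y \<and> set zs \<subseteq> F \<and>
      successively (\<lambda>x y. enat (d x y) \<le> N) zs \<and> sorted_wrt R (map len zs))"
    (is "_ \<longleftrightarrow> (\<exists>zs. ?P x zs)")
proof
  let ?r = "\<lambda>x y. x \<in> F \<and> y \<in> F \<and> enat (d x y) \<le> N \<and> R (len x) (len y)"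
  assume "steps F d N len R x y"
  then have "?r\<^sup>*\<^sup>* x y" by (simp add: steps_def)
  then show "\<exists>zs. ?P x zs"
    using x
  proof (induction rule: converse_rtranclp_induct)
    case base
    then show ?case by (intro exI[of _ "[y]"]) auto
  next
    case (step x x')
    then obtain zs where zs: "?P x' zs" by auto
    then have "R (len x) (len e)" if "e \<in> set zs" for e
      using step.hyps(1) that R(2) by (cases zs) (auto dest: transpD)
    then show ?case using zs step by (intro exI[of _ "x # zs"]) (auto simp: successively_Cons)
  qed
next
  assume "\<exists>zs. ?P x zs"
  then obtain zs where "?P x zs" by blast
  then show "steps F d N len R x y"
    unfolding steps_def
  proof (induction zs arbitrary: x)
    case (Cons z zs)
    show ?case
    proof (cases zs)
      case (Cons z' zs')
      then show ?thesis
        using Cons.IH[of z'] Cons.prems by (intro converse_rtranclp_into_rtranclp[of _ x z']) auto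
    qed (use Cons in auto)
  qed auto
qed

lemma steps_trans: "steps F d N len R x y \<Longrightarrow> steps F d N len R y z \<Longrightarrow> steps F d N len R x z"
  unfolding steps_def by (rule rtranclp_trans)

lemma steps_mono:
  assumes "steps F d N len R x y" "F \<subseteq> F'" "N \<le> N'"
  shows "steps F' d N' len R x y"
  using assms(1) unfolding steps_def
  by (rule rtranclp_mono[THEN predicate2D, rotated]) (use assms(2,3) order_trans in blast)

lemma steps_single:
  "x \<in> F \<Longrightarrow> y \<in> F \<Longrightarrow> enat (d x y) \<le> N \<Longrightarrow> R (len x) (len y) \<Longrightarrow> steps F d N len R x y"
  unfolding steps_def by auto

lemma is_chain_steps:
  assumes "reflp R" "transp R" "z \<in> rigid_facts T a"
  shows "(\<exists>zs. is_chain T d N a z z' zs \<and> sorted_wrt R (map rigid_length zs)) \<longleftrightarrow>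
    steps (rigid_facts T a) d N rigid_length R z z'"
  unfolding steps_iff_list[OF assms] is_chain_def by blast

lemma is_chain_steps_True:
  assumes "z \<in> rigid_facts T a"
  shows "(\<exists>zs. is_chain T d N a z z' zs) \<longleftrightarrow>
    steps (rigid_facts T a) d N rigid_length (\<lambda>_ _. True) z z'"
proof -
  have "sorted_wrt (\<lambda>_ _. True) xs" for xs :: "nat list" by (induction xs) auto
  then show ?thesis
    using is_chain_steps[of "\<lambda>_ _. True", OF _ _ assms, of d N z']
    by (simp add: reflp_def transp_def)
qed

lemma is_chain_steps_mono:
  assumes "z \<in> rigid_facts T a"
  shows "(\<exists>zs. is_chain T d N a z z' zs \<and> monotone_chain zs) \<longleftrightarrow>
    steps (rigid_facts T a) d N rigid_length (\<le>) z z' \<or> steps (rigid_facts T a) d N rigid_length (\<ge>) z z'"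
  using is_chain_steps[of "(\<le>)", OF _ _ assms, of d N z'] is_chain_steps[of "(\<ge>)", OF _ _ assms, of d N z']
  unfolding monotone_chain_def by auto

text \<open>The least value satisfies \<open>P'\<close> as soon as some value does; for catenary
  degrees \<open>\<infinity>\<close> does, since it permits a step between any two
  factorizations.\<close>

lemma Least_enat_le:
  fixes P P' :: "enat \<Rightarrow> bool"
  assumes "P' \<infinity>" "\<And>N. P' N \<Longrightarrow> P (max N 2)"
  shows "(LEAST N. P N) \<le> max (LEAST N. P' N) 2"
  using assms by (intro Least_le) (metis LeastI)

section \<open>Normal forms of factorizations, and the fibers of the transfer homomorphism\<close>

context cancel_monoid
begin

lemma facts_unit:
  assumes a: "a \<in> Units T" and z: "z \<in> rigid_facts T a"
  shows "z = cls (a, [])"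
proof -
  obtain \<epsilon> us where x: "(\<epsilon>, us) \<in> tuples T" "z = cls (\<epsilon>, us)"
    using z Zstar_iff by (auto simp: rigid_facts_def)
  note t = tuplesD[OF x(1)]
  have p: "\<epsilon> \<otimes> pr us = a" using z x rigid_pi_cls[OF x(1)] by (simp add: rigid_facts_def tuple_prod_def)
  have "us = []"
  proof (cases us)
    case (Cons u us')
    then have c: "u \<in> carrier T" "pr us' \<in> carrier T" using t by auto
    have "u \<otimes> pr us' \<in> Units T" using p a Units_prodD(2)[of \<epsilon> "pr us"] t Cons c by auto
    then have "u \<in> Units T" using Units_prodD c by blast
    then show ?thesis using t(3) Cons by (simp add: atoms_def)
  qed
  then show ?thesis using x p t by simp
qed

text \<open>The first atom absorbs the leading unit, so outside the units it suffices to work with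
  lists of atoms.\<close>

lemma facts_nonunit:
  assumes a: "a \<notin> Units T" and z: "z \<in> rigid_facts T a"
  shows "\<exists>us. us \<noteq> [] \<and> set us \<subseteq> atoms T \<and> pr us = a \<and> z = cls (\<one>, us)"
proof -
  obtain \<epsilon> us where x: "(\<epsilon>, us) \<in> tuples T" "z = cls (\<epsilon>, us)"
    using z Zstar_iff by (auto simp: rigid_facts_def)
  note t = tuplesD[OF x(1)]
  have p: "\<epsilon> \<otimes> pr us = a" using z x rigid_pi_cls[OF x(1)] by (simp add: rigid_facts_def tuple_prod_def)
  then have "us \<noteq> []" using a t by auto
  then obtain u us' where us: "us = u # us'" by (cases us) auto
  have c: "u \<in> carrier T" "set us' \<subseteq> carrier T" using t us by auto
  let ?us = "(\<epsilon> \<otimes> u) # us'"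
  have at: "set ?us \<subseteq> atoms T" using t us atom_unit_left by auto
  have "\<exists>\<delta> \<in> Units T. pr (drop i ?us) = \<delta> \<otimes> pr (drop i us)" if "i \<in> {1..<length us}" for i
  proof -
    have "drop i ?us = drop i us" using that us by (auto simp: drop_Cons')
    then show ?thesis using t(7)[of i] by (intro bexI[of _ \<one>]) auto
  qed
  moreover have "\<one> \<otimes> pr ?us = \<epsilon> \<otimes> pr us" using us t(2) c by (simp add: m_assoc)
  ultimately have "sim (\<epsilon>, us) (\<one>, ?us)"
    using x(1) at us unfolding sim_def by (auto simp: tuples_def tuple_prod_def)
  then have "z = cls (\<one>, ?us)" using x cls_eq_iff by auto
  moreover have "pr ?us = a" using p us t(2) c by (simp add: m_assoc)
  ultimately show ?thesis using at by blast
qed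

end

context transfer_lattice
begin

text \<open>Units do not change \<open>th\<close>, so corresponding tails have equal
  \<open>th\<close>; by additivity the value at an entry is the difference of two consecutive
  tails.\<close>

lemma sim_th:
  assumes "sim (\<epsilon>, us) (\<epsilon>', vs)"
  shows "map th us = map th vs"
proof -
  have t: "(\<epsilon>, us) \<in> tuples T" "(\<epsilon>', vs) \<in> tuples T" and l: "length us = length vs"
    and p: "\<epsilon> \<otimes> pr us = \<epsilon>' \<otimes> pr vs"
    and s: "\<And>i. i \<in> {1..<length us} \<Longrightarrow> \<exists>\<delta> \<in> Units T. pr (drop i vs) = \<delta> \<otimes> pr (drop i us)"
    using assms by (auto simp: sim_def tuple_prod_def)
  note tu = tuplesD[OF t(1)] and tv = tuplesD[OF t(2)]
  have *: "th (pr (drop i us)) = th (pr (drop i vs))" for i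
  proof -
    consider "i = 0" | "i \<in> {1..<length us}" | "length us \<le> i" by fastforce
    then show ?thesis
    proof cases
      case 1
      have "th (pr us) = th (\<epsilon> \<otimes> pr us)" "th (pr vs) = th (\<epsilon>' \<otimes> pr vs)"
        using th_unit_mult(2) tu(1) tu(7)[of 0] tv(1) tv(7)[of 0] by auto
      then show ?thesis using 1 p by simp
    next
      case 2
      then show ?thesis using s[OF 2] th_unit_mult(2) tu(7)[of i] by auto
    qed (use l in simp)
  qed
  have "th (us ! i) = th (vs ! i)" if i: "i < length us" for i
  proof -
    have "pr (drop i us) = us ! i \<otimes> pr (drop (Suc i) us)" "pr (drop i vs) = vs ! i \<otimes> pr (drop (Suc i) vs)"
      using i l by (simp_all add: Cons_nth_drop_Suc[symmetric])
    then have "th (us ! i) + th (pr (drop (Suc i) us)) = th (vs ! i) + th (pr (drop (Suc i) vs))"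
      using *[of i] th_mult tu(5)[OF i] tu(7) tv(5)[of i] tv(7) i l by simp
    then show ?thesis using *[of "Suc i"] by simp
  qed
  then show ?thesis using l by (intro nth_equalityI) auto
qed

text \<open>The blocks of a factorization without their order: the invariant that decides whether
  the images under \<open>theta_star\<close> have permutable distance zero.\<close>

definition thm_of :: "'t tuple set \<Rightarrow> 'c multiset multiset" where
  "thm_of z = mset (map th (snd (rep z)))"

lemma rep_th:
  assumes "(\<epsilon>, us) \<in> tuples T"
  shows "map th (snd (rep (cls (\<epsilon>, us)))) = map th us"
  using sim_th rep_cls[OF assms] by (metis prod.collapse)

lemma thm_of_cls: "(\<epsilon>, us) \<in> tuples T \<Longrightarrow> thm_of (cls (\<epsilon>, us)) = mset (map th us)"
  by (simp add: thm_of_def rep_th)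

lemma theta_star_tuples:
  assumes "z \<in> Zstar T"
  shows "({#}, map th (snd (rep z))) \<in> tuples B"
proof -
  have "rep z \<in> tuples T" using rep_Zstar[OF assms] by blast
  then have "set (snd (rep z)) \<subseteq> atoms T" by (auto simp: tuples_def)
  then have "set (map th (snd (rep z))) \<subseteq> atoms B" using th_atom atoms_carrier by auto
  then show ?thesis by (auto simp: tuples_def B_Units)
qed

lemma rigid_length_thm: "rigid_length z = size (thm_of z)"
  by (simp add: rigid_length_def thm_of_def)

lemma theta_star_facts:
  assumes "a \<in> carrier T" "z \<in> rigid_facts T a"
  shows "theta_star B th z \<in> rigid_facts B (th a)"
proof -
  interpret B: cancel_monoid B by (rule B_cancel)
  have z: "z \<in> Zstar T" "tuple_prod T (rep z) = a" using assms(2) by (auto simp: rigid_facts_def rigid_pi_def)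
  obtain \<epsilon> us where r: "rep z = (\<epsilon>, us)" by (metis surj_pair)
  then have t: "(\<epsilon>, us) \<in> tuples T" using rep_Zstar[OF z(1)] by simp
  have "B.pr bs = sum_list bs" for bs by (induction bs) auto
  moreover have "th a = sum_list (map th us)"
    using z(2) r th_unit_mult(2)[of "pr us" \<epsilon>] th_pr[of us] tuplesD[OF t] by (simp add: tuple_prod_def)
  ultimately have "tuple_prod B ({#}, map th us) = th a"
    by (simp add: tuple_prod_def)
  then show ?thesis
    using B.cls_facts[OF theta_star_tuples[OF z(1)]] r by (simp add: theta_star_def)
qed

lemma B_facts:
  assumes "w \<in> rigid_facts B b"
  shows "\<exists>bs. ({#}, bs) \<in> tuples B \<and> w = rigid_class B ({#}, bs) \<and> sum_list bs = b \<and>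
    rigid_length w = length bs \<and> rep w = ({#}, bs)"
proof -
  interpret B: cancel_monoid B by (rule B_cancel)
  have u: "Units B = {\<one>\<^bsub>B\<^esub>}" by (simp add: B_Units)
  obtain \<epsilon> bs where x: "(\<epsilon>, bs) \<in> tuples B" "w = B.cls (\<epsilon>, bs)"
    using assms B.Zstar_iff by (auto simp: rigid_facts_def)
  have e: "\<epsilon> = {#}" using x by (auto simp: tuples_def B_Units)
  have "B.pr bs = sum_list bs" for bs by (induction bs) auto
  then have "sum_list bs = b"
    using assms x e B.rigid_pi_cls[OF x(1)] by (simp add: rigid_facts_def tuple_prod_def)
  then show ?thesis using x e B.rigid_length_cls[OF x(1)] B.reduced_rep[OF u x(1)] by auto
qed

lemma theta_star_rep:
  assumes "z \<in> Zstar T"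
  shows "theta_star B th z = rigid_class B ({#}, map th (snd (rep z)))"
    "rep (theta_star B th z) = ({#}, map th (snd (rep z)))"
proof -
  interpret B: cancel_monoid B by (rule B_cancel)
  show 1: "theta_star B th z = rigid_class B ({#}, map th (snd (rep z)))" by (simp add: theta_star_def)
  have u: "Units B = {\<one>\<^bsub>B\<^esub>}" by (simp add: B_Units)
  show "rep (theta_star B th z) = ({#}, map th (snd (rep z)))"
    unfolding 1 using B.reduced_rep[OF u theta_star_tuples[OF assms]] .
qed

lemma perm_distance_theta:
  assumes "z \<in> Zstar T" "z' \<in> Zstar T"
  shows "perm_distance B (theta_star B th z) (theta_star B th z') = 0 \<longleftrightarrow> thm_of z = thm_of z'"
proof -
  interpret B: cancel_monoid B by (rule B_cancel)
  have u: "Units B = {\<one>\<^bsub>B\<^esub>}" by (simp add: B_Units)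
  let ?us = "map th (snd (rep z))" and ?vs = "map th (snd (rep z'))"
  note pd = B.reduced_perm_distance[OF u theta_star_tuples[OF assms(1)] theta_star_tuples[OF assms(2)]]
  show ?thesis
  proof
    assume 0: "perm_distance B (theta_star B th z) (theta_star B th z') = 0"
    obtain C where C: "C \<subseteq># mset ?us" "C \<subseteq># mset ?vs" "max (length ?us) (length ?vs) \<le> size C"
      using pd(1) 0 theta_star_rep(1) assms by auto
    have "C = mset ?us" "C = mset ?vs"
      using C subset_mset.le_imp_less_or_eq mset_subset_size size_mset by (metis leD max.bounded_iff)+
    then show "thm_of z = thm_of z'" by (simp add: thm_of_def)
  next
    assume "thm_of z = thm_of z'"
    then show "perm_distance B (theta_star B th z) (theta_star B th z') = 0"
      using pd(2) theta_star_rep(1) assms by (simp add: thm_of_def)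
  qed
qed

end

section \<open>Chains in the fibers, and lifting of chains of blocks\<close>

locale transfer_distance = transfer_lattice L jn lab T pid th Z
  for L :: "'a set set" and jn and lab :: "'a set \<Rightarrow> 'a set \<Rightarrow> 'c"
    and T :: "('t, 'x) monoid_scheme" (structure) and pid and th and Z +
  fixes d :: "'t tuple set \<Rightarrow> 't tuple set \<Rightarrow> nat"
  assumes d: "distance_on T d"
begin

abbreviation facts where "facts \<equiv> rigid_facts T"
abbreviation fib where "fib a m \<equiv> {z \<in> facts a. thm_of z = m}"

lemma one_tuple: "set us \<subseteq> atoms T \<Longrightarrow> (\<one>, us) \<in> tuples T"
  by (auto simp: tuples_def)

lemma one_facts: "set us \<subseteq> atoms T \<Longrightarrow> pr us = a \<Longrightarrow> cls (\<one>, us) \<in> facts a"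
  using cls_facts[OF one_tuple, of us a] pr_closed[OF atoms_sub, of us] by (auto simp: tuple_prod_def)

text \<open>All lengths in a fiber agree, so every reflexive \<open>R\<close> is respected. This is
  why fiber steps can be inserted into monotone chains.\<close>

lemma fiber_steps:
  assumes R: "reflp R" and a: "a \<in> carrier T" and z: "z \<in> fib a m" "z' \<in> fib a m"
  shows "steps (fib a m) d 2 rigid_length R z z'"
proof (cases "a \<in> Units T")
  case True
  then have "z = z'" using facts_unit[OF True] z by blast
  then show ?thesis by (simp add: steps_def)
next
  case False
  obtain us where us: "set us \<subseteq> atoms T" "pr us = a" "z = cls (\<one>, us)"
    using facts_nonunit[OF False] z by blast
  obtain vs where vs: "set vs \<subseteq> atoms T" "pr vs = a" "z' = cls (\<one>, vs)"
    using facts_nonunit[OF False] z by blast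
  have m: "mset (map th us) = m" "mset (map th vs) = m"
    using thm_of_cls[OF one_tuple] us vs z by auto
  then have "conn us vs" using fiber_connected us vs by simp
  then have "set vs \<subseteq> atoms T \<and> pr vs = a \<and> mset (map th vs) = m \<and>
      steps (fib a m) d 2 rigid_length R (cls (\<one>, us)) (cls (\<one>, vs))"
  proof (induction rule: rtranclp_induct)
    case base
    then show ?case using us m by (auto simp: steps_def)
  next
    case (step ys vs)
    have f: "cls (\<one>, ys) \<in> fib a m"
      using step.IH one_facts thm_of_cls[OF one_tuple] by auto
    from step.hyps(2) show ?case
    proof cases
      case rig
      then have t: "(\<one>, ys) \<in> tuples T" "(\<one>, vs) \<in> tuples T" "tuple_prod T (\<one>, ys) = tuple_prod T (\<one>, vs)"
        by (auto simp: sim_def)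
      have e: "cls (\<one>, ys) = cls (\<one>, vs)" using cls_eq_iff[OF t(1)] rig by blast
      have s: "set vs \<subseteq> atoms T" using t(2) by (auto simp: tuples_def)
      have "pr ys = pr vs" using t tuplesD(7)[OF t(1), of 0] tuplesD(7)[OF t(2), of 0]
        by (simp add: tuple_prod_def)
      moreover have "map th ys = map th vs" using sim_th[OF rig] .
      ultimately show ?thesis using step.IH s e by simp
    next
      case (swap xs b c zs b' c')
      have s: "set xs \<subseteq> atoms T" "set [b, c] \<subseteq> atoms T" "set [b', c'] \<subseteq> atoms T" "set zs \<subseteq> atoms T"
        using swap by auto
      note sc = s[THEN atoms_sub]
      have pe: "pr [b, c] = pr [b', c']" using swap sc by simp
      have "pr vs = pr ys"
        unfolding swap(1,2) using pr_append[of xs "[b, c] @ zs"] pr_append[of "[b, c]" zs]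
          pr_append[of xs "[b', c'] @ zs"] pr_append[of "[b', c']" zs] sc pe by simp
      then have pv: "pr vs = a" using step.IH by simp
      have mv: "mset (map th vs) = m" using step.IH swap by auto
      have sv: "set vs \<subseteq> atoms T" using s swap by auto
      have "d (cls (\<one>, ys)) (cls (\<one>, vs)) \<le> 2"
        using dist_mid[OF d s(1,2,3,4) pe] swap by simp
      then have "enat (d (cls (\<one>, ys)) (cls (\<one>, vs))) \<le> 2"
        by (metis enat_ord_simps(1) numeral_eq_enat)
      moreover have f': "cls (\<one>, vs) \<in> fib a m"
        using sv pv mv one_facts thm_of_cls[OF one_tuple] by auto
      moreover have "R (rigid_length (cls (\<one>, ys))) (rigid_length (cls (\<one>, vs)))"
        using f f' R by (simp add: rigid_length_thm reflpD)
      ultimately have "steps (fib a m) d 2 rigid_length R (cls (\<one>, ys)) (cls (\<one>, vs))"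
        using f by (intro steps_single)
      then have "steps (fib a m) d 2 rigid_length R (cls (\<one>, us)) (cls (\<one>, vs))"
        using step.IH by (auto intro: steps_trans[of _ _ _ _ _ _ "cls (\<one>, ys)"])
      then show ?thesis using sv pv mv by simp
    qed
  qed
  then show ?thesis using us vs by simp
qed

lemma fiber_steps':
  assumes "reflp R" "a \<in> carrier T" "z \<in> facts a" "z' \<in> facts a" "thm_of z = thm_of z'" "2 \<le> N"
  shows "steps (facts a) d N rigid_length R z z'"
  using steps_mono[OF fiber_steps[of R a z "thm_of z" z'], of "facts a" N] assms by auto

text \<open>The blocks common to \<open>w\<close> and \<open>w'\<close> are moved to the front
  inside the fiber, and then only the remaining tail is replaced. Its length is bounded by the
  permutable distance; the fiber steps contribute the 2.\<close>

lemma step_lift: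
  assumes R: "reflp R" and a: "a \<in> carrier T" and z: "z \<in> facts a" and m: "thm_of z = mset (snd (rep w))"
    and w: "w \<in> rigid_facts B (th a)" "w' \<in> rigid_facts B (th a)"
    and dw: "enat (perm_distance B w w') \<le> N" and Rw: "R (rigid_length w) (rigid_length w')"
  shows "\<exists>z' \<in> facts a. thm_of z' = mset (snd (rep w')) \<and> steps (facts a) d (max N 2) rigid_length R z z'"
proof (cases "a \<in> Units T")
  case True
  then have "th a = {#}" using th_unit_iff[OF a] by simp
  moreover have "bs = []" if "({#}, bs) \<in> tuples B" "sum_list bs = {#}" for bs
    using that B_atoms by (cases bs) (auto simp: tuples_def)
  ultimately have "snd (rep w) = []" "snd (rep w') = []"
    using B_facts[OF w(1)] B_facts[OF w(2)] by auto
  then show ?thesis using z m by (intro bexI[of _ z]) (auto simp: steps_def)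
next
  case False
  interpret B: cancel_monoid B by (rule B_cancel)
  have u: "Units B = {\<one>\<^bsub>B\<^esub>}" by (simp add: B_Units)
  obtain bs where bs: "({#}, bs) \<in> tuples B" "w = rigid_class B ({#}, bs)" "sum_list bs = th a"
    "rigid_length w = length bs" "rep w = ({#}, bs)" using B_facts[OF w(1)] by blast
  obtain cs where cs: "({#}, cs) \<in> tuples B" "w' = rigid_class B ({#}, cs)" "sum_list cs = th a"
    "rigid_length w' = length cs" "rep w' = ({#}, cs)" using B_facts[OF w(2)] by blast
  have tha: "th a \<noteq> {#}" using False th_unit_iff[OF a] by simp
  obtain K where K: "K \<subseteq># mset bs" "K \<subseteq># mset cs"
    "max (length bs) (length cs) \<le> perm_distance B w w' + size K"
    using B.reduced_perm_distance(1)[OF u bs(1) cs(1)] bs(2) cs(2) by auto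
  obtain ks where ks: "mset ks = K" by (metis ex_mset)
  obtain xs where xs: "mset bs = mset (ks @ xs)" by (metis K(1) ex_mset ks mset_append subset_mset.add_diff_inverse)
  obtain ys where ys: "mset cs = mset (ks @ ys)" by (metis K(2) ex_mset ks mset_append subset_mset.add_diff_inverse)
  have at: "set bs \<subseteq> atoms B" "set cs \<subseteq> atoms B" using bs(1) cs(1) by (auto simp: tuples_def)
  then have at': "set (ks @ xs) \<subseteq> atoms B" "set (ks @ ys) \<subseteq> atoms B"
    using xs ys by (metis mset_eq_setD)+
  then have Zs: "set (ks @ xs) \<subseteq> Z" "set ys \<subseteq> Z" by (auto simp: B_atoms)
  have sums: "sum_list (ks @ xs) = th a" "sum_list (ks @ ys) = th a"
    using xs ys bs(3) cs(3) by (metis sum_mset_sum_list)+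
  have "ks @ xs \<noteq> []" using sums(1) tha by auto
  then obtain us where us: "set us \<subseteq> carrier T" "map th us = ks @ xs" "a = pr us"
    using lift_factorization_ne[OF a Zs(1) sums(1)[symmetric]] by blast
  have usa: "set us \<subseteq> atoms T" using th_atoms[OF us(1)] us(2) at' by simp
  obtain us1 us2 where us12: "us = us1 @ us2" "map th us1 = ks" "map th us2 = xs"
    using us(2) by (metis map_eq_append_conv)
  have sa: "set us1 \<subseteq> atoms T" "set us2 \<subseteq> atoms T" using usa us12(1) by auto
  note sc = sa[THEN atoms_sub]
  have "sum_list ks + sum_list xs = sum_list ks + sum_list ys" using sums by simp
  then have s2: "sum_list xs = sum_list ys" by simp
  have "\<exists>us2'. set us2' \<subseteq> carrier T \<and> map th us2' = ys \<and> pr us2 = pr us2'"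
  proof (cases "ys = []")
    case True
    then have "xs = []"
      using s2 at'(1) B_atoms by (cases xs) auto
    then show ?thesis using us12 True by auto
  next
    case False
    have "th (pr us2) = sum_list ys" using th_pr[OF sc(2)] us12 s2 by simp
    then show ?thesis using lift_factorization_ne[OF _ Zs(2) _ False] sc by auto
  qed
  then obtain us2' where us2': "set us2' \<subseteq> carrier T" "map th us2' = ys" "pr us2 = pr us2'" by blast
  have sa': "set us2' \<subseteq> atoms T" using th_atoms[OF us2'(1)] us2'(2) at' by simp
  let ?z1 = "cls (\<one>, us)" and ?z2 = "cls (\<one>, us1 @ us2')"
  have z1: "?z1 \<in> facts a" using one_facts[OF usa] us(3) by simp
  have "pr (us1 @ us2') = a" using us(3) us12(1) us2' sc pr_append by simp
  then have z2: "?z2 \<in> facts a" using one_facts[of "us1 @ us2'" a] sa sa' by simp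
  have t1: "thm_of ?z1 = mset bs" using thm_of_cls[OF one_tuple[OF usa]] us(2) xs by simp
  have "thm_of ?z2 = mset (map th (us1 @ us2'))"
    using thm_of_cls[OF one_tuple, of "us1 @ us2'"] sa sa' by simp
  then have t2: "thm_of ?z2 = mset cs" using us12 us2' ys by simp
  have st1: "steps (facts a) d (max N 2) rigid_length R z ?z1"
    using fiber_steps'[OF R a z z1] t1 m bs(5) by simp
  have "d ?z1 ?z2 \<le> max (max (length us2) (length us2')) 1"
    using dist_mid[OF d sa(1) sa(2) sa' _ us2'(3), of "[]"] us12(1) by simp
  moreover have "length bs = size K + length us2" "length cs = size K + length us2'"
    using mset_eq_length[OF xs] mset_eq_length[OF ys] ks us12(3) us2'(2) by auto
  \<comment> \<open>The term 1 in the bound for \<open>d\<close> matters only when both tails are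
    empty; it is absorbed by 2.\<close>
  ultimately have "d ?z1 ?z2 \<le> perm_distance B w w' \<or> d ?z1 ?z2 \<le> 2" using K(3) by linarith
  then have "enat (d ?z1 ?z2) \<le> enat (perm_distance B w w') \<or> enat (d ?z1 ?z2) \<le> 2"
    by (simp add: numeral_eq_enat)
  then have "enat (d ?z1 ?z2) \<le> max N 2"
    using dw by (meson max.coboundedI1 max.coboundedI2 order_trans)
  moreover have "R (rigid_length ?z1) (rigid_length ?z2)"
    using Rw t1 t2 bs(4) cs(4) by (simp add: rigid_length_thm)
  ultimately have "steps (facts a) d (max N 2) rigid_length R ?z1 ?z2"
    using z1 z2 by (intro steps_single)
  from steps_trans[OF st1 this] show ?thesis using z2 t2 cs(5) by (intro bexI[of _ ?z2]) auto
qed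

text \<open>Lifting step by step ends in the fiber of \<open>z'\<close>, possibly at another
  factorization; a last chain inside this fiber reaches \<open>z'\<close>.\<close>

lemma steps_lift:
  assumes R: "reflp R" and a: "a \<in> carrier T" and z: "z \<in> facts a" "z' \<in> facts a"
    and s: "steps (rigid_facts B (th a)) (perm_distance B) N rigid_length R (theta_star B th z) (theta_star B th z')"
  shows "steps (facts a) d (max N 2) rigid_length R z z'"
proof -
  have zZ: "z \<in> Zstar T" "z' \<in> Zstar T" using z by (auto simp: rigid_facts_def)
  have th: "thm_of y = mset (snd (rep (theta_star B th y)))" if "y \<in> Zstar T" for y
    using theta_star_rep(2)[OF that] by (simp add: thm_of_def)
  have "\<exists>y \<in> facts a. thm_of y = mset (snd (rep (theta_star B th z'))) \<and>
      steps (facts a) d (max N 2) rigid_length R z y"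
    using s[unfolded steps_def]
  proof (induction rule: rtranclp_induct)
    case base
    then show ?case using z(1) th[OF zZ(1)] by (intro bexI[of _ z]) (auto simp: steps_def)
  next
    case (step w w')
    then obtain y where y: "y \<in> facts a" "thm_of y = mset (snd (rep w))"
      "steps (facts a) d (max N 2) rigid_length R z y" by blast
    then obtain y' where y': "y' \<in> facts a" "thm_of y' = mset (snd (rep w'))"
      "steps (facts a) d (max N 2) rigid_length R y y'"
      using step_lift[OF R a y(1,2), of w' N] step.hyps(2) by auto
    then show ?case using steps_trans[OF y(3) y'(3)] by auto
  qed
  then obtain y where y: "y \<in> facts a" "thm_of y = thm_of z'" "steps (facts a) d (max N 2) rigid_length R z y"
    using th[OF zZ(2)] by auto
  then show ?thesis
    using steps_trans[OF y(3) fiber_steps'[OF R a y(1) z(2) y(2)]] by simp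
qed

lemma fiber_bound:
  assumes a: "a \<in> carrier T"
  shows "cat_fiber_elem T B th d a \<le> 2"
  unfolding cat_fiber_elem_def
proof (rule Least_le, intro ballI impI)
  fix z z' assume z: "z \<in> facts a" "z' \<in> facts a"
    and 0: "perm_distance B (theta_star B th z) (theta_star B th z') = 0"
  have Zs: "y \<in> Zstar T" if "y \<in> facts a" for y using that by (simp add: rigid_facts_def)
  have m: "thm_of z' = thm_of z" using 0 perm_distance_theta Zs z by metis
  have "steps (fib a (thm_of z)) d 2 rigid_length (\<lambda>_ _. True) z z'"
    using fiber_steps[OF _ a] z m by (simp add: reflp_def)
  then obtain zs where zs: "zs \<noteq> []" "hd zs = z" "last zs = z'" "set zs \<subseteq> fib a (thm_of z)"
    "successively (\<lambda>x y. enat (d x y) \<le> 2) zs"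
    using steps_iff_list[of "\<lambda>_ _. True" z "fib a (thm_of z)" d 2 rigid_length z'] z
    by (auto simp: reflp_def transp_def)
  then show "\<exists>zs. is_chain T d 2 a z z' zs \<and>
      (\<forall>y \<in> set zs. perm_distance B (theta_star B th y) (theta_star B th z) = 0)"
  proof (intro exI[of _ zs] conjI ballI)
    show "is_chain T d 2 a z z' zs" using zs by (auto simp: is_chain_def)
    fix y assume "y \<in> set zs"
    then have "y \<in> facts a" "thm_of y = thm_of z" using zs(4) by auto
    then show "perm_distance B (theta_star B th y) (theta_star B th z) = 0"
      using perm_distance_theta[OF Zs Zs] z by simp
  qed
qed

lemma steps_infinity:
  assumes "z \<in> F" "z' \<in> F" "R (len z) (len z')"
  shows "steps F d' \<infinity> len R z z'"
  using assms by (intro steps_single) auto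

text \<open>Any two lengths are comparable, so a chain of two elements is monotone.\<close>

lemma mono_infinity:
  assumes "z \<in> rigid_facts B b" "z' \<in> rigid_facts B b"
  shows "\<exists>zs. is_chain B (perm_distance B) \<infinity> b z z' zs \<and> monotone_chain zs"
  unfolding is_chain_steps_mono[OF assms(1)]
  using steps_infinity[of z "rigid_facts B b" z' "(\<le>)" rigid_length]
    steps_infinity[of z "rigid_facts B b" z' "(\<ge>)" rigid_length] assms
  by (meson linear)

lemma cat_bound:
  assumes a: "a \<in> carrier T"
  shows "cat_elem T d a \<le> max (cat_elem B (perm_distance B) (th a)) 2"
  unfolding cat_elem_def
proof (rule Least_enat_le)
  show "\<forall>z \<in> rigid_facts B (th a). \<forall>z' \<in> rigid_facts B (th a).
      \<exists>zs. is_chain B (perm_distance B) \<infinity> (th a) z z' zs"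
    using mono_infinity by blast
  fix N
  assume h: "\<forall>z \<in> rigid_facts B (th a). \<forall>z' \<in> rigid_facts B (th a).
      \<exists>zs. is_chain B (perm_distance B) N (th a) z z' zs"
  show "\<forall>z \<in> facts a. \<forall>z' \<in> facts a. \<exists>zs. is_chain T d (max N 2) a z z' zs"
  proof (intro ballI)
    fix z z' assume z: "z \<in> facts a" "z' \<in> facts a"
    note t = theta_star_facts[OF a z(1)] theta_star_facts[OF a z(2)]
    show "\<exists>zs. is_chain T d (max N 2) a z z' zs"
      unfolding is_chain_steps_True[OF z(1)]
      using h[rule_format, OF t, unfolded is_chain_steps_True[OF t(1)]]
      by (intro steps_lift[OF _ a z]) (auto simp: reflp_def)
  qed
qed

lemma mono_lift:
  assumes a: "a \<in> carrier T" and z: "z \<in> facts a" "z' \<in> facts a"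
    and h: "\<exists>zs. is_chain B (perm_distance B) N (th a) (theta_star B th z) (theta_star B th z') zs \<and>
      monotone_chain zs"
  shows "\<exists>zs. is_chain T d (max N 2) a z z' zs \<and> monotone_chain zs"
  using h steps_lift[OF _ a z, of "(\<le>)" N] steps_lift[OF _ a z, of "(\<ge>)" N]
  unfolding is_chain_steps_mono[OF z(1)] is_chain_steps_mono[OF theta_star_facts[OF a z(1)]]
  by auto

lemma cat_mon_bound:
  assumes a: "a \<in> carrier T"
  shows "cat_mon_elem T d a \<le> max (cat_mon_elem B (perm_distance B) (th a)) 2"
  unfolding cat_mon_elem_def
proof (rule Least_enat_le)
  show "\<forall>z \<in> rigid_facts B (th a). \<forall>z' \<in> rigid_facts B (th a).
      \<exists>zs. is_chain B (perm_distance B) \<infinity> (th a) z z' zs \<and> monotone_chain zs"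
    using mono_infinity by blast
  fix N
  assume h: "\<forall>z \<in> rigid_facts B (th a). \<forall>z' \<in> rigid_facts B (th a).
      \<exists>zs. is_chain B (perm_distance B) N (th a) z z' zs \<and> monotone_chain zs"
  show "\<forall>z \<in> facts a. \<forall>z' \<in> facts a. \<exists>zs. is_chain T d (max N 2) a z z' zs \<and> monotone_chain zs"
  proof (intro ballI)
    fix z z' assume z: "z \<in> facts a" "z' \<in> facts a"
    show "\<exists>zs. is_chain T d (max N 2) a z z' zs \<and> monotone_chain zs"
      using h[rule_format, OF theta_star_facts[OF a z(1)] theta_star_facts[OF a z(2)]]
      by (rule mono_lift[OF a z])
  qed
qed

lemma rigid_length_theta:
  assumes "z \<in> facts a"
  shows "rigid_length (theta_star B th z) = rigid_length z"
  using theta_star_rep(2)[of z] assms by (simp add: rigid_length_def rigid_facts_def)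

lemma cat_eq_bound:
  assumes a: "a \<in> carrier T"
  shows "cat_eq_elem T d a \<le> max (cat_eq_elem B (perm_distance B) (th a)) 2"
  unfolding cat_eq_elem_def
proof (rule Least_enat_le)
  show "\<forall>z \<in> rigid_facts B (th a). \<forall>z' \<in> rigid_facts B (th a). rigid_length z = rigid_length z' \<longrightarrow>
      (\<exists>zs. is_chain B (perm_distance B) \<infinity> (th a) z z' zs \<and> monotone_chain zs)"
    using mono_infinity by blast
  fix N
  assume h: "\<forall>z \<in> rigid_facts B (th a). \<forall>z' \<in> rigid_facts B (th a). rigid_length z = rigid_length z' \<longrightarrow>
      (\<exists>zs. is_chain B (perm_distance B) N (th a) z z' zs \<and> monotone_chain zs)"
  show "\<forall>z \<in> facts a. \<forall>z' \<in> facts a. rigid_length z = rigid_length z' \<longrightarrow>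
      (\<exists>zs. is_chain T d (max N 2) a z z' zs \<and> monotone_chain zs)"
  proof (intro ballI impI)
    fix z z' assume z: "z \<in> facts a" "z' \<in> facts a" "rigid_length z = rigid_length z'"
    show "\<exists>zs. is_chain T d (max N 2) a z z' zs \<and> monotone_chain zs"
      using h[rule_format, OF theta_star_facts[OF a z(1)] theta_star_facts[OF a z(2)]] z
      by (intro mono_lift[OF a z(1,2)]) (simp add: rigid_length_theta)
  qed
qed

lemma SUP_bound:
  fixes f :: "'t \<Rightarrow> enat"
  assumes "\<And>a. a \<in> carrier T \<Longrightarrow> f a \<le> max (g (th a)) 2"
  shows "(SUP a \<in> carrier T. f a) \<le> max (SUP b \<in> carrier B. g b) 2"
proof (rule SUP_least)
  fix a assume a: "a \<in> carrier T"
  have "g (th a) \<le> (SUP b \<in> carrier B. g b)" using th_Z[OF a] by (intro SUP_upper) simp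
  then show "f a \<le> max (SUP b \<in> carrier B. g b) 2" using assms[OF a] by (meson max.mono order_refl order_trans)
qed

theorem catenary_bounds:
  "cat_fiber T B th d \<le> 2 \<and>
     (\<forall>a \<in> carrier T. cat_elem T d a \<le> max (cat_elem B (perm_distance B) (th a)) 2) \<and>
     (cat T d \<le> max (cat B (perm_distance B)) 2) \<and>
     (\<forall>a \<in> carrier T. cat_mon_elem T d a \<le> max (cat_mon_elem B (perm_distance B) (th a)) 2) \<and>
     (cat_mon T d \<le> max (cat_mon B (perm_distance B)) 2) \<and>
     (\<forall>a \<in> carrier T. cat_eq_elem T d a \<le> max (cat_eq_elem B (perm_distance B) (th a)) 2) \<and>
     (cat_eq T d \<le> max (cat_eq B (perm_distance B)) 2)"
  unfolding cat_fiber_def cat_def cat_mon_def cat_eq_def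
  using SUP_bound[of "cat_elem T d" "cat_elem B (perm_distance B)"]
    SUP_bound[of "cat_mon_elem T d" "cat_mon_elem B (perm_distance B)"]
    SUP_bound[of "cat_eq_elem T d" "cat_eq_elem B (perm_distance B)"]
    SUP_least[of "carrier T" "cat_fiber_elem T B th d" 2] cat_bound cat_mon_bound cat_eq_bound fiber_bound
  by blast

end

section \<open>Maximal orders and divisorial ideals\<close>

context monoid
begin

lemma unit_cancels:
  assumes "u \<in> Units G" "x \<in> carrier G"
  shows "inv u \<otimes> (u \<otimes> x) = x" "u \<otimes> (inv u \<otimes> x) = x"
  using assms by (simp_all add: m_assoc[symmetric] Units_closed)

lemma inv_mult_Units: "x \<in> Units G \<Longrightarrow> y \<in> Units G \<Longrightarrow> inv (x \<otimes> y) = inv y \<otimes> inv x"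
  by (rule inv_unique'[symmetric]) (auto simp: m_assoc unit_cancels Units_closed)

end

text \<open>Source, target, inverse and divisorial closure of a fractional ideal are all residuals,
  which turns ideal arithmetic into elementwise conditions.\<close>

definition lres :: "('a, 'b) monoid_scheme \<Rightarrow> 'a set \<Rightarrow> 'a set \<Rightarrow> 'a set" where
  "lres Q e A = {q \<in> carrier Q. \<forall>a \<in> A. q \<otimes>\<^bsub>Q\<^esub> a \<in> e}"

definition rres :: "('a, 'b) monoid_scheme \<Rightarrow> 'a set \<Rightarrow> 'a set \<Rightarrow> 'a set" where
  "rres Q e A = {q \<in> carrier Q. \<forall>a \<in> A. a \<otimes>\<^bsub>Q\<^esub> q \<in> e}"

lemma src_lres: "src Q I = lres Q I I"
  by (auto simp: src_def lres_def l_coset_def)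

lemma tgt_rres: "tgt Q I = rres Q I I"
  by (auto simp: tgt_def rres_def r_coset_def)

lemma coset_subset_iff:
  "A #>\<^bsub>Q\<^esub> y \<subseteq> e \<longleftrightarrow> (\<forall>a \<in> A. a \<otimes>\<^bsub>Q\<^esub> y \<in> e)"
  "y <#\<^bsub>Q\<^esub> A \<subseteq> e \<longleftrightarrow> (\<forall>a \<in> A. y \<otimes>\<^bsub>Q\<^esub> a \<in> e)"
  "A <#>\<^bsub>Q\<^esub> B \<subseteq> e \<longleftrightarrow> (\<forall>a \<in> A. \<forall>b \<in> B. a \<otimes>\<^bsub>Q\<^esub> b \<in> e)"
  "(x <#\<^bsub>Q\<^esub> A) #>\<^bsub>Q\<^esub> y \<subseteq> e \<longleftrightarrow> (\<forall>a \<in> A. x \<otimes>\<^bsub>Q\<^esub> a \<otimes>\<^bsub>Q\<^esub> y \<in> e)"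
  unfolding r_coset_def l_coset_def set_mult_def by blast+

lemma frac_left_ideal_iff:
  "frac_left_ideal Q e A \<longleftrightarrow> A \<subseteq> carrier Q \<and> (\<forall>s \<in> e. \<forall>a \<in> A. s \<otimes>\<^bsub>Q\<^esub> a \<in> A) \<and>
     (\<exists>x \<in> Units Q. x \<in> A) \<and> (\<exists>y \<in> Units Q. \<forall>a \<in> A. a \<otimes>\<^bsub>Q\<^esub> y \<in> e)"
  unfolding frac_left_ideal_def coset_subset_iff by blast

lemma frac_right_ideal_iff:
  "frac_right_ideal Q e A \<longleftrightarrow> A \<subseteq> carrier Q \<and> (\<forall>s \<in> e. \<forall>a \<in> A. a \<otimes>\<^bsub>Q\<^esub> s \<in> A) \<and>
     (\<exists>x \<in> Units Q. x \<in> A) \<and> (\<exists>y \<in> Units Q. \<forall>a \<in> A. y \<otimes>\<^bsub>Q\<^esub> a \<in> e)"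
  unfolding frac_right_ideal_def coset_subset_iff by blast

lemma equivalent_orders_iff:
  "equivalent_orders Q S S' \<longleftrightarrow>
     (\<exists>a \<in> Units Q. \<exists>b \<in> Units Q. \<forall>s \<in> S. a \<otimes>\<^bsub>Q\<^esub> s \<otimes>\<^bsub>Q\<^esub> b \<in> S') \<and>
     (\<exists>a \<in> Units Q. \<exists>b \<in> Units Q. \<forall>s \<in> S'. a \<otimes>\<^bsub>Q\<^esub> s \<otimes>\<^bsub>Q\<^esub> b \<in> S)"
  unfolding equivalent_orders_def coset_subset_iff(4) by blast

lemma ideal_inv_iff: "q \<in> ideal_inv Q I \<longleftrightarrow> q \<in> carrier Q \<and> (\<forall>a \<in> I. \<forall>b \<in> I. a \<otimes>\<^bsub>Q\<^esub> q \<otimes>\<^bsub>Q\<^esub> b \<in> I)"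
  by (auto simp: ideal_inv_def r_coset_def set_mult_def subset_iff)

text \<open>Boundedness by units: \<open>c e \<subseteq> e p\<^sup>-\<^sup>1\<close> for some unit
  \<open>c\<close>, and symmetrically. In this form the condition passes directly to equivalent
  orders.\<close>

definition unit_bounded :: "('a, 'b) monoid_scheme \<Rightarrow> 'a set \<Rightarrow> bool" where
  "unit_bounded Q e \<longleftrightarrow> (\<forall>p \<in> Units Q.
     (\<exists>c \<in> Units Q. \<forall>s \<in> e. c \<otimes>\<^bsub>Q\<^esub> s \<otimes>\<^bsub>Q\<^esub> p \<in> e) \<and> (\<exists>c \<in> Units Q. \<forall>s \<in> e. p \<otimes>\<^bsub>Q\<^esub> s \<otimes>\<^bsub>Q\<^esub> c \<in> e))"

locale quot_monoid = monoid Q for Q (structure)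
begin

declare Units_closed [simp] unit_cancels [simp]

lemma orderD:
  assumes "order_in Q e"
  shows "e \<subseteq> carrier Q" "\<one> \<in> e" "s \<in> e \<Longrightarrow> s \<in> carrier Q" "s \<in> e \<Longrightarrow> t \<in> e \<Longrightarrow> s \<otimes> t \<in> e"
    "q \<in> carrier Q \<Longrightarrow> \<exists>a \<in> e. \<exists>c \<in> e \<inter> Units Q. q = a \<otimes> inv c"
    "q \<in> carrier Q \<Longrightarrow> \<exists>b \<in> e. \<exists>d \<in> e \<inter> Units Q. q = inv d \<otimes> b"
  using assms by (auto simp: order_in_def submonoid_def)

text \<open>For right fractions conjugate \<open>q\<close> by \<open>a\<close>, write the result as
  \<open>s c\<^sup>-\<^sup>1\<close>, and expand:
  \<open>q = (a s b) (a c b)\<^sup>-\<^sup>1\<close>. For left fractions the conjugation is by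
  \<open>b\<close>.\<close>

lemma order_of_sub:
  assumes e: "order_in Q e" and f: "submonoid f Q"
    and ab: "a \<in> Units Q" "b \<in> Units Q" "\<And>s. s \<in> e \<Longrightarrow> a \<otimes> s \<otimes> b \<in> f"
  shows "order_in Q f"
  unfolding order_in_def
proof (intro conjI ballI f)
  fix q assume q: "q \<in> carrier Q"
  obtain s c where s: "s \<in> e" "c \<in> e" "c \<in> Units Q" "inv a \<otimes> q \<otimes> a = s \<otimes> inv c"
    using orderD(5)[OF e, of "inv a \<otimes> q \<otimes> a"] q ab by auto
  note sc = orderD(3)[OF e s(1)] orderD(3)[OF e s(2)]
  have "q = a \<otimes> (inv a \<otimes> q \<otimes> a) \<otimes> inv a" using q ab by (simp add: m_assoc)
  also have "\<dots> = (a \<otimes> s \<otimes> b) \<otimes> inv (a \<otimes> c \<otimes> b)"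
    unfolding s(4) using ab s(3) sc by (simp add: m_assoc inv_mult_Units)
  finally show "\<exists>s \<in> f. \<exists>c \<in> f \<inter> Units Q. q = s \<otimes> inv c"
    using ab s by (intro bexI[of _ "a \<otimes> s \<otimes> b"] bexI[of _ "a \<otimes> c \<otimes> b"]) auto
next
  fix q assume q: "q \<in> carrier Q"
  obtain s c where s: "s \<in> e" "c \<in> e" "c \<in> Units Q" "b \<otimes> q \<otimes> inv b = inv c \<otimes> s"
    using orderD(6)[OF e, of "b \<otimes> q \<otimes> inv b"] q ab by auto
  note sc = orderD(3)[OF e s(1)] orderD(3)[OF e s(2)]
  have "q = inv b \<otimes> (b \<otimes> q \<otimes> inv b) \<otimes> b" using q ab by (simp add: m_assoc)
  also have "\<dots> = inv (a \<otimes> c \<otimes> b) \<otimes> (a \<otimes> s \<otimes> b)"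
    unfolding s(4) using ab s(3) sc by (simp add: m_assoc inv_mult_Units)
  finally show "\<exists>s \<in> f. \<exists>c \<in> f \<inter> Units Q. q = inv c \<otimes> s"
    using ab s by (intro bexI[of _ "a \<otimes> s \<otimes> b"] bexI[of _ "a \<otimes> c \<otimes> b"]) auto
qed

lemma equiv_sym: "equivalent_orders Q e f \<Longrightarrow> equivalent_orders Q f e"
  by (auto simp: equivalent_orders_iff)

lemma equiv_trans1:
  assumes "e \<subseteq> carrier Q" "a \<in> Units Q" "b \<in> Units Q" "\<forall>s \<in> e. a \<otimes> s \<otimes> b \<in> f"
    "a' \<in> Units Q" "b' \<in> Units Q" "\<forall>s \<in> f. a' \<otimes> s \<otimes> b' \<in> g"
  shows "\<exists>a \<in> Units Q. \<exists>b \<in> Units Q. \<forall>s \<in> e. a \<otimes> s \<otimes> b \<in> g"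
proof (intro bexI ballI)
  fix s assume s: "s \<in> e"
  have "(a' \<otimes> a) \<otimes> s \<otimes> (b \<otimes> b') = a' \<otimes> (a \<otimes> s \<otimes> b) \<otimes> b'"
    using assms s by (simp add: m_assoc subset_iff)
  then show "(a' \<otimes> a) \<otimes> s \<otimes> (b \<otimes> b') \<in> g" using assms s by simp
qed (use assms in auto)

lemma equiv_trans:
  assumes "equivalent_orders Q e f" "equivalent_orders Q f g" "e \<subseteq> carrier Q" "g \<subseteq> carrier Q"
  shows "equivalent_orders Q e g"
proof -
  obtain a b c d where 1: "a \<in> Units Q" "b \<in> Units Q" "\<forall>s \<in> e. a \<otimes> s \<otimes> b \<in> f"
    "c \<in> Units Q" "d \<in> Units Q" "\<forall>s \<in> f. c \<otimes> s \<otimes> d \<in> e"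
    using assms(1) unfolding equivalent_orders_iff by blast
  obtain a' b' c' d' where 2: "a' \<in> Units Q" "b' \<in> Units Q" "\<forall>s \<in> f. a' \<otimes> s \<otimes> b' \<in> g"
    "c' \<in> Units Q" "d' \<in> Units Q" "\<forall>s \<in> g. c' \<otimes> s \<otimes> d' \<in> f"
    using assms(2) unfolding equivalent_orders_iff by blast
  show ?thesis
    unfolding equivalent_orders_iff
    using equiv_trans1[OF assms(3) 1(1-3) 2(1-3)] equiv_trans1[OF assms(4) 2(4-6) 1(4-6)] by simp
qed

section \<open>Left and right orders of a fractional ideal, and its closure\<close>

lemma maxD: "maximal_order Q e \<Longrightarrow> order_in Q e"
  by (simp add: maximal_order_def)

text \<open>A submonoid above \<open>e\<close> is automatically an order, so an inclusion and
  equivalence suffice for equality with a maximal order. Sources and targets are determined in this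
  way.\<close>

lemma max_eq:
  assumes "maximal_order Q e" "submonoid f Q" "e \<subseteq> f" "equivalent_orders Q e f"
  shows "f = e"
proof -
  have "order_in Q f"
    using order_of_sub[OF maxD[OF assms(1)] assms(2) Units_one_closed Units_one_closed]
      orderD(1)[OF maxD[OF assms(1)]] assms(3) by (auto simp: subset_iff)
  then show ?thesis using assms by (auto simp: maximal_order_def)
qed

lemma tgt_order:
  assumes e: "order_in Q e" and K: "frac_left_ideal Q e K"
  shows "order_in Q (tgt Q K)" "equivalent_orders Q e (tgt Q K)"
proof -
  obtain x y where x: "x \<in> Units Q" "x \<in> K" and y: "y \<in> Units Q" "\<forall>a \<in> K. a \<otimes> y \<in> e"
    and Kc: "K \<subseteq> carrier Q" and l: "\<forall>s \<in> e. \<forall>a \<in> K. s \<otimes> a \<in> K"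
    using K by (auto simp: frac_left_ideal_iff)
  have sub: "submonoid (tgt Q K) Q"
  proof
    fix s t assume s: "s \<in> tgt Q K" "t \<in> tgt Q K"
    then have "k \<otimes> (s \<otimes> t) \<in> K" if "k \<in> K" for k
      using that Kc by (auto simp: tgt_rres rres_def subset_iff m_assoc[symmetric])
    then show "s \<otimes> t \<in> tgt Q K" using s by (auto simp: tgt_rres rres_def)
  qed (use Kc in \<open>auto simp: tgt_rres rres_def\<close>)
  \<comment> \<open>\<open>K y\<close> lies in \<open>e\<close> and \<open>e x\<close> lies in
    \<open>K\<close>, so right multiplication by \<open>y s x\<close> returns to
    \<open>K\<close>.\<close>
  have 1: "y \<otimes> s \<otimes> x \<in> tgt Q K" if s: "s \<in> e" for s
  proof -
    note sc = orderD(3)[OF e s]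
    have "k \<otimes> (y \<otimes> s \<otimes> x) \<in> K" if k: "k \<in> K" for k
    proof -
      have "k \<otimes> (y \<otimes> s \<otimes> x) = ((k \<otimes> y) \<otimes> s) \<otimes> x"
        using k Kc x y sc by (simp add: m_assoc subset_iff)
      moreover have "(k \<otimes> y) \<otimes> s \<in> e" using orderD(4)[OF e] y k s by blast
      ultimately show ?thesis using l x by auto
    qed
    then show ?thesis using x y sc by (auto simp: tgt_rres rres_def)
  qed
  show "order_in Q (tgt Q K)" using order_of_sub[OF e sub y(1) x(1) 1] .
  have 2: "x \<otimes> t \<otimes> y \<in> e" if "t \<in> tgt Q K" for t
    using that x y by (auto simp: tgt_rres rres_def)
  show "equivalent_orders Q e (tgt Q K)"
    unfolding equivalent_orders_iff using 1 2 x y by blast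
qed

text \<open>The left order of \<open>K\<close> contains \<open>e\<close> and is equivalent to it, so
  maximality of \<open>e\<close> applies. On the right side no maximal order is given beforehand;
  see \<open>tgt_max\<close>.\<close>

lemma src_eq:
  assumes m: "maximal_order Q e" and K: "frac_left_ideal Q e K"
  shows "src Q K = e"
proof (rule max_eq[OF m])
  note e = maxD[OF m]
  obtain x y where x: "x \<in> Units Q" "x \<in> K" and y: "y \<in> Units Q" "\<forall>a \<in> K. a \<otimes> y \<in> e"
    and Kc: "K \<subseteq> carrier Q" and l: "\<forall>s \<in> e. \<forall>a \<in> K. s \<otimes> a \<in> K"
    using K by (auto simp: frac_left_ideal_iff)
  show "submonoid (src Q K) Q"
  proof
    fix s t assume s: "s \<in> src Q K" "t \<in> src Q K"
    then have "(s \<otimes> t) \<otimes> k \<in> K" if "k \<in> K" for k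
      using that Kc by (auto simp: src_lres lres_def subset_iff m_assoc)
    then show "s \<otimes> t \<in> src Q K" using s by (auto simp: src_lres lres_def)
  qed (use Kc in \<open>auto simp: src_lres lres_def\<close>)
  show sub: "e \<subseteq> src Q K" using l orderD(1)[OF e] by (auto simp: src_lres lres_def)
  have "\<forall>s \<in> e. \<one> \<otimes> s \<otimes> \<one> \<in> src Q K" using sub orderD(3)[OF e] by auto
  moreover have "\<one> \<otimes> q \<otimes> (x \<otimes> y) \<in> e" if "q \<in> src Q K" for q
  proof -
    have "q \<in> carrier Q" "q \<otimes> x \<in> K" using that x by (auto simp: src_lres lres_def)
    then show ?thesis using y x by (simp add: m_assoc[symmetric])
  qed
  ultimately show "equivalent_orders Q e (src Q K)"
    unfolding equivalent_orders_iff using x y by blast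
qed

lemma ideal_inv_rres: "K \<subseteq> carrier Q \<Longrightarrow> ideal_inv Q K = rres Q (src Q K) K"
  by (auto simp: ideal_inv_iff src_lres rres_def lres_def)

lemma ideal_inv_lres: "K \<subseteq> carrier Q \<Longrightarrow> ideal_inv Q K = lres Q (tgt Q K) K"
  by (auto simp: ideal_inv_iff tgt_rres rres_def lres_def subset_iff m_assoc)

lemma rres_fli:
  assumes m: "maximal_order Q e" and K: "frac_left_ideal Q e K"
  shows "frac_left_ideal Q (tgt Q K) (rres Q e K)"
proof -
  note e = maxD[OF m]
  obtain x y where x: "x \<in> Units Q" "x \<in> K" and y: "y \<in> Units Q" "\<forall>a \<in> K. a \<otimes> y \<in> e"
    and Kc: "K \<subseteq> carrier Q" and l: "\<forall>s \<in> e. \<forall>a \<in> K. s \<otimes> a \<in> K"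
    using K by (auto simp: frac_left_ideal_iff)
  have 1: "t \<otimes> q \<in> rres Q e K" if "t \<in> tgt Q K" "q \<in> rres Q e K" for t q
    using that Kc by (auto simp: tgt_rres rres_def subset_iff m_assoc[symmetric])
  have 2: "y \<in> rres Q e K" using y by (auto simp: rres_def)
  have 3: "q \<otimes> x \<in> tgt Q K" if "q \<in> rres Q e K" for q
    using that x Kc l by (auto simp: tgt_rres rres_def subset_iff m_assoc[symmetric])
  show ?thesis unfolding frac_left_ideal_iff using 1 2 3 x y by (auto simp: rres_def)
qed

lemma rres_tgt:
  assumes m: "maximal_order Q e" and K: "frac_left_ideal Q e K"
  shows "tgt Q (rres Q e K) = e"
proof (rule max_eq[OF m])
  note e = maxD[OF m]
  note t = tgt_order[OF e K]
  note t' = tgt_order[OF t(1) rres_fli[OF m K]]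
  show "submonoid (tgt Q (rres Q e K)) Q" using t'(1) by (simp add: order_in_def)
  show "e \<subseteq> tgt Q (rres Q e K)"
    using orderD(1,4)[OF e] K unfolding frac_left_ideal_iff
    by (auto simp: tgt_rres rres_def subset_iff m_assoc[symmetric])
  show "equivalent_orders Q e (tgt Q (rres Q e K))"
    using equiv_trans[OF t(2) t'(2) orderD(1)[OF e] orderD(1)[OF t'(1)]] .
qed

text \<open>The closure of the Galois connection between right and left residuals. It makes sense
  for any set and agrees with \<open>div_closure\<close> on the fractional left ideals of a maximal
  order.\<close>

definition cl :: "'a set \<Rightarrow> 'a set \<Rightarrow> 'a set" where
  "cl e K = lres Q e (rres Q e K)"

lemma closure_eq:
  assumes m: "maximal_order Q e" and K: "frac_left_ideal Q e K"
  shows "ideal_inv Q K = rres Q e K" "div_closure Q K = cl e K"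
proof -
  have Kc: "K \<subseteq> carrier Q" using K by (simp add: frac_left_ideal_iff)
  show 1: "ideal_inv Q K = rres Q e K" using ideal_inv_rres[OF Kc] src_eq[OF m K] by simp
  have "rres Q e K \<subseteq> carrier Q" by (auto simp: rres_def)
  then have "ideal_inv Q (rres Q e K) = lres Q e (rres Q e K)"
    using ideal_inv_lres[of "rres Q e K"] rres_tgt[OF m K] by simp
  then show "div_closure Q K = cl e K" unfolding div_closure_def 1 cl_def .
qed

lemma cl_upper: "K \<subseteq> carrier Q \<Longrightarrow> K \<subseteq> cl e K"
  by (auto simp: cl_def lres_def rres_def)

lemma rres_cl: "K \<subseteq> carrier Q \<Longrightarrow> rres Q e (cl e K) = rres Q e K"
  using cl_upper[of K e] by (auto simp: cl_def lres_def rres_def)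

lemma cl_mono: "K \<subseteq> K' \<Longrightarrow> cl e K \<subseteq> cl e K'"
  by (auto simp: cl_def lres_def rres_def)

lemma cl_fli:
  assumes e: "order_in Q e" and K: "frac_left_ideal Q e K"
  shows "frac_left_ideal Q e (cl e K)"
proof -
  obtain x y where x: "x \<in> Units Q" "x \<in> K" and y: "y \<in> Units Q" "\<forall>a \<in> K. a \<otimes> y \<in> e"
    and Kc: "K \<subseteq> carrier Q" using K by (auto simp: frac_left_ideal_iff)
  have 1: "s \<otimes> q \<in> cl e K" if "s \<in> e" "q \<in> cl e K" for s q
    using that orderD(3,4)[OF e] by (auto simp: cl_def lres_def rres_def m_assoc)
  have "y \<in> rres Q e K" using y by (auto simp: rres_def)
  then have 2: "\<forall>q \<in> cl e K. q \<otimes> y \<in> e" by (auto simp: cl_def lres_def)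
  have 3: "x \<in> cl e K" "cl e K \<subseteq> carrier Q" using x cl_upper[OF Kc] by (auto simp: cl_def lres_def)
  show ?thesis unfolding frac_left_ideal_iff using 1 2 3 x(1) y(1) by blast
qed

lemma cl_divisorial:
  assumes m: "maximal_order Q e" and K: "frac_left_ideal Q e K"
  shows "divisorial Q (cl e K)"
proof -
  have "cl e (cl e K) = cl e K"
    using rres_cl[of K e] K by (simp add: cl_def frac_left_ideal_iff)
  then show ?thesis
    using closure_eq(2)[OF m cl_fli[OF maxD[OF m] K]] by (simp add: divisorial_def)
qed

lemma self_fli: "order_in Q e \<Longrightarrow> frac_left_ideal Q e e"
  unfolding frac_left_ideal_iff using orderD[of e]
  by (auto intro!: bexI[of _ \<one>] simp: subset_iff)

lemma residual_self:
  assumes "order_in Q e" shows "rres Q e e = e" "lres Q e e = e"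
  using orderD[OF assms] by (auto simp: rres_def lres_def dest: bspec[of _ _ \<one>])

text \<open>Multiplying \<open>c\<close> by its own denominator puts it into \<open>e\<close>, so
  that it keeps \<open>e\<close> itself inside \<open>e\<close> as well.\<close>

lemma unit_bounded_strong:
  assumes e: "order_in Q e" and b: "unit_bounded Q e" and p: "p \<in> Units Q"
  shows "\<exists>c \<in> Units Q \<inter> e. \<forall>s \<in> e. c \<otimes> s \<otimes> p \<in> e" "\<exists>c \<in> Units Q \<inter> e. \<forall>s \<in> e. p \<otimes> s \<otimes> c \<in> e"
proof -
  obtain c where c: "c \<in> Units Q" "\<forall>s \<in> e. c \<otimes> s \<otimes> p \<in> e" using b p by (auto simp: unit_bounded_def)
  obtain u v where uv: "u \<in> e" "v \<in> e" "v \<in> Units Q" "c = inv v \<otimes> u" using orderD(6)[OF e, of c] c by auto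
  have uc: "u \<in> carrier Q" "v \<in> carrier Q" using uv orderD(3)[OF e] by auto
  have u: "u = v \<otimes> c" using uv uc by simp
  have "u \<otimes> s \<otimes> p = v \<otimes> (c \<otimes> s \<otimes> p)" if "s \<in> e" for s
    using u uv c p uc orderD(3)[OF e that] by (simp add: m_assoc)
  then have "\<forall>s \<in> e. u \<otimes> s \<otimes> p \<in> e" using c(2) uv orderD(4)[OF e] by metis
  moreover have "u \<in> Units Q" unfolding u using uv(3) c(1) by simp
  ultimately show "\<exists>c \<in> Units Q \<inter> e. \<forall>s \<in> e. c \<otimes> s \<otimes> p \<in> e" using uv by blast
next
  obtain c where c: "c \<in> Units Q" "\<forall>s \<in> e. p \<otimes> s \<otimes> c \<in> e" using b p by (auto simp: unit_bounded_def)
  obtain u v where uv: "u \<in> e" "v \<in> e" "v \<in> Units Q" "c = u \<otimes> inv v" using orderD(5)[OF e, of c] c by auto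
  have uc: "u \<in> carrier Q" "v \<in> carrier Q" using uv orderD(3)[OF e] by auto
  have u: "u = c \<otimes> v" using uv uc by (simp add: m_assoc)
  have "p \<otimes> s \<otimes> u = (p \<otimes> s \<otimes> c) \<otimes> v" if "s \<in> e" for s
    using u uv c p uc orderD(3)[OF e that] by (simp add: m_assoc)
  then have "\<forall>s \<in> e. p \<otimes> s \<otimes> u \<in> e" using c(2) uv orderD(4)[OF e] by metis
  moreover have "u \<in> Units Q" unfolding u using uv(3) c(1) by simp
  ultimately show "\<exists>c \<in> Units Q \<inter> e. \<forall>s \<in> e. p \<otimes> s \<otimes> c \<in> e" using uv by blast
qed

lemma unit_bounded_equiv:
  assumes e: "order_in Q e" and b: "unit_bounded Q e" and f: "f \<subseteq> carrier Q" and eq: "equivalent_orders Q e f"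
  shows "unit_bounded Q f"
proof -
  obtain a b' where ab: "a \<in> Units Q" "b' \<in> Units Q" "\<forall>s \<in> e. a \<otimes> s \<otimes> b' \<in> f"
    using eq by (auto simp: equivalent_orders_iff)
  obtain c d where cd: "c \<in> Units Q" "d \<in> Units Q" "\<forall>s \<in> f. c \<otimes> s \<otimes> d \<in> e"
    using eq by (auto simp: equivalent_orders_iff)
  show ?thesis unfolding unit_bounded_def
  proof (intro ballI conjI)
    fix p assume p: "p \<in> Units Q"
    obtain k where k: "k \<in> Units Q" "\<forall>s \<in> e. k \<otimes> s \<otimes> (inv d \<otimes> p \<otimes> inv b') \<in> e"
      using unit_bounded_strong(1)[OF e b, of "inv d \<otimes> p \<otimes> inv b'"] p ab cd by auto
    have "(a \<otimes> k \<otimes> c) \<otimes> t \<otimes> p \<in> f" if t: "t \<in> f" for t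
    proof -
      have tc: "t \<in> carrier Q" using t f by auto
      have "(a \<otimes> k \<otimes> c) \<otimes> t \<otimes> p = a \<otimes> (k \<otimes> (c \<otimes> t \<otimes> d) \<otimes> (inv d \<otimes> p \<otimes> inv b')) \<otimes> b'"
        using tc p ab cd k by (simp add: m_assoc)
      then show ?thesis using k(2) cd(3) t ab(3) by simp
    qed
    then show "\<exists>c \<in> Units Q. \<forall>s \<in> f. c \<otimes> s \<otimes> p \<in> f" using ab k cd by (intro bexI[of _ "a \<otimes> k \<otimes> c"]) auto
    obtain k where k: "k \<in> Units Q" "\<forall>s \<in> e. (inv a \<otimes> p \<otimes> inv c) \<otimes> s \<otimes> k \<in> e"
      using unit_bounded_strong(2)[OF e b, of "inv a \<otimes> p \<otimes> inv c"] p ab cd by auto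
    have "p \<otimes> t \<otimes> (d \<otimes> k \<otimes> b') \<in> f" if t: "t \<in> f" for t
    proof -
      have tc: "t \<in> carrier Q" using t f by auto
      have "p \<otimes> t \<otimes> (d \<otimes> k \<otimes> b') = a \<otimes> ((inv a \<otimes> p \<otimes> inv c) \<otimes> (c \<otimes> t \<otimes> d) \<otimes> k) \<otimes> b'"
        using tc p ab cd k by (simp add: m_assoc)
      then show ?thesis using k(2) cd(3) t ab(3) by simp
    qed
    then show "\<exists>c \<in> Units Q. \<forall>s \<in> f. p \<otimes> s \<otimes> c \<in> f" using ab k cd by (intro bexI[of _ "d \<otimes> k \<otimes> b'"]) auto
  qed
qed

text \<open>A two-sided ideal inside \<open>e p\<^sup>-\<^sup>1\<close> contains a unit
  \<open>c\<close>, hence also \<open>c e\<close>.\<close>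

lemma bounded_order_unit_bounded:
  assumes e: "order_in Q e" and b: "bounded_order Q e"
  shows "unit_bounded Q e"
  unfolding unit_bounded_def
proof (intro ballI conjI)
  fix p assume p: "p \<in> Units Q"
  have "frac_left_ideal Q e {s \<otimes> inv p | s. s \<in> e}"
    unfolding frac_left_ideal_iff
  proof (intro conjI)
    show "{s \<otimes> inv p | s. s \<in> e} \<subseteq> carrier Q" using p orderD(3)[OF e] by auto
    show "\<forall>s \<in> e. \<forall>a \<in> {s \<otimes> inv p | s. s \<in> e}. s \<otimes> a \<in> {s \<otimes> inv p | s. s \<in> e}"
      using p orderD(3,4)[OF e] by (auto simp: m_assoc[symmetric])
    show "\<exists>x \<in> Units Q. x \<in> {s \<otimes> inv p | s. s \<in> e}"
      using p orderD(2)[OF e] by (intro bexI[of _ "inv p"]) (auto intro!: exI[of _ \<one>])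
    show "\<exists>y \<in> Units Q. \<forall>a \<in> {s \<otimes> inv p | s. s \<in> e}. a \<otimes> y \<in> e"
      using p orderD(3)[OF e] by (intro bexI[of _ p]) (auto simp: m_assoc)
  qed
  then obtain J where J: "frac_ideal Q e J" "J \<subseteq> {s \<otimes> inv p | s. s \<in> e}" using b by (auto simp: bounded_order_def)
  then obtain c where c: "c \<in> Units Q" "c \<in> J" by (auto simp: frac_ideal_def frac_left_ideal_iff)
  have "c \<otimes> s \<otimes> p \<in> e" if "s \<in> e" for s
  proof -
    have "c \<otimes> s \<in> J" using J(1) c that by (auto simp: frac_ideal_def frac_right_ideal_iff)
    then obtain t where "t \<in> e" "c \<otimes> s = t \<otimes> inv p" using J(2) by auto
    then show ?thesis using p orderD(3)[OF e] by (simp add: m_assoc)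
  qed
  then show "\<exists>c \<in> Units Q. \<forall>s \<in> e. c \<otimes> s \<otimes> p \<in> e" using c by auto
next
  fix p assume p: "p \<in> Units Q"
  have "frac_right_ideal Q e {inv p \<otimes> s | s. s \<in> e}"
    unfolding frac_right_ideal_iff
  proof (intro conjI)
    show "{inv p \<otimes> s | s. s \<in> e} \<subseteq> carrier Q" using p orderD(3)[OF e] by auto
    show "\<forall>s \<in> e. \<forall>a \<in> {inv p \<otimes> s | s. s \<in> e}. a \<otimes> s \<in> {inv p \<otimes> s | s. s \<in> e}"
      using p orderD(3,4)[OF e] by (auto simp: m_assoc)
    show "\<exists>x \<in> Units Q. x \<in> {inv p \<otimes> s | s. s \<in> e}"
      using p orderD(2)[OF e] by (intro bexI[of _ "inv p"]) (auto intro!: exI[of _ \<one>])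
    show "\<exists>y \<in> Units Q. \<forall>a \<in> {inv p \<otimes> s | s. s \<in> e}. y \<otimes> a \<in> e"
      using p orderD(3)[OF e] by (intro bexI[of _ p]) auto
  qed
  then obtain J where J: "frac_ideal Q e J" "J \<subseteq> {inv p \<otimes> s | s. s \<in> e}" using b by (auto simp: bounded_order_def)
  then obtain c where c: "c \<in> Units Q" "c \<in> J" by (auto simp: frac_ideal_def frac_left_ideal_iff)
  have "p \<otimes> s \<otimes> c \<in> e" if "s \<in> e" for s
  proof -
    have "s \<otimes> c \<in> J" using J(1) c that by (auto simp: frac_ideal_def frac_left_ideal_iff)
    then obtain t where "t \<in> e" "s \<otimes> c = inv p \<otimes> t" using J(2) by auto
    then show ?thesis using p c orderD(3)[OF e] that by (simp add: m_assoc)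
  qed
  then show "\<exists>c \<in> Units Q. \<forall>s \<in> e. p \<otimes> s \<otimes> c \<in> e" using c by auto
qed

text \<open>The right order of a divisorial left ideal \<open>K\<close> is maximal: a larger equivalent order \<open>f\<close> would
  yield the order \<open>e \<union> K f K\<^sup>-\<^sup>1\<close>, which is equivalent to \<open>e\<close> by boundedness.\<close>

lemma tgt_max:
  assumes m: "maximal_order Q e" and b: "unit_bounded Q e" and K: "frac_left_ideal Q e K"
    and dv: "divisorial Q K"
  shows "maximal_order Q (tgt Q K)"
  unfolding maximal_order_def
proof (intro conjI allI impI)
  note e = maxD[OF m]
  note t = tgt_order[OF e K]
  show "order_in Q (tgt Q K)" by (rule t(1))
  fix f assume f: "order_in Q f \<and> equivalent_orders Q (tgt Q K) f \<and> tgt Q K \<subseteq> f"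
  obtain x y where x: "x \<in> Units Q" "x \<in> K" and y: "y \<in> Units Q" "\<forall>a \<in> K. a \<otimes> y \<in> e"
    and Kc: "K \<subseteq> carrier Q" and l: "\<forall>s \<in> e. \<forall>a \<in> K. s \<otimes> a \<in> K"
    using K by (auto simp: frac_left_ideal_iff)
  define R where "R = rres Q e K"
  have Rc: "R \<subseteq> carrier Q" by (auto simp: R_def rres_def)
  have Rr: "q \<otimes> s \<in> R" if "q \<in> R" "s \<in> e" for q s
    using that rres_tgt[OF m K] by (auto simp: R_def tgt_rres rres_def)
  have KR: "k \<otimes> q \<in> e" if "k \<in> K" "q \<in> R" for k q using that by (auto simp: R_def rres_def)
  have fo: "order_in Q f" using f by simp
  note ec = orderD(3)[OF e] and fc = orderD(3)[OF fo]
  \<comment> \<open>\<open>R K\<close> lies in the right order of \<open>K\<close>, hence in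
    \<open>f\<close>; this makes the product \<open>K f R\<close> closed under
    multiplication.\<close>
  have RK: "q \<otimes> k \<in> f" if q: "q \<in> R" and k: "k \<in> K" for q k
  proof -
    have "k' \<otimes> (q \<otimes> k) \<in> K" if "k' \<in> K" for k'
      using KR[OF that q] l k q Kc Rc that by (simp add: m_assoc[symmetric] subset_iff)
    then have "q \<otimes> k \<in> tgt Q K" using q k Rc Kc by (auto simp: tgt_rres rres_def)
    then show ?thesis using f by auto
  qed
  define M where "M = {k \<otimes> t \<otimes> q | k t q. k \<in> K \<and> t \<in> f \<and> q \<in> R}"
  have MI: "k \<otimes> t \<otimes> q \<in> M" if "k \<in> K" "t \<in> f" "q \<in> R" for k t q using that by (auto simp: M_def)
  have eM: "s \<otimes> u \<in> M" if "s \<in> e" "u \<in> M" for s u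
  proof -
    obtain k t q where u: "u = k \<otimes> t \<otimes> q" "k \<in> K" "t \<in> f" "q \<in> R" using \<open>u \<in> M\<close> by (auto simp: M_def)
    then have "s \<otimes> u = (s \<otimes> k) \<otimes> t \<otimes> q" using \<open>s \<in> e\<close> ec fc Kc Rc by (simp add: m_assoc subset_iff)
    then show ?thesis using MI[of "s \<otimes> k" t q] u l \<open>s \<in> e\<close> by simp
  qed
  have Me: "u \<otimes> s \<in> M" if "s \<in> e" "u \<in> M" for s u
  proof -
    obtain k t q where u: "u = k \<otimes> t \<otimes> q" "k \<in> K" "t \<in> f" "q \<in> R" using \<open>u \<in> M\<close> by (auto simp: M_def)
    then have "u \<otimes> s = k \<otimes> t \<otimes> (q \<otimes> s)" using \<open>s \<in> e\<close> ec fc Kc Rc by (simp add: m_assoc subset_iff)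
    then show ?thesis using MI[of k t "q \<otimes> s"] u Rr \<open>s \<in> e\<close> by simp
  qed
  have MM: "u \<otimes> u' \<in> M" if "u' \<in> M" "u \<in> M" for u u'
  proof -
    obtain k t q where u: "u = k \<otimes> t \<otimes> q" "k \<in> K" "t \<in> f" "q \<in> R" using \<open>u \<in> M\<close> by (auto simp: M_def)
    obtain k' t' q' where u': "u' = k' \<otimes> t' \<otimes> q'" "k' \<in> K" "t' \<in> f" "q' \<in> R" using \<open>u' \<in> M\<close> by (auto simp: M_def)
    have "u \<otimes> u' = k \<otimes> (t \<otimes> ((q \<otimes> k') \<otimes> t')) \<otimes> q'"
      using u u' fc Kc Rc by (simp add: m_assoc subset_iff)
    moreover have "t \<otimes> ((q \<otimes> k') \<otimes> t') \<in> f" using u u' RK orderD(4)[OF fo] by simp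
    ultimately show ?thesis using MI u(2) u'(4) by simp
  qed
  have Mc: "M \<subseteq> carrier Q" using Kc Rc fc by (auto simp: M_def subset_iff)
  have sub: "submonoid (e \<union> M) Q"
  proof
    show "e \<union> M \<subseteq> carrier Q" using Mc orderD(1)[OF e] by auto
    show "\<one> \<in> e \<union> M" using orderD(2)[OF e] by auto
    show "\<And>u v. u \<in> e \<union> M \<Longrightarrow> v \<in> e \<union> M \<Longrightarrow> u \<otimes> v \<in> e \<union> M"
      using eM Me MM orderD(4)[OF e] by auto
  qed
  have "equivalent_orders Q e f" using equiv_trans[OF t(2) _ orderD(1)[OF e] orderD(1)[OF fo]] f by blast
  then obtain c0 d0 where cd: "c0 \<in> Units Q" "d0 \<in> Units Q" "\<forall>s \<in> f. c0 \<otimes> s \<otimes> d0 \<in> e"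
    by (auto simp: equivalent_orders_iff)
  \<comment> \<open>\<open>c\<close> and \<open>d\<close> bound \<open>K f R\<close> factor by
    factor: \<open>K y\<close>, \<open>c0 f d0\<close> and \<open>x R\<close> lie in
    \<open>e\<close>, and the units in between are absorbed by boundedness.\<close>
  obtain c where c: "c \<in> Units Q" "c \<in> e" "\<forall>s \<in> e. c \<otimes> s \<otimes> (inv y \<otimes> inv c0) \<in> e"
    using unit_bounded_strong(1)[OF e b, of "inv y \<otimes> inv c0"] y cd by auto
  obtain d where d: "d \<in> Units Q" "d \<in> e" "\<forall>s \<in> e. (inv d0 \<otimes> inv x) \<otimes> s \<otimes> d \<in> e"
    using unit_bounded_strong(2)[OF e b, of "inv d0 \<otimes> inv x"] x cd by auto
  have "c \<otimes> u \<otimes> d \<in> e" if u: "u \<in> M" for u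
  proof -
    obtain k t q where u: "u = k \<otimes> t \<otimes> q" "k \<in> K" "t \<in> f" "q \<in> R" using u by (auto simp: M_def)
    note cc = Kc[THEN subsetD, OF u(2)] fc[OF u(3)] Rc[THEN subsetD, OF u(4)]
    have "c \<otimes> u \<otimes> d = (c \<otimes> (k \<otimes> y) \<otimes> (inv y \<otimes> inv c0)) \<otimes> ((c0 \<otimes> t \<otimes> d0) \<otimes> ((inv d0 \<otimes> inv x) \<otimes> (x \<otimes> q) \<otimes> d))"
      using u(1) cc c d cd x y by (simp add: m_assoc)
    moreover have "c \<otimes> (k \<otimes> y) \<otimes> (inv y \<otimes> inv c0) \<in> e" using c(3) y(2) u(2) by blast
    moreover have "c0 \<otimes> t \<otimes> d0 \<in> e" using cd(3) u(3) by blast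
    moreover have "(inv d0 \<otimes> inv x) \<otimes> (x \<otimes> q) \<otimes> d \<in> e" using d(3) KR[OF x(2) u(4)] by blast
    ultimately show ?thesis using orderD(4)[OF e] by simp
  qed
  then have "\<forall>u \<in> e \<union> M. c \<otimes> u \<otimes> d \<in> e" using c d orderD(4)[OF e] by auto
  moreover have "\<forall>u \<in> e. \<one> \<otimes> u \<otimes> \<one> \<in> e \<union> M" using ec by auto
  ultimately have "equivalent_orders Q e (e \<union> M)" unfolding equivalent_orders_iff using c d by blast
  then have Me': "M \<subseteq> e" using max_eq[OF m sub] by auto
  have Kcl: "K = cl e K" using dv closure_eq(2)[OF m K] by (simp add: divisorial_def)
  have "t \<in> tgt Q K" if t: "t \<in> f" for t
  proof -
    \<comment> \<open>\<open>K t R \<subseteq> e\<close> says that \<open>K t\<close> lies in the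
      closure of \<open>K\<close>, which is \<open>K\<close> by divisoriality.\<close>
    have "k \<otimes> t \<in> cl e K" if k: "k \<in> K" for k
      using Me' t k Kc fc[OF t] by (auto simp: cl_def lres_def R_def[symmetric] M_def subset_iff)
    then show ?thesis using Kcl fc[OF t] by (auto simp: tgt_rres rres_def)
  qed
  then show "f = tgt Q K" using f by auto
qed

end

section \<open>The groupoid of divisorial fractional ideals\<close>

locale order_class = quot_monoid Q for Q (structure) +
  fixes \<alpha> :: "'a set set"
  assumes a_max: "e \<in> \<alpha> \<Longrightarrow> maximal_order Q e"
    and a_bdd: "e \<in> \<alpha> \<Longrightarrow> unit_bounded Q e"
    and a_equiv: "e \<in> \<alpha> \<Longrightarrow> f \<in> \<alpha> \<Longrightarrow> equivalent_orders Q e f"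
    and a_closed: "e \<in> \<alpha> \<Longrightarrow> maximal_order Q f \<Longrightarrow> equivalent_orders Q e f \<Longrightarrow> f \<in> \<alpha>"

lemma (in quot_monoid) order_class_maximal:
  assumes m: "maximal_order Q S" and b: "bounded_order Q S"
  shows "order_class Q (maximal_orders_equiv Q S)"
proof -
  note S = maxD[OF m]
  have c: "e \<subseteq> carrier Q" if "e \<in> maximal_orders_equiv Q S" for e
    using that orderD(1)[OF maxD] by (auto simp: maximal_orders_equiv_def)
  show ?thesis
  proof
    fix e assume e: "e \<in> maximal_orders_equiv Q S"
    then show "maximal_order Q e" by (simp add: maximal_orders_equiv_def)
    have eq: "equivalent_orders Q S e" using e by (simp add: maximal_orders_equiv_def)
    show "unit_bounded Q e"
      using unit_bounded_equiv[OF S bounded_order_unit_bounded[OF S b] c[OF e] eq] .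
    fix f
    show "equivalent_orders Q e f" if f: "f \<in> maximal_orders_equiv Q S"
    proof -
      have "equivalent_orders Q S f" using f by (simp add: maximal_orders_equiv_def)
      then show ?thesis using equiv_trans[OF equiv_sym[OF eq] _ c[OF e] c[OF f]] by simp
    qed
    assume "maximal_order Q f" "equivalent_orders Q e f"
    then show "f \<in> maximal_orders_equiv Q S"
      using equiv_trans[OF eq _ orderD(1)[OF S] orderD(1)[OF maxD]] by (simp add: maximal_orders_equiv_def)
  qed
qed

context order_class
begin

abbreviation F where "F \<equiv> Fv Q \<alpha>"
abbreviation vm (infixl "\<cdot>" 70) where "I \<cdot> J \<equiv> vmult Q I J"
abbreviation ii where "ii \<equiv> ideal_inv Q"
abbreviation s where "s \<equiv> src Q"
abbreviation t where "t \<equiv> tgt Q"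

lemma a_order: "e \<in> \<alpha> \<Longrightarrow> order_in Q e" using a_max maxD by blast

lemma F_iff: "I \<in> F \<longleftrightarrow> divisorial Q I \<and> s I \<in> \<alpha> \<and> frac_left_ideal Q (s I) I"
proof
  assume "I \<in> F"
  then obtain e where e: "divisorial Q I" "e \<in> \<alpha>" "frac_left_ideal Q e I" by (auto simp: Fv_def)
  then show "divisorial Q I \<and> s I \<in> \<alpha> \<and> frac_left_ideal Q (s I) I"
    using src_eq[OF a_max[OF e(2)] e(3)] by simp
qed (auto simp: Fv_def)

lemma FI:
  assumes "e \<in> \<alpha>" "frac_left_ideal Q e K"
  shows "cl e K \<in> F" "s (cl e K) = e"
proof -
  have 1: "frac_left_ideal Q e (cl e K)" using cl_fli[OF a_order] assms by blast
  show 2: "s (cl e K) = e" using src_eq[OF a_max 1] assms by blast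
  show "cl e K \<in> F" unfolding F_iff 2 using 1 assms cl_divisorial[OF a_max] by blast
qed

lemma F_carrier: "I \<in> F \<Longrightarrow> I \<subseteq> carrier Q"
  by (simp add: F_iff frac_left_ideal_iff)

lemma F_mem: "I \<in> F \<Longrightarrow> q \<in> I \<Longrightarrow> q \<in> carrier Q"
  using F_carrier by blast

lemma F_unit: "I \<in> F \<Longrightarrow> \<exists>x \<in> Units Q. x \<in> I"
  by (simp add: F_iff frac_left_ideal_iff)

lemma F_srcI: "I \<in> F \<Longrightarrow> s I \<in> \<alpha>"
  by (simp add: F_iff)

lemma F_fli: "I \<in> F \<Longrightarrow> frac_left_ideal Q (s I) I"
  by (simp add: F_iff)

lemma F_tgtI:
  assumes "I \<in> F" shows "t I \<in> \<alpha>"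
proof -
  have I: "divisorial Q I" "s I \<in> \<alpha>" "frac_left_ideal Q (s I) I" using assms by (auto simp: F_iff)
  show ?thesis
    using a_closed[OF I(2) tgt_max[OF a_max[OF I(2)] a_bdd[OF I(2)] I(3,1)]]
      tgt_order(2)[OF a_order[OF I(2)] I(3)] by blast
qed

lemma src_mult: "I \<in> F \<Longrightarrow> q \<in> s I \<Longrightarrow> x \<in> I \<Longrightarrow> q \<otimes> x \<in> I"
  by (auto simp: src_lres lres_def)

lemma tgt_mult: "x \<in> I \<Longrightarrow> q \<in> t I \<Longrightarrow> x \<otimes> q \<in> I"
  by (auto simp: tgt_rres rres_def)

lemma F_inv:
  assumes "I \<in> F"
  shows "ii I \<in> F" "s (ii I) = t I" "t (ii I) = s I" "ii (ii I) = I"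
proof -
  have I: "divisorial Q I" "s I \<in> \<alpha>" "frac_left_ideal Q (s I) I" using assms by (auto simp: F_iff)
  note ce = closure_eq(1)[OF a_max[OF I(2)] I(3)]
  have fl: "frac_left_ideal Q (t I) (ii I)" using rres_fli[OF a_max[OF I(2)] I(3)] ce by simp
  show s: "s (ii I) = t I" using src_eq[OF a_max[OF F_tgtI[OF assms]] fl] .
  show "t (ii I) = s I" using rres_tgt[OF a_max[OF I(2)] I(3)] ce by simp
  show i: "ii (ii I) = I" using I(1) by (simp add: divisorial_def div_closure_def)
  show "ii I \<in> F" unfolding F_iff s using fl F_tgtI[OF assms] i by (simp add: divisorial_def div_closure_def)
qed

text \<open>For groupoid elements, \<open>I\<close> and \<open>ii I\<close> are residuals of each
  other from either side. Products are compared through these membership tests.\<close>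

lemma F_mem_iff:
  assumes "I \<in> F"
  shows "p \<in> ii I \<longleftrightarrow> p \<in> carrier Q \<and> (\<forall>a \<in> I. a \<otimes> p \<in> s I)"
    "p \<in> ii I \<longleftrightarrow> p \<in> carrier Q \<and> (\<forall>a \<in> I. p \<otimes> a \<in> t I)"
    "p \<in> I \<longleftrightarrow> p \<in> carrier Q \<and> (\<forall>a \<in> ii I. p \<otimes> a \<in> s I)"
    "p \<in> I \<longleftrightarrow> p \<in> carrier Q \<and> (\<forall>a \<in> ii I. a \<otimes> p \<in> t I)"
proof -
  have 1: "p \<in> ii J \<longleftrightarrow> p \<in> carrier Q \<and> (\<forall>a \<in> J. a \<otimes> p \<in> s J)"
    "p \<in> ii J \<longleftrightarrow> p \<in> carrier Q \<and> (\<forall>a \<in> J. p \<otimes> a \<in> t J)" if "J \<in> F" for J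
    using ideal_inv_rres[OF F_carrier[OF that]] ideal_inv_lres[OF F_carrier[OF that]]
    by (auto simp: rres_def lres_def)
  note F = F_inv[OF assms]
  show "p \<in> ii I \<longleftrightarrow> p \<in> carrier Q \<and> (\<forall>a \<in> I. a \<otimes> p \<in> s I)"
    "p \<in> ii I \<longleftrightarrow> p \<in> carrier Q \<and> (\<forall>a \<in> I. p \<otimes> a \<in> t I)" using 1[OF assms] by auto
  show "p \<in> I \<longleftrightarrow> p \<in> carrier Q \<and> (\<forall>a \<in> ii I. p \<otimes> a \<in> s I)"
    "p \<in> I \<longleftrightarrow> p \<in> carrier Q \<and> (\<forall>a \<in> ii I. a \<otimes> p \<in> t I)" using 1[OF F(1)] F(2,3,4) by auto
qed

lemma F_cl: "I \<in> F \<Longrightarrow> cl (s I) I = I"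
  using closure_eq(2)[OF a_max] by (auto simp: F_iff divisorial_def)

lemma cl_least: "J \<in> F \<Longrightarrow> K \<subseteq> J \<Longrightarrow> cl (s J) K \<subseteq> J"
  using cl_mono F_cl by metis

lemma prod_fli:
  assumes I: "I \<in> F" and J: "J \<in> F" and c: "t I = s J"
  shows "frac_left_ideal Q (s I) (I <#> J)"
proof -
  note sI = a_order[OF F_srcI[OF I]]
  obtain x y where x: "x \<in> Units Q" "x \<in> I" and y: "y \<in> Units Q" "\<forall>a \<in> I. a \<otimes> y \<in> s I"
    using F_fli[OF I] by (auto simp: frac_left_ideal_iff)
  obtain x' y' where x': "x' \<in> Units Q" "x' \<in> J" and y': "y' \<in> Units Q" "\<forall>a \<in> J. a \<otimes> y' \<in> s J"
    using F_fli[OF J] by (auto simp: frac_left_ideal_iff)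
  note m = F_mem[OF I] F_mem[OF J] orderD(3)[OF sI]
  show ?thesis
    unfolding frac_left_ideal_iff
  proof (intro conjI ballI)
    show "I <#> J \<subseteq> carrier Q" using m by (auto simp: set_mult_def)
    fix q a assume q: "q \<in> s I" "a \<in> I <#> J"
    then obtain i j where "i \<in> I" "j \<in> J" "a = i \<otimes> j" by (auto simp: set_mult_def)
    then have "q \<otimes> a = (q \<otimes> i) \<otimes> j" "q \<otimes> i \<in> I" "j \<in> J"
      using q m src_mult[OF I] by (auto simp: m_assoc)
    then show "q \<otimes> a \<in> I <#> J" unfolding set_mult_def by blast
  next
    show "\<exists>x \<in> Units Q. x \<in> I <#> J"
      using x x' by (intro bexI[of _ "x \<otimes> x'"]) (auto simp: set_mult_def)
    have "i \<otimes> j \<otimes> (y' \<otimes> y) \<in> s I" if "i \<in> I" "j \<in> J" for i j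
    proof -
      have "i \<otimes> (j \<otimes> y') \<in> I" using tgt_mult[OF that(1), of "j \<otimes> y'"] y' c that by auto
      then have "i \<otimes> (j \<otimes> y') \<otimes> y \<in> s I" using y by blast
      then show ?thesis using that m y y' by (simp add: m_assoc)
    qed
    then show "\<exists>y \<in> Units Q. \<forall>a \<in> I <#> J. a \<otimes> y \<in> s I"
      using y y' by (intro bexI[of _ "y' \<otimes> y"]) (auto simp: set_mult_def)
  qed
qed

lemma vm_cl:
  assumes "I \<in> F" "J \<in> F" "t I = s J"
  shows "I \<cdot> J = cl (s I) (I <#> J)"
  unfolding vmult_def using closure_eq(2)[OF a_max[OF F_srcI[OF assms(1)]] prod_fli[OF assms]] .

text \<open>The closure is a left residual of a right residual: a right multiplier of
  \<open>K\<close> acts on the right residual from the left, and therefore on the closure from the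
  right.\<close>

lemma cl_tgt:
  assumes q: "q \<in> carrier Q" "\<And>k. k \<in> K \<Longrightarrow> k \<otimes> q \<in> K" and K: "K \<subseteq> carrier Q"
  shows "q \<in> t (cl e K)"
proof -
  have "p \<otimes> q \<in> cl e K" if p: "p \<in> cl e K" for p
  proof -
    have pc: "p \<in> carrier Q" using p by (simp add: cl_def lres_def)
    have "q \<otimes> r \<in> rres Q e K" if "r \<in> rres Q e K" for r
      using that q K by (auto simp: rres_def subset_iff m_assoc[symmetric])
    then have "p \<otimes> (q \<otimes> r) \<in> e" if "r \<in> rres Q e K" for r
      using that p by (auto simp: cl_def lres_def)
    then show ?thesis using pc q(1) by (auto simp: cl_def lres_def rres_def m_assoc)
  qed
  then show ?thesis using q(1) by (auto simp: tgt_rres rres_def)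
qed

text \<open>For the target only the inclusion of \<open>t J\<close> has to be shown, since both
  sides are maximal orders of one class.\<close>

lemma vm_F:
  assumes "I \<in> F" "J \<in> F" "t I = s J"
  shows "I \<cdot> J \<in> F" "s (I \<cdot> J) = s I" "t (I \<cdot> J) = t J"
proof -
  note f = FI[OF F_srcI[OF assms(1)] prod_fli[OF assms]]
  show 1: "I \<cdot> J \<in> F" "s (I \<cdot> J) = s I" using f vm_cl[OF assms] by auto
  show "t (I \<cdot> J) = t J"
  proof (rule max_eq[OF a_max[OF F_tgtI[OF assms(2)]]])
    show "submonoid (t (I \<cdot> J)) Q" using a_order[OF F_tgtI[OF 1(1)]] by (simp add: order_in_def)
    show "equivalent_orders Q (t J) (t (I \<cdot> J))" using a_equiv F_tgtI 1(1) assms(2) by blast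
    show "t J \<subseteq> t (I \<cdot> J)"
    proof
      fix q assume q: "q \<in> t J"
      have "k \<otimes> q \<in> I <#> J" if "k \<in> I <#> J" for k
        using that tgt_mult[OF _ q] F_mem[OF assms(1)] F_mem[OF assms(2)] q
        by (fastforce simp: set_mult_def tgt_rres rres_def m_assoc)
      then show "q \<in> t (I \<cdot> J)"
        unfolding vm_cl[OF assms] using q prod_fli[OF assms]
        by (intro cl_tgt) (auto simp: tgt_rres rres_def frac_left_ideal_iff)
    qed
  qed
qed

section \<open>The groupoid laws\<close>

lemma vm_mem:
  assumes "I \<in> F" "J \<in> F" "t I = s J" "a \<in> I" "b \<in> J"
  shows "a \<otimes> b \<in> I \<cdot> J"
proof -
  have "I <#> J \<subseteq> carrier Q" using prod_fli[OF assms(1-3)] by (simp add: frac_left_ideal_iff)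
  moreover have "a \<otimes> b \<in> I <#> J" using assms by (auto simp: set_mult_def)
  ultimately show ?thesis using cl_upper vm_cl[OF assms(1-3)] by blast
qed

lemma vm_least:
  assumes "I \<in> F" "J \<in> F" "t I = s J" "H \<in> F" "s H = s I" "\<And>a b. a \<in> I \<Longrightarrow> b \<in> J \<Longrightarrow> a \<otimes> b \<in> H"
  shows "I \<cdot> J \<subseteq> H"
proof -
  have "I <#> J \<subseteq> H" using assms(6) by (auto simp: set_mult_def)
  then show ?thesis using cl_least[OF assms(4)] vm_cl[OF assms(1-3)] assms(5) by simp
qed

text \<open>A set and its closure have the same right residual, so the inverse of a product is
  tested on elementary products alone. This is why identities between products are proved for their
  inverses.\<close>

lemma vm_inv_iff:
  assumes "I \<in> F" "J \<in> F" "t I = s J"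
  shows "p \<in> ii (I \<cdot> J) \<longleftrightarrow> p \<in> carrier Q \<and> (\<forall>a \<in> I. \<forall>b \<in> J. a \<otimes> b \<otimes> p \<in> s I)"
proof -
  have fl: "frac_left_ideal Q (s I) (cl (s I) (I <#> J))"
    using cl_fli[OF a_order[OF F_srcI[OF assms(1)]] prod_fli[OF assms]] .
  have "I <#> J \<subseteq> carrier Q" using prod_fli[OF assms] by (simp add: frac_left_ideal_iff)
  then have "ii (I \<cdot> J) = rres Q (s I) (I <#> J)"
    unfolding vm_cl[OF assms] closure_eq(1)[OF a_max[OF F_srcI[OF assms(1)]] fl] by (rule rres_cl)
  then show ?thesis by (auto simp: rres_def set_mult_def)
qed

lemma F_inv_inj: "I \<in> F \<Longrightarrow> J \<in> F \<Longrightarrow> ii I = ii J \<Longrightarrow> I = J"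
  using F_inv(4) by metis

text \<open>Both inverses consist of those \<open>p\<close> for which all products
  \<open>i j k p\<close> lie in \<open>s I\<close>.\<close>

lemma vm_assoc:
  assumes I: "I \<in> F" and J: "J \<in> F" and K: "K \<in> F" and c: "t I = s J" "t J = s K"
  shows "I \<cdot> J \<cdot> K = I \<cdot> (J \<cdot> K)"
proof (rule F_inv_inj)
  note IJ = vm_F[OF I J c(1)] and JK = vm_F[OF J K c(2)]
  have c': "t (I \<cdot> J) = s K" "t I = s (J \<cdot> K)" using IJ JK c by auto
  show "I \<cdot> J \<cdot> K \<in> F" "I \<cdot> (J \<cdot> K) \<in> F"
    using vm_F(1)[OF IJ(1) K c'(1)] vm_F(1)[OF I JK(1) c'(2)] .
  note m = F_mem[OF I] F_mem[OF J] F_mem[OF K]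
  have "p \<in> ii (I \<cdot> J \<cdot> K) \<longleftrightarrow> p \<in> ii (I \<cdot> (J \<cdot> K))" if p: "p \<in> carrier Q" for p
  proof -
    have "p \<in> ii (I \<cdot> J \<cdot> K) \<longleftrightarrow> (\<forall>k \<in> K. \<forall>x \<in> I \<cdot> J. x \<otimes> (k \<otimes> p) \<in> s I)"
      using vm_inv_iff[OF IJ(1) K c'(1), of p] p IJ(2) m F_mem[OF IJ(1)] by (auto simp: m_assoc)
    also have "\<dots> \<longleftrightarrow> (\<forall>k \<in> K. k \<otimes> p \<in> ii (I \<cdot> J))"
      using F_mem_iff(1)[OF IJ(1)] IJ(2) p m by auto
    also have "\<dots> \<longleftrightarrow> (\<forall>k \<in> K. \<forall>i \<in> I. \<forall>j \<in> J. i \<otimes> j \<otimes> (k \<otimes> p) \<in> s I)"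
      using vm_inv_iff[OF I J c(1)] p m by auto
    finally have 1: "p \<in> ii (I \<cdot> J \<cdot> K) \<longleftrightarrow> (\<forall>k \<in> K. \<forall>i \<in> I. \<forall>j \<in> J. i \<otimes> j \<otimes> (k \<otimes> p) \<in> s I)" .
    have "p \<in> ii (I \<cdot> (J \<cdot> K)) \<longleftrightarrow> (\<forall>x \<in> J \<cdot> K. \<forall>i \<in> I. i \<otimes> (x \<otimes> p) \<in> s I)"
      using vm_inv_iff[OF I JK(1) c'(2), of p] p m F_mem[OF JK(1)] by (auto simp: m_assoc)
    also have "\<dots> \<longleftrightarrow> (\<forall>x \<in> J \<cdot> K. x \<otimes> p \<in> ii I)"
      using F_mem_iff(1)[OF I] p F_mem[OF JK(1)] by auto
    \<comment> \<open>Moving the factor from \<open>I\<close> to the other side exchanges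
      \<open>s I\<close> for \<open>t I\<close>, the source of \<open>J \<cdot> K\<close>, so that
      the condition becomes one on the inverse of \<open>J \<cdot> K\<close>.\<close>
    also have "\<dots> \<longleftrightarrow> (\<forall>i \<in> I. \<forall>x \<in> J \<cdot> K. x \<otimes> (p \<otimes> i) \<in> s (J \<cdot> K))"
      using F_mem_iff(2)[OF I] p F_mem[OF JK(1)] m JK(2) c by (auto simp: m_assoc)
    also have "\<dots> \<longleftrightarrow> (\<forall>i \<in> I. p \<otimes> i \<in> ii (J \<cdot> K))"
      using F_mem_iff(1)[OF JK(1)] p m by auto
    also have "\<dots> \<longleftrightarrow> (\<forall>i \<in> I. \<forall>j \<in> J. \<forall>k \<in> K. j \<otimes> k \<otimes> (p \<otimes> i) \<in> t I)"
      using vm_inv_iff[OF J K c(2)] p m c by auto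
    also have "\<dots> \<longleftrightarrow> (\<forall>j \<in> J. \<forall>k \<in> K. j \<otimes> k \<otimes> p \<in> ii I)"
      using F_mem_iff(2)[OF I] p m by (auto simp: m_assoc)
    also have "\<dots> \<longleftrightarrow> (\<forall>j \<in> J. \<forall>k \<in> K. \<forall>i \<in> I. i \<otimes> (j \<otimes> k \<otimes> p) \<in> s I)"
      using F_mem_iff(1)[OF I] p m by auto
    finally have 2: "p \<in> ii (I \<cdot> (J \<cdot> K)) \<longleftrightarrow> (\<forall>j \<in> J. \<forall>k \<in> K. \<forall>i \<in> I. i \<otimes> (j \<otimes> k \<otimes> p) \<in> s I)" .
    show ?thesis unfolding 1 2 using p m by (auto simp: m_assoc)
  qed
  then show "ii (I \<cdot> J \<cdot> K) = ii (I \<cdot> (J \<cdot> K))" by (auto simp: ideal_inv_iff)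
qed

lemma alpha_F:
  assumes "e \<in> \<alpha>"
  shows "e \<in> F" "s e = e" "t e = e" "ii e = e"
proof -
  note fl = self_fli[OF a_order[OF assms]] and r = residual_self[OF a_order[OF assms]]
  have c: "cl e e = e" using r by (simp add: cl_def)
  show "e \<in> F" "s e = e" using FI[OF assms fl] c by auto
  show "t e = e" using r by (simp add: tgt_rres)
  show "ii e = e" using closure_eq(1)[OF a_max[OF assms] fl] r by simp
qed

lemma vm_unit_left:
  assumes "I \<in> F" shows "s I \<cdot> I = I"
proof
  note e = alpha_F[OF F_srcI[OF assms]]
  show "s I \<cdot> I \<subseteq> I" using vm_least[OF e(1) assms e(3) assms e(2)[symmetric]] src_mult[OF assms] by blast
  have "\<one> \<in> s I" using orderD(2)[OF a_order[OF F_srcI[OF assms]]] .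
  then show "I \<subseteq> s I \<cdot> I" using vm_mem[OF e(1) assms e(3), of \<one>] F_mem[OF assms] by fastforce
qed

lemma vm_unit_right:
  assumes "I \<in> F" shows "I \<cdot> t I = I"
proof
  note e = alpha_F[OF F_tgtI[OF assms]]
  show "I \<cdot> t I \<subseteq> I" using vm_least[OF assms e(1) e(2)[symmetric] assms HOL.refl] tgt_mult by blast
  have "\<one> \<in> t I" using orderD(2)[OF a_order[OF F_tgtI[OF assms]]] .
  then show "I \<subseteq> I \<cdot> t I" using vm_mem[OF assms e(1) e(2)[symmetric], of _ \<one>] F_mem[OF assms] by fastforce
qed

text \<open>The inverse of the product is the right order of \<open>ii I\<close>, which is the
  identity \<open>s I\<close>.\<close>

lemma vm_inv_right:
  assumes "I \<in> F" shows "I \<cdot> ii I = s I"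
proof (rule F_inv_inj)
  note v = F_inv[OF assms] and e = alpha_F[OF F_srcI[OF assms]]
  have c: "t I = s (ii I)" using v by simp
  show "I \<cdot> ii I \<in> F" "s I \<in> F" using vm_F(1)[OF assms v(1) c] e(1) .
  have "p \<in> ii (I \<cdot> ii I) \<longleftrightarrow> p \<in> t (ii I)" for p
  proof -
    have "p \<in> ii (I \<cdot> ii I) \<longleftrightarrow> p \<in> carrier Q \<and> (\<forall>b \<in> ii I. \<forall>a \<in> I. a \<otimes> (b \<otimes> p) \<in> s I)"
      using vm_inv_iff[OF assms v(1) c, of p] F_mem[OF assms] F_mem[OF v(1)] by (auto simp: m_assoc)
    also have "\<dots> \<longleftrightarrow> p \<in> carrier Q \<and> (\<forall>b \<in> ii I. b \<otimes> p \<in> ii I)"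
      using F_mem_iff(1)[OF assms] F_mem[OF v(1)] by auto
    finally show ?thesis by (simp add: tgt_rres rres_def)
  qed
  then have "ii (I \<cdot> ii I) = t (ii I)" by blast
  then show "ii (I \<cdot> ii I) = ii (s I)" using v(3) e(4) by simp
qed

lemma vm_inv_left:
  assumes "I \<in> F" shows "ii I \<cdot> I = t I"
  using vm_inv_right[OF F_inv(1)[OF assms]] F_inv[OF assms] by simp

lemma vm_mono:
  assumes "I \<in> F" "J \<in> F" "t I = s J" "I' \<in> F" "J' \<in> F" "t I' = s J'" "I \<subseteq> I'" "J \<subseteq> J'" "s I = s I'"
  shows "I \<cdot> J \<subseteq> I' \<cdot> J'"
  using assms vm_F(1,2)[OF assms(4-6)] by (intro vm_least vm_mem) auto

lemma vm_cancel_left: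
  assumes "I \<in> F" "J \<in> F"
  shows "t I = s J \<Longrightarrow> ii I \<cdot> (I \<cdot> J) = J" "s I = s J \<Longrightarrow> I \<cdot> (ii I \<cdot> J) = J"
proof -
  note v = F_inv[OF assms(1)]
  show "ii I \<cdot> (I \<cdot> J) = J" if "t I = s J"
    using vm_assoc[OF v(1) assms v(3) that] vm_inv_left[OF assms(1)] vm_unit_left[OF assms(2)] that by simp
  show "I \<cdot> (ii I \<cdot> J) = J" if "s I = s J"
    using vm_assoc[OF assms(1) v(1) assms(2)] v vm_inv_right[OF assms(1)] vm_unit_left[OF assms(2)] that by simp
qed

lemma vm_cancel_right:
  assumes "I \<in> F" "J \<in> F"
  shows "t J = s I \<Longrightarrow> (J \<cdot> I) \<cdot> ii I = J" "t J = t I \<Longrightarrow> (J \<cdot> ii I) \<cdot> I = J"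
proof -
  note v = F_inv[OF assms(1)]
  show "(J \<cdot> I) \<cdot> ii I = J" if "t J = s I"
    using vm_assoc[OF assms(2,1) v(1) that] v vm_inv_right[OF assms(1)] vm_unit_right[OF assms(2)] that by simp
  show "(J \<cdot> ii I) \<cdot> I = J" if "t J = t I"
    using vm_assoc[OF assms(2) v(1) assms(1)] v vm_inv_left[OF assms(1)] vm_unit_right[OF assms(2)] that by simp
qed

lemma vm_inverse:
  assumes "I \<in> F" "J \<in> F" "t I = s J"
  shows "ii (I \<cdot> J) = ii J \<cdot> ii I"
proof -
  note IJ = vm_F[OF assms] and vI = F_inv[OF assms(1)] and vJ = F_inv[OF assms(2)]
  have c: "t (ii J) = s (ii I)" using vI vJ assms by simp
  note JI = vm_F[OF vJ(1) vI(1) c]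
  have "(I \<cdot> J) \<cdot> (ii J \<cdot> ii I) = s I"
    using vm_assoc[OF assms(1,2) JI(1)] vm_cancel_left(2)[OF assms(2) vI(1)] vm_inv_right[OF assms(1)]
      JI vJ vI assms(3) by simp
  then have "ii (I \<cdot> J) \<cdot> ((I \<cdot> J) \<cdot> (ii J \<cdot> ii I)) = ii (I \<cdot> J)"
    using vm_unit_right[OF F_inv(1)[OF IJ(1)]] F_inv(3)[OF IJ(1)] IJ(2) by simp
  then show ?thesis using vm_cancel_left(1)[OF IJ(1) JI(1)] IJ JI vJ by simp
qed

end

section \<open>The modular lattice of divisorial left ideals\<close>

context quot_monoid
begin

lemma r_coset_mem:
  assumes w: "w \<in> Units Q" and A: "A \<subseteq> carrier Q"
  shows "x \<in> A #> w \<longleftrightarrow> x \<in> carrier Q \<and> x \<otimes> inv w \<in> A"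
proof
  assume "x \<in> A #> w"
  then obtain a where "a \<in> A" "x = a \<otimes> w" by (auto simp: r_coset_def)
  then show "x \<in> carrier Q \<and> x \<otimes> inv w \<in> A" using A w by (auto simp: m_assoc subset_iff)
next
  assume x: "x \<in> carrier Q \<and> x \<otimes> inv w \<in> A"
  then have "x = (x \<otimes> inv w) \<otimes> w" using w by (simp add: m_assoc)
  then show "x \<in> A #> w" using x unfolding r_coset_def by blast
qed

lemma l_coset_mem:
  assumes w: "w \<in> Units Q" and A: "A \<subseteq> carrier Q"
  shows "x \<in> w <# A \<longleftrightarrow> x \<in> carrier Q \<and> inv w \<otimes> x \<in> A"
proof
  assume "x \<in> w <# A"
  then obtain a where "a \<in> A" "x = w \<otimes> a" by (auto simp: l_coset_def)
  then show "x \<in> carrier Q \<and> inv w \<otimes> x \<in> A" using A w by (auto simp: subset_iff)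
next
  assume x: "x \<in> carrier Q \<and> inv w \<otimes> x \<in> A"
  then have "x = w \<otimes> (inv w \<otimes> x)" using w by simp
  then show "x \<in> w <# A" using x unfolding l_coset_def by blast
qed

lemma r_coset_mono: "A \<subseteq> B \<Longrightarrow> A #> w \<subseteq> B #> w"
  by (auto simp: r_coset_def)

lemma r_coset_mult: "a \<in> A \<Longrightarrow> a \<otimes> w \<in> A #> w"
  by (auto simp: r_coset_def)

lemma l_coset_mult: "a \<in> A \<Longrightarrow> w \<otimes> a \<in> w <# A"
  by (auto simp: l_coset_def)

lemma r_coset_closed: "w \<in> Units Q \<Longrightarrow> A \<subseteq> carrier Q \<Longrightarrow> A #> w \<subseteq> carrier Q"
  by (auto simp: r_coset_def)

lemma r_coset_assoc: "w \<in> carrier Q \<Longrightarrow> v \<in> carrier Q \<Longrightarrow> A \<subseteq> carrier Q \<Longrightarrow> (A #> w) #> v = A #> (w \<otimes> v)"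
  by (auto simp: r_coset_def m_assoc subset_iff)

lemma r_coset_one: "A \<subseteq> carrier Q \<Longrightarrow> A #> \<one> = A"
  by (auto simp: r_coset_def subset_iff)

lemma r_coset_mono_iff:
  assumes "w \<in> Units Q" "A \<subseteq> carrier Q" "A' \<subseteq> carrier Q"
  shows "A #> w \<subseteq> A' #> w \<longleftrightarrow> A \<subseteq> A'"
proof
  assume "A #> w \<subseteq> A' #> w"
  then have "(A #> w) #> inv w \<subseteq> (A' #> w) #> inv w" by (rule r_coset_mono)
  then show "A \<subseteq> A'" using assms by (simp add: r_coset_assoc r_coset_one)
qed (rule r_coset_mono)

lemma l_coset_inj:
  assumes "w \<in> Units Q" "A \<subseteq> carrier Q" "A' \<subseteq> carrier Q" "w <# A = w <# A'"
  shows "A = A'"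
proof -
  have "x \<in> A \<longleftrightarrow> x \<in> A'" if "x \<in> carrier Q" for x
    using l_coset_mem[OF assms(1,2), of "w \<otimes> x"] l_coset_mem[OF assms(1,3), of "w \<otimes> x"] that assms(1,4) by simp
  then show ?thesis using assms(2,3) by blast
qed

lemma ideal_inv_carrier: "ideal_inv Q I \<subseteq> carrier Q"
  by (auto simp: ideal_inv_iff)

lemma ideal_inv_r_coset:
  assumes w: "w \<in> Units Q" and I: "I \<subseteq> carrier Q"
  shows "ideal_inv Q (I #> w) = inv w <# ideal_inv Q I"
proof -
  have "q \<in> ideal_inv Q (I #> w) \<longleftrightarrow> w \<otimes> q \<in> ideal_inv Q I" if q: "q \<in> carrier Q" for q
  proof -
    have "a \<otimes> w \<otimes> q \<otimes> (b \<otimes> w) \<in> I #> w \<longleftrightarrow> a \<otimes> (w \<otimes> q) \<otimes> b \<in> I" if "a \<in> I" "b \<in> I" for a b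
      using that q w I by (auto simp: r_coset_mem m_assoc subset_iff)
    then show ?thesis using q w unfolding ideal_inv_iff by (auto simp: r_coset_def)
  qed
  then show ?thesis
    using l_coset_mem[of "inv w" "ideal_inv Q I"] w ideal_inv_carrier by auto
qed

lemma ideal_inv_l_coset:
  assumes w: "w \<in> Units Q" and I: "I \<subseteq> carrier Q"
  shows "ideal_inv Q (w <# I) = ideal_inv Q I #> inv w"
proof -
  have "q \<in> ideal_inv Q (w <# I) \<longleftrightarrow> q \<otimes> w \<in> ideal_inv Q I" if q: "q \<in> carrier Q" for q
  proof -
    have "w \<otimes> a \<otimes> q \<otimes> (w \<otimes> b) \<in> w <# I \<longleftrightarrow> a \<otimes> (q \<otimes> w) \<otimes> b \<in> I" if "a \<in> I" "b \<in> I" for a b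
      using that q w I by (auto simp: l_coset_mem m_assoc subset_iff)
    then show ?thesis using q w unfolding ideal_inv_iff by (auto simp: l_coset_def)
  qed
  then show ?thesis
    using r_coset_mem[of "inv w" "ideal_inv Q I"] w ideal_inv_carrier by auto
qed

lemma divisorial_r_coset:
  assumes "w \<in> Units Q" "I \<subseteq> carrier Q" "divisorial Q I"
  shows "divisorial Q (I #> w)"
  using assms ideal_inv_carrier[of I] ideal_inv_r_coset[of w I] ideal_inv_l_coset[of "inv w" "ideal_inv Q I"]
  by (simp add: divisorial_def div_closure_def)

lemma divisorial_l_coset:
  assumes "w \<in> Units Q" "I \<subseteq> carrier Q" "divisorial Q I"
  shows "divisorial Q (w <# I)"
  using assms ideal_inv_carrier[of I] ideal_inv_l_coset[of w I] ideal_inv_r_coset[of "inv w" "ideal_inv Q I"]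
  by (simp add: divisorial_def div_closure_def)

lemma fli_r_coset:
  assumes w: "w \<in> Units Q" and I: "frac_left_ideal Q e I" and e: "order_in Q e"
  shows "frac_left_ideal Q e (I #> w)"
proof -
  obtain x y where x: "x \<in> Units Q" "x \<in> I" and y: "y \<in> Units Q" "\<forall>a \<in> I. a \<otimes> y \<in> e"
    and Ic: "I \<subseteq> carrier Q" and l: "\<forall>s \<in> e. \<forall>a \<in> I. s \<otimes> a \<in> I"
    using I by (auto simp: frac_left_ideal_iff)
  show ?thesis unfolding frac_left_ideal_iff
  proof (intro conjI)
    show "I #> w \<subseteq> carrier Q" using r_coset_closed[OF w Ic] .
    show "\<forall>s \<in> e. \<forall>a \<in> I #> w. s \<otimes> a \<in> I #> w"
      using l Ic w orderD(3)[OF e] by (auto simp: r_coset_def subset_iff m_assoc[symmetric])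
    show "\<exists>x \<in> Units Q. x \<in> I #> w" using x w r_coset_mult by (intro bexI[of _ "x \<otimes> w"]) auto
    show "\<exists>y \<in> Units Q. \<forall>a \<in> I #> w. a \<otimes> y \<in> e"
      using y w Ic by (intro bexI[of _ "inv w \<otimes> y"]) (auto simp: r_coset_def subset_iff m_assoc)
  qed
qed

end

locale arith_order = order_class Q \<alpha> for Q (structure) and \<alpha> +
  fixes S :: "'a set"
  assumes S_in: "S \<in> \<alpha>"
    and acc_l: "ascending_chain_condition {I. left_order_ideal Q S I \<and> divisorial Q I}"
    and acc_r: "ascending_chain_condition {I. right_order_ideal Q S I \<and> divisorial Q I}"
    and modl: "modular_ideal_lattice Q {I. frac_left_ideal Q S I \<and> divisorial Q I}"
begin

definition L where "L = {I. frac_left_ideal Q S I \<and> divisorial Q I}"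
definition jn where "jn I J = div_closure Q (I \<union> J)"

lemmas S_max = a_max[OF S_in] and S_order = a_order[OF S_in] and S_F = alpha_F[OF S_in]
lemmas S_mem = orderD(3)[OF S_order] and S_one = orderD(2)[OF S_order]

lemma L_iff: "I \<in> L \<longleftrightarrow> I \<in> F \<and> s I = S"
proof
  assume "I \<in> L"
  then have I: "frac_left_ideal Q S I" "divisorial Q I" by (auto simp: L_def)
  then show "I \<in> F \<and> s I = S" using src_eq[OF S_max I(1)] S_in by (simp add: F_iff)
qed (auto simp: L_def F_iff)

lemma L_F: "I \<in> L \<Longrightarrow> I \<in> F" and L_s: "I \<in> L \<Longrightarrow> s I = S"
  by (auto simp: L_iff)

lemma S_L: "S \<in> L" using S_F by (simp add: L_iff)

lemma L_carrier: "I \<in> L \<Longrightarrow> I \<subseteq> carrier Q"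
  using F_carrier L_F by blast

section \<open>Lattice operations and chain conditions for fractional left ideals\<close>

lemma left_ore:
  assumes "x \<in> Units Q" "y \<in> Units Q"
  shows "\<exists>b \<in> S. \<exists>d \<in> S \<inter> Units Q. d \<otimes> y = b \<otimes> x"
proof -
  obtain b d where b: "b \<in> S" "d \<in> S \<inter> Units Q" "y \<otimes> inv x = inv d \<otimes> b"
    using orderD(6)[OF S_order, of "y \<otimes> inv x"] assms by auto
  have "d \<otimes> y = d \<otimes> (y \<otimes> inv x) \<otimes> x" using b(2) assms by (simp add: m_assoc)
  also have "\<dots> = b \<otimes> x" unfolding b(3) using b(1,2) S_mem by simp
  finally show ?thesis using b by blast
qed

lemma right_ore:
  assumes "x \<in> Units Q" "y \<in> Units Q"
  shows "\<exists>b \<in> S. \<exists>d \<in> S \<inter> Units Q. y \<otimes> d = x \<otimes> b"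
proof -
  obtain b d where b: "b \<in> S" "d \<in> S \<inter> Units Q" "inv x \<otimes> y = b \<otimes> inv d"
    using orderD(5)[OF S_order, of "inv x \<otimes> y"] assms by auto
  have "y \<otimes> d = x \<otimes> (inv x \<otimes> y) \<otimes> d" using b(2) assms by simp
  also have "\<dots> = x \<otimes> b" unfolding b(3) using b(1,2) S_mem assms by (simp add: m_assoc)
  finally show ?thesis using b by blast
qed

text \<open>The Ore condition supplies a common left multiple of a unit of \<open>I\<close> and a
  unit of \<open>J\<close>, that is, a unit in the intersection.\<close>

lemma Int_fli:
  assumes I: "frac_left_ideal Q S I" and J: "frac_left_ideal Q S J"
  shows "frac_left_ideal Q S (I \<inter> J)"
proof -
  obtain x where x: "x \<in> Units Q" "x \<in> I" using I by (auto simp: frac_left_ideal_iff)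
  obtain y where y: "y \<in> Units Q" "y \<in> J" using J by (auto simp: frac_left_ideal_iff)
  obtain b d where b: "b \<in> S" "d \<in> S \<inter> Units Q" "d \<otimes> y = b \<otimes> x" using left_ore[OF x(1) y(1)] by blast
  have "b \<otimes> x \<in> I" "d \<otimes> y \<in> J"
    using I J x y b(1,2) unfolding frac_left_ideal_iff by blast+
  then have "d \<otimes> y \<in> I" "d \<otimes> y \<in> J" "d \<otimes> y \<in> Units Q"
    using b(2) x y unfolding b(3)[symmetric] by auto
  then have "\<exists>x \<in> Units Q. x \<in> I \<inter> J" by blast
  then show ?thesis using I J unfolding frac_left_ideal_iff by blast
qed

lemma Un_fli:
  assumes I: "frac_left_ideal Q S I" and J: "frac_left_ideal Q S J"
  shows "frac_left_ideal Q S (I \<union> J)"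
proof -
  obtain x where x: "x \<in> Units Q" "\<forall>a \<in> I. a \<otimes> x \<in> S" using I by (auto simp: frac_left_ideal_iff)
  obtain y where y: "y \<in> Units Q" "\<forall>a \<in> J. a \<otimes> y \<in> S" using J by (auto simp: frac_left_ideal_iff)
  have c: "I \<subseteq> carrier Q" "J \<subseteq> carrier Q" using I J by (auto simp: frac_left_ideal_iff)
  obtain b d where b: "b \<in> S" "d \<in> S \<inter> Units Q" "y \<otimes> d = x \<otimes> b" using right_ore[OF x(1) y(1)] by blast
  have bc: "b \<in> carrier Q" "d \<in> carrier Q" using b by (auto simp: S_mem)
  have "a \<otimes> (y \<otimes> d) \<in> S" if "a \<in> I \<union> J" for a
  proof (cases "a \<in> I")
    case True
    then have ax: "a \<otimes> x \<in> S" "a \<in> carrier Q" using x c by auto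
    have "a \<otimes> (x \<otimes> b) = (a \<otimes> x) \<otimes> b" using ax x bc by (simp add: m_assoc)
    then show ?thesis using b orderD(4)[OF S_order ax(1) b(1)] by simp
  next
    case False
    then have ay: "a \<otimes> y \<in> S" "a \<in> carrier Q" using that y c by auto
    have "a \<otimes> (y \<otimes> d) = (a \<otimes> y) \<otimes> d" using ay y bc by (simp add: m_assoc)
    then show ?thesis using orderD(4)[OF S_order ay(1)] b(2) by simp
  qed
  moreover have "y \<otimes> d \<in> Units Q" using y(1) b(2) Units_m_closed by blast
  ultimately have 1: "\<exists>y \<in> Units Q. \<forall>a \<in> I \<union> J. a \<otimes> y \<in> S" by blast
  have 2: "\<exists>x \<in> Units Q. x \<in> I \<union> J" "\<forall>s \<in> S. \<forall>a \<in> I \<union> J. s \<otimes> a \<in> I \<union> J"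
    using I J by (auto simp: frac_left_ideal_iff)
  show ?thesis unfolding frac_left_ideal_iff using 1 2 c by simp
qed

lemma L_fli: "I \<in> L \<Longrightarrow> frac_left_ideal Q S I" by (simp add: L_def)

lemma L_unit: "I \<in> L \<Longrightarrow> \<exists>x \<in> Units Q. x \<in> I"
  by (simp add: L_def frac_left_ideal_iff)

lemma L_bound: "I \<in> L \<Longrightarrow> \<exists>y \<in> Units Q. \<forall>a \<in> I. a \<otimes> y \<in> S"
  by (simp add: L_def frac_left_ideal_iff)

lemma L_Int:
  assumes "I \<in> L" "J \<in> L" shows "I \<inter> J \<in> L"
proof -
  have fl: "frac_left_ideal Q S (I \<inter> J)" using Int_fli assms L_fli by blast
  have "cl S (I \<inter> J) \<subseteq> I \<inter> J"
    using cl_least[OF L_F[OF assms(1)], of "I \<inter> J"] cl_least[OF L_F[OF assms(2)], of "I \<inter> J"]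
      assms by (simp add: L_iff)
  then have "cl S (I \<inter> J) = I \<inter> J" using cl_upper[of "I \<inter> J" S] L_carrier assms by blast
  then show ?thesis using FI[OF S_in fl] by (simp add: L_iff)
qed

lemma jn_cl:
  assumes "I \<in> L" "J \<in> L" shows "jn I J = cl S (I \<union> J)"
  unfolding jn_def using closure_eq(2)[OF S_max Un_fli[OF L_fli L_fli]] assms by simp

lemma jn_L: assumes "I \<in> L" "J \<in> L" shows "jn I J \<in> L"
  unfolding jn_cl[OF assms] L_iff using FI[OF S_in Un_fli[OF L_fli L_fli]] assms by simp

lemma jn_ub: assumes "I \<in> L" "J \<in> L" shows "I \<union> J \<subseteq> jn I J"
  unfolding jn_cl[OF assms] using cl_upper[of "I \<union> J"] L_carrier[OF assms(1)] L_carrier[OF assms(2)] by simp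

lemma jn_lub: assumes "I \<in> L" "J \<in> L" "K \<in> L" "I \<subseteq> K" "J \<subseteq> K" shows "jn I J \<subseteq> K"
  unfolding jn_cl[OF assms(1,2)] using cl_least[OF L_F[OF assms(3)], of "I \<union> J"] L_s[OF assms(3)] assms(4,5)
  by simp

lemma r_coset_L: assumes "w \<in> Units Q" "I \<in> L" shows "I #> w \<in> L"
  using fli_r_coset[OF assms(1) L_fli[OF assms(2)] S_order]
    divisorial_r_coset[OF assms(1) L_carrier[OF assms(2)]] assms(2) by (simp add: L_def)

text \<open>Right translation by a unit carries everything below \<open>J\<close> into
  \<open>S\<close>, where the chain condition is assumed.\<close>

lemma acc_L: assumes J: "J \<in> L" shows "wf_on_top L J"
  unfolding wf_on_top_def wf_iff_no_infinite_down_chain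
proof
  assume "\<exists>f. \<forall>i. (f (Suc i), f i) \<in> {(K', K). K \<in> L \<and> K' \<in> L \<and> K \<subset> K' \<and> K' \<subseteq> J}"
  then obtain f where "\<forall>i. (f (Suc i), f i) \<in> {(K', K). K \<in> L \<and> K' \<in> L \<and> K \<subset> K' \<and> K' \<subseteq> J}" ..
  then have f: "\<And>i. f i \<in> L" "\<And>i. f i \<subset> f (Suc i)" "\<And>i. f (Suc i) \<subseteq> J" by simp_all
  obtain y where y: "y \<in> Units Q" "\<forall>a \<in> J. a \<otimes> y \<in> S"
    using L_bound[OF J] by blast
  define g where "g i = f i #> y" for i
  have "g i \<in> {I. left_order_ideal Q S I \<and> divisorial Q I}" for i
  proof -
    have "g i \<in> L" using r_coset_L[OF y(1) f(1)] by (simp add: g_def)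
    moreover have "f i \<subseteq> J" using f(2,3)[of i] by blast
    then have "g i \<subseteq> S" using y by (auto simp: g_def r_coset_def)
    ultimately show ?thesis by (auto simp: L_def left_order_ideal_def)
  qed
  moreover have "g i \<subseteq> g (Suc i)" for i
    using r_coset_mono[of "f i" "f (Suc i)" y] f(2)[of i] by (simp add: g_def less_imp_le)
  ultimately obtain m where "\<forall>n \<ge> m. g n = g m"
    using acc_l unfolding ascending_chain_condition_def by blast
  from this[rule_format, of "Suc m"] have "g (Suc m) \<subseteq> g m" by simp
  then have "f (Suc m) \<subseteq> f m" using r_coset_mono_iff[OF y(1) L_carrier[OF f(1)] L_carrier[OF f(1)]]
    by (simp add: g_def)
  then show False using f(2)[of m] by blast
qed

lemma inv_antimono: assumes "I \<in> L" "J \<in> L" "I \<subseteq> J" shows "ii J \<subseteq> ii I"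
  using F_mem_iff(1)[OF L_F[OF assms(1)]] F_mem_iff(1)[OF L_F[OF assms(2)]] L_s[OF assms(1)] L_s[OF assms(2)]
    assms(3) by (auto simp: subset_iff)

text \<open>Inversion reverses inclusions and exchanges left and right: a descending chain above
  \<open>I\<close>, inverted and multiplied by a unit \<open>x\<close> of \<open>I\<close>, is an
  ascending chain of divisorial right ideals of \<open>S\<close>.\<close>

lemma dcc_L: assumes I: "I \<in> L" shows "wf_on_bot L I"
  unfolding wf_on_bot_def wf_iff_no_infinite_down_chain
proof
  assume "\<exists>f. \<forall>i. (f (Suc i), f i) \<in> {(K, K'). K \<in> L \<and> K' \<in> L \<and> K \<subset> K' \<and> I \<subseteq> K}"
  then obtain f where "\<forall>i. (f (Suc i), f i) \<in> {(K, K'). K \<in> L \<and> K' \<in> L \<and> K \<subset> K' \<and> I \<subseteq> K}" ..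
  then have f: "\<And>i. f i \<in> L" "\<And>i. f (Suc i) \<subset> f i" "\<And>i. I \<subseteq> f (Suc i)" by simp_all
  obtain x where x: "x \<in> Units Q" "x \<in> I" using L_unit[OF I] by blast
  have xf: "x \<in> f i" for i using f(2,3)[of i] x by blast
  define g where "g i = x <# ii (f i)" for i
  have "g i \<in> {I. right_order_ideal Q S I \<and> divisorial Q I}" for i
  proof -
    note v = F_inv[OF L_F[OF f(1)[of i]]]
    have vS: "t (ii (f i)) = S" using v L_s[OF f(1)] by simp
    have c: "ii (f i) \<subseteq> carrier Q" using F_carrier[OF v(1)] .
    have "divisorial Q (ii (f i))" using v(1) by (simp add: F_iff)
    then have d: "divisorial Q (g i)" using divisorial_l_coset[OF x(1) c] by (simp add: g_def)
    have sub: "g i \<subseteq> S"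
      using F_mem_iff(1)[OF L_F[OF f(1)[of i]]] xf L_s[OF f(1)[of i]] by (auto simp: g_def l_coset_def)
    have "frac_right_ideal Q S (g i)"
      unfolding frac_right_ideal_iff
    proof (intro conjI)
      show "g i \<subseteq> carrier Q" using sub S_mem by auto
      show "\<forall>s \<in> S. \<forall>a \<in> g i. a \<otimes> s \<in> g i"
      proof (intro ballI)
        fix q a assume q: "q \<in> S" "a \<in> g i"
        then obtain p where p: "p \<in> ii (f i)" "a = x \<otimes> p" by (auto simp: g_def l_coset_def)
        have "p \<otimes> q \<in> ii (f i)" using tgt_mult[OF p(1)] vS q by simp
        moreover have "a \<otimes> q = x \<otimes> (p \<otimes> q)" using p c x q S_mem by (auto simp: m_assoc)
        ultimately show "a \<otimes> q \<in> g i" unfolding g_def using l_coset_mult by simp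
      qed
      obtain y where "y \<in> Units Q" "y \<in> ii (f i)" using F_unit[OF v(1)] by auto
      then show "\<exists>y \<in> Units Q. y \<in> g i"
        using x l_coset_mult[of y "ii (f i)" x] by (intro bexI[of _ "x \<otimes> y"]) (auto simp: g_def)
      show "\<exists>y \<in> Units Q. \<forall>a \<in> g i. y \<otimes> a \<in> S" using sub S_mem by (intro bexI[of _ \<one>]) auto
    qed
    then show ?thesis using d sub by (simp add: right_order_ideal_def)
  qed
  moreover have "g i \<subseteq> g (Suc i)" for i
    using inv_antimono[OF f(1) f(1), of "Suc i" i] f(2)[of i] by (auto simp: g_def l_coset_def)
  ultimately obtain m where "\<forall>n \<ge> m. g n = g m"
    using acc_r unfolding ascending_chain_condition_def by blast
  from this[rule_format, of "Suc m"] have "x <# ii (f (Suc m)) = x <# ii (f m)" by (simp add: g_def)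
  then have "ii (f (Suc m)) = ii (f m)" using l_coset_inj[OF x(1) ideal_inv_carrier ideal_inv_carrier] by blast
  then have "f (Suc m) = f m" using F_inv_inj[OF L_F[OF f(1)] L_F[OF f(1)]] by simp
  then show False using f(2)[of m] by blast
qed

sublocale modular_lattice L jn
proof
  fix I J K assume "I \<in> L" "J \<in> L" "K \<in> L" "I \<subseteq> K"
  then show "jn I J \<inter> K \<subseteq> jn I (J \<inter> K)"
    using modl unfolding modular_ideal_lattice_def L_def[symmetric] jn_def by simp
qed (use L_Int jn_L jn_ub jn_lub acc_L dcc_L in auto)

end

section \<open>Two-sided ideals acting on the lattice\<close>

lemma (in group) comm_quotients:
  assumes c: "x \<in> carrier G" "a \<in> carrier G" "b \<in> carrier G"
    and ab: "x \<otimes> a = a \<otimes> x" "x \<otimes> b = b \<otimes> x"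
  shows "x \<otimes> (a \<otimes> inv b) = (a \<otimes> inv b) \<otimes> x"
proof -
  have "inv b \<otimes> (b \<otimes> x) \<otimes> inv b = x \<otimes> inv b" using c by (simp add: m_assoc[symmetric])
  moreover have "inv b \<otimes> (x \<otimes> b) \<otimes> inv b = inv b \<otimes> x" using c by (simp add: m_assoc)
  ultimately have "x \<otimes> inv b = inv b \<otimes> x" using ab(2) by simp
  then have "a \<otimes> (x \<otimes> inv b) = a \<otimes> (inv b \<otimes> x)" by simp
  then show ?thesis using c ab(1) by (simp add: m_assoc[symmetric])
qed

context arith_order
begin

definition V where "V = {A \<in> F. s A = S \<and> t A = S}"

text \<open>For a cover \<open>I \<subset> J\<close>, the residual \<open>X I J\<close> is the transport to \<open>S\<close> of the largest two-sided
  ideal contained in the maximal integral element \<open>J\<^sup>-\<^sup>1I\<close>, so it determines the norm of that element.\<close>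

definition X where "X I J = lres Q I J"

section \<open>Two-sided ideals acting on left ideals, and the residuals of covers\<close>

lemma V_F: "A \<in> V \<Longrightarrow> A \<in> F" and V_s: "A \<in> V \<Longrightarrow> s A = S" and V_t: "A \<in> V \<Longrightarrow> t A = S"
  by (auto simp: V_def)

lemma V_L: "A \<in> V \<Longrightarrow> A \<in> L" by (simp add: V_def L_iff)

lemma S_V: "S \<in> V" using S_F by (simp add: V_def)

lemma V_mult:
  assumes "A \<in> V" "B \<in> V" shows "A \<cdot> B \<in> V"
  using vm_F[OF V_F[OF assms(1)] V_F[OF assms(2)]] assms by (simp add: V_def)

lemma V_inv: assumes "A \<in> V" shows "ii A \<in> V"
  using F_inv[OF V_F[OF assms]] assms by (simp add: V_def)

lemma V_one: assumes "A \<in> V" shows "S \<cdot> A = A" "A \<cdot> S = A"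
  using vm_unit_left[OF V_F[OF assms]] vm_unit_right[OF V_F[OF assms]] assms by (simp_all add: V_def)

lemma VL_mult: assumes "A \<in> V" "J \<in> L" shows "A \<cdot> J \<in> L" "t (A \<cdot> J) = t J"
  using vm_F[OF V_F[OF assms(1)] L_F[OF assms(2)]] assms by (simp_all add: V_def L_iff)

lemma VL_assoc: assumes "A \<in> V" "B \<in> V" "J \<in> L" shows "A \<cdot> B \<cdot> J = A \<cdot> (B \<cdot> J)"
  using vm_assoc[OF V_F[OF assms(1)] V_F[OF assms(2)] L_F[OF assms(3)]] assms by (simp add: V_def L_iff)

lemma VL_one: assumes "J \<in> L" shows "S \<cdot> J = J"
  using vm_unit_left[OF L_F[OF assms]] L_s[OF assms] by simp

lemma VL_mono:
  assumes "A \<in> V" "A' \<in> V" "J \<in> L" "J' \<in> L" "A \<subseteq> A'" "J \<subseteq> J'"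
  shows "A \<cdot> J \<subseteq> A' \<cdot> J'"
  using vm_mono[OF V_F[OF assms(1)] L_F[OF assms(3)] _ V_F[OF assms(2)] L_F[OF assms(4)] _ assms(5,6)] assms
  by (simp add: V_def L_iff)

lemma VL_cancel:
  assumes "A \<in> V" "J \<in> L" shows "ii A \<cdot> (A \<cdot> J) = J" "A \<cdot> (ii A \<cdot> J) = J"
  using vm_cancel_left[OF V_F[OF assms(1)] L_F[OF assms(2)]] assms by (simp_all add: V_def L_iff)

lemma V_inv_mult: assumes "A \<in> V" shows "A \<cdot> ii A = S" "ii A \<cdot> A = S"
  using vm_inv_right[OF V_F[OF assms]] vm_inv_left[OF V_F[OF assms]] assms by (simp_all add: V_def)

lemma VL_sub:
  assumes "A \<in> V" "J \<in> L" "A \<subseteq> S" shows "A \<cdot> J \<subseteq> J"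
  using VL_mono[OF assms(1) S_V assms(2) assms(2) assms(3) order_refl] VL_one[OF assms(2)] by simp

text \<open>The adjunction between the action of \<open>V\<close> and the residual. As
  \<open>I\<close> is divisorial, a product ideal lies in \<open>I\<close> as soon as all elementary
  products do.\<close>

lemma VL_le_iff:
  assumes "A \<in> V" "J \<in> L" "I \<in> L" shows "A \<cdot> J \<subseteq> I \<longleftrightarrow> A \<subseteq> X I J"
proof
  assume "A \<cdot> J \<subseteq> I"
  then show "A \<subseteq> X I J"
    using vm_mem[OF V_F[OF assms(1)] L_F[OF assms(2)]] assms F_mem[OF V_F[OF assms(1)]]
    by (auto simp: X_def lres_def V_def L_iff)
next
  assume "A \<subseteq> X I J"
  then show "A \<cdot> J \<subseteq> I"
    using vm_least[OF V_F[OF assms(1)] L_F[OF assms(2)] _ L_F[OF assms(3)]] assms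
    by (auto simp: X_def lres_def V_def L_iff)
qed

lemma V_I:
  assumes "A \<in> L" "\<And>a q. a \<in> A \<Longrightarrow> q \<in> S \<Longrightarrow> a \<otimes> q \<in> A" shows "A \<in> V"
proof -
  have "t A = S"
  proof (rule max_eq[OF S_max])
    show "submonoid (t A) Q" using a_order[OF F_tgtI[OF L_F[OF assms(1)]]] by (simp add: order_in_def)
    show "equivalent_orders Q S (t A)" using a_equiv[OF S_in F_tgtI[OF L_F[OF assms(1)]]] .
    show "S \<subseteq> t A" using assms(2) S_mem by (auto simp: tgt_rres rres_def)
  qed
  then show ?thesis using assms(1) by (simp add: V_def L_iff)
qed

lemma V_Int: assumes "A \<in> V" "B \<in> V" shows "A \<inter> B \<in> V"
proof (rule V_I)
  show "A \<inter> B \<in> L" using int_closed[OF V_L[OF assms(1)] V_L[OF assms(2)]] .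
  fix a q assume a: "a \<in> A \<inter> B" and q: "q \<in> S"
  then show "a \<otimes> q \<in> A \<inter> B"
    using tgt_mult[of a A q] tgt_mult[of a B q] V_t[OF assms(1)] V_t[OF assms(2)] by simp
qed

lemma V_jn: assumes "A \<in> V" "B \<in> V" shows "jn A B \<in> V"
proof (rule V_I)
  show "jn A B \<in> L" using jn_closed V_L assms by blast
  fix a q assume a: "a \<in> jn A B" and q: "q \<in> S"
  have "q \<in> t (cl S (A \<union> B))"
  proof (rule cl_tgt)
    show "q \<in> carrier Q" using S_mem[OF q] .
    show "k \<otimes> q \<in> A \<union> B" if "k \<in> A \<union> B" for k
      using that q tgt_mult[of k A q] tgt_mult[of k B q] V_t[OF assms(1)] V_t[OF assms(2)] by auto
    show "A \<union> B \<subseteq> carrier Q" using F_carrier[OF V_F[OF assms(1)]] F_carrier[OF V_F[OF assms(2)]] by simp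
  qed
  then show "a \<otimes> q \<in> jn A B" using tgt_mult[of a "jn A B" q] a jn_cl[OF V_L[OF assms(1)] V_L[OF assms(2)]] by simp
qed

text \<open>Boundedness supplies a unit in the residual. It is divisorial because \<open>I\<close>
  is: membership in \<open>I\<close> can be tested on \<open>ii I\<close>.\<close>

lemma X_V:
  assumes I: "I \<in> L" and J: "J \<in> L" shows "X I J \<in> V"
proof -
  obtain z where z: "z \<in> Units Q" "z \<in> I" using L_unit[OF I] by blast
  obtain w where w: "w \<in> Units Q" "\<forall>a \<in> I. a \<otimes> w \<in> S" using L_bound[OF I] by blast
  obtain j where j: "j \<in> Units Q" "j \<in> J" using L_unit[OF J] by blast
  obtain y where y: "y \<in> Units Q" "\<forall>a \<in> J. a \<otimes> y \<in> S" using L_bound[OF J] by blast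
  note m = F_mem[OF L_F[OF I]] F_mem[OF L_F[OF J]]
  have Imul: "q \<otimes> a \<in> I" if "q \<in> S" "a \<in> I" for q a using src_mult[OF L_F[OF I]] L_s[OF I] that by simp
  have Jmul: "q \<otimes> a \<in> J" if "q \<in> S" "a \<in> J" for q a using src_mult[OF L_F[OF J]] L_s[OF J] that by simp
  \<comment> \<open>Since \<open>J y \<subseteq> S\<close> and \<open>S z \<subseteq> I\<close>, a
    unit \<open>c\<close> with \<open>c S y\<^sup>-\<^sup>1 z\<^sup>-\<^sup>1 \<subseteq> S\<close>
    carries \<open>J\<close> into \<open>I\<close>.\<close>
  obtain c where c: "c \<in> Units Q" "\<forall>q \<in> S. c \<otimes> q \<otimes> (inv y \<otimes> inv z) \<in> S"
    using a_bdd[OF S_in, unfolded unit_bounded_def, rule_format, of "inv y \<otimes> inv z"] y(1) z(1) by auto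
  have cX: "c \<in> X I J"
  proof -
    have "c \<otimes> a \<in> I" if a: "a \<in> J" for a
    proof -
      have "c \<otimes> (a \<otimes> y) \<otimes> (inv y \<otimes> inv z) \<in> S" using c(2) y(2) a by blast
      then have "c \<otimes> (a \<otimes> y) \<otimes> (inv y \<otimes> inv z) \<otimes> z \<in> I" using Imul z by blast
      then show ?thesis using a m c(1) y(1) z(1) by (simp add: m_assoc)
    qed
    then show ?thesis using c(1) by (simp add: X_def lres_def)
  qed
  have left: "q \<otimes> a \<in> X I J" if "q \<in> S" "a \<in> X I J" for q a
    using that Imul m S_mem by (auto simp: X_def lres_def m_assoc)
  have right: "a \<otimes> q \<in> X I J" if "q \<in> S" "a \<in> X I J" for q a
    using that Jmul m S_mem by (auto simp: X_def lres_def m_assoc)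
  have bd: "a \<otimes> (j \<otimes> w) \<in> S" if "a \<in> X I J" for a
  proof -
    have "a \<in> carrier Q" "a \<otimes> j \<in> I" using that j by (auto simp: X_def lres_def)
    then show ?thesis using w j by (simp add: m_assoc[symmetric])
  qed
  have fl: "frac_left_ideal Q S (X I J)"
    unfolding frac_left_ideal_iff
  proof (intro conjI)
    show "X I J \<subseteq> carrier Q" by (auto simp: X_def lres_def)
    show "\<exists>x \<in> Units Q. x \<in> X I J" using c(1) cX by blast
    show "\<exists>y \<in> Units Q. \<forall>a \<in> X I J. a \<otimes> y \<in> S" using bd j(1) w(1) Units_m_closed by blast
  qed (use left in auto)
  have "q \<in> X I J" if q: "q \<in> cl S (X I J)" for q
  proof -
    have qc: "q \<in> carrier Q" using q by (simp add: cl_def lres_def)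
    have "q \<otimes> a \<in> I" if a: "a \<in> J" for a
    proof -
      have "q \<otimes> a \<otimes> p \<in> S" if p: "p \<in> ii I" for p
      proof -
        have pc: "p \<in> carrier Q" using p by (simp add: ideal_inv_iff)
        have "a \<otimes> p \<in> rres Q S (X I J)"
        proof -
          have "x \<otimes> (a \<otimes> p) \<in> S" if x: "x \<in> X I J" for x
          proof -
            have "x \<otimes> a \<in> I" "x \<in> carrier Q" using x a by (auto simp: X_def lres_def)
            then have "x \<otimes> a \<otimes> p \<in> S" using F_mem_iff(1)[OF L_F[OF I]] p L_s[OF I] by auto
            then show ?thesis using x pc m a by (auto simp: X_def lres_def m_assoc)
          qed
          then show ?thesis using pc m a by (simp add: rres_def)
        qed
        then have "q \<otimes> (a \<otimes> p) \<in> S" using q by (auto simp: cl_def lres_def)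
        then show ?thesis using qc pc m a by (simp add: m_assoc)
      qed
      then show ?thesis using F_mem_iff(3)[OF L_F[OF I]] L_s[OF I] qc m a by auto
    qed
    then show ?thesis using qc by (simp add: X_def lres_def)
  qed
  then have "cl S (X I J) = X I J" using cl_upper[of "X I J" S] fl by (auto simp: frac_left_ideal_iff)
  then have "X I J \<in> L" using FI[OF S_in fl] by (simp add: L_iff)
  then show ?thesis by (rule V_I) (rule right)
qed

lemma X_sub:
  assumes "I \<in> L" "J \<in> L" "I \<subseteq> J" shows "X I J \<subseteq> S"
  using L_s[OF assms(2)] assms(3) by (auto simp: X_def lres_def src_lres)

lemma X_mult:
  assumes "I \<in> L" "J \<in> L" shows "X I J \<cdot> J \<subseteq> I"
  using VL_le_iff[OF X_V[OF assms] assms(2,1)] by simp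

text \<open>Multiplication by \<open>A\<close> is monotone and invertible, so the bound can be
  tested after applying \<open>ii A\<close>.\<close>

lemma VL_jn:
  assumes A: "A \<in> V" and L: "I \<in> L" "H \<in> L" "K \<in> L" and s: "A \<cdot> I \<subseteq> K" "A \<cdot> H \<subseteq> K"
  shows "A \<cdot> jn I H \<subseteq> K"
proof -
  note v = V_inv[OF A] and K = VL_mult(1)[OF V_inv[OF A] L(3)]
  have "M \<subseteq> ii A \<cdot> K" if "M \<in> L" "A \<cdot> M \<subseteq> K" for M
    using VL_mono[OF v v VL_mult(1)[OF A that(1)] L(3) order_refl that(2)] VL_cancel(1)[OF A that(1)] by simp
  then have "jn I H \<subseteq> ii A \<cdot> K" using jn_least[OF L(1,2) K] L s by blast
  then have "A \<cdot> jn I H \<subseteq> A \<cdot> (ii A \<cdot> K)"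
    using VL_mono[OF A A jn_closed[OF L(1,2)] K order_refl] by simp
  then show ?thesis using VL_cancel(2)[OF A L(3)] by simp
qed

text \<open>An integral two-sided ideal maps \<open>I\<close> into \<open>I\<close> and
  \<open>H\<close> into \<open>H\<close>. So it maps the join into \<open>I\<close> as soon as it
  maps \<open>H\<close> into \<open>I\<close>, and conversely it then maps \<open>H\<close> into
  both.\<close>

lemma X_persp:
  assumes L: "I \<in> L" "H \<in> L" and j: "jn I H = J"
  shows "X (I \<inter> H) H = X I J"
proof
  have J: "J \<in> L" "I \<subseteq> J" "H \<subseteq> J" using jn_closed[OF L] jn_upper1[OF L] jn_upper2[OF L] j by auto
  have IH: "I \<inter> H \<in> L" using int_closed L by blast
  show "X I J \<subseteq> X (I \<inter> H) H"
    using X_sub[OF L(1) J(1,2)] J src_mult[OF L_F[OF L(2)]] L_s[OF L(2)] by (auto simp: X_def lres_def)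
  let ?A = "X (I \<inter> H) H"
  have A: "?A \<in> V" "?A \<subseteq> S" using X_V[OF IH L(2)] X_sub[OF IH L(2)] by auto
  have "?A \<cdot> H \<subseteq> I" using X_mult[OF IH L(2)] by auto
  then have "?A \<cdot> J \<subseteq> I" using VL_jn[OF A(1) L L(1) VL_sub[OF A(1) L(1) A(2)]] j by simp
  then show "?A \<subseteq> X I J" using VL_le_iff[OF A(1) J(1) L(1)] by simp
qed

lemma covD:
  assumes "cov L I J"
  shows "I \<in> L" "J \<in> L" "I \<subseteq> J" "I \<noteq> J" "K \<in> L \<Longrightarrow> I \<subseteq> K \<Longrightarrow> K \<subseteq> J \<Longrightarrow> K = I \<or> K = J"
  using assms by (auto simp: cov_def)

text \<open>If \<open>A\<close> exceeds the residual, then \<open>I\<close> and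
  \<open>A \<cdot> J\<close> join to \<open>J\<close>. Were the same true of the cofactor
  \<open>?Z\<close>, multiplying that join by \<open>A\<close> would put \<open>A \<cdot> J\<close>
  into \<open>I\<close>. So \<open>?Z\<close> lies in the residual, that is, \<open>ii A\<close> is
  integral, and \<open>A\<close> is \<open>S\<close>.\<close>

lemma X_maximal:
  assumes c: "cov L I J" and A: "A \<in> V" "X I J \<subseteq> A" "A \<subseteq> S"
  shows "A = X I J \<or> A = S"
proof -
  note I = covD[OF c]
  have AJ: "A \<cdot> J \<in> L" "A \<cdot> J \<subseteq> J" using VL_mult(1)[OF A(1) I(2)] VL_sub[OF A(1) I(2) A(3)] .
  have jL: "jn I (A \<cdot> J) \<in> L" "I \<subseteq> jn I (A \<cdot> J)" "A \<cdot> J \<subseteq> jn I (A \<cdot> J)"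
    using jn_closed[OF I(1) AJ(1)] jn_upper1[OF I(1) AJ(1)] jn_upper2[OF I(1) AJ(1)] .
  consider "jn I (A \<cdot> J) = I" | "jn I (A \<cdot> J) = J"
    using I(5)[OF jL(1,2) jn_least[OF I(1) AJ(1) I(2,3) AJ(2)]] by blast
  then show ?thesis
  proof cases
    case 1
    then have "A \<subseteq> X I J" using jL(3) VL_le_iff[OF A(1) I(2,1)] by simp
    then show ?thesis using A(2) by blast
  next
    case 2
    have XV: "X I J \<in> V" using X_V[OF I(1,2)] .
    let ?Z = "ii A \<cdot> X I J"
    have Z: "?Z \<in> V" using V_mult[OF V_inv[OF A(1)] XV] .
    have ZS: "?Z \<subseteq> S"
      using VL_mono[OF V_inv[OF A(1)] V_inv[OF A(1)] V_L[OF XV] V_L[OF A(1)] order_refl A(2)]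
        V_inv_mult(2)[OF A(1)] by simp
    have ZJ: "?Z \<cdot> J \<in> L" "?Z \<cdot> J \<subseteq> J" using VL_mult(1)[OF Z I(2)] VL_sub[OF Z I(2) ZS] .
    have jL': "jn I (?Z \<cdot> J) \<in> L" "I \<subseteq> jn I (?Z \<cdot> J)" "?Z \<cdot> J \<subseteq> jn I (?Z \<cdot> J)"
      using jn_closed[OF I(1) ZJ(1)] jn_upper1[OF I(1) ZJ(1)] jn_upper2[OF I(1) ZJ(1)] .
    consider "jn I (?Z \<cdot> J) = I" | "jn I (?Z \<cdot> J) = J"
      using I(5)[OF jL'(1,2) jn_least[OF I(1) ZJ(1) I(2,3) ZJ(2)]] by blast
    then show ?thesis
    proof cases
      case 1
      then have "?Z \<subseteq> X I J" using jL'(3) VL_le_iff[OF Z I(2,1)] by simp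
      then have "?Z \<cdot> ii (X I J) \<subseteq> X I J \<cdot> ii (X I J)"
        using VL_mono[OF Z XV V_L[OF V_inv[OF XV]] V_L[OF V_inv[OF XV]] _ order_refl] by blast
      moreover have "?Z \<cdot> ii (X I J) = ii A"
        using VL_assoc[OF V_inv[OF A(1)] XV V_L[OF V_inv[OF XV]]] V_inv_mult(1)[OF XV]
          V_one(2)[OF V_inv[OF A(1)]] by simp
      ultimately have "ii A \<subseteq> S" using V_inv_mult(1)[OF XV] by simp
      then have "A \<cdot> ii A \<subseteq> A \<cdot> S"
        using VL_mono[OF A(1) A(1) V_L[OF V_inv[OF A(1)]] S_L order_refl] by simp
      then show ?thesis using V_inv_mult(1)[OF A(1)] V_one(2)[OF A(1)] A(3) by simp
    next
      case 2
      have "A \<cdot> (?Z \<cdot> J) = X I J \<cdot> J"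
        using VL_assoc[OF A(1) Z I(2)] VL_cancel(2)[OF A(1) V_L[OF XV]] by simp
      then have "A \<cdot> jn I (?Z \<cdot> J) \<subseteq> I"
        using VL_jn[OF A(1) I(1) ZJ(1) I(1) VL_sub[OF A(1) I(1) A(3)]] X_mult[OF I(1,2)] by simp
      then have "A \<cdot> J \<subseteq> I" using 2 by simp
      then have "jn I (A \<cdot> J) = I" using jn_absorb[OF I(1) AJ(1)] by simp
      then show ?thesis using \<open>jn I (A \<cdot> J) = J\<close> I(4) by simp
    qed
  qed
qed

text \<open>The new intermediate ideal is the join of \<open>I\<close> with
  \<open>X I J \<cdot> K\<close>. Maximality of the residual keeps it from lying in
  \<open>J\<close>, modularity keeps it strictly below \<open>K\<close>, and the residuals follow
  from perspectivity.\<close>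

lemma X_swap:
  assumes c: "cov L I J" and c': "cov L J K" and ne: "X I J \<noteq> X J K"
  shows "\<exists>W. cov L I W \<and> cov L W K \<and> X I W = X J K \<and> X W K = X I J"
proof -
  note I = covD[OF c] and J = covD[OF c']
  let ?A = "X I J"
  have A: "?A \<in> V" "?A \<subseteq> S" using X_V[OF I(1,2)] X_sub[OF I(1,2,3)] .
  define N where "N = ?A \<cdot> K"
  have N: "N \<in> L" "N \<subseteq> K" unfolding N_def using VL_mult(1)[OF A(1) J(2)] VL_sub[OF A(1) J(2) A(2)] .
  have NJ: "\<not> N \<subseteq> J"
  proof
    assume "N \<subseteq> J"
    then have "?A \<subseteq> X J K" using VL_le_iff[OF A(1) J(2,1)] by (simp add: N_def)
    then have "X J K = S"
      using X_maximal[OF c X_V[OF J(1,2)] _ X_sub[OF J(1,2,3)]] ne by auto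
    then have "S \<cdot> K \<subseteq> J" using X_mult[OF J(1,2)] by simp
    then show False using VL_one[OF J(2)] J(3,4) by auto
  qed
  define W where "W = jn I N"
  have W: "W \<in> L" "I \<subseteq> W" "N \<subseteq> W" "W \<subseteq> K"
    unfolding W_def using jn_closed[OF I(1) N(1)] jn_upper1[OF I(1) N(1)] jn_upper2[OF I(1) N(1)]
      jn_least[OF I(1) N(1) J(2) _ N(2)] I(3) J(3) by auto
  have WK: "W \<noteq> K"
  proof
    assume e: "W = K"
    \<comment> \<open>Dividing by \<open>?A\<close> moves \<open>?M\<close> into the cover from
      \<open>J\<close> to \<open>K\<close>, so \<open>?M\<close> is \<open>?A \<cdot> K\<close> or
      \<open>?A \<cdot> J\<close>. The first puts \<open>N\<close> into \<open>J\<close>; the second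
      puts \<open>?M\<close> into \<open>I\<close>, and by modularity \<open>J\<close> as
      well.\<close>
    let ?M = "N \<inter> J"
    have M: "?M \<in> L" using int_closed[OF N(1) J(1)] .
    have AJ: "?A \<cdot> J \<in> L" "?A \<cdot> J \<subseteq> ?M"
      using VL_mult(1)[OF A(1) J(1)] VL_mono[OF A(1) A(1) J(1,2) order_refl J(3)] VL_sub[OF A(1) J(1) A(2)]
      by (auto simp: N_def)
    note v = V_inv[OF A(1)]
    let ?M' = "ii ?A \<cdot> ?M"
    have M': "?M' \<in> L" "?A \<cdot> ?M' = ?M" using VL_mult(1)[OF v M] VL_cancel(2)[OF A(1) M] .
    have "J \<subseteq> ?M'"
      using VL_mono[OF v v AJ(1) M order_refl AJ(2)] VL_cancel(1)[OF A(1) J(1)] by simp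
    moreover have "?M' \<subseteq> K"
      using VL_mono[OF v v M N(1) order_refl Int_lower1] VL_cancel(1)[OF A(1) J(2)] by (simp add: N_def)
    ultimately have "?M' = J \<or> ?M' = K" using J(5)[OF M'(1)] by blast
    then show False
    proof
      assume "?M' = K"
      then have "?M = N" using M'(2) by (simp add: N_def)
      then show False using NJ by blast
    next
      assume "?M' = J"
      then have "?M \<subseteq> I" using M'(2) X_mult[OF I(1,2)] by simp
      then have "jn I ?M = I" using jn_absorb[OF I(1) M] by simp
      moreover have "J \<subseteq> jn I N \<inter> J" using e J(3) by (simp add: W_def)
      ultimately have "J \<subseteq> I" using modular[OF I(1) N(1) I(2,3)] by (metis subset_trans)
      then show False using I(3,4) by blast
    qed
  qed
  have "J \<inter> W = I \<or> J \<inter> W = J" using I(5)[OF int_closed[OF I(2) W(1)]] I(3) W(2) by auto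
  moreover have "J \<inter> W \<noteq> J"
  proof
    assume "J \<inter> W = J"
    then have "W = J" using J(5)[OF W(1)] W(4) WK by blast
    then show False using NJ W(3) by simp
  qed
  ultimately have JW: "J \<inter> W = I" by blast
  have JWj: "jn J W = K"
  proof -
    have j: "jn J W \<in> L" "J \<subseteq> jn J W" "W \<subseteq> jn J W" "jn J W \<subseteq> K"
      using jn_closed[OF J(1) W(1)] jn_upper1[OF J(1) W(1)] jn_upper2[OF J(1) W(1)]
        jn_least[OF J(1) W(1) J(2,3) W(4)] .
    then show ?thesis using J(5)[OF j(1,2,4)] NJ W(3) by blast
  qed
  have WJj: "jn W J = K" using JWj jn_commute[OF J(1) W(1)] by simp
  have "cov L I W" using cov_down[of J W] c' WJj JW W(1) by (simp add: Int_commute)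
  moreover have "cov L W K" using cov_up[of J W] c JW JWj W(1) by simp
  moreover have "X I W = X J K" using X_persp[OF J(1) W(1) JWj] JW by simp
  moreover have "X W K = X I J" using X_persp[OF W(1) J(1) WJj] JW by (simp add: Int_commute)
  ultimately show ?thesis by blast
qed

section \<open>Commutativity of the group of two-sided divisorial ideals\<close>

definition VG where "VG = \<lparr>carrier = V, monoid.mult = vmult Q, one = S\<rparr>"

lemma VG_simps [simp]: "carrier VG = V" "monoid.mult VG = vmult Q" "one VG = S"
  by (simp_all add: VG_def)

lemma VG_group: "group VG"
proof (rule groupI)
  fix A B C assume "A \<in> carrier VG" "B \<in> carrier VG" "C \<in> carrier VG"
  then show "A \<otimes>\<^bsub>VG\<^esub> B \<otimes>\<^bsub>VG\<^esub> C = A \<otimes>\<^bsub>VG\<^esub> (B \<otimes>\<^bsub>VG\<^esub> C)"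
    using VL_assoc[OF _ _ V_L] by simp
next
  fix A assume "A \<in> carrier VG"
  then show "\<exists>B \<in> carrier VG. B \<otimes>\<^bsub>VG\<^esub> A = \<one>\<^bsub>VG\<^esub>"
    using V_inv V_inv_mult(2) by (intro bexI[of _ "ii A"]) auto
qed (use V_mult S_V V_one in auto)

text \<open>In a lattice-ordered group \<open>A (A \<or> B)\<^sup>-\<^sup>1 B = A \<and> B\<close>; so coprime elements commute.\<close>

lemma coprime_mult:
  assumes A: "A \<in> V" "A \<subseteq> S" and B: "B \<in> V" "B \<subseteq> S" and j: "jn A B = S"
  shows "A \<cdot> B = A \<inter> B"
proof
  have "A \<cdot> B \<subseteq> A"
    using VL_mono[OF A(1) A(1) V_L[OF B(1)] S_L order_refl B(2)] V_one(2)[OF A(1)] by simp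
  then show "A \<cdot> B \<subseteq> A \<inter> B" using VL_sub[OF A(1) V_L[OF B(1)] A(2)] by blast
  let ?D = "A \<inter> B"
  note D = V_Int[OF A(1) B(1)] and vA = V_inv[OF A(1)] and vB = V_inv[OF B(1)]
  note DB = V_mult[OF D vB] and AD = V_mult[OF vA D]
  \<comment> \<open>The quotient \<open>?W\<close> lies in the inverses of both \<open>A\<close> and
    \<open>B\<close>, hence in the inverse of their join \<open>S\<close>; so it is
    integral.\<close>
  let ?W = "ii A \<cdot> (?D \<cdot> ii B)"
  have W: "?W \<in> V" using V_mult[OF vA DB] .
  have "?D \<cdot> ii B \<subseteq> S"
    using VL_mono[OF D B(1) V_L[OF vB] V_L[OF vB] Int_lower2 order_refl] V_inv_mult(1)[OF B(1)] by simp
  then have W1: "?W \<subseteq> ii A"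
    using VL_mono[OF vA vA V_L[OF DB] S_L order_refl] V_one(2)[OF vA] by simp
  have "ii A \<cdot> ?D \<subseteq> S"
    using VL_mono[OF vA vA V_L[OF D] V_L[OF A(1)] order_refl Int_lower1] V_inv_mult(2)[OF A(1)] by simp
  then have "(ii A \<cdot> ?D) \<cdot> ii B \<subseteq> ii B" using VL_sub[OF AD V_L[OF vB]] by simp
  then have W2: "?W \<subseteq> ii B" using VL_assoc[OF vA D V_L[OF vB]] by simp
  have "p \<in> S" if p: "p \<in> ii A" "p \<in> ii B" for p
  proof -
    have c: "A \<union> B \<subseteq> carrier Q" using L_carrier[OF V_L[OF A(1)]] L_carrier[OF V_L[OF B(1)]] by simp
    have "p \<in> rres Q S (A \<union> B)"
      using p F_mem_iff(1)[OF V_F[OF A(1)]] F_mem_iff(1)[OF V_F[OF B(1)]] V_s[OF A(1)] V_s[OF B(1)]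
      by (auto simp: rres_def)
    then have "p \<in> rres Q S (cl S (A \<union> B))" using rres_cl[OF c] by simp
    then have "p \<in> rres Q S S" using jn_cl[OF V_L[OF A(1)] V_L[OF B(1)]] j by simp
    then show ?thesis using residual_self[OF S_order] by simp
  qed
  then have "?W \<subseteq> S" using W1 W2 by blast
  then have "?W \<cdot> B \<subseteq> B" using VL_sub[OF W V_L[OF B(1)]] by simp
  then have "A \<cdot> (?W \<cdot> B) \<subseteq> A \<cdot> B"
    using VL_mono[OF A(1) A(1) VL_mult(1)[OF W V_L[OF B(1)]] V_L[OF B(1)] order_refl] by simp
  moreover have "A \<cdot> (?W \<cdot> B) = ?D"
  proof -
    have "?W \<cdot> B = ii A \<cdot> (?D \<cdot> (ii B \<cdot> B))"
      using VL_assoc[OF vA DB V_L[OF B(1)]] VL_assoc[OF D vB V_L[OF B(1)]] by simp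
    then show ?thesis using V_inv_mult(2)[OF B(1)] V_one(2)[OF D] VL_cancel(2)[OF A(1) V_L[OF D]] by simp
  qed
  ultimately show "?D \<subseteq> A \<cdot> B" by simp
qed

text \<open>Noetherian induction on the product. Dividing \<open>A\<close> and \<open>B\<close> by
  their join \<open>D\<close> leaves coprime cofactors, which commute; \<open>D\<close> commutes
  with each cofactor by induction, as \<open>D \<cdot> A' = A\<close> and
  \<open>D \<cdot> B' = B\<close> are strictly above \<open>A \<cdot> B\<close>.\<close>

lemma integral_comm:
  assumes "A \<in> V" "A \<subseteq> S" "B \<in> V" "B \<subseteq> S"
  shows "A \<cdot> B = B \<cdot> A"
proof -
  let ?r = "{(K', K). K \<in> L \<and> K' \<in> L \<and> K \<subset> K' \<and> K' \<subseteq> S}"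
  define P where "P = A \<cdot> B"
  have "wf ?r" using acc_L[OF S_L] by (simp add: wf_on_top_def)
  then show ?thesis
    using assms P_def
  proof (induction P arbitrary: A B rule: wf_induct_rule)
    case (less P)
    note A = less.prems(1,2) and B = less.prems(3,4)
    show ?case
    proof (cases "A = S \<or> B = S")
      case True
      then show ?thesis using V_one[OF A(1)] V_one[OF B(1)] by (elim disjE) simp_all
    next
      case False
      define D where "D = jn A B"
      have D: "D \<in> V" "D \<subseteq> S" "A \<subseteq> D" "B \<subseteq> D"
        unfolding D_def using V_jn[OF A(1) B(1)] jn_least[OF V_L[OF A(1)] V_L[OF B(1)] S_L A(2) B(2)]
          jn_upper1[OF V_L[OF A(1)] V_L[OF B(1)]] jn_upper2[OF V_L[OF A(1)] V_L[OF B(1)]] .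
      note vD = V_inv[OF D(1)]
      define A' where "A' = ii D \<cdot> A"
      define B' where "B' = ii D \<cdot> B"
      have V': "A' \<in> V" "B' \<in> V" using V_mult[OF vD] A(1) B(1) by (auto simp: A'_def B'_def)
      have S': "A' \<subseteq> S" "B' \<subseteq> S"
        using VL_mono[OF vD vD V_L[OF A(1)] V_L[OF D(1)] order_refl D(3)]
          VL_mono[OF vD vD V_L[OF B(1)] V_L[OF D(1)] order_refl D(4)] V_inv_mult(2)[OF D(1)]
        by (auto simp: A'_def B'_def)
      have DA: "D \<cdot> A' = A" "D \<cdot> B' = B"
        using VL_cancel(2)[OF D(1) V_L[OF A(1)]] VL_cancel(2)[OF D(1) V_L[OF B(1)]] by (auto simp: A'_def B'_def)
      let ?E = "jn A' B'"
      have E: "?E \<in> L" "A' \<subseteq> ?E" "B' \<subseteq> ?E" "?E \<subseteq> S"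
        using jn_closed[OF V_L[OF V'(1)] V_L[OF V'(2)]] jn_upper1[OF V_L[OF V'(1)] V_L[OF V'(2)]]
          jn_upper2[OF V_L[OF V'(1)] V_L[OF V'(2)]] jn_least[OF V_L[OF V'(1)] V_L[OF V'(2)] S_L S'] .
      have "A \<subseteq> D \<cdot> ?E" "B \<subseteq> D \<cdot> ?E"
        using VL_mono[OF D(1) D(1) V_L[OF V'(1)] E(1) order_refl E(2)]
          VL_mono[OF D(1) D(1) V_L[OF V'(2)] E(1) order_refl E(3)] DA by auto
      then have "D \<subseteq> D \<cdot> ?E"
        using jn_least[OF V_L[OF A(1)] V_L[OF B(1)] VL_mult(1)[OF D(1) E(1)]] by (simp add: D_def)
      then have "ii D \<cdot> D \<subseteq> ii D \<cdot> (D \<cdot> ?E)"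
        using VL_mono[OF vD vD V_L[OF D(1)] VL_mult(1)[OF D(1) E(1)] order_refl] by simp
      then have "?E = S" using V_inv_mult(2)[OF D(1)] VL_cancel(1)[OF D(1) E(1)] E(4) by simp
      then have c': "A' \<cdot> B' = B' \<cdot> A'"
        using coprime_mult[OF V'(1) S'(1) V'(2) S'(2)] coprime_mult[OF V'(2) S'(2) V'(1) S'(1)]
          jn_commute[OF V_L[OF V'(1)] V_L[OF V'(2)]] by (simp add: Int_commute)
      have AB: "A \<cdot> B \<subseteq> A" "A \<cdot> B \<subseteq> B"
        using VL_mono[OF A(1) A(1) V_L[OF B(1)] S_L order_refl B(2)] V_one(2)[OF A(1)]
          VL_sub[OF A(1) V_L[OF B(1)] A(2)] by auto
      have "A \<cdot> B \<noteq> A"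
      proof
        assume "A \<cdot> B = A"
        then have "B = ii A \<cdot> A" using VL_cancel(1)[OF A(1) V_L[OF B(1)]] by simp
        then show False using V_inv_mult(2)[OF A(1)] False by simp
      qed
      moreover have "A \<cdot> B \<noteq> B"
      proof
        assume e: "A \<cdot> B = B"
        have "A = (A \<cdot> B) \<cdot> ii B"
          using VL_assoc[OF A(1) B(1) V_L[OF V_inv[OF B(1)]]] V_inv_mult(1)[OF B(1)] V_one(2)[OF A(1)] by simp
        then show False using e V_inv_mult(1)[OF B(1)] False by simp
      qed
      ultimately have r: "(A, P) \<in> ?r" "(B, P) \<in> ?r"
        using AB V_L A B V_mult[OF A(1) B(1)] less.prems(5) by auto
      have cA: "D \<cdot> A' = A' \<cdot> D" by (rule less.IH[OF r(1) D(1,2) V'(1) S'(1) DA(1)[symmetric]])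
      have cB: "D \<cdot> B' = B' \<cdot> D" by (rule less.IH[OF r(2) D(1,2) V'(2) S'(2) DA(2)[symmetric]])
      interpret VG: group VG by (rule VG_group)
      have as: "U \<cdot> U' \<cdot> U'' = U \<cdot> (U' \<cdot> U'')" if "U \<in> V" "U' \<in> V" "U'' \<in> V" for U U' U''
        using VG.m_assoc[of U U' U''] that by simp
      note m = V_mult[OF D(1) V'(1)] V_mult[OF D(1) V'(2)] V_mult[OF V'] V_mult[OF V'(2,1)]
      have "A \<cdot> B = (D \<cdot> A') \<cdot> (D \<cdot> B')" using DA by simp
      also have "\<dots> = D \<cdot> ((A' \<cdot> D) \<cdot> B')"
        by (simp only: as[OF D(1) V'(1) m(2)] as[OF V'(1) D(1) V'(2)])
      also have "\<dots> = D \<cdot> (D \<cdot> (A' \<cdot> B'))"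
        by (simp only: cA[symmetric] as[OF D(1) V'])
      also have "\<dots> = D \<cdot> ((D \<cdot> B') \<cdot> A')"
        by (simp only: c' as[OF D(1) V'(2,1)])
      also have "\<dots> = D \<cdot> ((B' \<cdot> D) \<cdot> A')" by (simp only: cB)
      also have "\<dots> = (D \<cdot> B') \<cdot> (D \<cdot> A')"
        by (simp only: as[OF D(1) V'(2) m(1)] as[OF V'(2) D(1) V'(1)])
      also have "\<dots> = B \<cdot> A" using DA by simp
      finally show ?thesis .
    qed
  qed
qed

text \<open>\<open>S \<inter> ii Y\<close> serves as the denominator: it is integral, and so is its
  product with \<open>Y\<close>.\<close>

lemma V_quotient:
  assumes Y: "Y \<in> V"
  shows "\<exists>A B. A \<in> V \<and> A \<subseteq> S \<and> B \<in> V \<and> B \<subseteq> S \<and> Y = B \<otimes>\<^bsub>VG\<^esub> inv\<^bsub>VG\<^esub> A"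
proof -
  interpret VG: group VG by (rule VG_group)
  let ?A = "S \<inter> ii Y"
  have A: "?A \<in> V" using V_Int[OF S_V V_inv[OF Y]] .
  have "Y \<cdot> ?A \<subseteq> S"
    using VL_mono[OF Y Y V_L[OF A] V_L[OF V_inv[OF Y]] order_refl Int_lower2] V_inv_mult(1)[OF Y] by simp
  moreover have "Y = (Y \<otimes>\<^bsub>VG\<^esub> ?A) \<otimes>\<^bsub>VG\<^esub> inv\<^bsub>VG\<^esub> ?A"
    using VG.inv_closed[of ?A] VG.r_inv[of ?A] VG.m_assoc[of Y ?A "inv\<^bsub>VG\<^esub> ?A"] A Y V_one(2)[OF Y] by simp
  ultimately show ?thesis using A V_mult[OF Y A] by (intro exI[of _ ?A] exI[of _ "Y \<cdot> ?A"]) simp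
qed

lemma V_comm:
  assumes "A \<in> V" "B \<in> V" shows "A \<cdot> B = B \<cdot> A"
proof -
  interpret VG: group VG by (rule VG_group)
  have 1: "A \<cdot> B = B \<cdot> A" if A: "A \<in> V" "A \<subseteq> S" and B: "B \<in> V" for A B
  proof -
    obtain C D where CD: "C \<in> V" "C \<subseteq> S" "D \<in> V" "D \<subseteq> S" "B = D \<otimes>\<^bsub>VG\<^esub> inv\<^bsub>VG\<^esub> C"
      using V_quotient[OF B] by blast
    show ?thesis
      using VG.comm_quotients[of A D C] integral_comm[OF A CD(1,2)] integral_comm[OF A CD(3,4)] CD A by simp
  qed
  obtain C D where CD: "C \<in> V" "C \<subseteq> S" "D \<in> V" "D \<subseteq> S" "B = D \<otimes>\<^bsub>VG\<^esub> inv\<^bsub>VG\<^esub> C"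
    using V_quotient[OF assms(2)] by blast
  show ?thesis
    using VG.comm_quotients[of A D C] 1[OF CD(1,2) assms(1)] 1[OF CD(3,4) assms(1)] CD assms by simp
qed

end

section \<open>The abstract norm on the lattice of left ideals\<close>

context order_class
begin

text \<open>The hom-sets of the groupoid. With both ends in the membership statement, composability
  is checked by resolution.\<close>

definition Hm where "Hm e f = {I \<in> F. s I = e \<and> t I = f}"

lemma Hm_D: "I \<in> Hm e f \<Longrightarrow> I \<in> F \<and> s I = e \<and> t I = f" by (simp add: Hm_def)

lemma Hm_mult: assumes "I \<in> Hm e f" "J \<in> Hm f g" shows "I \<cdot> J \<in> Hm e g"
  using vm_F[of I J] assms by (simp add: Hm_def)

lemma Hm_inv: assumes "I \<in> Hm e f" shows "ii I \<in> Hm f e"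
  using F_inv[of I] assms by (simp add: Hm_def)

lemma Hm_assoc:
  assumes "I \<in> Hm e f" "J \<in> Hm f g" "K \<in> Hm g h" shows "I \<cdot> J \<cdot> K = I \<cdot> (J \<cdot> K)"
  using vm_assoc[of I J K] assms by (simp add: Hm_def)

lemma Hm_cancel_left:
  assumes "I \<in> Hm e f" shows "J \<in> Hm f g \<Longrightarrow> ii I \<cdot> (I \<cdot> J) = J" "J \<in> Hm e g \<Longrightarrow> I \<cdot> (ii I \<cdot> J) = J"
  using vm_cancel_left[of I J] assms by (simp_all add: Hm_def)

lemma Hm_cancel_right:
  assumes "I \<in> Hm e f" shows "J \<in> Hm g e \<Longrightarrow> J \<cdot> I \<cdot> ii I = J" "J \<in> Hm g f \<Longrightarrow> J \<cdot> ii I \<cdot> I = J"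
  using vm_cancel_right[of I J] assms by (simp_all add: Hm_def)

lemma Hm_inv_mult: assumes "I \<in> Hm e f" shows "I \<cdot> ii I = e" "ii I \<cdot> I = f"
  using vm_inv_right[of I] vm_inv_left[of I] assms by (simp_all add: Hm_def)

lemma Hm_one: assumes "I \<in> Hm e f" shows "e \<cdot> I = I" "I \<cdot> f = I"
  using vm_unit_left[of I] vm_unit_right[of I] assms by (simp_all add: Hm_def)

lemma Hm_inverse: assumes "I \<in> Hm e f" "J \<in> Hm f g" shows "ii (I \<cdot> J) = ii J \<cdot> ii I"
  using vm_inverse[of I J] assms by (simp add: Hm_def)

lemma Hm_alpha: "e \<in> \<alpha> \<Longrightarrow> e \<in> Hm e e"
  using alpha_F[of e] by (simp add: Hm_def)

lemma Hm_ends: assumes "I \<in> Hm e f" shows "e \<in> \<alpha>" "f \<in> \<alpha>"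
  using F_srcI[of I] F_tgtI[of I] assms by (auto simp: Hm_def)

lemma Hm_mono:
  assumes "I \<in> Hm e f" "I' \<in> Hm e f" "J \<in> Hm f g" "J' \<in> Hm f g'" "I \<subseteq> I'" "J \<subseteq> J'"
  shows "I \<cdot> J \<subseteq> I' \<cdot> J'"
  using vm_mono[of I J I' J'] assms by (simp add: Hm_def)

lemma vertex_group_Hm: "vertex_group Q \<alpha> e = Hm e e"
  by (auto simp: vertex_group_def Hm_def)

abbreviation \<kappa> where "\<kappa> \<equiv> conj_class Q \<alpha>"

text \<open>Conjugating \<open>x\<close> by \<open>a\<close> is the same as conjugating its
  transport by \<open>b \<cdot> a\<close>, and every arrow out of \<open>e\<close> has the form
  \<open>b \<cdot> a\<close>.\<close>

lemma conj_transport: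
  assumes b: "b \<in> Hm e f" and x: "x \<in> Hm f f"
  shows "\<kappa> (b \<cdot> x \<cdot> ii b) = \<kappa> x"
proof -
  let ?y = "b \<cdot> x \<cdot> ii b"
  note ib = Hm_inv[OF b] and bx = Hm_mult[OF b x]
  note y = Hm_mult[OF bx ib]
  have key: "ii (b \<cdot> a) \<cdot> ?y \<cdot> (b \<cdot> a) = ii a \<cdot> x \<cdot> a" if a: "a \<in> Hm f g" for a g
  proof -
    note ba = Hm_mult[OF b a] and xa = Hm_mult[OF x a] and ia = Hm_inv[OF a]
    have "?y \<cdot> (b \<cdot> a) = b \<cdot> (x \<cdot> a)"
      using Hm_assoc[OF bx ib ba] Hm_cancel_left(1)[OF b a] Hm_assoc[OF b x a] by simp
    then have "ii (b \<cdot> a) \<cdot> ?y \<cdot> (b \<cdot> a) = ii a \<cdot> ii b \<cdot> (b \<cdot> (x \<cdot> a))"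
      using Hm_assoc[OF Hm_inv[OF ba] y ba] Hm_inverse[OF b a] by simp
    also have "\<dots> = ii a \<cdot> (x \<cdot> a)"
      using Hm_assoc[OF ia ib Hm_mult[OF b xa]] Hm_cancel_left(1)[OF b xa] by simp
    also have "\<dots> = ii a \<cdot> x \<cdot> a" using Hm_assoc[OF ia x a] by simp
    finally show ?thesis .
  qed
  have sx: "s x = f" "s ?y = e" using Hm_D[OF x] Hm_D[OF y] by auto
  show ?thesis
  proof
    show "\<kappa> x \<subseteq> \<kappa> ?y"
    proof
      fix z assume "z \<in> \<kappa> x"
      then obtain a where a: "a \<in> F" "s a = f" "z = ii a \<cdot> x \<cdot> a" using sx by (auto simp: conj_class_def)
      then have a': "a \<in> Hm f (t a)" by (simp add: Hm_def)
      have "z = ii (b \<cdot> a) \<cdot> ?y \<cdot> (b \<cdot> a)" using key[OF a'] a by simp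
      then show "z \<in> \<kappa> ?y" using Hm_D[OF Hm_mult[OF b a']] sx unfolding conj_class_def by blast
    qed
    show "\<kappa> ?y \<subseteq> \<kappa> x"
    proof
      fix z assume "z \<in> \<kappa> ?y"
      then obtain a where a: "a \<in> F" "s a = e" "z = ii a \<cdot> ?y \<cdot> a" using sx by (auto simp: conj_class_def)
      then have a': "a \<in> Hm e (t a)" by (simp add: Hm_def)
      note c = Hm_mult[OF ib a']
      have "z = ii (ii b \<cdot> a) \<cdot> x \<cdot> (ii b \<cdot> a)"
        using key[OF c] a(3) Hm_cancel_left(2)[OF b a'] by simp
      then show "z \<in> \<kappa> x" using Hm_D[OF c] sx unfolding conj_class_def by blast
    qed
  qed
qed

lemma conj_class_self: assumes "x \<in> Hm e e" shows "x \<in> \<kappa> x"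
proof -
  have e: "e \<in> \<alpha>" using Hm_ends[OF assms] by simp
  have "x = ii e \<cdot> x \<cdot> e" using Hm_one[OF assms] alpha_F(4)[OF e] by simp
  then show ?thesis using alpha_F[OF e] Hm_D[OF assms] unfolding conj_class_def by blast
qed

end

context arith_order
begin

section \<open>The norm group, computed in the vertex group at \<open>S\<close>\<close>

lemma V_Hm: "V = Hm S S" by (simp add: V_def Hm_def)

lemma L_Hm: "I \<in> L \<Longrightarrow> I \<in> Hm S (t I)" by (simp add: L_iff Hm_def)

lemma Hm_L: "I \<in> Hm S e \<Longrightarrow> I \<in> L" by (simp add: L_iff Hm_def)

text \<open>The closure of the product \<open>S e\<close> is an arrow from \<open>S\<close> to
  \<open>e\<close>; boundedness makes it a fractional ideal.\<close>

lemma connected: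
  assumes e: "e \<in> \<alpha>" shows "\<exists>b. b \<in> Hm S e"
proof -
  note eo = a_order[OF e]
  obtain c d where cd: "c \<in> Units Q" "d \<in> Units Q" "\<forall>p \<in> e. c \<otimes> p \<otimes> d \<in> S"
    using a_equiv[OF e S_in] unfolding equivalent_orders_iff by blast
  obtain k where k: "k \<in> Units Q" "\<forall>q \<in> S. inv c \<otimes> q \<otimes> k \<in> S"
    using a_bdd[OF S_in, unfolded unit_bounded_def, rule_format, of "inv c"] cd(1) by auto
  define K where "K = {q \<otimes> p | q p. q \<in> S \<and> p \<in> e}"
  have mem: "q \<otimes> p \<in> K" if "q \<in> S" "p \<in> e" for q p using that by (auto simp: K_def)
  have Kc: "K \<subseteq> carrier Q" using S_mem orderD(3)[OF eo] by (auto simp: K_def)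
  have left: "a \<otimes> b \<in> K" if a: "a \<in> S" and b: "b \<in> K" for a b
  proof -
    obtain q p where "q \<in> S" "p \<in> e" "b = q \<otimes> p" using b by (auto simp: K_def)
    then show ?thesis
      using a mem[of "a \<otimes> q" p] orderD(4)[OF S_order] S_mem orderD(3)[OF eo] by (simp add: m_assoc)
  qed
  have right: "b \<otimes> a \<in> K" if a: "a \<in> e" and b: "b \<in> K" for a b
  proof -
    obtain q p where "q \<in> S" "p \<in> e" "b = q \<otimes> p" using b by (auto simp: K_def)
    then show ?thesis
      using a mem[of q "p \<otimes> a"] orderD(4)[OF eo] S_mem orderD(3)[OF eo] by (simp add: m_assoc)
  qed
  have bd: "b \<otimes> (d \<otimes> k) \<in> S" if b: "b \<in> K" for b
  proof -
    obtain q p where qp: "q \<in> S" "p \<in> e" "b = q \<otimes> p" using b by (auto simp: K_def)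
    have "b \<otimes> (d \<otimes> k) = q \<otimes> (inv c \<otimes> (c \<otimes> p \<otimes> d) \<otimes> k)"
      using qp cd(1,2) k(1) S_mem orderD(3)[OF eo] by (simp add: m_assoc)
    then show ?thesis using orderD(4)[OF S_order qp(1)] k(2) cd(3) qp(2) by simp
  qed
  have fl: "frac_left_ideal Q S K"
    unfolding frac_left_ideal_iff
  proof (intro conjI)
    show "\<exists>x \<in> Units Q. x \<in> K"
      using mem[OF S_one orderD(2)[OF eo]] by (intro bexI[of _ \<one>]) auto
    show "\<exists>y \<in> Units Q. \<forall>a \<in> K. a \<otimes> y \<in> S"
      using bd cd(2) k(1) by (intro bexI[of _ "d \<otimes> k"]) auto
  qed (use Kc left in auto)
  note b = FI[OF S_in fl]
  have "t (cl S K) = e"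
  proof (rule max_eq[OF a_max[OF e]])
    note tc = F_tgtI[OF b(1)]
    show "submonoid (t (cl S K)) Q" using a_order[OF tc] by (simp add: order_in_def)
    show "equivalent_orders Q e (t (cl S K))" using a_equiv[OF e tc] .
    show "e \<subseteq> t (cl S K)" using cl_tgt[OF _ _ Kc] right orderD(3)[OF eo] by blast
  qed
  then show ?thesis using b by (auto simp: Hm_def)
qed

abbreviation \<G> where "\<G> \<equiv> norm_group Q \<alpha>"

lemma norm_group_carrier: "carrier \<G> = \<kappa> ` V"
proof
  show "\<kappa> ` V \<subseteq> carrier \<G>" using S_in by (auto simp: norm_group_def vertex_group_Hm V_Hm)
  show "carrier \<G> \<subseteq> \<kappa> ` V"
  proof
    fix Z assume "Z \<in> carrier \<G>"
    then obtain e x where x: "e \<in> \<alpha>" "x \<in> Hm e e" "Z = \<kappa> x"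
      by (auto simp: norm_group_def vertex_group_Hm)
    obtain b where b: "b \<in> Hm S e" using connected[OF x(1)] by blast
    have "b \<cdot> x \<cdot> ii b \<in> V" unfolding V_Hm using Hm_mult[OF Hm_mult[OF b x(2)] Hm_inv[OF b]] .
    then show "Z \<in> \<kappa> ` V" using conj_transport[OF b x(2)] x(3) by (metis imageI)
  qed
qed

text \<open>An element of \<open>V\<close> in the class of \<open>B\<close> is conjugate to
  \<open>B\<close> inside the group \<open>V\<close>, which is commutative.\<close>

lemma conj_class_inj:
  assumes "A \<in> V" "B \<in> V" "\<kappa> A = \<kappa> B" shows "A = B"
proof -
  have "A \<in> \<kappa> B" using conj_class_self assms V_Hm by blast
  then obtain a where a: "a \<in> F" "s a = S" "A = ii a \<cdot> B \<cdot> a"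
    using V_s[OF assms(2)] by (auto simp: conj_class_def)
  have a': "a \<in> Hm S (t a)" using a by (simp add: Hm_def)
  have "ii a \<cdot> B \<cdot> a \<in> Hm (t a) (t a)"
    using Hm_mult[OF Hm_mult[OF Hm_inv[OF a']] a'] assms(2) V_Hm by blast
  then have "t a = S" using a(3) assms(1) by (simp add: Hm_def V_def)
  then have aV: "a \<in> V" using a by (simp add: V_def)
  have "A = B \<cdot> ii a \<cdot> a" using a(3) V_comm[OF V_inv[OF aV] assms(2)] by simp
  then show ?thesis
    using VL_assoc[OF assms(2) V_inv[OF aV] V_L[OF aV]] V_inv_mult(2)[OF aV] V_one(2)[OF assms(2)] by simp
qed

text \<open>The definite description has one value, since all representatives can be transported to
  \<open>S\<close> along one arrow \<open>b\<close>, conjugation by \<open>b\<close> is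
  multiplicative, and over \<open>S\<close> a class has a single representative.\<close>

lemma norm_group_mult:
  assumes A: "A \<in> V" and B: "B \<in> V"
  shows "\<kappa> A \<otimes>\<^bsub>\<G>\<^esub> \<kappa> B = \<kappa> (A \<cdot> B)"
proof -
  let ?P = "\<lambda>Z. \<exists>e \<in> \<alpha>. \<exists>x \<in> vertex_group Q \<alpha> e. \<exists>y \<in> vertex_group Q \<alpha> e.
      \<kappa> A = \<kappa> x \<and> \<kappa> B = \<kappa> y \<and> Z = \<kappa> (x \<cdot> y)"
  have "(THE Z. ?P Z) = \<kappa> (A \<cdot> B)"
  proof (rule the_equality)
    show "?P (\<kappa> (A \<cdot> B))" using A B S_in unfolding vertex_group_Hm V_Hm by blast
    fix Z assume "?P Z"
    then obtain e x y where x: "e \<in> \<alpha>" "x \<in> Hm e e" "y \<in> Hm e e" "\<kappa> A = \<kappa> x" "\<kappa> B = \<kappa> y" "Z = \<kappa> (x \<cdot> y)"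
      unfolding vertex_group_Hm by blast
    obtain b where b: "b \<in> Hm S e" using connected[OF x(1)] by blast
    note ib = Hm_inv[OF b]
    let ?c = "\<lambda>x. b \<cdot> x \<cdot> ii b"
    have cV: "?c x \<in> V" if "x \<in> Hm e e" for x
      unfolding V_Hm using Hm_mult[OF Hm_mult[OF b that] ib] .
    have "A = ?c x" "B = ?c y"
      using conj_class_inj[OF A cV[OF x(2)]] conj_class_inj[OF B cV[OF x(3)]]
        conj_transport[OF b x(2)] conj_transport[OF b x(3)] x(4,5) by auto
    moreover have "?c x \<cdot> ?c y = ?c (x \<cdot> y)"
    proof -
      note bx = Hm_mult[OF b x(2)] and yb = Hm_mult[OF x(3) ib]
      have "?c x \<cdot> ?c y = b \<cdot> x \<cdot> (ii b \<cdot> (b \<cdot> (y \<cdot> ii b)))"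
        using Hm_assoc[OF bx ib Hm_mult[OF Hm_mult[OF b x(3)] ib]] Hm_assoc[OF b x(3) ib] by simp
      also have "\<dots> = b \<cdot> x \<cdot> (y \<cdot> ii b)" using Hm_cancel_left(1)[OF b yb] by simp
      also have "\<dots> = ?c (x \<cdot> y)" using Hm_assoc[OF bx x(3) ib] Hm_assoc[OF b x(2,3)] by simp
      finally show ?thesis .
    qed
    ultimately show "Z = \<kappa> (A \<cdot> B)"
      using conj_transport[OF b Hm_mult[OF x(2,3)]] x(6) by simp
  qed
  then show ?thesis by (simp add: norm_group_def)
qed

lemma norm_group_one: "\<one>\<^bsub>\<G>\<^esub> = \<kappa> S"
proof -
  have "(THE Z. \<exists>e \<in> \<alpha>. Z = \<kappa> e) = \<kappa> S"
  proof (rule the_equality)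
    show "\<exists>e \<in> \<alpha>. \<kappa> S = \<kappa> e" using S_in by blast
    fix Z assume "\<exists>e \<in> \<alpha>. Z = \<kappa> e"
    then obtain e where e: "e \<in> \<alpha>" "Z = \<kappa> e" by blast
    obtain b where b: "b \<in> Hm S e" using connected[OF e(1)] by blast
    have "b \<cdot> e \<cdot> ii b = S" using Hm_one(2)[OF b] Hm_inv_mult(1)[OF b] by simp
    then show "Z = \<kappa> S" using conj_transport[OF b Hm_alpha[OF e(1)]] e by simp
  qed
  then show ?thesis by (simp add: norm_group_def)
qed

lemma norm_group_comm_group: "comm_group \<G>"
proof (rule comm_groupI)
  fix x y assume "x \<in> carrier \<G>" "y \<in> carrier \<G>"
  then obtain A B where A: "A \<in> V" "x = \<kappa> A" "B \<in> V" "y = \<kappa> B" by (auto simp: norm_group_carrier)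
  show "x \<otimes>\<^bsub>\<G>\<^esub> y \<in> carrier \<G>" using norm_group_mult V_mult A by (simp add: norm_group_carrier)
  show "x \<otimes>\<^bsub>\<G>\<^esub> y = y \<otimes>\<^bsub>\<G>\<^esub> x" using norm_group_mult V_comm[OF A(1,3)] A by simp
  fix z assume "z \<in> carrier \<G>"
  then obtain C where C: "C \<in> V" "z = \<kappa> C" by (auto simp: norm_group_carrier)
  show "x \<otimes>\<^bsub>\<G>\<^esub> y \<otimes>\<^bsub>\<G>\<^esub> z = x \<otimes>\<^bsub>\<G>\<^esub> (y \<otimes>\<^bsub>\<G>\<^esub> z)"
    using norm_group_mult V_mult A C VL_assoc[OF A(1,3) V_L[OF C(1)]] by simp
next
  show "\<one>\<^bsub>\<G>\<^esub> \<in> carrier \<G>" using S_V by (auto simp: norm_group_one norm_group_carrier)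
next
  fix x assume "x \<in> carrier \<G>"
  then obtain A where A: "A \<in> V" "x = \<kappa> A" by (auto simp: norm_group_carrier)
  show "\<one>\<^bsub>\<G>\<^esub> \<otimes>\<^bsub>\<G>\<^esub> x = x" using norm_group_mult[OF S_V A(1)] V_one(1)[OF A(1)] A by (simp add: norm_group_one)
  show "\<exists>y \<in> carrier \<G>. y \<otimes>\<^bsub>\<G>\<^esub> x = \<one>\<^bsub>\<G>\<^esub>"
    using norm_group_mult[OF V_inv[OF A(1)] A(1)] V_inv[OF A(1)] V_inv_mult(2)[OF A(1)] A
    by (intro bexI[of _ "\<kappa> (ii A)"]) (auto simp: norm_group_one norm_group_carrier)
qed

text \<open>The groupoid element \<open>J\<^sup>-\<^sup>1 I\<close>. Left multiplication by
  \<open>J\<close> identifies integral elements with source \<open>t J\<close> and ideals below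
  \<open>J\<close>; thus quotients along a chain compose from the top down.\<close>

definition quo where "quo I J = ii J \<cdot> I"

lemma quo_Hm: assumes "I \<in> L" "J \<in> L" shows "quo I J \<in> Hm (t J) (t I)"
  unfolding quo_def using Hm_mult[OF Hm_inv[OF L_Hm[OF assms(2)]] L_Hm[OF assms(1)]] .

lemma quo_cancel: assumes "I \<in> L" "J \<in> L" shows "J \<cdot> quo I J = I"
  unfolding quo_def using Hm_cancel_left(2)[OF L_Hm[OF assms(2)] L_Hm[OF assms(1)]] .

lemma quo_trans: assumes "I \<in> L" "J \<in> L" "K \<in> L" shows "quo I K = quo J K \<cdot> quo I J"
proof -
  note h = L_Hm[OF assms(1)] L_Hm[OF assms(2)] L_Hm[OF assms(3)]
  have "quo J K \<cdot> quo I J = ii K \<cdot> (J \<cdot> quo I J)"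
    unfolding quo_def[of J K] using Hm_assoc[OF Hm_inv[OF h(3)] h(2) quo_Hm[OF assms(1,2)]] .
  then show ?thesis using quo_cancel[OF assms(1,2)] by (simp add: quo_def)
qed

lemma quo_self: assumes "I \<in> L" shows "quo I I = t I"
  unfolding quo_def using Hm_inv_mult(2)[OF L_Hm[OF assms]] .

lemma quo_sub:
  assumes "I \<in> L" "J \<in> L" "I \<subseteq> J" shows "quo I J \<subseteq> t J"
proof -
  note h = L_Hm[OF assms(1)] L_Hm[OF assms(2)]
  have "ii J \<cdot> I \<subseteq> ii J \<cdot> J" using Hm_mono[OF Hm_inv[OF h(2)] Hm_inv[OF h(2)] h order_refl assms(3)] .
  then show ?thesis using Hm_inv_mult(2)[OF h(2)] by (simp add: quo_def)
qed

lemma lift_sub: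
  assumes "J \<in> L" "u \<in> Hm (t J) e" "u \<subseteq> t J" shows "J \<cdot> u \<in> L" "J \<cdot> u \<subseteq> J" "quo (J \<cdot> u) J = u"
proof -
  note h = L_Hm[OF assms(1)]
  show "J \<cdot> u \<in> L" using Hm_L[OF Hm_mult[OF h assms(2)]] .
  have "t J \<in> Hm (t J) (t J)" using Hm_alpha Hm_ends[OF h] by blast
  then show "J \<cdot> u \<subseteq> J" using Hm_mono[OF h h assms(2) _ order_refl assms(3)] Hm_one(2)[OF h] by simp
  show "quo (J \<cdot> u) J = u" unfolding quo_def using Hm_cancel_left(1)[OF h assms(2)] .
qed

section \<open>Maximal integral elements and covers\<close>

lemma Iv_iff: "u \<in> Iv Q \<alpha> \<longleftrightarrow> u \<in> F \<and> u \<subseteq> s u"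
proof
  assume "u \<in> Iv Q \<alpha>"
  then obtain e where e: "divisorial Q u" "e \<in> \<alpha>" "frac_left_ideal Q e u" "u \<subseteq> e"
    by (auto simp: Iv_def left_order_ideal_def)
  then show "u \<in> F \<and> u \<subseteq> s u" using src_eq[OF a_max[OF e(2)] e(3)] by (simp add: F_iff)
qed (auto simp: Iv_def left_order_ideal_def F_iff)

lemma maximal_integral_iff:
  "u \<in> maximal_integral Q \<alpha> \<longleftrightarrow> u \<in> F \<and> u \<subseteq> s u \<and> u \<noteq> s u \<and>
     (\<forall>v \<in> F. s v = s u \<longrightarrow> v \<subseteq> s u \<longrightarrow> u \<subseteq> v \<longrightarrow> v = u \<or> v = s u)"
  (is "_ \<longleftrightarrow> ?R")
proof
  assume "u \<in> maximal_integral Q \<alpha>"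
  then have u: "u \<in> Iv Q \<alpha>" "u \<noteq> s u"
    and m: "\<And>v. v \<in> Iv Q \<alpha> \<Longrightarrow> s v = s u \<Longrightarrow> v \<noteq> s u \<Longrightarrow> u \<subseteq> v \<Longrightarrow> v = u"
    unfolding maximal_integral_def by blast+
  have "v = u \<or> v = s u" if "v \<in> F" "s v = s u" "v \<subseteq> s u" "u \<subseteq> v" for v
    using m[of v] that by (auto simp: Iv_iff)
  then show ?R using u by (simp add: Iv_iff)
next
  assume R: ?R
  show "u \<in> maximal_integral Q \<alpha>"
    unfolding maximal_integral_def
  proof (intro CollectI bexI[of _ "s u"] conjI ballI impI)
    show "u \<in> {J \<in> Iv Q \<alpha>. s J = s u} - {s u}" using R by (simp add: Iv_iff)
    show "s u \<in> \<alpha>" using R F_srcI by simp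
    fix v assume v: "v \<in> {J \<in> Iv Q \<alpha>. s J = s u} - {s u}" "u \<subseteq> v"
    then have v': "v \<in> F" "s v = s u" "v \<noteq> s u" "v \<subseteq> s v" unfolding Iv_iff by blast+
    then have "v \<subseteq> s u" by simp
    then show "v = u" using R v' v(2) by blast
  qed
qed

lemma quo_maximal_integral:
  assumes c: "cov L I J" shows "quo I J \<in> maximal_integral Q \<alpha>"
proof -
  note I = covD[OF c]
  note u = Hm_D[OF quo_Hm[OF I(1,2)]]
  have "quo I J \<noteq> t J"
  proof
    assume "quo I J = t J"
    then have "J \<cdot> t J = I" using quo_cancel[OF I(1,2)] by simp
    then show False using Hm_one(2)[OF L_Hm[OF I(2)]] I(4) by simp
  qed
  moreover have "v = quo I J \<or> v = t J" if v: "v \<in> F" "s v = t J" "v \<subseteq> t J" "quo I J \<subseteq> v" for v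
  proof -
    have vh: "v \<in> Hm (t J) (t v)" using v by (simp add: Hm_def)
    note jv = lift_sub[OF I(2) vh v(3)]
    have "I \<subseteq> J \<cdot> v"
      using Hm_mono[OF L_Hm[OF I(2)] L_Hm[OF I(2)] quo_Hm[OF I(1,2)] vh order_refl v(4)]
        quo_cancel[OF I(1,2)] by simp
    then have "J \<cdot> v = I \<or> J \<cdot> v = J" using I(5)[OF jv(1) _ jv(2)] by blast
    then show ?thesis using jv(3) quo_self[OF I(2)] by auto
  qed
  ultimately show ?thesis using u quo_sub[OF I(1,2,3)] by (auto simp: maximal_integral_iff)
qed

lemma maximal_integral_cov:
  assumes J: "J \<in> L" and u: "u \<in> maximal_integral Q \<alpha>" "s u = t J"
  shows "cov L (J \<cdot> u) J" "quo (J \<cdot> u) J = u"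
proof -
  have uh: "u \<in> Hm (t J) (t u)" and us: "u \<subseteq> t J" and un: "u \<noteq> t J"
    and um: "\<And>v. v \<in> F \<Longrightarrow> s v = t J \<Longrightarrow> v \<subseteq> t J \<Longrightarrow> u \<subseteq> v \<Longrightarrow> v = u \<or> v = t J"
    using u by (auto simp: maximal_integral_iff Hm_def)
  note ju = lift_sub[OF J uh us]
  show "quo (J \<cdot> u) J = u" by (rule ju(3))
  have "J \<cdot> u \<noteq> J" using ju(3) quo_self[OF J] un by auto
  moreover have "K = J \<cdot> u \<or> K = J" if K: "K \<in> L" "J \<cdot> u \<subseteq> K" "K \<subseteq> J" for K
  proof -
    note kh = quo_Hm[OF K(1) J]
    have "quo (J \<cdot> u) J \<subseteq> quo K J"
      unfolding quo_def
      using Hm_mono[OF Hm_inv[OF L_Hm[OF J]] Hm_inv[OF L_Hm[OF J]] L_Hm[OF ju(1)] L_Hm[OF K(1)] order_refl K(2)] .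
    then have "quo K J = u \<or> quo K J = t J"
      using um[of "quo K J"] Hm_D[OF kh] quo_sub[OF K(1) J K(3)] ju(3) by simp
    then show ?thesis
    proof
      assume "quo K J = u"
      then show ?thesis using quo_cancel[OF K(1) J] by simp
    next
      assume "quo K J = t J"
      then show ?thesis using quo_cancel[OF K(1) J] Hm_one(2)[OF L_Hm[OF J]] by simp
    qed
  qed
  ultimately show "cov L (J \<cdot> u) J" unfolding cov_def using ju(1,2) J by blast
qed

end

locale arith_norm = arith_order Q \<alpha> S for Q (structure) and \<alpha> S +
  fixes \<eta> :: "'a set \<Rightarrow> 'a set set"
  assumes norm: "abstract_norm Q \<alpha> \<eta>"
begin

sublocale \<G>: comm_group \<G> by (rule norm_group_comm_group)

lemma norm_closed: "I \<in> F \<Longrightarrow> \<eta> I \<in> carrier \<G>"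
  using norm by (auto simp: abstract_norm_def)

lemma norm_mult: assumes "I \<in> Hm e f" "J \<in> Hm f g" shows "\<eta> (I \<cdot> J) = \<eta> I \<otimes>\<^bsub>\<G>\<^esub> \<eta> J"
  using norm assms by (auto simp: abstract_norm_def Hm_def)

lemma norm_alpha: assumes "e \<in> \<alpha>" shows "\<eta> e = \<one>\<^bsub>\<G>\<^esub>"
proof -
  note h = Hm_alpha[OF assms]
  have "\<eta> e \<otimes>\<^bsub>\<G>\<^esub> \<eta> e = \<eta> e" using norm_mult[OF h h] Hm_one(1)[OF h] by simp
  moreover have "\<eta> e \<in> carrier \<G>" using norm_closed alpha_F[OF assms] by blast
  ultimately show ?thesis using \<G>.r_cancel_one by blast
qed

text \<open>Conjugation by \<open>J\<close> matches the two-sided ideals inside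
  \<open>quo I J\<close> with those inside \<open>X I J\<close>, so the supremum in the definition
  of the norm is attained by the transport of the residual.\<close>

lemma norm_quo:
  assumes c: "cov L I J" shows "\<eta> (quo I J) = \<kappa> (X I J)"
proof -
  note I = covD[OF c]
  let ?u = "quo I J" and ?e = "t J" and ?X = "X I J"
  note jh = L_Hm[OF I(2)] and uh = quo_Hm[OF I(1,2)]
  note ij = Hm_inv[OF jh]
  have XV: "?X \<in> Hm S S" using X_V[OF I(1,2)] by (simp add: V_Hm)
  obtain x where x: "is_supremum (vertex_group Q \<alpha> (s ?u)) {x' \<in> vertex_group Q \<alpha> (s ?u). x' \<subseteq> ?u} x"
    "\<eta> ?u = \<kappa> x"
    using norm[unfolded abstract_norm_def, THEN conjunct2, THEN conjunct2, rule_format, OF quo_maximal_integral[OF c]]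
    by blast
  have se: "s ?u = ?e" using Hm_D[OF uh] by simp
  define x0 where "x0 = ii J \<cdot> (?X \<cdot> J)"
  note xj = Hm_mult[OF XV jh]
  have x0h: "x0 \<in> Hm ?e ?e" unfolding x0_def using Hm_mult[OF ij xj] .
  have x0u: "x0 \<subseteq> ?u"
    unfolding x0_def quo_def
    using Hm_mono[OF ij ij xj L_Hm[OF I(1)] order_refl X_mult[OF I(1,2)]] .
  have max: "y \<subseteq> x0" if y: "y \<in> Hm ?e ?e" "y \<subseteq> ?u" for y
  proof -
    let ?Y = "J \<cdot> y \<cdot> ii J"
    note jy = Hm_mult[OF jh y(1)]
    have YV: "?Y \<in> Hm S S" using Hm_mult[OF jy ij] .
    have YJ: "?Y \<cdot> J = J \<cdot> y" using Hm_cancel_right(2)[OF jh jy] .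
    have "J \<cdot> y \<subseteq> I" using Hm_mono[OF jh jh y(1) uh order_refl y(2)] quo_cancel[OF I(1,2)] by simp
    then have "?Y \<subseteq> ?X" using VL_le_iff[of ?Y J I] YV YJ I(1,2) V_Hm by simp
    then have "J \<cdot> y \<subseteq> ?X \<cdot> J" using Hm_mono[OF YV XV jh jh _ order_refl] YJ by simp
    then have "ii J \<cdot> (J \<cdot> y) \<subseteq> x0" unfolding x0_def using Hm_mono[OF ij ij jy xj order_refl] by simp
    then show ?thesis using Hm_cancel_left(1)[OF jh y(1)] by simp
  qed
  have sup: "\<forall>m \<in> {y \<in> Hm ?e ?e. y \<subseteq> ?u}. m \<subseteq> x"
    "\<forall>y \<in> Hm ?e ?e. (\<forall>m \<in> {y \<in> Hm ?e ?e. y \<subseteq> ?u}. m \<subseteq> y) \<longrightarrow> x \<subseteq> y"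
    using x(1) unfolding is_supremum_def se vertex_group_Hm by blast+
  have "x0 \<subseteq> x" using sup(1) x0h x0u by blast
  moreover have "x \<subseteq> x0" using sup(2) x0h max by blast
  ultimately have "x = x0" by blast
  moreover have "J \<cdot> x0 \<cdot> ii J = ?X"
    unfolding x0_def using Hm_cancel_left(2)[OF jh xj] Hm_cancel_right(1)[OF jh XV] by simp
  ultimately show ?thesis using x(2) conj_transport[OF jh x0h] by simp
qed

abbreviation P where "P \<equiv> principal_norms Q S \<eta>"

definition lab where "lab I J = ideal_class Q \<alpha> P \<eta> (quo I J)"

lemma lab_cov: "cov L I J \<Longrightarrow> lab I J = P #>\<^bsub>\<G>\<^esub> \<kappa> (X I J)"
  by (simp add: lab_def ideal_class_def norm_quo)

sublocale labelled_lattice L jn lab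
proof
  fix I J H assume c: "cov L I J" and H: "H \<in> L" "H \<subseteq> J" "jn I H = J"
  note I = covD[OF c]
  have j: "jn H I = J" using jn_commute[OF H(1) I(1)] H(3) by (rule trans)
  have "cov L (H \<inter> I) H" by (rule cov_down[of I H, unfolded j, OF c H(1)])
  then have "cov L (I \<inter> H) H" by (simp only: Int_commute)
  from lab_cov[OF this] show "lab (I \<inter> H) H = lab I J"
    unfolding lab_cov[OF c] X_persp[OF I(1) H(1,3)] .
next
  fix I J K assume c: "cov L I J" "cov L J K" and ne: "lab I J \<noteq> lab J K"
  \<comment> \<open>The label of a cover is a function of its residual, so different labels come
    from different residuals.\<close>
  have "X I J \<noteq> X J K" using ne lab_cov[OF c(1)] lab_cov[OF c(2)] by auto
  then obtain W where W: "cov L I W" "cov L W K" "X I W = X J K" "X W K = X I J"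
    using X_swap[OF c] by auto
  then show "\<exists>W. cov L I W \<and> cov L W K \<and> lab I W = lab J K \<and> lab W K = lab I J"
    using lab_cov[OF c(1)] lab_cov[OF c(2)] lab_cov[OF W(1)] lab_cov[OF W(2)] by (intro exI[of _ W]) simp
qed

lemma norm_seg:
  assumes "I \<in> L" "J \<in> L" shows "\<eta> I = \<eta> J \<otimes>\<^bsub>\<G>\<^esub> \<eta> (quo I J)"
  using norm_mult[OF L_Hm[OF assms(2)] quo_Hm[OF assms]] quo_cancel[OF assms] by simp

end

section \<open>The block homomorphism\<close>

lemma (in quot_monoid) Units_r_cancel:
  assumes "u \<in> Units Q" "b \<in> carrier Q" "c \<in> carrier Q" "b \<otimes> u = c \<otimes> u"
  shows "b = c"
proof -
  have "b = b \<otimes> u \<otimes> inv u" using assms(1,2) by (simp add: m_assoc)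
  also have "\<dots> = c" unfolding assms(4) using assms(1,3) by (simp add: m_assoc)
  finally show ?thesis .
qed

context arith_norm
begin

section \<open>Right translation by units\<close>

lemma r_coset_cancel:
  assumes "w \<in> Units Q" "A \<subseteq> carrier Q"
  shows "(A #> w) #> inv w = A" "(A #> inv w) #> w = A"
  using assms by (simp_all add: r_coset_assoc r_coset_one)

text \<open>The residual acts from the left and does not notice a translation on the right. Labels
  and norms of quotients inherit this invariance.\<close>

lemma X_r_coset:
  assumes w: "w \<in> Units Q" and I: "I \<in> L" and J: "J \<in> L"
  shows "X (I #> w) (J #> w) = X I J"
proof -
  note c = L_carrier[OF I] L_carrier[OF J]
  have "q \<otimes> (j \<otimes> w) \<in> I #> w \<longleftrightarrow> q \<otimes> j \<in> I" if "q \<in> carrier Q" "j \<in> J" for q j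
    using r_coset_mem[OF w c(1), of "q \<otimes> (j \<otimes> w)"] that w c(2) by (auto simp: m_assoc)
  then show ?thesis by (auto simp: X_def lres_def r_coset_def)
qed

lemma cov_r_coset:
  assumes w: "w \<in> Units Q" and c: "cov L I J"
  shows "cov L (I #> w) (J #> w)"
proof -
  note I = covD[OF c]
  note Ic = L_carrier[OF I(1)] L_carrier[OF I(2)]
  have "K = I #> w \<or> K = J #> w" if K: "K \<in> L" "I #> w \<subseteq> K" "K \<subseteq> J #> w" for K
  proof -
    let ?K = "K #> inv w"
    have KL: "?K \<in> L" using r_coset_L[OF _ K(1)] w by simp
    have "I \<subseteq> ?K" "?K \<subseteq> J"
      using r_coset_mono[OF K(2), of "inv w"] r_coset_mono[OF K(3), of "inv w"] r_coset_cancel(1)[OF w] Ic by auto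
    then have "?K = I \<or> ?K = J" using I(5)[OF KL] by blast
    then show ?thesis using r_coset_cancel(2)[OF w L_carrier[OF K(1)]] by auto
  qed
  moreover have "I #> w \<noteq> J #> w" using r_coset_cancel(1)[OF w] Ic I(4) by metis
  ultimately show ?thesis
    unfolding cov_def using r_coset_L[OF w I(1)] r_coset_L[OF w I(2)] r_coset_mono[OF I(3), of w] by blast
qed

lemma seg_r_coset:
  assumes w: "w \<in> Units Q" and s: "sg I J M"
  shows "sg (I #> w) (J #> w) M" "\<eta> (quo (I #> w) (J #> w)) = \<eta> (quo I J)"
proof -
  have "sg (I #> w) (J #> w) M \<and> \<eta> (quo (I #> w) (J #> w)) = \<eta> (quo I J)"
    using s
  proof (induction rule: seg.induct)
    case (refl I)
    have "\<eta> (quo K K) = \<one>\<^bsub>\<G>\<^esub>" if "K \<in> L" for K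
      using norm_alpha[OF F_tgtI[OF L_F[OF that]]] quo_self[OF that] by simp
    then show ?case using seg.refl[OF r_coset_L[OF w refl]] r_coset_L[OF w refl] refl by simp
  next
    case (step I J K M)
    note I = covD[OF step.hyps(1)]
    have K: "K \<in> L" using seg_mem[OF step.hyps(2)] by simp
    note c = cov_r_coset[OF w step.hyps(1)]
    note wL = r_coset_L[OF w I(1)] r_coset_L[OF w I(2)] r_coset_L[OF w K]
    have l: "lab (I #> w) (J #> w) = lab I J"
      using lab_cov[OF c] lab_cov[OF step.hyps(1)] X_r_coset[OF w I(1,2)] by simp
    have "sg (I #> w) (K #> w) (add_mset (lab I J) M)"
      using seg.step[OF c, of lab "K #> w" M] step.IH l by simp
    moreover have q: "\<eta> (quo I' K') = \<eta> (quo J' K') \<otimes>\<^bsub>\<G>\<^esub> \<eta> (quo I' J')"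
      if "I' \<in> L" "J' \<in> L" "K' \<in> L" for I' J' K'
      using norm_mult[OF quo_Hm[OF that(2,3)] quo_Hm[OF that(1,2)]] quo_trans[OF that] by simp
    have "\<eta> (quo (I #> w) (K #> w)) = \<eta> (quo I K)"
      using q[OF wL] q[OF I(1,2) K] step.IH norm_quo[OF c] norm_quo[OF step.hyps(1)] X_r_coset[OF w I(1,2)]
      by simp
    ultimately show ?case by simp
  qed
  then show "sg (I #> w) (J #> w) M" "\<eta> (quo (I #> w) (J #> w)) = \<eta> (quo I J)" by auto
qed

lemma quo_closed: "I \<in> L \<Longrightarrow> J \<in> L \<Longrightarrow> \<eta> (quo I J) \<in> carrier \<G>"
  using norm_closed[OF conjunct1[OF Hm_D[OF quo_Hm]]] .

text \<open>\<open>I\<close> and \<open>S #> w\<close> need not be composable in the groupoid. So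
  \<open>I\<close> and \<open>S\<close> are both compared with their meet; the norms of the two
  quotients do not change under translation.\<close>

lemma norm_r_coset:
  assumes w: "w \<in> Units Q" and I: "I \<in> L"
  shows "\<eta> (I #> w) = \<eta> (S #> w) \<otimes>\<^bsub>\<G>\<^esub> \<eta> I"
proof -
  let ?K = "S \<inter> I"
  have K: "?K \<in> L" using int_closed[OF S_L I] .
  note wL = r_coset_L[OF w I] r_coset_L[OF w S_L] r_coset_L[OF w K]
  obtain M where M: "sg ?K S M" using seg_exists[OF K S_L] by auto
  obtain N where N: "sg ?K I N" using seg_exists[OF K I] by auto
  have c: "\<eta> I \<in> carrier \<G>" "\<eta> (I #> w) \<in> carrier \<G>" "\<eta> (S #> w) \<in> carrier \<G>"
    "\<eta> (quo ?K S) \<in> carrier \<G>" "\<eta> (quo ?K I) \<in> carrier \<G>"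
    using norm_closed L_F wL I quo_closed K S_L by auto
  have 1: "\<eta> (quo ?K S) = \<eta> I \<otimes>\<^bsub>\<G>\<^esub> \<eta> (quo ?K I)"
    using norm_seg[OF K S_L] norm_seg[OF K I] norm_alpha[OF S_in] c by simp
  have "\<eta> (I #> w) \<otimes>\<^bsub>\<G>\<^esub> \<eta> (quo ?K I) = \<eta> (S #> w) \<otimes>\<^bsub>\<G>\<^esub> \<eta> (quo ?K S)"
    using norm_seg[OF wL(3,2)] norm_seg[OF wL(3,1)] seg_r_coset(2)[OF w M] seg_r_coset(2)[OF w N] by simp
  also have "\<dots> = \<eta> (S #> w) \<otimes>\<^bsub>\<G>\<^esub> \<eta> I \<otimes>\<^bsub>\<G>\<^esub> \<eta> (quo ?K I)"
    unfolding 1 using c by (simp add: \<G>.m_assoc)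
  finally show ?thesis using c by simp
qed

section \<open>Factorizations into maximal integral elements and labelled chains\<close>

abbreviation icl where "icl \<equiv> ideal_class Q \<alpha> P \<eta>"

text \<open>Multiplying the factors onto \<open>H\<close> one after another descends through covers.
  With \<open>seg_unique\<close> this shows that the multiset of classes does not depend on the
  factorization.\<close>

lemma integral_factors_seg:
  assumes "integral_factors Q \<alpha> K Is"
  shows "K \<in> F \<and> (\<forall>H \<in> L. t H = s K \<longrightarrow> sg (H \<cdot> K) H (mset (map icl Is)))"
  using assms
proof (induction rule: integral_factors.induct)
  case (identity e)
  have "sg (H \<cdot> e) H {#}" if "H \<in> L" "t H = s e" for H
  proof -
    have "H \<cdot> e = H" using Hm_one(2)[OF L_Hm[OF that(1)]] that(2) alpha_F(2)[OF identity] by simp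
    then show ?thesis using seg.refl[OF that(1)] by simp
  qed
  then show ?case using alpha_F(1)[OF identity] by simp
next
  case (product I J Is)
  have IF: "I \<in> F" using product.hyps(1) by (simp add: maximal_integral_iff)
  have JF: "J \<in> F" using product.IH by simp
  note IJ = vm_F[OF IF JF product.hyps(3)]
  have "sg (H \<cdot> (I \<cdot> J)) H (mset (map icl (I # Is)))" if H: "H \<in> L" "t H = s (I \<cdot> J)" for H
  proof -
    have sI: "s I = t H" using H(2) IJ(2) by simp
    note c = maximal_integral_cov[OF H(1) product.hyps(1) sI]
    have HI: "H \<cdot> I \<in> L" "t (H \<cdot> I) = t I" using vm_F[OF L_F[OF H(1)] IF] sI L_s[OF H(1)] by (auto simp: L_iff)
    have "sg ((H \<cdot> I) \<cdot> J) (H \<cdot> I) (mset (map icl Is))" using product.IH HI product.hyps(3) by simp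
    moreover have "(H \<cdot> I) \<cdot> J = H \<cdot> (I \<cdot> J)"
      using vm_assoc[OF L_F[OF H(1)] IF JF] sI product.hyps(3) by simp
    moreover have "lab (H \<cdot> I) H = icl I" using c(2) by (simp add: lab_def)
    ultimately show ?thesis using seg_trans[OF _ seg_cov[OF c(1)]] by fastforce
  qed
  then show ?case using IJ(1) by blast
qed

text \<open>A chain grows by covers at its bottom, which are the last factors, whereas
  \<open>integral_factors\<close> grows at the front.\<close>

lemma integral_factors_snoc:
  assumes "integral_factors Q \<alpha> K Is" "u \<in> maximal_integral Q \<alpha>" "t K = s u"
  shows "integral_factors Q \<alpha> (K \<cdot> u) (Is @ [u])"
  using assms(1,3)
proof (induction rule: integral_factors.induct)
  case (identity e)
  have uF: "u \<in> F" using assms(2) by (simp add: maximal_integral_iff)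
  have se: "s u = e" using identity alpha_F(3) by simp
  have tu: "t u \<in> \<alpha>" using F_tgtI[OF uF] .
  have "integral_factors Q \<alpha> (u \<cdot> t u) [u]"
    using integral_factors.product[OF assms(2) integral_factors.identity[OF tu]] alpha_F(2)[OF tu] by simp
  then show ?case using vm_unit_left[OF uF] vm_unit_right[OF uF] se by simp
next
  case (product I J Is)
  have uF: "u \<in> F" using assms(2) by (simp add: maximal_integral_iff)
  have IF: "I \<in> F" using product.hyps(1) by (simp add: maximal_integral_iff)
  have JF: "J \<in> F" using integral_factors_seg[OF product.hyps(2)] by simp
  have tJ: "t J = s u" using product.prems vm_F(3)[OF IF JF product.hyps(3)] by simp
  have "integral_factors Q \<alpha> (I \<cdot> (J \<cdot> u)) (I # Is @ [u])"
    using integral_factors.product[OF product.hyps(1) product.IH[OF tJ]] vm_F(2)[OF JF uF tJ] product.hyps(3) by simp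
  then show ?case using vm_assoc[OF IF JF uF product.hyps(3) tJ] by simp
qed

lemma seg_integral_factors:
  assumes "sg I H M"
  shows "\<exists>Is. integral_factors Q \<alpha> (quo I H) Is \<and> mset (map icl Is) = M"
  using assms
proof (induction rule: seg.induct)
  case (refl I)
  then show ?case
    using integral_factors.identity[OF F_tgtI[OF L_F[OF refl]]] quo_self[OF refl] by (intro exI[of _ "[]"]) simp
next
  case (step I J K M)
  obtain Is where Is: "integral_factors Q \<alpha> (quo J K) Is" "mset (map icl Is) = M" using step.IH by blast
  note I = covD[OF step.hyps(1)]
  have K: "K \<in> L" using seg_mem[OF step.hyps(2)] by simp
  have "t (quo J K) = s (quo I J)" using Hm_D[OF quo_Hm[OF I(2) K]] Hm_D[OF quo_Hm[OF I(1,2)]] by simp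
  then have "integral_factors Q \<alpha> (quo J K \<cdot> quo I J) (Is @ [quo I J])"
    using integral_factors_snoc[OF Is(1) quo_maximal_integral[OF step.hyps(1)]] by simp
  then show ?case
    using quo_trans[OF I(1,2) K] Is(2) by (intro exI[of _ "Is @ [quo I J]"]) (simp add: lab_def)
qed

end

locale arith_principal = arith_norm Q \<alpha> S \<eta> for Q (structure) and \<alpha> S \<eta> +
  assumes canc: "cancellative Q \<subseteq> Units Q"
    and princ: "I \<in> L \<Longrightarrow> principal_left Q S I \<longleftrightarrow> \<eta> I \<in> P"
begin

lemma Units_cancellative: "cancellative Q = Units Q"
proof
  show "Units Q \<subseteq> cancellative Q"
  proof
    fix u assume u: "u \<in> Units Q"
    have "\<forall>b \<in> carrier Q. \<forall>c \<in> carrier Q. (u \<otimes> b = u \<otimes> c \<longrightarrow> b = c) \<and> (b \<otimes> u = c \<otimes> u \<longrightarrow> b = c)"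
      by (intro ballI conjI impI) (simp_all add: u Units_r_cancel[OF u])
    then show "u \<in> cancellative Q" unfolding cancellative_def using Units_closed[OF u] by (intro CollectI conjI)
  qed
qed (rule canc)

section \<open>The class group and principal ideals\<close>

lemma Su_L: "w \<in> Units Q \<Longrightarrow> S #> w \<in> L" using r_coset_L S_L by blast

lemma Su_mem: assumes "w \<in> Units Q" shows "x \<in> S #> w \<longleftrightarrow> x \<in> carrier Q \<and> x \<otimes> inv w \<in> S"
  using r_coset_mem[OF assms] L_carrier[OF S_L] by simp

text \<open>\<open>S #> (q \<otimes> w)\<close> is the translate of \<open>S #> q\<close> by
  \<open>w\<close>, so \<open>norm_r_coset\<close> makes principal norms multiplicative.\<close>

lemma P_subgroup: "subgroup P \<G>"
proof (rule \<G>.subgroupI)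
  have P: "P = {\<eta> (S #> q) | q. q \<in> Units Q}" by (simp add: principal_norms_def Units_cancellative)
  have cl: "\<eta> (S #> q) \<in> carrier \<G>" if "q \<in> Units Q" for q using norm_closed[OF L_F[OF Su_L[OF that]]] .
  show "P \<subseteq> carrier \<G>"
  proof
    fix a assume "a \<in> P"
    then obtain q where "q \<in> Units Q" "a = \<eta> (S #> q)" unfolding P by blast
    then show "a \<in> carrier \<G>" using cl[of q] by simp
  qed
  show "P \<noteq> {}" unfolding P using Units_one_closed by blast
  have m: "\<eta> (S #> (q \<otimes> w)) = \<eta> (S #> w) \<otimes>\<^bsub>\<G>\<^esub> \<eta> (S #> q)" if "q \<in> Units Q" "w \<in> Units Q" for q w
    using norm_r_coset[OF that(2) Su_L[OF that(1)]] that L_carrier[OF S_L] by (simp add: r_coset_assoc)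
  fix a assume "a \<in> P"
  then obtain q where q: "q \<in> Units Q" "a = \<eta> (S #> q)" unfolding P by blast
  have "\<eta> (S #> inv q) \<otimes>\<^bsub>\<G>\<^esub> a = \<one>\<^bsub>\<G>\<^esub>"
    using m[OF q(1), of "inv q"] q norm_alpha[OF S_in] r_coset_one[OF L_carrier[OF S_L]] by simp
  then have "inv\<^bsub>\<G>\<^esub> a = \<eta> (S #> inv q)" using \<G>.inv_equality[of "\<eta> (S #> inv q)" a] cl[OF q(1)] cl[OF Units_inv_Units[OF q(1)]] q(2) by simp
  then show "inv\<^bsub>\<G>\<^esub> a \<in> P" unfolding P using Units_inv_Units[OF q(1)] by blast
  fix b assume "b \<in> P"
  then obtain w where w: "w \<in> Units Q" "b = \<eta> (S #> w)" unfolding P by blast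
  then have "a \<otimes>\<^bsub>\<G>\<^esub> b = \<eta> (S #> (w \<otimes> q))" using m[OF w(1) q(1)] q by simp
  then show "a \<otimes>\<^bsub>\<G>\<^esub> b \<in> P" unfolding P using Units_m_closed[OF w(1) q(1)] by blast
qed

abbreviation C where "C \<equiv> class_group Q \<alpha> P"

sublocale C: comm_group C
  unfolding class_group_def by (rule \<G>.abelian_FactGroup[OF P_subgroup])

lemma C_one: "\<one>\<^bsub>C\<^esub> = P" by (simp add: class_group_def)

lemma icl_closed: "I \<in> F \<Longrightarrow> icl I \<in> carrier C"
  unfolding class_group_def carrier_FactGroup ideal_class_def using norm_closed[of I] by simp

lemma icl_mult:
  assumes "I \<in> Hm e f" "J \<in> Hm f g" shows "icl (I \<cdot> J) = icl I \<otimes>\<^bsub>C\<^esub> icl J"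
proof -
  interpret normal P \<G> using \<G>.subgroup_imp_normal[OF P_subgroup] .
  have "\<eta> I \<in> carrier \<G>" "\<eta> J \<in> carrier \<G>" using norm_closed[OF conjunct1[OF Hm_D[OF assms(1)]]] norm_closed[OF conjunct1[OF Hm_D[OF assms(2)]]] by simp_all
  then show ?thesis
    using rcos_sum[of "\<eta> I" "\<eta> J"] norm_mult[OF assms] by (simp add: class_group_def ideal_class_def)
qed

lemma principal_iff:
  assumes "I \<in> L" shows "principal_left Q S I \<longleftrightarrow> icl I = \<one>\<^bsub>C\<^esub>"
proof -
  have c: "\<eta> I \<in> carrier \<G>" using norm_closed[OF L_F[OF assms]] .
  show ?thesis
    unfolding princ[OF assms] C_one ideal_class_def
    using \<G>.coset_join1[OF _ c P_subgroup] \<G>.coset_join2[OF c P_subgroup] by iprover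
qed

abbreviation CM where "CM \<equiv> {icl I | I. I \<in> maximal_integral Q \<alpha>}"

lemma CM_carrier: "CM \<subseteq> carrier C"
  using icl_closed unfolding maximal_integral_iff by blast

definition Z where "Z = carrier (block_monoid C CM)"

lemma block_monoid_eq: "block_monoid C CM = mset_monoid Z"
  by (simp add: Z_def block_monoid_def mset_monoid_def)

abbreviation cpr where "cpr gs \<equiv> foldr (\<otimes>\<^bsub>C\<^esub>) gs \<one>\<^bsub>C\<^esub>"

lemma cpr_closed: "set gs \<subseteq> CM \<Longrightarrow> cpr gs \<in> carrier C"
  using CM_carrier by (induction gs) auto

lemma cpr_append: "set gs \<subseteq> CM \<Longrightarrow> set hs \<subseteq> CM \<Longrightarrow> cpr (gs @ hs) = cpr gs \<otimes>\<^bsub>C\<^esub> cpr hs"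
proof (induction gs)
  case (Cons g gs)
  then have "g \<in> carrier C" "cpr gs \<in> carrier C" "cpr hs \<in> carrier C"
    using CM_carrier cpr_closed by auto
  then show ?case using Cons by (simp add: C.m_assoc)
qed (use cpr_closed in auto)

text \<open>Commutativity of the class group makes the product of a list depend only on its
  multiset.\<close>

lemma Z_iff: "mset gs \<in> Z \<longleftrightarrow> set gs \<subseteq> CM \<and> cpr gs = \<one>\<^bsub>C\<^esub>"
proof
  assume "mset gs \<in> Z"
  then obtain hs where hs: "mset gs = mset hs" "set hs \<subseteq> CM" "cpr hs = \<one>\<^bsub>C\<^esub>"
    by (auto simp: Z_def block_monoid_def)
  have "cpr hs = cpr gs"
    using C.multlist_perm_cong[of hs gs] hs(1,2) CM_carrier by auto
  then show "set gs \<subseteq> CM \<and> cpr gs = \<one>\<^bsub>C\<^esub>" using hs mset_eq_setD[OF hs(1)] by simp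
qed (auto simp: Z_def block_monoid_def)

lemma Z_closed: assumes M: "M \<in> Z" shows "M + N \<in> Z \<longleftrightarrow> N \<in> Z"
proof -
  obtain gs where gs: "mset gs = M" using ex_mset by blast
  obtain hs where hs: "mset hs = N" using ex_mset by blast
  have g: "set gs \<subseteq> CM" "cpr gs = \<one>\<^bsub>C\<^esub>" using M gs Z_iff[of gs] by auto
  show ?thesis
  proof (cases "set hs \<subseteq> CM")
    case True
    then have "cpr (gs @ hs) = cpr hs" using cpr_append[OF g(1) True] g(2) cpr_closed by simp
    then show ?thesis using Z_iff[of "gs @ hs"] Z_iff[of hs] g True gs hs by simp
  next
    case False
    then have "\<not> set (gs @ hs) \<subseteq> CM" by simp
    then show ?thesis using False Z_iff[of "gs @ hs"] Z_iff[of hs] gs hs by simp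
  qed
qed

lemma seg_class:
  assumes "sg I J M"
  shows "\<exists>gs. mset gs = M \<and> set gs \<subseteq> CM \<and> icl I = cpr gs \<otimes>\<^bsub>C\<^esub> icl J"
  using assms
proof (induction rule: seg.induct)
  case (refl I)
  then show ?case using icl_closed[OF L_F[OF refl]] by (intro exI[of _ "[]"]) simp
next
  case (step I J K M)
  obtain gs where gs: "mset gs = M" "set gs \<subseteq> CM" "icl J = cpr gs \<otimes>\<^bsub>C\<^esub> icl K" using step.IH by blast
  note I = covD[OF step.hyps(1)]
  have K: "K \<in> L" using seg_mem[OF step.hyps(2)] by simp
  have "quo I J \<in> maximal_integral Q \<alpha>" using quo_maximal_integral[OF step.hyps(1)] .
  then have lC: "lab I J \<in> CM" by (auto simp: lab_def)
  have c: "lab I J \<in> carrier C" "icl K \<in> carrier C" "cpr gs \<in> carrier C"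
    using lC CM_carrier icl_closed[OF L_F[OF K]] cpr_closed[OF gs(2)] by auto
  have "icl I = icl J \<otimes>\<^bsub>C\<^esub> lab I J"
    using icl_mult[OF L_Hm[OF I(2)] quo_Hm[OF I(1,2)]] quo_cancel[OF I(1,2)] by (simp add: lab_def)
  also have "\<dots> = cpr (lab I J # gs) \<otimes>\<^bsub>C\<^esub> icl K"
    using gs(3) c by (simp add: C.m_ac)
  finally show ?case using gs(1,2) lC by (intro exI[of _ "lab I J # gs"]) simp
qed

text \<open>The classes of \<open>I\<close> and \<open>J\<close> differ by the product of the
  labels, and an ideal in \<open>L\<close> is principal exactly when its class is trivial.\<close>

lemma seg_principal_iff:
  assumes s: "sg I J M" and J: "principal_left Q S J"
  shows "principal_left Q S I \<longleftrightarrow> M \<in> Z"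
proof -
  obtain gs where gs: "mset gs = M" "set gs \<subseteq> CM" "icl I = cpr gs \<otimes>\<^bsub>C\<^esub> icl J" using seg_class[OF s] by blast
  have "I \<in> L" "J \<in> L" using seg_mem[OF s] by auto
  then have "icl I = cpr gs" "principal_left Q S I \<longleftrightarrow> icl I = \<one>\<^bsub>C\<^esub>"
    using gs(3) J principal_iff cpr_closed[OF gs(2)] by auto
  then show ?thesis using Z_iff[of gs] gs(1,2) by simp
qed

lemma principal_Su: "w \<in> Units Q \<Longrightarrow> principal_left Q S (S #> w)"
  by (auto simp: principal_left_def Units_cancellative)

definition \<theta> where "\<theta> a = block_hom Q S \<alpha> P \<eta> (S #> a)"

text \<open>The Ore conditions bring two elements of \<open>Q\<close> to a common denominator; an
  equation between their multiples by \<open>a\<close> then becomes one in \<open>S\<close>, where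
  \<open>a\<close> can be cancelled.\<close>

lemma cancellative_S: "cancellative (Q\<lparr>carrier := S\<rparr>) = S \<inter> Units Q"
proof
  show "S \<inter> Units Q \<subseteq> cancellative (Q\<lparr>carrier := S\<rparr>)"
  proof
    fix a assume a: "a \<in> S \<inter> Units Q"
    then have u: "a \<in> Units Q" by simp
    have "\<forall>b \<in> S. \<forall>c \<in> S. (a \<otimes> b = a \<otimes> c \<longrightarrow> b = c) \<and> (b \<otimes> a = c \<otimes> a \<longrightarrow> b = c)"
      by (intro ballI conjI impI) (simp_all add: u S_mem Units_r_cancel[OF u])
    then show "a \<in> cancellative (Q\<lparr>carrier := S\<rparr>)" using a by (simp add: cancellative_def)
  qed
  show "cancellative (Q\<lparr>carrier := S\<rparr>) \<subseteq> S \<inter> Units Q"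
  proof
    fix a assume a: "a \<in> cancellative (Q\<lparr>carrier := S\<rparr>)"
    have "a \<in> S \<and> (\<forall>b \<in> S. \<forall>c \<in> S. (a \<otimes> b = a \<otimes> c \<longrightarrow> b = c) \<and> (b \<otimes> a = c \<otimes> a \<longrightarrow> b = c))"
      using a by (simp add: cancellative_def)
    then have aS: "a \<in> S" and cc: "\<forall>b \<in> S. \<forall>c \<in> S. (a \<otimes> b = a \<otimes> c \<longrightarrow> b = c) \<and> (b \<otimes> a = c \<otimes> a \<longrightarrow> b = c)"
      by (rule conjunct1, rule conjunct2)
    have lc: "b = c" if "b \<in> S" "c \<in> S" "a \<otimes> b = a \<otimes> c" for b c
      using bspec[OF bspec[OF cc that(1)] that(2)] that(3) by simp
    have rc: "b = c" if "b \<in> S" "c \<in> S" "b \<otimes> a = c \<otimes> a" for b c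
      using bspec[OF bspec[OF cc that(1)] that(2)] that(3) by simp
    note ac = S_mem[OF aS]
    have "b = c" if bc: "b \<in> carrier Q" "c \<in> carrier Q" "a \<otimes> b = a \<otimes> c" for b c
    proof -
      obtain p d where p: "p \<in> S" "d \<in> S \<inter> Units Q" "b = p \<otimes> inv d" using orderD(5)[OF S_order bc(1)] by blast
      obtain p' d' where p': "p' \<in> S" "d' \<in> S \<inter> Units Q" "c = p' \<otimes> inv d'" using orderD(5)[OF S_order bc(2)] by blast
      obtain f g where fg: "f \<in> S" "g \<in> S \<inter> Units Q" "d' \<otimes> g = d \<otimes> f" using right_ore[of d d'] p(2) p'(2) by blast
      have mem: "p \<in> carrier Q" "p' \<in> carrier Q" "f \<in> carrier Q" "g \<in> carrier Q" "d \<in> Units Q" "d' \<in> Units Q" "g \<in> Units Q"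
        using p p' fg S_mem by auto
      have bm: "b \<otimes> (d \<otimes> f) = p \<otimes> f" using p(3) mem by (simp add: m_assoc)
      have cm: "c \<otimes> (d \<otimes> f) = p' \<otimes> g" unfolding fg(3)[symmetric] using p'(3) mem by (simp add: m_assoc)
      have "a \<otimes> (p \<otimes> f) = (a \<otimes> b) \<otimes> (d \<otimes> f)" unfolding bm[symmetric] using ac bc(1) mem by (simp add: m_assoc)
      also have "\<dots> = a \<otimes> (p' \<otimes> g)" unfolding bc(3) cm[symmetric] using ac bc(2) mem by (simp add: m_assoc)
      finally have "p \<otimes> f = p' \<otimes> g" using lc[of "p \<otimes> f" "p' \<otimes> g"] orderD(4)[OF S_order, of p f] orderD(4)[OF S_order, of p' g] p(1) p'(1) fg(1,2) by simp
      then have e: "b \<otimes> (d' \<otimes> g) = c \<otimes> (d' \<otimes> g)" using bm cm fg(3) by simp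
      have "d' \<otimes> g \<in> Units Q" using mem by simp
      then show ?thesis using Units_r_cancel[of "d' \<otimes> g" b c] e bc(1,2) by simp
    qed
    moreover have "b = c" if bc: "b \<in> carrier Q" "c \<in> carrier Q" "b \<otimes> a = c \<otimes> a" for b c
    proof -
      obtain p d where p: "p \<in> S" "d \<in> S \<inter> Units Q" "b = inv d \<otimes> p" using orderD(6)[OF S_order bc(1)] by blast
      obtain p' d' where p': "p' \<in> S" "d' \<in> S \<inter> Units Q" "c = inv d' \<otimes> p'" using orderD(6)[OF S_order bc(2)] by blast
      obtain f g where fg: "f \<in> S" "g \<in> S \<inter> Units Q" "g \<otimes> d' = f \<otimes> d" using left_ore[of d d'] p(2) p'(2) by blast
      have mem: "p \<in> carrier Q" "p' \<in> carrier Q" "f \<in> carrier Q" "g \<in> carrier Q" "d \<in> Units Q" "d' \<in> Units Q" "g \<in> Units Q"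
        using p p' fg S_mem by auto
      have bm: "f \<otimes> d \<otimes> b = f \<otimes> p" using p(3) mem by (simp add: m_assoc)
      have cm: "f \<otimes> d \<otimes> c = g \<otimes> p'" unfolding fg(3)[symmetric] using p'(3) mem by (simp add: m_assoc)
      have "f \<otimes> p \<otimes> a = f \<otimes> d \<otimes> (b \<otimes> a)" unfolding bm[symmetric] using ac bc(1) mem by (simp add: m_assoc)
      also have "\<dots> = g \<otimes> p' \<otimes> a" unfolding bc(3) cm[symmetric] using ac bc(2) mem by (simp add: m_assoc)
      finally have "f \<otimes> p = g \<otimes> p'" using rc[of "f \<otimes> p" "g \<otimes> p'"] orderD(4)[OF S_order, of f p] orderD(4)[OF S_order, of g p'] p(1) p'(1) fg(1,2) by simp
      then have e: "g \<otimes> d' \<otimes> b = g \<otimes> d' \<otimes> c" using bm cm fg(3) by simp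
      have "g \<otimes> d' \<in> Units Q" using mem by simp
      then show ?thesis using Units_l_cancel[of "g \<otimes> d'" b c] bc(1,2) e by simp
    qed
    ultimately have "\<forall>b \<in> carrier Q. \<forall>c \<in> carrier Q. (a \<otimes> b = a \<otimes> c \<longrightarrow> b = c) \<and> (b \<otimes> a = c \<otimes> a \<longrightarrow> b = c)"
      by (intro ballI conjI impI)
    then have "a \<in> cancellative Q" unfolding cancellative_def using ac by (intro CollectI conjI)
    then show "a \<in> S \<inter> Units Q" using aS canc by blast
  qed
qed

section \<open>The transfer lattice of \<open>S\<close>\<close>

abbreviation T where "T \<equiv> cancellative_part Q S"

lemma T_simps: "carrier T = S \<inter> Units Q" "monoid.mult T = (\<otimes>)" "one T = \<one>"
  by (simp_all add: cancellative_part_def cancellative_S)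

lemma T_cancel: "cancel_monoid T"
proof -
  have "monoid T"
    by (rule monoidI) (use S_mem S_one orderD(4)[OF S_order] in \<open>auto simp: T_simps m_assoc\<close>)
  moreover have "carrier T \<subseteq> cancellative T"
  proof
    fix a assume a: "a \<in> carrier T"
    then have "a \<in> cancellative Q" unfolding Units_cancellative by (simp add: T_simps)
    then show "a \<in> cancellative T" using a by (auto simp: cancellative_def T_simps)
  qed
  ultimately show ?thesis by (simp add: cancel_monoid_def cancel_monoid_axioms_def)
qed

lemma T_UnitsI: "u \<in> S \<Longrightarrow> u \<in> Units Q \<Longrightarrow> inv u \<in> S \<Longrightarrow> u \<in> Units T"
  unfolding Units_def[of T] T_simps by (intro CollectI conjI bexI[of _ "inv u"]) auto

text \<open>Every list of factors of \<open>S #> a\<close> yields a chain from \<open>S #> a\<close>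
  to \<open>S\<close>, so by Jordan-Hoelder the definite description in \<open>block_hom\<close> has
  exactly one candidate.\<close>

lemma \<theta>_seg:
  assumes a: "a \<in> carrier T"
  shows "sg (S #> a) S (\<theta> a)"
proof -
  have a': "a \<in> S" "a \<in> Units Q" using a by (auto simp: T_simps)
  note aL = Su_L[OF a'(2)]
  have sub: "S #> a \<subseteq> S" using orderD(4)[OF S_order] a' by (auto simp: r_coset_def)
  obtain M where M: "sg (S #> a) S M" using seg_exists[OF aL S_L sub] by blast
  have q: "quo (S #> a) S = S #> a"
    using Hm_one(1)[OF L_Hm[OF aL]] S_F(4) by (simp add: quo_def)
  obtain Is where Is: "integral_factors Q \<alpha> (S #> a) Is" "mset (map icl Is) = M"
    using seg_integral_factors[OF M] q by auto
  have u: "mset (map icl Js) = M" if "integral_factors Q \<alpha> (S #> a) Js" for Js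
  proof -
    have "sg (S \<cdot> (S #> a)) S (mset (map icl Js))"
      using integral_factors_seg[OF that] S_L S_F(3) L_s[OF aL] by simp
    then show ?thesis using seg_unique[OF M] Hm_one(1)[OF L_Hm[OF aL]] by simp
  qed
  have "(THE B. \<exists>Is. integral_factors Q \<alpha> (S #> a) Is \<and> B = mset (map icl Is)) = M"
    by (rule the_equality) (use Is u in auto)
  \<comment> \<open>\<open>block_hom\<close> is restricted to this set, so membership is needed to
    unfold it; conjugation by \<open>\<one>\<close> suffices.\<close>
  moreover have "S #> a \<in> conj_principal_ideals Q S"
  proof -
    have "\<one> <# (S #> a) = S #> a"
      using L_carrier[OF aL] by (auto simp: l_coset_def subset_iff)
    then have "S #> a = (inv \<one> <# (S #> a)) #> \<one>"
      using r_coset_one[OF L_carrier[OF aL]] by simp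
    then show ?thesis
      unfolding conj_principal_ideals_def Units_cancellative cancellative_S using a' Units_one_closed by blast
  qed
  ultimately show ?thesis using M by (simp add: \<theta>_def block_hom_def)
qed

lemma transfer: "transfer_lattice L jn lab T (\<lambda>w. S #> w) \<theta> Z"
proof -
  interpret T: cancel_monoid T by (rule T_cancel)
  have Sc: "S \<subseteq> carrier Q" using L_carrier[OF S_L] .
  have one: "S #> \<one> = S" using r_coset_one[OF Sc] .
  show ?thesis
  proof
    fix w assume "w \<in> carrier T"
    then show "S #> w \<in> L" using Su_L by (simp add: T_simps)
  next
    fix w w' assume w: "w \<in> carrier T" "w' \<in> carrier T" and e: "S #> w = S #> w'"
    have W: "w \<in> Units Q" "w' \<in> Units Q" "w \<in> carrier Q" "w' \<in> carrier Q" using w by (auto simp: T_simps)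
    have "w' \<in> S #> w" "w \<in> S #> w'" using Su_mem W S_one e by auto
    then have d: "w' \<otimes> inv w \<in> S" "w \<otimes> inv w' \<in> S" using Su_mem W by auto
    have "w' \<otimes> inv w \<in> Units T"
      using d W by (intro T_UnitsI) (auto simp: inv_mult_Units)
    moreover have "w' = (w' \<otimes> inv w) \<otimes> w" using W by (simp add: m_assoc)
    ultimately show "\<exists>\<delta> \<in> Units T. w' = \<delta> \<otimes>\<^bsub>T\<^esub> w" unfolding T_simps by blast
  next
    fix u w assume u: "u \<in> carrier T" and w: "w \<in> carrier T"
    then have "u \<in> carrier Q" "w \<in> Units Q" by (auto simp: T_simps)
    then show "sg (S #> (u \<otimes>\<^bsub>T\<^esub> w)) (S #> w) (\<theta> u)"
      using seg_r_coset(1)[OF _ \<theta>_seg[OF u], of w] Sc by (simp add: r_coset_assoc T_simps)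
  next
    fix u assume u: "u \<in> carrier T"
    have "principal_left Q S (S #> u)" "principal_left Q S S"
      using principal_Su[of u] principal_Su[of \<one>] u one by (auto simp: T_simps)
    then show "\<theta> u \<in> Z" using seg_principal_iff[OF \<theta>_seg[OF u]] by simp
  next
    fix a K N M assume a: "a \<in> carrier T" and s: "sg (S #> a) K N" "sg K (S #> \<one>\<^bsub>T\<^esub>) M" and M: "M \<in> Z"
    have s': "sg K S M" using s(2) one by (simp add: T_simps)
    have "principal_left Q S S" using principal_Su[of \<one>] one by simp
    then have "principal_left Q S K" using seg_principal_iff[OF s'] M by simp
    then obtain q where q: "q \<in> Units Q" "K = S #> q" by (auto simp: principal_left_def Units_cancellative)
    have "q \<in> K" using q Su_mem S_one by simp
    then have "q \<in> S" using seg_mem[OF s'] by blast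
    then show "\<exists>w \<in> carrier T. K = S #> w" using q by (auto simp: T_simps)
  next
    fix w a assume w: "w \<in> carrier T" and a: "a \<in> carrier T" and sub: "S #> a \<subseteq> S #> w"
    have W: "w \<in> Units Q" "a \<in> Units Q" using w a by (auto simp: T_simps)
    have "a \<in> S #> a" using Su_mem[OF W(2)] W S_one by simp
    then have "a \<otimes> inv w \<in> S" using sub Su_mem[OF W(1)] by blast
    moreover have "a = (a \<otimes> inv w) \<otimes> w" using W by (simp add: m_assoc)
    ultimately show "\<exists>u \<in> carrier T. a = u \<otimes>\<^bsub>T\<^esub> w" using W by (auto simp: T_simps intro!: bexI[of _ "a \<otimes> inv w"])
  next
    show "{#} \<in> Z" using Z_iff[of "[]"] by simp
  qed (rule Z_closed)
qed

end

theorem corollary7p11: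
  fixes Q :: "('a, 'b) monoid_scheme"
    and S :: "'a set"
    and \<alpha> :: "'a set set"
    and \<eta> :: "'a set \<Rightarrow> 'a set set"
    and P :: "'a set set set"
    and C :: "'a set set set monoid"
    and C\<^sub>M :: "'a set set set set"
    and \<B> :: "'a set set set multiset monoid"
    and \<theta> :: "'a \<Rightarrow> 'a set set set multiset"
    and T :: "('a, 'b) monoid_scheme"
    and d :: "'a tuple set \<Rightarrow> 'a tuple set \<Rightarrow> nat"
  assumes "quotient_semigroup Q"
    and "arithmetical_maximal_order Q S"
    and "\<alpha> = maximal_orders_equiv Q S"
    and "abstract_norm Q \<alpha> \<eta>"
    and "P = principal_norms Q S \<eta>"
    and "C = class_group Q \<alpha> P"
    and "C\<^sub>M = {ideal_class Q \<alpha> P \<eta> I | I. I \<in> maximal_integral Q \<alpha>}"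
    and "\<And>I. frac_left_ideal Q S I \<Longrightarrow> divisorial Q I \<Longrightarrow> principal_left Q S I \<longleftrightarrow> \<eta> I \<in> P"
    and "\<B> = block_monoid C C\<^sub>M"
    and "\<theta> = (\<lambda>a. block_hom Q S \<alpha> P \<eta> (S #>\<^bsub>Q\<^esub> a))"
    and "T = cancellative_part Q S"
    and "distance_on T d"
    and "conj_invariant Q S d"
  shows "(cat_fiber T \<B> \<theta> d \<le> 2) \<and>
     (\<forall>a \<in> carrier T. cat_elem T d a \<le> max (cat_elem \<B> (perm_distance \<B>) (\<theta> a)) 2) \<and>
     (cat T d \<le> max (cat \<B> (perm_distance \<B>)) 2) \<and>
     (\<forall>a \<in> carrier T. cat_mon_elem T d a \<le> max (cat_mon_elem \<B> (perm_distance \<B>) (\<theta> a)) 2) \<and>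
     (cat_mon T d \<le> max (cat_mon \<B> (perm_distance \<B>)) 2) \<and>
     (\<forall>a \<in> carrier T. cat_eq_elem T d a \<le> max (cat_eq_elem \<B> (perm_distance \<B>) (\<theta> a)) 2) \<and>
     (cat_eq T d \<le> max (cat_eq \<B> (perm_distance \<B>)) 2)"
proof -
  have Q: "monoid Q" "cancellative Q \<subseteq> Units Q" using assms(1) by (auto simp: quotient_semigroup_def)
  have S: "maximal_order Q S" "bounded_order Q S"
    "ascending_chain_condition {I. left_order_ideal Q S I \<and> divisorial Q I}"
    "ascending_chain_condition {I. right_order_ideal Q S I \<and> divisorial Q I}"
    "modular_ideal_lattice Q {I. frac_left_ideal Q S I \<and> divisorial Q I}"
    using assms(2) by (simp_all add: arithmetical_maximal_order_def)
  interpret quot_monoid Q using Q(1) by (simp add: quot_monoid_def)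
  interpret order_class Q \<alpha> unfolding assms(3) by (rule order_class_maximal[OF S(1,2)])
  have Sc: "S \<subseteq> carrier Q" using orderD(1)[OF maxD[OF S(1)]] .
  have "equivalent_orders Q S S"
  proof -
    have "\<forall>q \<in> S. \<one>\<^bsub>Q\<^esub> \<otimes>\<^bsub>Q\<^esub> q \<otimes>\<^bsub>Q\<^esub> \<one>\<^bsub>Q\<^esub> \<in> S" using Sc by auto
    then show ?thesis unfolding equivalent_orders_iff using Units_one_closed by blast
  qed
  then have "S \<in> \<alpha>" using S(1) assms(3) by (simp add: maximal_orders_equiv_def)
  then interpret arith_order Q \<alpha> S by unfold_locales (use S in auto)
  interpret arith_norm Q \<alpha> S \<eta> by unfold_locales (rule assms(4))
  interpret R: arith_principal Q \<alpha> S \<eta>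
    by unfold_locales (use Q(2) assms(5,8) in \<open>auto simp: L_def\<close>)
  interpret transfer_distance L jn lab T "\<lambda>w. S #>\<^bsub>Q\<^esub> w" \<theta> R.Z d
  proof -
    have "\<theta> = R.\<theta>" using assms(5,10) by (simp add: R.\<theta>_def fun_eq_iff)
    then show "transfer_distance L jn lab T (\<lambda>w. S #>\<^bsub>Q\<^esub> w) \<theta> R.Z d"
      unfolding transfer_distance_def transfer_distance_axioms_def
      using R.transfer assms(11,12) by simp
  qed
  have "\<B> = mset_monoid R.Z"
    using assms(5,6,7,9) R.block_monoid_eq by simp
  then show ?thesis using catenary_bounds by simp
qed

end
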